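(* Let $L/K$ be a finite separable extension of fields with Galois closure $E$, $G=\mathrm{Gal}(E/K)$, $G_L=\mathrm{Gal}(E/L)$, $X=G/G_L$. Let $N_1,N_2$ be regular subgroups of $\mathrm{Perm}(X)$ normalized by $\lambda(G)$. Let $G'$ be a normal subgroup of $G$ and $K'=E^{G'}$. Then $K'\otimes_K E[N_1]^G\cong K'\otimes_K E[N_2]^G$ as $K'$-Hopf algebras if and only if $(N_1,\ast)\cong(N_2,\ast)$ as $G'$-groups (with $G'$ acting by restriction of $\ast$).
   Context: $X=G/G_L$ is the set of left cosets $\overline{\tau}=\tau G_L$, and $\lambda:G\to\mathrm{Perm}(X)$ is given by $\lambda(\sigma)(\overline{\tau})=\overline{\sigma\tau}$. A subgroup $N\le \mathrm{Perm}(X)$ is regular if $|N|=|X|$ and $N$ acts transitively on $X$. $G$ acts on $\mathrm{Perm}(X)$ by $\sigma\ast\eta=\lambda(\sigma)\eta\lambda(\sigma)^{-1}$. $G$ acts on $E[N]$ by acting on $E$ as Galois automorphisms and on $N$ via $\ast$; $E[N]^G$ is the fixed $K$-Hopf algebra. Two $G'$-groups are isomorphic as $G'$-groups if there is a $G'$-equivariant group isomorphism between them. *)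

theory Defs
  imports "HOL-Algebra.Algebra"
begin

section \<open>Field extensions inside a field \<open>E\<close>\<close>

text \<open>Polynomials are coefficient lists, leading coefficient first.\<close>

definition poly_deriv :: "('a, 'm) ring_scheme \<Rightarrow> 'a list \<Rightarrow> 'a list" where
  "poly_deriv R p =
     ring.normalize R (map (\<lambda>i. add_pow R (Polynomials.degree p - i) (p ! i)) [0..<Polynomials.degree p])"

definition separable_poly :: "('a, 'm) ring_scheme \<Rightarrow> 'a set \<Rightarrow> 'a list \<Rightarrow> bool" where
  "separable_poly E K p \<longleftrightarrow>
     (\<forall>d \<in> carrier (univ_poly E K).
        d divides\<^bsub>univ_poly E K\<^esub> p \<and> d divides\<^bsub>univ_poly E K\<^esub> (poly_deriv E p) \<longrightarrow> d \<in> Units (univ_poly E K))"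

definition separable_extension :: "('a, 'm) ring_scheme \<Rightarrow> 'a set \<Rightarrow> 'a set \<Rightarrow> bool" where
  "separable_extension E K M \<longleftrightarrow>
     (\<forall>x \<in> M. ring.algebraic E K x \<and> separable_poly E K (ring.Irr E K x))"

text \<open>The library's \<^const>\<open>ring.splitted_on\<close> is only meaningful for finite sets, so splitting over
  \<open>M\<close> is expressed with \<^const>\<open>ring.splitted\<close> over the field with carrier \<open>M\<close>.\<close>

definition normal_extension :: "('a, 'm) ring_scheme \<Rightarrow> 'a set \<Rightarrow> 'a set \<Rightarrow> bool" where
  "normal_extension E K M \<longleftrightarrow>
     (\<forall>x \<in> M. ring.algebraic E K x) \<and>
     (\<forall>p \<in> carrier (univ_poly E K).
        pirreducible\<^bsub>E\<^esub> K p \<and> (\<exists>x \<in> M. ring.eval E p x = \<zero>\<^bsub>E\<^esub>)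
          \<longrightarrow> ring.splitted (E\<lparr>carrier := M\<rparr>) p)"

definition finite_galois_extension :: "('a, 'm) ring_scheme \<Rightarrow> 'a set \<Rightarrow> 'a set \<Rightarrow> bool" where
  "finite_galois_extension E K M \<longleftrightarrow>
     ring.finite_dimension E K M \<and> normal_extension E K M \<and> separable_extension E K M"

definition galois_closure :: "('a, 'm) ring_scheme \<Rightarrow> 'a set \<Rightarrow> 'a set \<Rightarrow> bool" where
  "galois_closure E K L \<longleftrightarrow>
     finite_galois_extension E K (carrier E) \<and>
     (\<forall>M. subfield M E \<and> L \<subseteq> M \<and> finite_galois_extension E K M \<longrightarrow> M = carrier E)"

definition galois_group :: "('a, 'm) ring_scheme \<Rightarrow> 'a set \<Rightarrow> ('a \<Rightarrow> 'a) monoid" where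
  "galois_group E K =
     (BijGroup (carrier E))
       \<lparr>carrier := {\<sigma> \<in> Bij (carrier E). \<sigma> \<in> ring_hom E E \<and> (\<forall>x \<in> K. \<sigma> x = x)}\<rparr>"

definition fixed_field :: "('a, 'm) ring_scheme \<Rightarrow> ('a \<Rightarrow> 'a) set \<Rightarrow> 'a set" where
  "fixed_field E S = {x \<in> carrier E. \<forall>\<sigma> \<in> S. \<sigma> x = x}"


section \<open>Permutations of \<open>G/H\<close>\<close>

text \<open>\<open>\<sigma> <# (\<tau> <# H) = (\<sigma> \<otimes> \<tau>) <# H\<close>, so this is the map sending \<open>\<tau>H\<close> to \<open>\<sigma>\<tau>H\<close>.\<close>

definition left_translation :: "('g, 'm) monoid_scheme \<Rightarrow> 'g set \<Rightarrow> 'g \<Rightarrow> 'g set \<Rightarrow> 'g set" where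
  "left_translation G H \<sigma> = (\<lambda>C \<in> lcosets\<^bsub>G\<^esub> H. \<sigma> <#\<^bsub>G\<^esub> C)"

definition star_action ::
    "('g, 'm) monoid_scheme \<Rightarrow> 'g set \<Rightarrow> 'g \<Rightarrow> ('g set \<Rightarrow> 'g set) \<Rightarrow> ('g set \<Rightarrow> 'g set)" where
  "star_action G H \<sigma> \<eta> =
     (let P = BijGroup (lcosets\<^bsub>G\<^esub> H); l = left_translation G H \<sigma> in
        l \<otimes>\<^bsub>P\<^esub> \<eta> \<otimes>\<^bsub>P\<^esub> inv\<^bsub>P\<^esub> l)"

definition regular_subgroup :: "'x set \<Rightarrow> ('x \<Rightarrow> 'x) set \<Rightarrow> bool" where
  "regular_subgroup Y N \<longleftrightarrow>
     subgroup N (BijGroup Y) \<and> card N = card Y \<and> (\<forall>x \<in> Y. \<forall>y \<in> Y. \<exists>\<eta> \<in> N. \<eta> x = y)"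

definition perm_group :: "'x set \<Rightarrow> ('x \<Rightarrow> 'x) set \<Rightarrow> ('x \<Rightarrow> 'x) monoid" where
  "perm_group Y N = (BijGroup Y)\<lparr>carrier := N\<rparr>"


section \<open>Monoid algebras and tensor products\<close>

text \<open>Elements of \<open>F[M]\<close> are finitely supported functions on \<open>M\<close>, zero outside the carrier.\<close>

definition monoid_algebra ::
    "('f, 'a) ring_scheme \<Rightarrow> ('m, 'b) monoid_scheme \<Rightarrow> ('f, 'm \<Rightarrow> 'f) module" where
  "monoid_algebra F M =
     \<lparr>carrier = {u. (\<forall>m. u m \<in> carrier F) \<and> (\<forall>m. m \<notin> carrier M \<longrightarrow> u m = \<zero>\<^bsub>F\<^esub>) \<and>
                    finite {m. u m \<noteq> \<zero>\<^bsub>F\<^esub>}},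
      monoid.mult = (\<lambda>u v m. \<Oplus>\<^bsub>F\<^esub>p \<in> {p. u (fst p) \<noteq> \<zero>\<^bsub>F\<^esub> \<and> v (snd p) \<noteq> \<zero>\<^bsub>F\<^esub> \<and> fst p \<otimes>\<^bsub>M\<^esub> snd p = m}.
                u (fst p) \<otimes>\<^bsub>F\<^esub> v (snd p)),
      monoid.one = (\<lambda>m. if m = \<one>\<^bsub>M\<^esub> then \<one>\<^bsub>F\<^esub> else \<zero>\<^bsub>F\<^esub>),
      ring.zero = (\<lambda>m. \<zero>\<^bsub>F\<^esub>),
      ring.add = (\<lambda>u v m. u m \<oplus>\<^bsub>F\<^esub> v m),
      smult = (\<lambda>r u m. r \<otimes>\<^bsub>F\<^esub> u m)\<rparr>"

definition basis_elem :: "('f, 'a) ring_scheme \<Rightarrow> 'm \<Rightarrow> 'm \<Rightarrow> 'f" where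
  "basis_elem F m = (\<lambda>m'. if m' = m then \<one>\<^bsub>F\<^esub> else \<zero>\<^bsub>F\<^esub>)"

text \<open>The tensor product \<open>A \<otimes>\<^sub>F B\<close> is the free \<open>F\<close>-module on \<open>A \<times> B\<close> modulo the submodule generated
  by the bilinearity relations. The free module is taken to be the monoid algebra of the
  multiplicative monoid \<open>A \<times> B\<close>, whose convolution product induces
  \<open>(a \<otimes> b)(a' \<otimes> b') = aa' \<otimes> bb'\<close> on the quotient.\<close>

definition tensor_relators ::
    "('f, 'r) ring_scheme \<Rightarrow> ('f, 'a, 's) module_scheme \<Rightarrow> ('f, 'b, 't) module_scheme
      \<Rightarrow> ('a \<times> 'b \<Rightarrow> 'f) set" where
  "tensor_relators F A B =
     (let P = monoid_algebra F (A \<times>\<times> B); e = basis_elem F in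
        {e (a \<oplus>\<^bsub>A\<^esub> a', b) \<ominus>\<^bsub>P\<^esub> (e (a, b) \<oplus>\<^bsub>P\<^esub> e (a', b)) |a a' b.
           a \<in> carrier A \<and> a' \<in> carrier A \<and> b \<in> carrier B} \<union>
        {e (a, b \<oplus>\<^bsub>B\<^esub> b') \<ominus>\<^bsub>P\<^esub> (e (a, b) \<oplus>\<^bsub>P\<^esub> e (a, b')) |a b b'.
           a \<in> carrier A \<and> b \<in> carrier B \<and> b' \<in> carrier B} \<union>
        {e (r \<odot>\<^bsub>A\<^esub> a, b) \<ominus>\<^bsub>P\<^esub> (r \<odot>\<^bsub>P\<^esub> e (a, b)) |r a b.
           r \<in> carrier F \<and> a \<in> carrier A \<and> b \<in> carrier B} \<union>
        {e (a, r \<odot>\<^bsub>B\<^esub> b) \<ominus>\<^bsub>P\<^esub> (r \<odot>\<^bsub>P\<^esub> e (a, b)) |r a b.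
           r \<in> carrier F \<and> a \<in> carrier A \<and> b \<in> carrier B})"

definition tensor_kernel ::
    "('f, 'r) ring_scheme \<Rightarrow> ('f, 'a, 's) module_scheme \<Rightarrow> ('f, 'b, 't) module_scheme
      \<Rightarrow> ('a \<times> 'b \<Rightarrow> 'f) set" where
  "tensor_kernel F A B =
     \<Inter>{S. submodule S F (monoid_algebra F (A \<times>\<times> B)) \<and> tensor_relators F A B \<subseteq> S}"

definition tensor ::
    "('f, 'r) ring_scheme \<Rightarrow> ('f, 'a, 's) module_scheme \<Rightarrow> ('f, 'b, 't) module_scheme
      \<Rightarrow> ('f, ('a \<times> 'b \<Rightarrow> 'f) set) module" where
  "tensor F A B =
     (let P = monoid_algebra F (A \<times>\<times> B); I = tensor_kernel F A B in
        \<lparr>carrier = a_rcosets\<^bsub>P\<^esub> I,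
         monoid.mult = rcoset_mult P I,
         monoid.one = I +>\<^bsub>P\<^esub> \<one>\<^bsub>P\<^esub>,
         ring.zero = I,
         ring.add = set_add P,
         smult = (\<lambda>r T. \<Union>u \<in> T. I +>\<^bsub>P\<^esub> (r \<odot>\<^bsub>P\<^esub> u))\<rparr>)"

definition pure_tensor ::
    "('f, 'r) ring_scheme \<Rightarrow> ('f, 'a, 's) module_scheme \<Rightarrow> ('f, 'b, 't) module_scheme
      \<Rightarrow> 'a \<Rightarrow> 'b \<Rightarrow> ('a \<times> 'b \<Rightarrow> 'f) set" where
  "pure_tensor F A B a b =
     tensor_kernel F A B +>\<^bsub>monoid_algebra F (A \<times>\<times> B)\<^esub> basis_elem F (a, b)"

text \<open>The \<open>F\<close>-linear map \<open>A \<otimes>\<^sub>F B \<rightarrow> W\<close> with \<open>a \<otimes> b \<mapsto> \<beta> a b\<close>, for an \<open>F\<close>-bilinear \<open>\<beta>\<close>: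
  the linear extension of \<open>\<beta>\<close> to the free module is constant on cosets of the kernel.\<close>

definition tensor_lift ::
    "('f, 'r) ring_scheme \<Rightarrow> ('f, 'w, 's) module_scheme \<Rightarrow> ('a \<Rightarrow> 'b \<Rightarrow> 'w)
      \<Rightarrow> ('a \<times> 'b \<Rightarrow> 'f) set \<Rightarrow> 'w" where
  "tensor_lift F W \<beta> T =
     the_elem ((\<lambda>u. \<Oplus>\<^bsub>W\<^esub>p \<in> {p. u p \<noteq> \<zero>\<^bsub>F\<^esub>}. u p \<odot>\<^bsub>W\<^esub> \<beta> (fst p) (snd p)) ` T)"

definition self_algebra :: "('f, 'r) ring_scheme \<Rightarrow> ('f, 'f) module" where
  "self_algebra F =
     \<lparr>carrier = carrier F, monoid.mult = monoid.mult F, monoid.one = monoid.one F,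
      ring.zero = ring.zero F, ring.add = ring.add F, smult = monoid.mult F\<rparr>"


section \<open>Hopf algebras\<close>

record ('f, 'h) hopf = "('f, 'h) module" +
  comult :: "'h \<Rightarrow> ('h \<times> 'h \<Rightarrow> 'f) set"
  counit :: "'h \<Rightarrow> 'f"
  antipode :: "'h \<Rightarrow> 'h"

definition hopf_iso ::
    "('f, 'r) ring_scheme \<Rightarrow> ('f, 'a, 's) hopf_scheme \<Rightarrow> ('f, 'b, 't) hopf_scheme \<Rightarrow> ('a \<Rightarrow> 'b) set" where
  "hopf_iso F A B =
     {\<phi> \<in> ring_iso A B.
        (\<forall>r \<in> carrier F. \<forall>x \<in> carrier A. \<phi> (r \<odot>\<^bsub>A\<^esub> x) = r \<odot>\<^bsub>B\<^esub> \<phi> x) \<and>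
        (\<forall>x \<in> carrier A.
           comult B (\<phi> x) =
             tensor_lift F (tensor F B B) (\<lambda>a b. pure_tensor F B B (\<phi> a) (\<phi> b)) (comult A x)) \<and>
        (\<forall>x \<in> carrier A. counit B (\<phi> x) = counit A x) \<and>
        (\<forall>x \<in> carrier A. antipode B (\<phi> x) = \<phi> (antipode A x))}"

definition hopf_isomorphic ::
    "('f, 'r) ring_scheme \<Rightarrow> ('f, 'a, 's) hopf_scheme \<Rightarrow> ('f, 'b, 't) hopf_scheme \<Rightarrow> bool" where
  "hopf_isomorphic F A B \<longleftrightarrow> hopf_iso F A B \<noteq> {}"

text \<open>The group algebra \<open>F[M]\<close>: every \<open>m \<in> M\<close> is grouplike.\<close>

definition group_hopf ::
    "('f, 'a) ring_scheme \<Rightarrow> ('m, 'b) monoid_scheme \<Rightarrow> ('f, 'm \<Rightarrow> 'f) hopf" where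
  "group_hopf F M =
     (let A = monoid_algebra F M in
        module.extend A
          \<lparr>comult = (\<lambda>u. \<Oplus>\<^bsub>tensor F A A\<^esub>m \<in> {m. u m \<noteq> \<zero>\<^bsub>F\<^esub>}.
                       u m \<odot>\<^bsub>tensor F A A\<^esub> pure_tensor F A A (basis_elem F m) (basis_elem F m)),
           counit = (\<lambda>u. \<Oplus>\<^bsub>F\<^esub>m \<in> {m. u m \<noteq> \<zero>\<^bsub>F\<^esub>}. u m),
           antipode = (\<lambda>u m. if m \<in> carrier M then u (inv\<^bsub>M\<^esub> m) else \<zero>\<^bsub>F\<^esub>)\<rparr>)"

text \<open>Let \<open>F\<close> be a subfield of \<open>F'\<close>, \<open>A\<close> an \<open>F'\<close>-Hopf algebra and \<open>S \<subseteq> A\<close> an \<open>F\<close>-form of \<open>A\<close>. All operations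
  of \<open>A\<close> but the comultiplication restrict to \<open>S\<close> literally; the comultiplication of \<open>A\<close> restricts to
  \<open>S\<close> via the canonical injection \<open>S \<otimes>\<^sub>F S \<rightarrow> A \<otimes>\<^bsub>F'\<^esub> A\<close>.\<close>

definition restrict_hopf ::
    "('f, 'r) ring_scheme \<Rightarrow> ('f, 's) ring_scheme \<Rightarrow> ('f, 'h) hopf \<Rightarrow> 'h set \<Rightarrow> ('f, 'h) hopf" where
  "restrict_hopf F F' A S =
     A\<lparr>carrier := S,
       comult := (\<lambda>x. THE t. t \<in> carrier (tensor F (A\<lparr>carrier := S\<rparr>) (A\<lparr>carrier := S\<rparr>)) \<and>
                    tensor_lift F (tensor F' A A) (pure_tensor F' A A) t = comult A x)\<rparr>"

text \<open>The \<open>F'\<close>-Hopf algebra \<open>F' \<otimes>\<^sub>F H\<close> for a subring \<open>F\<close> of \<open>F'\<close>, with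
  \<open>\<Delta>(a \<otimes> h) = a \<cdot> \<Sum> (1 \<otimes> h\<^sub>1) \<otimes> (1 \<otimes> h\<^sub>2)\<close> where \<open>\<Delta>(h) = \<Sum> h\<^sub>1 \<otimes> h\<^sub>2\<close>.\<close>

definition base_change_algebra ::
    "('f, 'r) ring_scheme \<Rightarrow> ('f, 's) ring_scheme \<Rightarrow> ('f, 'h, 't) module_scheme
      \<Rightarrow> ('f, ('f \<times> 'h \<Rightarrow> 'f) set) module" where
  "base_change_algebra F F' H =
     (let T = tensor F (self_algebra F') H in
        T\<lparr>smult := (\<lambda>c. tensor_lift F T (\<lambda>a h. pure_tensor F (self_algebra F') H (c \<otimes>\<^bsub>F'\<^esub> a) h))\<rparr>)"

definition base_change ::
    "('f, 'r) ring_scheme \<Rightarrow> ('f, 's) ring_scheme \<Rightarrow> ('f, 'h, 't) hopf_scheme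
      \<Rightarrow> ('f, ('f \<times> 'h \<Rightarrow> 'f) set) hopf" where
  "base_change F F' H =
     (let T = base_change_algebra F F' H;
          p = pure_tensor F (self_algebra F') H;
          TT = tensor F' T T in
        module.extend T
          \<lparr>comult = tensor_lift F TT
             (\<lambda>a h. a \<odot>\<^bsub>TT\<^esub>
                tensor_lift F TT (\<lambda>h1 h2. pure_tensor F' T T (p \<one>\<^bsub>F'\<^esub> h1) (p \<one>\<^bsub>F'\<^esub> h2)) (comult H h)),
           counit = tensor_lift F (self_algebra F') (\<lambda>a h. a \<otimes>\<^bsub>F'\<^esub> counit H h),
           antipode = tensor_lift F T (\<lambda>a h. p a (antipode H h))\<rparr>)"


section \<open>The Hopf algebra \<open>E[N]\<^sup>G\<close>\<close>

text \<open>\<open>\<sigma> (\<Sum>\<eta>. c\<^sub>\<eta> \<eta>) = \<Sum>\<eta>. \<sigma>(c\<^sub>\<eta>) (\<sigma> * \<eta>)\<close>: the coefficient at \<open>\<eta>\<close> is \<open>\<sigma>\<close> of the one at \<open>\<sigma>\<inverse> * \<eta>\<close>.\<close>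

definition galois_action ::
    "('e, 'm) ring_scheme \<Rightarrow> ('e \<Rightarrow> 'e) monoid \<Rightarrow> ('e \<Rightarrow> 'e) set
      \<Rightarrow> (('e \<Rightarrow> 'e) set \<Rightarrow> ('e \<Rightarrow> 'e) set) set \<Rightarrow> ('e \<Rightarrow> 'e)
      \<Rightarrow> ((('e \<Rightarrow> 'e) set \<Rightarrow> ('e \<Rightarrow> 'e) set) \<Rightarrow> 'e) \<Rightarrow> ((('e \<Rightarrow> 'e) set \<Rightarrow> ('e \<Rightarrow> 'e) set) \<Rightarrow> 'e)" where
  "galois_action E G H N \<sigma> u =
     (\<lambda>\<eta>. if \<eta> \<in> N then \<sigma> (u (star_action G H (inv\<^bsub>G\<^esub> \<sigma>) \<eta>)) else \<zero>\<^bsub>E\<^esub>)"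

definition fixed_hopf ::
    "('e, 'm) ring_scheme \<Rightarrow> 'e set \<Rightarrow> ('e \<Rightarrow> 'e) monoid \<Rightarrow> ('e \<Rightarrow> 'e) set
      \<Rightarrow> (('e \<Rightarrow> 'e) set \<Rightarrow> ('e \<Rightarrow> 'e) set) set
      \<Rightarrow> ('e, (('e \<Rightarrow> 'e) set \<Rightarrow> ('e \<Rightarrow> 'e) set) \<Rightarrow> 'e) hopf" where
  "fixed_hopf E K G H N =
     (let A = group_hopf E (perm_group (lcosets\<^bsub>G\<^esub> H) N) in
        restrict_hopf (E\<lparr>carrier := K\<rparr>) E A
          {u \<in> carrier A. \<forall>\<sigma> \<in> carrier G. galois_action E G H N \<sigma> u = u})"

end

theory Submission
  imports Defs
begin

text \<open>Since \<open>K = E\<^sup>G\<close>, there are \<open>c\<^sub>i, d\<^sub>i \<in> E\<close> such that \<open>\<Sum>i. \<sigma>(c\<^sub>i) \<tau>(d\<^sub>i)\<close> is \<open>1\<close> for \<open>\<sigma> = \<tau>\<close> and \<open>0\<close> otherwise. For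
  \<open>t \<in> E\<close> of trace \<open>1\<close>, the traces of \<open>c\<^sub>i t x\<close> and of \<open>d\<^sub>i x\<close> for \<open>x \<in> N\<close> are elements \<open>p\<^sub>k, g\<^sub>k\<close> of \<open>E[N]\<^sup>G\<close> with \<open>\<Sum>k. p\<^sub>k(x) g\<^sub>k(y) = 1\<close> if
  \<open>x = y\<close> and \<open>0\<close> otherwise. They form a dual basis of \<open>E[N]\<^sup>G\<close>, which identifies \<open>K' \<otimes> E[N]\<^sup>G\<close> with
  \<open>E[N]\<^bsup>G'\<^esup>\<close> and embeds the tensor square of \<open>E[N]\<^bsup>G'\<^esup>\<close> into the functions \<open>N \<times> N \<rightarrow> E\<close>, where the
  comultiplication becomes the extension of a function from the diagonal by \<open>0\<close>.

  The elements \<open>g\<^sub>k\<close> span \<open>E[N]\<close> over \<open>E\<close>, so an isomorphism of \<open>K'\<close>-Hopf algebras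
  \<open>E[N\<^sub>1]\<^bsup>G'\<^esup> \<rightarrow> E[N\<^sub>2]\<^bsup>G'\<^esup>\<close> has a matrix over \<open>E\<close>. As it sends group-like elements to group-like
  elements, the matrix is that of a map \<open>N\<^sub>1 \<rightarrow> N\<^sub>2\<close>, which is then an isomorphism of \<open>G'\<close>-groups.
  Conversely, such an isomorphism of groups induces one of the group algebras over \<open>E\<close> that respects
  the invariants.\<close>

subsection \<open>Finite sums\<close>

text \<open>The obstacle is that tensor products are literal quotients of free modules, and that the
  comultiplication of E[N]^G is specified only by its image in the tensor square of E[N] over E:
  nothing can be computed before the canonical maps between tensor products are known to be
  injective. The dual basis removes it. If the pairings of a module with the p k have values in the
  small field, every tensor can be expanded along the g k, so it is determined by its matrix of
  coordinates in E, and an identity between tensors becomes an identity between functions with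
  values in E. All Hopf operations are therefore recorded in coordinates, and the base change is
  never handled except through them.

  The factor t in the p k avoids a division by |G|: without it the sum over k would be |G| instead
  of 1 on the diagonal, which is 0 when the characteristic of E divides |G|. An element of trace 1
  exists in every characteristic.

  The same family serves the converse. Since the g k span all functions on N over E, a statement
  known only for invariant elements can be tested against them and becomes a statement about single
  group elements.\<close>

lemma (in abelian_monoid) finsum_swap:
  assumes "finite A" "finite B" "\<And>a b. a \<in> A \<Longrightarrow> b \<in> B \<Longrightarrow> f a b \<in> carrier G"
  shows "(\<Oplus>a\<in>A. \<Oplus>b\<in>B. f a b) = (\<Oplus>b\<in>B. \<Oplus>a\<in>A. f a b)"
  using assms(1,3)
proof (induction A rule: finite_induct)
  case empty
  then show ?case by (simp add: finsum_zero)
next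
  case (insert x A)
  have "(\<Oplus>a\<in>insert x A. \<Oplus>b\<in>B. f a b) = (\<Oplus>b\<in>B. f x b) \<oplus> (\<Oplus>a\<in>A. \<Oplus>b\<in>B. f a b)"
    using insert by (intro finsum_insert) (auto intro!: finsum_closed)
  also have "\<dots> = (\<Oplus>b\<in>B. f x b) \<oplus> (\<Oplus>b\<in>B. \<Oplus>a\<in>A. f a b)"
    using insert by simp
  also have "\<dots> = (\<Oplus>b\<in>B. f x b \<oplus> (\<Oplus>a\<in>A. f a b))"
    using insert by (intro finsum_addf[symmetric]) (auto intro!: finsum_closed)
  also have "\<dots> = (\<Oplus>b\<in>B. \<Oplus>a\<in>insert x A. f a b)"
    using insert by (intro finsum_cong') (auto intro!: finsum_closed finsum_insert[symmetric])
  finally show ?case .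
qed

lemma (in abelian_monoid) finsum_cong_closed:
  assumes "\<And>i. i \<in> A \<Longrightarrow> f i = g i" "\<And>i. i \<in> A \<Longrightarrow> g i \<in> carrier G"
  shows "finsum G f A = finsum G g A"
  using assms by (intro finsum_cong') auto

lemma (in abelian_monoid) finsum_mono_neutral:
  assumes "finite B" "A \<subseteq> B" "\<And>i. i \<in> B - A \<Longrightarrow> f i = \<zero>" "f \<in> A \<rightarrow> carrier G"
  shows "finsum G f A = finsum G f B"
  using assms by (intro add.finprod_mono_neutral_cong_left) auto

lemma (in abelian_monoid) finsum_delta:
  assumes "finite A" "i \<in> A" "f i \<in> carrier G" "\<And>j. j \<in> A \<Longrightarrow> j \<noteq> i \<Longrightarrow> f j = \<zero>"
  shows "finsum G f A = f i"
proof -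
  have "finsum G f {i} = finsum G f A"
    using assms by (intro finsum_mono_neutral) auto
  thus ?thesis using assms by simp
qed

lemma (in abelian_monoid) finsum_all_zero:
  assumes "\<And>i. i \<in> A \<Longrightarrow> f i = \<zero>"
  shows "finsum G f A = \<zero>"
  by (rule add.finprod_one_eqI) (use assms in auto)

text \<open>Extended by zero from the fibres to all of \<open>A\<close>, the inner sums can be
  exchanged with the outer one; each \<open>a\<close> lies in exactly one fibre.\<close>

lemma (in abelian_monoid) finsum_fibres:
  assumes "finite A" "finite B" "f ` A \<subseteq> B" "\<And>a. a \<in> A \<Longrightarrow> h a \<in> carrier G"
  shows "(\<Oplus>b\<in>B. \<Oplus>a\<in>{a \<in> A. f a = b}. h a) = (\<Oplus>a\<in>A. h a)"
proof -
  have "(\<Oplus>b\<in>B. \<Oplus>a\<in>{a \<in> A. f a = b}. h a)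
      = (\<Oplus>b\<in>B. \<Oplus>a\<in>A. if f a = b then h a else \<zero>)"
  proof (rule finsum_cong_closed)
    fix b assume "b \<in> B"
    have "(\<Oplus>a\<in>{a \<in> A. f a = b}. h a) = (\<Oplus>a\<in>{a \<in> A. f a = b}. if f a = b then h a else \<zero>)"
      using assms(4) by (intro finsum_cong') auto
    also have "\<dots> = (\<Oplus>a\<in>A. if f a = b then h a else \<zero>)"
      using assms by (intro finsum_mono_neutral) auto
    finally show "(\<Oplus>a\<in>{a \<in> A. f a = b}. h a) = (\<Oplus>a\<in>A. if f a = b then h a else \<zero>)" .
  qed (use assms in \<open>auto intro!: finsum_closed\<close>)
  also have "\<dots> = (\<Oplus>a\<in>A. \<Oplus>b\<in>B. if f a = b then h a else \<zero>)"
    using assms by (intro finsum_swap) auto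
  also have "\<dots> = (\<Oplus>a\<in>A. h a)"
  proof (rule finsum_cong_closed)
    fix a assume "a \<in> A"
    then show "(\<Oplus>b\<in>B. if f a = b then h a else \<zero>) = h a"
      using assms finsum_delta[of B "f a" "\<lambda>b. if f a = b then h a else \<zero>"] by auto
  qed (use assms in auto)
  finally show ?thesis .
qed

lemma (in abelian_monoid) finsum_Times:
  assumes "finite A" "finite B" "\<And>a b. a \<in> A \<Longrightarrow> b \<in> B \<Longrightarrow> f (a, b) \<in> carrier G"
  shows "(\<Oplus>p\<in>A \<times> B. f p) = (\<Oplus>a\<in>A. \<Oplus>b\<in>B. f (a, b))"
  using assms(1,3)
proof (induction A rule: finite_induct)
  case empty
  then show ?case by simp
next
  case (insert x A)
  have "(\<Oplus>p\<in>insert x A \<times> B. f p) = (\<Oplus>p\<in>Pair x ` B \<union> A \<times> B. f p)"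
    by (rule arg_cong[where f = "finsum G f"]) auto
  also have "\<dots> = (\<Oplus>p\<in>Pair x ` B. f p) \<oplus> (\<Oplus>p\<in>A \<times> B. f p)"
    using insert assms(2) by (intro finsum_Un_disjoint) auto
  also have "(\<Oplus>p\<in>Pair x ` B. f p) = (\<Oplus>b\<in>B. f (x, b))"
    using insert.prems by (intro finsum_reindex) (auto simp: inj_on_def)
  also have "(\<Oplus>p\<in>A \<times> B. f p) = (\<Oplus>a\<in>A. \<Oplus>b\<in>B. f (a, b))"
    using insert by simp
  also have "(\<Oplus>b\<in>B. f (x, b)) \<oplus> (\<Oplus>a\<in>A. \<Oplus>b\<in>B. f (a, b)) = (\<Oplus>a\<in>insert x A. \<Oplus>b\<in>B. f (a, b))"
    using insert by (intro finsum_insert[symmetric]) (auto intro!: finsum_closed)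
  finally show ?case .
qed

lemma (in abelian_group) eq_if_minus_zero:
  assumes "x \<in> carrier G" "y \<in> carrier G" "x \<ominus> y = \<zero>"
  shows "x = y"
proof -
  have "x = (x \<ominus> y) \<oplus> y" using assms(1,2) by (simp add: a_minus_def a_assoc l_neg)
  then show ?thesis using assms by simp
qed

lemma abelian_group_hom_addI:
  assumes "abelian_group A" "abelian_group B"
    and "\<And>x. x \<in> carrier A \<Longrightarrow> h x \<in> carrier B"
    and "\<And>x y. x \<in> carrier A \<Longrightarrow> y \<in> carrier A \<Longrightarrow> h (x \<oplus>\<^bsub>A\<^esub> y) = h x \<oplus>\<^bsub>B\<^esub> h y"
  shows "abelian_group_hom A B h"
proof -
  interpret A: abelian_group A by fact
  interpret B: abelian_group B by fact
  show ?thesis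
    by (intro abelian_group_homI group_hom.intro group_hom_axioms.intro
        A.abelian_group_axioms B.abelian_group_axioms A.a_group B.a_group)
       (auto simp: hom_def assms(3,4))
qed

lemma abelian_group_hom_finsum:
  assumes "abelian_group_hom A B h" "finite S" "\<And>i. i \<in> S \<Longrightarrow> f i \<in> carrier A"
  shows "h (finsum A f S) = finsum B (\<lambda>i. h (f i)) S"
proof -
  interpret abelian_group_hom A B h by fact
  show ?thesis
    using assms(2,3)
  proof (induction S rule: finite_induct)
    case empty
    then show ?case by simp
  next
    case (insert x S)
    have "h (finsum A f (insert x S)) = h (f x \<oplus>\<^bsub>A\<^esub> finsum A f S)"
      using insert by (subst G.finsum_insert) auto
    also have "\<dots> = h (f x) \<oplus>\<^bsub>B\<^esub> h (finsum A f S)"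
      using insert by (intro hom_add) (auto intro!: G.finsum_closed)
    also have "\<dots> = finsum B (\<lambda>i. h (f i)) (insert x S)"
      using insert by (subst H.finsum_insert) auto
    finally show ?case .
  qed
qed

subsection \<open>Free modules\<close>

lemma monoid_algebra_simps:
  "carrier (monoid_algebra F M) = {u. (\<forall>m. u m \<in> carrier F) \<and> (\<forall>m. m \<notin> carrier M \<longrightarrow> u m = \<zero>\<^bsub>F\<^esub>) \<and>
                    finite {m. u m \<noteq> \<zero>\<^bsub>F\<^esub>}}"
  "\<zero>\<^bsub>monoid_algebra F M\<^esub> = (\<lambda>m. \<zero>\<^bsub>F\<^esub>)"
  "u \<oplus>\<^bsub>monoid_algebra F M\<^esub> v = (\<lambda>m. u m \<oplus>\<^bsub>F\<^esub> v m)"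
  "r \<odot>\<^bsub>monoid_algebra F M\<^esub> u = (\<lambda>m. r \<otimes>\<^bsub>F\<^esub> u m)"
  "\<one>\<^bsub>monoid_algebra F M\<^esub> = basis_elem F \<one>\<^bsub>M\<^esub>"
  by (auto simp: monoid_algebra_def basis_elem_def)

text \<open>\<open>M\<close> acts as a mere index set, which lets the result cover
  \<open>A \<times>\<times> B\<close> for modules \<open>A\<close> and \<open>B\<close> whose
  products satisfy no laws.\<close>

lemma monoid_algebra_module:
  assumes "cring F"
  shows "module F (monoid_algebra F M)"
proof -
  interpret cring F by fact
  show ?thesis
  proof (rule moduleI[OF assms])
    show "abelian_group (monoid_algebra F M)"
    proof (rule abelian_groupI, unfold monoid_algebra_simps)
      fix x y assume x: "x \<in> {u. (\<forall>m. u m \<in> carrier F) \<and> (\<forall>m. m \<notin> carrier M \<longrightarrow> u m = \<zero>\<^bsub>F\<^esub>) \<and>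
                    finite {m. u m \<noteq> \<zero>\<^bsub>F\<^esub>}}"
         and y: "y \<in> {u. (\<forall>m. u m \<in> carrier F) \<and> (\<forall>m. m \<notin> carrier M \<longrightarrow> u m = \<zero>\<^bsub>F\<^esub>) \<and>
                    finite {m. u m \<noteq> \<zero>\<^bsub>F\<^esub>}}"
      have "{m. x m \<oplus>\<^bsub>F\<^esub> y m \<noteq> \<zero>\<^bsub>F\<^esub>} \<subseteq> {m. x m \<noteq> \<zero>\<^bsub>F\<^esub>} \<union> {m. y m \<noteq> \<zero>\<^bsub>F\<^esub>}"
        by auto
      moreover have "finite ({m. x m \<noteq> \<zero>\<^bsub>F\<^esub>} \<union> {m. y m \<noteq> \<zero>\<^bsub>F\<^esub>})" using x y by auto
      ultimately have "finite {m. x m \<oplus>\<^bsub>F\<^esub> y m \<noteq> \<zero>\<^bsub>F\<^esub>}" by (rule finite_subset)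
      then show "(\<lambda>m. x m \<oplus>\<^bsub>F\<^esub> y m) \<in> {u. (\<forall>m. u m \<in> carrier F) \<and> (\<forall>m. m \<notin> carrier M \<longrightarrow> u m = \<zero>\<^bsub>F\<^esub>) \<and>
                    finite {m. u m \<noteq> \<zero>\<^bsub>F\<^esub>}}"
        using x y by auto
    next
      fix x assume x: "x \<in> {u. (\<forall>m. u m \<in> carrier F) \<and> (\<forall>m. m \<notin> carrier M \<longrightarrow> u m = \<zero>\<^bsub>F\<^esub>) \<and>
                    finite {m. u m \<noteq> \<zero>\<^bsub>F\<^esub>}}"
      have "{m. \<ominus>\<^bsub>F\<^esub> x m \<noteq> \<zero>\<^bsub>F\<^esub>} \<subseteq> {m. x m \<noteq> \<zero>\<^bsub>F\<^esub>}" by auto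
      then have "finite {m. \<ominus>\<^bsub>F\<^esub> x m \<noteq> \<zero>\<^bsub>F\<^esub>}" using x finite_subset by auto
      then show "\<exists>y\<in>{u. (\<forall>m. u m \<in> carrier F) \<and> (\<forall>m. m \<notin> carrier M \<longrightarrow> u m = \<zero>\<^bsub>F\<^esub>) \<and>
                    finite {m. u m \<noteq> \<zero>\<^bsub>F\<^esub>}}. (\<lambda>m. y m \<oplus>\<^bsub>F\<^esub> x m) = (\<lambda>m. \<zero>\<^bsub>F\<^esub>)"
        using x by (intro bexI[of _ "\<lambda>m. \<ominus>\<^bsub>F\<^esub> x m"]) (auto simp: l_neg)
    qed (auto simp: a_ac)
    fix a x assume a: "a \<in> carrier F" and x: "x \<in> carrier (monoid_algebra F M)"
    have "{m. a \<otimes>\<^bsub>F\<^esub> x m \<noteq> \<zero>\<^bsub>F\<^esub>} \<subseteq> {m. x m \<noteq> \<zero>\<^bsub>F\<^esub>}" using a by auto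
    then have "finite {m. a \<otimes>\<^bsub>F\<^esub> x m \<noteq> \<zero>\<^bsub>F\<^esub>}"
      using x finite_subset by (auto simp: monoid_algebra_simps)
    then show "a \<odot>\<^bsub>monoid_algebra F M\<^esub> x \<in> carrier (monoid_algebra F M)"
      using a x by (auto simp: monoid_algebra_simps)
  qed (auto simp: monoid_algebra_simps l_distr r_distr m_assoc)
qed

lemma basis_elem_closed:
  assumes "cring F" "m \<in> carrier M"
  shows "basis_elem F m \<in> carrier (monoid_algebra F M)"
proof -
  interpret cring F by fact
  have "{m'. basis_elem F m m' \<noteq> \<zero>\<^bsub>F\<^esub>} \<subseteq> {m}" by (auto simp: basis_elem_def)
  then have "finite {m'. basis_elem F m m' \<noteq> \<zero>\<^bsub>F\<^esub>}" using finite_subset by blast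
  then show ?thesis using assms by (auto simp: monoid_algebra_simps basis_elem_def)
qed

text \<open>Induction on the support, splitting off one coefficient at a time.\<close>

lemma monoid_algebra_induct [consumes 2, case_names zero add smult_basis]:
  assumes "cring F" "u \<in> carrier (monoid_algebra F M)"
    and "Q \<zero>\<^bsub>monoid_algebra F M\<^esub>"
    and "\<And>u v. \<lbrakk>u \<in> carrier (monoid_algebra F M); v \<in> carrier (monoid_algebra F M); Q u; Q v\<rbrakk>
            \<Longrightarrow> Q (u \<oplus>\<^bsub>monoid_algebra F M\<^esub> v)"
    and "\<And>r m. \<lbrakk>r \<in> carrier F; m \<in> carrier M\<rbrakk> \<Longrightarrow> Q (r \<odot>\<^bsub>monoid_algebra F M\<^esub> basis_elem F m)"
  shows "Q u"
proof -
  interpret cring F by fact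
  interpret P: module F "monoid_algebra F M" by (rule monoid_algebra_module[OF assms(1)])
  have "Q u" if "finite S" "u \<in> carrier (monoid_algebra F M)" "{m. u m \<noteq> \<zero>\<^bsub>F\<^esub>} = S" for S u
    using that
  proof (induction S arbitrary: u rule: finite_induct)
    case empty
    then have "u = \<zero>\<^bsub>monoid_algebra F M\<^esub>" by (auto simp: monoid_algebra_simps)
    then show ?case using assms(3) by simp
  next
    case (insert m S)
    define v where "v = (\<lambda>x. if x = m then \<zero>\<^bsub>F\<^esub> else u x)"
    define w where "w = u m \<odot>\<^bsub>monoid_algebra F M\<^esub> basis_elem F m"
    have uc: "\<And>x. u x \<in> carrier F" using insert.prems by (auto simp: monoid_algebra_simps)
    have S: "{x. v x \<noteq> \<zero>\<^bsub>F\<^esub>} = S" using insert by (auto simp: v_def)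
    have v: "v \<in> carrier (monoid_algebra F M)"
      using insert S by (auto simp: monoid_algebra_simps v_def)
    have m: "m \<in> carrier M" using insert.prems by (auto simp: monoid_algebra_simps)
    have w: "w \<in> carrier (monoid_algebra F M)" "Q w"
      unfolding w_def using basis_elem_closed[OF assms(1) m] uc assms(5) m by auto
    have "u = v \<oplus>\<^bsub>monoid_algebra F M\<^esub> w"
      using uc by (auto simp: v_def w_def monoid_algebra_simps basis_elem_def)
    then show ?case using assms(4)[OF v w(1) insert.IH[OF v S] w(2)] by simp
  qed
  then show ?thesis using assms(2) by (auto simp: monoid_algebra_simps)
qed

text \<open>The expression inside \<open>tensor_lift\<close>, isolated so that it can be studied on
  the free module before cosets are taken.\<close>

definition lin_ext :: "('f, 'r) ring_scheme \<Rightarrow> ('f, 'w, 's) module_scheme \<Rightarrow> ('m \<Rightarrow> 'w) \<Rightarrow> ('m \<Rightarrow> 'f) \<Rightarrow> 'w"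
  where "lin_ext F W f u = (\<Oplus>\<^bsub>W\<^esub>p \<in> {p. u p \<noteq> \<zero>\<^bsub>F\<^esub>}. u p \<odot>\<^bsub>W\<^esub> f p)"

context
  fixes F :: "('f, 'r) ring_scheme" and W :: "('f, 'w, 's) module_scheme"
    and M :: "('m, 'b) monoid_scheme" and f :: "'m \<Rightarrow> 'w"
  assumes W: "module F W" and f_Pi: "f \<in> carrier M \<rightarrow> carrier W"
begin

private lemma f: "m \<in> carrier M \<Longrightarrow> f m \<in> carrier W"
  using f_Pi by auto

interpretation W: module F W by (rule W)
interpretation P: module F "monoid_algebra F M" by (rule monoid_algebra_module) unfold_locales

text \<open>Supports shrink under sums and scalar multiples. Replacing them by a common finite
  superset makes the linear extensions of several elements comparable term by term.\<close>

lemma lin_ext_superset: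
  assumes "u \<in> carrier (monoid_algebra F M)" "finite S" "S \<subseteq> carrier M" "{m. u m \<noteq> \<zero>\<^bsub>F\<^esub>} \<subseteq> S"
  shows "lin_ext F W f u = (\<Oplus>\<^bsub>W\<^esub>m \<in> S. u m \<odot>\<^bsub>W\<^esub> f m)"
  unfolding lin_ext_def
  using assms f by (intro W.finsum_mono_neutral) (auto simp: monoid_algebra_simps subset_iff)

lemma lin_ext_closed:
  assumes "u \<in> carrier (monoid_algebra F M)"
  shows "lin_ext F W f u \<in> carrier W"
  unfolding lin_ext_def
  using assms f by (intro W.finsum_closed) (fastforce simp: monoid_algebra_simps)

lemma supp_subset: "u \<in> carrier (monoid_algebra F M) \<Longrightarrow> {m. u m \<noteq> \<zero>\<^bsub>F\<^esub>} \<subseteq> carrier M"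
   "u \<in> carrier (monoid_algebra F M) \<Longrightarrow> finite {m. u m \<noteq> \<zero>\<^bsub>F\<^esub>}"
   "u \<in> carrier (monoid_algebra F M) \<Longrightarrow> u m \<in> carrier F"
  by (auto simp: monoid_algebra_simps)

lemma lin_ext_add:
  assumes u: "u \<in> carrier (monoid_algebra F M)" and v: "v \<in> carrier (monoid_algebra F M)"
  shows "lin_ext F W f (u \<oplus>\<^bsub>monoid_algebra F M\<^esub> v) = lin_ext F W f u \<oplus>\<^bsub>W\<^esub> lin_ext F W f v"
proof -
  define S where "S = {m. u m \<noteq> \<zero>\<^bsub>F\<^esub>} \<union> {m. v m \<noteq> \<zero>\<^bsub>F\<^esub>}"
  have S: "finite S" "S \<subseteq> carrier M" using u v supp_subset by (auto simp: S_def)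
  have uv: "u \<oplus>\<^bsub>monoid_algebra F M\<^esub> v \<in> carrier (monoid_algebra F M)" using u v by simp
  have "{m. (u \<oplus>\<^bsub>monoid_algebra F M\<^esub> v) m \<noteq> \<zero>\<^bsub>F\<^esub>} \<subseteq> S"
    by (auto simp: S_def monoid_algebra_simps)
  then have "lin_ext F W f (u \<oplus>\<^bsub>monoid_algebra F M\<^esub> v)
      = (\<Oplus>\<^bsub>W\<^esub>m \<in> S. (u m \<oplus>\<^bsub>F\<^esub> v m) \<odot>\<^bsub>W\<^esub> f m)"
    using lin_ext_superset[OF uv S] by (simp add: monoid_algebra_simps)
  also have "\<dots> = (\<Oplus>\<^bsub>W\<^esub>m \<in> S. u m \<odot>\<^bsub>W\<^esub> f m \<oplus>\<^bsub>W\<^esub> v m \<odot>\<^bsub>W\<^esub> f m)"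
    using S f supp_subset(3)[OF u] supp_subset(3)[OF v]
    by (intro W.finsum_cong') (auto simp: W.smult_l_distr subset_iff)
  also have "\<dots> = (\<Oplus>\<^bsub>W\<^esub>m \<in> S. u m \<odot>\<^bsub>W\<^esub> f m) \<oplus>\<^bsub>W\<^esub> (\<Oplus>\<^bsub>W\<^esub>m \<in> S. v m \<odot>\<^bsub>W\<^esub> f m)"
    using S f supp_subset(3)[OF u] supp_subset(3)[OF v] by (intro W.finsum_addf) auto
  also have "(\<Oplus>\<^bsub>W\<^esub>m \<in> S. u m \<odot>\<^bsub>W\<^esub> f m) = lin_ext F W f u"
    using u S by (intro lin_ext_superset[symmetric]) (auto simp: S_def)
  also have "(\<Oplus>\<^bsub>W\<^esub>m \<in> S. v m \<odot>\<^bsub>W\<^esub> f m) = lin_ext F W f v"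
    using v S by (intro lin_ext_superset[symmetric]) (auto simp: S_def)
  finally show ?thesis .
qed

lemma lin_ext_smult:
  assumes u: "u \<in> carrier (monoid_algebra F M)" and r: "r \<in> carrier F"
  shows "lin_ext F W f (r \<odot>\<^bsub>monoid_algebra F M\<^esub> u) = r \<odot>\<^bsub>W\<^esub> lin_ext F W f u"
proof -
  define S where "S = {m. u m \<noteq> \<zero>\<^bsub>F\<^esub>}"
  have S: "finite S" "S \<subseteq> carrier M" using u supp_subset by (auto simp: S_def)
  have "lin_ext F W f (r \<odot>\<^bsub>monoid_algebra F M\<^esub> u) = (\<Oplus>\<^bsub>W\<^esub>m \<in> S. (r \<otimes>\<^bsub>F\<^esub> u m) \<odot>\<^bsub>W\<^esub> f m)"
    using P.smult_closed[OF r u] u r S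
    by (subst lin_ext_superset[of _ S]) (auto simp: S_def monoid_algebra_simps(4))
  also have "\<dots> = (\<Oplus>\<^bsub>W\<^esub>m \<in> S. r \<odot>\<^bsub>W\<^esub> (u m \<odot>\<^bsub>W\<^esub> f m))"
    using S f supp_subset(3)[OF u] r
    by (intro W.finsum_cong') (auto simp: W.smult_assoc1 subset_iff)
  also have "\<dots> = r \<odot>\<^bsub>W\<^esub> (\<Oplus>\<^bsub>W\<^esub>m \<in> S. u m \<odot>\<^bsub>W\<^esub> f m)"
    using S f supp_subset(3)[OF u] r by (intro W.finsum_smult_ldistr[symmetric]) auto
  finally show ?thesis by (simp add: lin_ext_def S_def)
qed

lemma lin_ext_basis:
  assumes "m \<in> carrier M" "\<one>\<^bsub>F\<^esub> \<noteq> \<zero>\<^bsub>F\<^esub>"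
  shows "lin_ext F W f (basis_elem F m) = f m"
proof -
  have "lin_ext F W f (basis_elem F m) = (\<Oplus>\<^bsub>W\<^esub>m' \<in> {m}. basis_elem F m m' \<odot>\<^bsub>W\<^esub> f m')"
    using assms basis_elem_closed[OF _ assms(1)] W.R.cring_axioms
    by (intro lin_ext_superset) (auto simp: basis_elem_def)
  also have "\<dots> = f m" using f assms by (simp add: basis_elem_def)
  finally show ?thesis .
qed

lemma lin_ext_hom: "abelian_group_hom (monoid_algebra F M) W (lin_ext F W f)"
  by (rule abelian_group_hom_addI[OF P.abelian_group_axioms W.abelian_group_axioms])
     (auto simp: lin_ext_closed lin_ext_add)

lemma lin_ext_minus:
  assumes u: "u \<in> carrier (monoid_algebra F M)" and v: "v \<in> carrier (monoid_algebra F M)"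
  shows "lin_ext F W f (u \<ominus>\<^bsub>monoid_algebra F M\<^esub> v) = lin_ext F W f u \<ominus>\<^bsub>W\<^esub> lin_ext F W f v"
proof -
  interpret h: abelian_group_hom "monoid_algebra F M" W "lin_ext F W f" by (rule lin_ext_hom)
  show ?thesis using u v by (simp add: a_minus_def)
qed

text \<open>A coefficient of the convolution product is a sum over the factorisations of an element,
  that is, over a fibre of the multiplication on the product of the two supports. Summing over all
  fibres gives the double sum over that product.\<close>

lemma lin_ext_mult:
  assumes u: "u \<in> carrier (monoid_algebra F M)" and v: "v \<in> carrier (monoid_algebra F M)"
    and M: "\<And>x y. x \<in> carrier M \<Longrightarrow> y \<in> carrier M \<Longrightarrow> x \<otimes>\<^bsub>M\<^esub> y \<in> carrier M"
  shows "u \<otimes>\<^bsub>monoid_algebra F M\<^esub> v \<in> carrier (monoid_algebra F M)"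
    and "lin_ext F W f (u \<otimes>\<^bsub>monoid_algebra F M\<^esub> v)
       = (\<Oplus>\<^bsub>W\<^esub>s \<in> {s. u s \<noteq> \<zero>\<^bsub>F\<^esub>}. \<Oplus>\<^bsub>W\<^esub>t \<in> {t. v t \<noteq> \<zero>\<^bsub>F\<^esub>}. (u s \<otimes>\<^bsub>F\<^esub> v t) \<odot>\<^bsub>W\<^esub> f (s \<otimes>\<^bsub>M\<^esub> t))"
proof -
  let ?A = "{s. u s \<noteq> \<zero>\<^bsub>F\<^esub>} \<times> {t. v t \<noteq> \<zero>\<^bsub>F\<^esub>}"
  let ?\<mu> = "\<lambda>p. fst p \<otimes>\<^bsub>M\<^esub> snd p"
  let ?h = "\<lambda>p. u (fst p) \<otimes>\<^bsub>F\<^esub> v (snd p)"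
  have uv: "(u \<otimes>\<^bsub>monoid_algebra F M\<^esub> v) m = (\<Oplus>\<^bsub>F\<^esub>p \<in> {p \<in> ?A. ?\<mu> p = m}. ?h p)" for m
    by (auto simp: monoid_algebra_def intro!: arg_cong[where f = "finsum F _"])
  have A: "finite ?A" "?A \<subseteq> carrier M \<times> carrier M"
    using supp_subset(1,2)[OF u] supp_subset(1,2)[OF v] by auto
  have S: "finite (?\<mu> ` ?A)" "?\<mu> ` ?A \<subseteq> carrier M"
    using A M by (auto simp: subset_iff)
  have h: "?h p \<in> carrier F" for p
    using supp_subset(3)[OF u] supp_subset(3)[OF v] by auto
  have supp: "{m. (u \<otimes>\<^bsub>monoid_algebra F M\<^esub> v) m \<noteq> \<zero>\<^bsub>F\<^esub>} \<subseteq> ?\<mu> ` ?A"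
  proof
    fix m assume "m \<in> {m. (u \<otimes>\<^bsub>monoid_algebra F M\<^esub> v) m \<noteq> \<zero>\<^bsub>F\<^esub>}"
    then have "{p \<in> ?A. ?\<mu> p = m} \<noteq> {}" unfolding uv mem_Collect_eq by (metis W.R.finsum_empty)
    then show "m \<in> ?\<mu> ` ?A" by blast
  qed
  have "(u \<otimes>\<^bsub>monoid_algebra F M\<^esub> v) m \<in> carrier F" for m
    unfolding uv using h by (intro W.R.finsum_closed) auto
  moreover have "finite {m. (u \<otimes>\<^bsub>monoid_algebra F M\<^esub> v) m \<noteq> \<zero>\<^bsub>F\<^esub>}"
    using finite_subset[OF supp S(1)] .
  ultimately show closed: "u \<otimes>\<^bsub>monoid_algebra F M\<^esub> v \<in> carrier (monoid_algebra F M)"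
    using order_trans[OF supp S(2)] unfolding monoid_algebra_simps(1) by blast
  have fp: "f (?\<mu> p) \<in> carrier W" if "p \<in> ?A" for p
    using that S(2) f by blast
  have "lin_ext F W f (u \<otimes>\<^bsub>monoid_algebra F M\<^esub> v)
      = (\<Oplus>\<^bsub>W\<^esub>m \<in> ?\<mu> ` ?A. (\<Oplus>\<^bsub>F\<^esub>p \<in> {p \<in> ?A. ?\<mu> p = m}. ?h p) \<odot>\<^bsub>W\<^esub> f m)"
    by (subst lin_ext_superset[OF closed S supp]) (simp only: uv)
  also have "\<dots> = (\<Oplus>\<^bsub>W\<^esub>m \<in> ?\<mu> ` ?A. \<Oplus>\<^bsub>W\<^esub>p \<in> {p \<in> ?A. ?\<mu> p = m}. ?h p \<odot>\<^bsub>W\<^esub> f (?\<mu> p))"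
  proof (rule W.finsum_cong_closed)
    fix m assume m: "m \<in> ?\<mu> ` ?A"
    then have fm: "f m \<in> carrier W" using S f by blast
    have "abelian_group_hom F W (\<lambda>r. r \<odot>\<^bsub>W\<^esub> f m)"
      by (rule abelian_group_hom_addI[OF W.R.abelian_group_axioms W.M.abelian_group_axioms])
         (use fm in \<open>auto simp: W.smult_l_distr\<close>)
    from abelian_group_hom_finsum[OF this, of "{p \<in> ?A. ?\<mu> p = m}" ?h]
    have "(\<Oplus>\<^bsub>F\<^esub>p \<in> {p \<in> ?A. ?\<mu> p = m}. ?h p) \<odot>\<^bsub>W\<^esub> f m = (\<Oplus>\<^bsub>W\<^esub>p \<in> {p \<in> ?A. ?\<mu> p = m}. ?h p \<odot>\<^bsub>W\<^esub> f m)"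
      using A h by auto
    also have "\<dots> = (\<Oplus>\<^bsub>W\<^esub>p \<in> {p \<in> ?A. ?\<mu> p = m}. ?h p \<odot>\<^bsub>W\<^esub> f (?\<mu> p))"
      by (rule W.finsum_cong_closed) (use h fm in auto)
    finally show "(\<Oplus>\<^bsub>F\<^esub>p \<in> {p \<in> ?A. ?\<mu> p = m}. ?h p) \<odot>\<^bsub>W\<^esub> f m
        = (\<Oplus>\<^bsub>W\<^esub>p \<in> {p \<in> ?A. ?\<mu> p = m}. ?h p \<odot>\<^bsub>W\<^esub> f (?\<mu> p))" .
    show "(\<Oplus>\<^bsub>W\<^esub>p \<in> {p \<in> ?A. ?\<mu> p = m}. ?h p \<odot>\<^bsub>W\<^esub> f (?\<mu> p)) \<in> carrier W"
      by (rule W.finsum_closed) (use h fp in auto)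
  qed
  also have "\<dots> = (\<Oplus>\<^bsub>W\<^esub>p \<in> ?A. ?h p \<odot>\<^bsub>W\<^esub> f (?\<mu> p))"
    by (rule W.finsum_fibres[OF A(1) S(1)]) (use h fp in auto)
  also have "\<dots> = (\<Oplus>\<^bsub>W\<^esub>s \<in> {s. u s \<noteq> \<zero>\<^bsub>F\<^esub>}. \<Oplus>\<^bsub>W\<^esub>t \<in> {t. v t \<noteq> \<zero>\<^bsub>F\<^esub>}. (u s \<otimes>\<^bsub>F\<^esub> v t) \<odot>\<^bsub>W\<^esub> f (s \<otimes>\<^bsub>M\<^esub> t))"
    by (subst W.finsum_Times)
       (use h[of "(_, _)"] fp supp_subset(2)[OF u] supp_subset(2)[OF v] in auto)
  finally show "lin_ext F W f (u \<otimes>\<^bsub>monoid_algebra F M\<^esub> v)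
       = (\<Oplus>\<^bsub>W\<^esub>s \<in> {s. u s \<noteq> \<zero>\<^bsub>F\<^esub>}. \<Oplus>\<^bsub>W\<^esub>t \<in> {t. v t \<noteq> \<zero>\<^bsub>F\<^esub>}. (u s \<otimes>\<^bsub>F\<^esub> v t) \<odot>\<^bsub>W\<^esub> f (s \<otimes>\<^bsub>M\<^esub> t))" .
qed

end

subsection \<open>Tensor products\<close>

definition bilinear_map ::
    "('f, 'r) ring_scheme \<Rightarrow> ('f, 'a, 's) module_scheme \<Rightarrow> ('f, 'b, 't) module_scheme
      \<Rightarrow> ('f, 'w, 'u) module_scheme \<Rightarrow> ('a \<Rightarrow> 'b \<Rightarrow> 'w) \<Rightarrow> bool" where
  "bilinear_map F A B W \<beta> \<longleftrightarrow>
     (\<forall>a \<in> carrier A. \<forall>b \<in> carrier B. \<beta> a b \<in> carrier W) \<and>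
     (\<forall>a \<in> carrier A. \<forall>a' \<in> carrier A. \<forall>b \<in> carrier B. \<beta> (a \<oplus>\<^bsub>A\<^esub> a') b = \<beta> a b \<oplus>\<^bsub>W\<^esub> \<beta> a' b) \<and>
     (\<forall>a \<in> carrier A. \<forall>b \<in> carrier B. \<forall>b' \<in> carrier B. \<beta> a (b \<oplus>\<^bsub>B\<^esub> b') = \<beta> a b \<oplus>\<^bsub>W\<^esub> \<beta> a b') \<and>
     (\<forall>r \<in> carrier F. \<forall>a \<in> carrier A. \<forall>b \<in> carrier B. \<beta> (r \<odot>\<^bsub>A\<^esub> a) b = r \<odot>\<^bsub>W\<^esub> \<beta> a b) \<and>
     (\<forall>r \<in> carrier F. \<forall>a \<in> carrier A. \<forall>b \<in> carrier B. \<beta> a (r \<odot>\<^bsub>B\<^esub> b) = r \<odot>\<^bsub>W\<^esub> \<beta> a b)"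

lemma bilinear_mapI:
  assumes "\<And>a b. a \<in> carrier A \<Longrightarrow> b \<in> carrier B \<Longrightarrow> \<beta> a b \<in> carrier W"
    and "\<And>a a' b. a \<in> carrier A \<Longrightarrow> a' \<in> carrier A \<Longrightarrow> b \<in> carrier B \<Longrightarrow> \<beta> (a \<oplus>\<^bsub>A\<^esub> a') b = \<beta> a b \<oplus>\<^bsub>W\<^esub> \<beta> a' b"
    and "\<And>a b b'. a \<in> carrier A \<Longrightarrow> b \<in> carrier B \<Longrightarrow> b' \<in> carrier B \<Longrightarrow> \<beta> a (b \<oplus>\<^bsub>B\<^esub> b') = \<beta> a b \<oplus>\<^bsub>W\<^esub> \<beta> a b'"
    and "\<And>r a b. r \<in> carrier F \<Longrightarrow> a \<in> carrier A \<Longrightarrow> b \<in> carrier B \<Longrightarrow> \<beta> (r \<odot>\<^bsub>A\<^esub> a) b = r \<odot>\<^bsub>W\<^esub> \<beta> a b"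
    and "\<And>r a b. r \<in> carrier F \<Longrightarrow> a \<in> carrier A \<Longrightarrow> b \<in> carrier B \<Longrightarrow> \<beta> a (r \<odot>\<^bsub>B\<^esub> b) = r \<odot>\<^bsub>W\<^esub> \<beta> a b"
  shows "bilinear_map F A B W \<beta>"
  using assms by (auto simp: bilinear_map_def)

text \<open>The tensor product reads only these five fields, so records that differ in the zero or
  in the Hopf operations give literally the same quotient. This identifies the tensor products of
  the various records built on one module.\<close>

lemma tensor_cong:
  assumes "carrier A' = carrier A" "monoid.mult A' = monoid.mult A" "monoid.one A' = monoid.one A"
    "ring.add A' = ring.add A" "smult A' = smult A"
    and "carrier B' = carrier B" "monoid.mult B' = monoid.mult B" "monoid.one B' = monoid.one B"
    "ring.add B' = ring.add B" "smult B' = smult B"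
  shows "tensor F A' B' = tensor F A B" "pure_tensor F A' B' = pure_tensor F A B"
proof -
  have D: "A' \<times>\<times> B' = A \<times>\<times> B" using assms by (simp add: DirProd_def)
  then have R: "tensor_relators F A' B' = tensor_relators F A B"
    using assms by (simp add: tensor_relators_def)
  show "tensor F A' B' = tensor F A B" "pure_tensor F A' B' = pure_tensor F A B"
    using D R by (simp_all add: tensor_def pure_tensor_def[abs_def] tensor_kernel_def)
qed

locale module_pair = A: module F A + B: module F B
  for F :: "('f, 'r) ring_scheme" and A :: "('f, 'a, 's) module_scheme"
    and B :: "('f, 'b, 't) module_scheme" +
  assumes one_not_zero: "\<one>\<^bsub>F\<^esub> \<noteq> \<zero>\<^bsub>F\<^esub>"
begin

abbreviation P :: "('f, 'a \<times> 'b \<Rightarrow> 'f) module" where "P \<equiv> monoid_algebra F (A \<times>\<times> B)"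
abbreviation I :: "('a \<times> 'b \<Rightarrow> 'f) set" where "I \<equiv> tensor_kernel F A B"
abbreviation q :: "('a \<times> 'b \<Rightarrow> 'f) \<Rightarrow> ('a \<times> 'b \<Rightarrow> 'f) set" where "q u \<equiv> I +>\<^bsub>P\<^esub> u"

sublocale P: module F P
  by (rule monoid_algebra_module) (rule A.R.cring_axioms)

lemma basis_elem_P: "a \<in> carrier A \<Longrightarrow> b \<in> carrier B \<Longrightarrow> basis_elem F (a, b) \<in> carrier P"
  by (rule basis_elem_closed[OF A.R.cring_axioms]) simp

lemma tensor_relators_subset: "tensor_relators F A B \<subseteq> carrier P"
  unfolding tensor_relators_def Let_def by (auto simp: basis_elem_P)

lemma tensor_kernel_submodule: "submodule I F P"
proof -
  \<comment> \<open>The family that is intersected is nonempty; otherwise the intersection would be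
    the whole type instead of a subset of the free module.\<close>
  have car: "carrier P \<in> {S. submodule S F P \<and> tensor_relators F A B \<subseteq> S}"
    using tensor_relators_subset P.carrier_is_submodule by simp
  have E: "S \<subseteq> carrier P" "\<zero>\<^bsub>P\<^esub> \<in> S" "\<And>a. a \<in> S \<Longrightarrow> \<ominus>\<^bsub>P\<^esub> a \<in> S" "\<And>a b. a \<in> S \<Longrightarrow> b \<in> S \<Longrightarrow> a \<oplus>\<^bsub>P\<^esub> b \<in> S"
    "\<And>r a. r \<in> carrier F \<Longrightarrow> a \<in> S \<Longrightarrow> r \<odot>\<^bsub>P\<^esub> a \<in> S"
    if "submodule S F P" for S
  proof -
    show "S \<subseteq> carrier P" "\<And>a. a \<in> S \<Longrightarrow> \<ominus>\<^bsub>P\<^esub> a \<in> S" "\<And>a b. a \<in> S \<Longrightarrow> b \<in> S \<Longrightarrow> a \<oplus>\<^bsub>P\<^esub> b \<in> S"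
      "\<And>r a. r \<in> carrier F \<Longrightarrow> a \<in> S \<Longrightarrow> r \<odot>\<^bsub>P\<^esub> a \<in> S"
      using P.submoduleE[OF that] by auto
    show "\<zero>\<^bsub>P\<^esub> \<in> S" using subgroup.one_closed[OF submodule.axioms(1)[OF that]] by simp
  qed
  show ?thesis
    unfolding tensor_kernel_def
    by (rule P.submoduleI) (use car E in auto)
qed

lemma tensor_relators_kernel: "tensor_relators F A B \<subseteq> I"
  by (auto simp: tensor_kernel_def)

lemma tensor_kernel_minimal:
  "submodule S F P \<Longrightarrow> tensor_relators F A B \<subseteq> S \<Longrightarrow> I \<subseteq> S"
  by (auto simp: tensor_kernel_def)

sublocale I: abelian_subgroup I P
  by (rule abelian_subgroupI2[OF P.a_comm_group submodule.axioms(1)[OF tensor_kernel_submodule]])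

lemma q_eqI:
  assumes "u \<in> carrier P" "v \<in> carrier P" "u \<ominus>\<^bsub>P\<^esub> v \<in> I"
  shows "q u = q v"
  using assms I.a_rcos_module_rev[of v u] I.a_repr_independence'[of u v] by (simp add: a_minus_def)

lemma q_mem_diff:
  assumes "u \<in> carrier P" "v \<in> q u"
  shows "v \<in> carrier P" "v \<ominus>\<^bsub>P\<^esub> u \<in> I"
  using assms I.a_rcos_module_imp[of u v] I.a_elemrcos_carrier[of u v] by (simp_all add: a_minus_def)

lemma carrier_tensor: "carrier (tensor F A B) = q ` carrier P"
  by (auto simp: tensor_def Let_def A_RCOSETS_def' a_r_coset_def)

lemma q_add: "u \<in> carrier P \<Longrightarrow> v \<in> carrier P \<Longrightarrow> q u \<oplus>\<^bsub>tensor F A B\<^esub> q v = q (u \<oplus>\<^bsub>P\<^esub> v)"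
  by (simp add: tensor_def Let_def I.a_rcos_sum)

lemma q_zero: "\<zero>\<^bsub>tensor F A B\<^esub> = q \<zero>\<^bsub>P\<^esub>"
  using I.a_rcos_const[of "\<zero>\<^bsub>P\<^esub>"] by (simp add: tensor_def Let_def)

text \<open>The scalar action on a coset is a union over its representatives. Since the kernel is a
  submodule, all the cosets united here coincide.\<close>

lemma q_smult:
  assumes r: "r \<in> carrier F" and u: "u \<in> carrier P"
  shows "r \<odot>\<^bsub>tensor F A B\<^esub> q u = q (r \<odot>\<^bsub>P\<^esub> u)"
proof -
  have "q (r \<odot>\<^bsub>P\<^esub> v) = q (r \<odot>\<^bsub>P\<^esub> u)" if "v \<in> q u" for v
  proof (rule q_eqI)
    have v: "v \<in> carrier P" "v \<ominus>\<^bsub>P\<^esub> u \<in> I" using q_mem_diff[OF u that] .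
    have "r \<odot>\<^bsub>P\<^esub> v \<ominus>\<^bsub>P\<^esub> r \<odot>\<^bsub>P\<^esub> u = r \<odot>\<^bsub>P\<^esub> (v \<ominus>\<^bsub>P\<^esub> u)"
      using r u v(1) by (simp add: a_minus_def P.smult_r_distr P.smult_r_minus)
    then show "r \<odot>\<^bsub>P\<^esub> v \<ominus>\<^bsub>P\<^esub> r \<odot>\<^bsub>P\<^esub> u \<in> I"
      using P.submoduleE(4)[OF tensor_kernel_submodule r v(2)] by simp
    show "r \<odot>\<^bsub>P\<^esub> v \<in> carrier P" "r \<odot>\<^bsub>P\<^esub> u \<in> carrier P" using r u v by auto
  qed
  then have "(\<Union>v \<in> q u. q (r \<odot>\<^bsub>P\<^esub> v)) = (\<Union>v \<in> q u. q (r \<odot>\<^bsub>P\<^esub> u))" by (rule SUP_cong[OF refl])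
  also have "\<dots> = q (r \<odot>\<^bsub>P\<^esub> u)" using I.a_rcos_self[OF u] by blast
  finally show ?thesis by (simp add: tensor_def Let_def)
qed

lemma tensor_module: "module F (tensor F A B)"
proof (rule moduleI)
  show "cring F" by (rule A.R.cring_axioms)
  show "abelian_group (tensor F A B)"
  proof (rule abelian_groupI)
    fix x assume "x \<in> carrier (tensor F A B)"
    then obtain u where u: "u \<in> carrier P" "x = q u" by (auto simp: carrier_tensor)
    have "q (\<ominus>\<^bsub>P\<^esub> u) \<oplus>\<^bsub>tensor F A B\<^esub> x = \<zero>\<^bsub>tensor F A B\<^esub>"
      using u by (simp add: q_add q_zero P.l_neg)
    then show "\<exists>y\<in>carrier (tensor F A B). y \<oplus>\<^bsub>tensor F A B\<^esub> x = \<zero>\<^bsub>tensor F A B\<^esub>"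
      using u by (auto simp: carrier_tensor)
  qed (auto simp: carrier_tensor q_add q_zero P.a_ac)
qed (auto simp: carrier_tensor q_add q_zero q_smult P.smult_l_distr P.smult_r_distr P.smult_assoc1)

sublocale T: module F "tensor F A B" by (rule tensor_module)

lemma pure_tensor_q: "pure_tensor F A B a b = q (basis_elem F (a, b))"
  by (simp add: pure_tensor_def)

lemma pure_tensor_closed:
  "a \<in> carrier A \<Longrightarrow> b \<in> carrier B \<Longrightarrow> pure_tensor F A B a b \<in> carrier (tensor F A B)"
  by (simp add: pure_tensor_q carrier_tensor basis_elem_P)

lemma pure_tensor_bilinear: "bilinear_map F A B (tensor F A B) (pure_tensor F A B)"
proof (rule bilinear_mapI)
  show "pure_tensor F A B (a \<oplus>\<^bsub>A\<^esub> a') b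
      = pure_tensor F A B a b \<oplus>\<^bsub>tensor F A B\<^esub> pure_tensor F A B a' b"
    if "a \<in> carrier A" "a' \<in> carrier A" "b \<in> carrier B" for a a' b
  proof -
    have "basis_elem F (a \<oplus>\<^bsub>A\<^esub> a', b) \<ominus>\<^bsub>P\<^esub> (basis_elem F (a, b) \<oplus>\<^bsub>P\<^esub> basis_elem F (a', b)) \<in> tensor_relators F A B"
      unfolding tensor_relators_def Let_def using that by blast
    then show ?thesis
      using that tensor_relators_kernel
      by (simp add: pure_tensor_q q_add basis_elem_P) (rule q_eqI, auto simp: basis_elem_P)
  qed
  show "pure_tensor F A B a (b \<oplus>\<^bsub>B\<^esub> b')
      = pure_tensor F A B a b \<oplus>\<^bsub>tensor F A B\<^esub> pure_tensor F A B a b'"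
    if "a \<in> carrier A" "b \<in> carrier B" "b' \<in> carrier B" for a b b'
  proof -
    have "basis_elem F (a, b \<oplus>\<^bsub>B\<^esub> b') \<ominus>\<^bsub>P\<^esub> (basis_elem F (a, b) \<oplus>\<^bsub>P\<^esub> basis_elem F (a, b')) \<in> tensor_relators F A B"
      unfolding tensor_relators_def Let_def using that by blast
    then show ?thesis
      using that tensor_relators_kernel
      by (simp add: pure_tensor_q q_add basis_elem_P) (rule q_eqI, auto simp: basis_elem_P)
  qed
  show "pure_tensor F A B (r \<odot>\<^bsub>A\<^esub> a) b = r \<odot>\<^bsub>tensor F A B\<^esub> pure_tensor F A B a b"
    if "r \<in> carrier F" "a \<in> carrier A" "b \<in> carrier B" for r a b
  proof -
    have "basis_elem F (r \<odot>\<^bsub>A\<^esub> a, b) \<ominus>\<^bsub>P\<^esub> (r \<odot>\<^bsub>P\<^esub> basis_elem F (a, b)) \<in> tensor_relators F A B"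
      unfolding tensor_relators_def Let_def using that by blast
    then show ?thesis
      using that tensor_relators_kernel
      by (simp add: pure_tensor_q q_smult basis_elem_P) (rule q_eqI, auto simp: basis_elem_P)
  qed
  show "pure_tensor F A B a (r \<odot>\<^bsub>B\<^esub> b) = r \<odot>\<^bsub>tensor F A B\<^esub> pure_tensor F A B a b"
    if "r \<in> carrier F" "a \<in> carrier A" "b \<in> carrier B" for r a b
  proof -
    have "basis_elem F (a, r \<odot>\<^bsub>B\<^esub> b) \<ominus>\<^bsub>P\<^esub> (r \<odot>\<^bsub>P\<^esub> basis_elem F (a, b)) \<in> tensor_relators F A B"
      unfolding tensor_relators_def Let_def using that by blast
    then show ?thesis
      using that tensor_relators_kernel
      by (simp add: pure_tensor_q q_smult basis_elem_P) (rule q_eqI, auto simp: basis_elem_P)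
  qed
qed (rule pure_tensor_closed)

lemma pure_tensor_add_left:
  "a \<in> carrier A \<Longrightarrow> a' \<in> carrier A \<Longrightarrow> b \<in> carrier B \<Longrightarrow>
    pure_tensor F A B (a \<oplus>\<^bsub>A\<^esub> a') b = pure_tensor F A B a b \<oplus>\<^bsub>tensor F A B\<^esub> pure_tensor F A B a' b"
  and pure_tensor_add_right:
  "a \<in> carrier A \<Longrightarrow> b \<in> carrier B \<Longrightarrow> b' \<in> carrier B \<Longrightarrow>
    pure_tensor F A B a (b \<oplus>\<^bsub>B\<^esub> b') = pure_tensor F A B a b \<oplus>\<^bsub>tensor F A B\<^esub> pure_tensor F A B a b'"
  and pure_tensor_smult_left:
  "r \<in> carrier F \<Longrightarrow> a \<in> carrier A \<Longrightarrow> b \<in> carrier B \<Longrightarrow>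
    pure_tensor F A B (r \<odot>\<^bsub>A\<^esub> a) b = r \<odot>\<^bsub>tensor F A B\<^esub> pure_tensor F A B a b"
  and pure_tensor_smult_right:
  "r \<in> carrier F \<Longrightarrow> a \<in> carrier A \<Longrightarrow> b \<in> carrier B \<Longrightarrow>
    pure_tensor F A B a (r \<odot>\<^bsub>B\<^esub> b) = r \<odot>\<^bsub>tensor F A B\<^esub> pure_tensor F A B a b"
  using pure_tensor_bilinear by (simp_all add: bilinear_map_def)

text \<open>No case for zero or for scalar multiples is required: a scalar is absorbed into the left
  factor of a pure tensor, and zero is itself a pure tensor.\<close>

lemma tensor_induct [consumes 1, case_names pure add]:
  assumes t: "t \<in> carrier (tensor F A B)"
    and pure: "\<And>a b. a \<in> carrier A \<Longrightarrow> b \<in> carrier B \<Longrightarrow> Q (pure_tensor F A B a b)"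
    and add: "\<And>s t. \<lbrakk>s \<in> carrier (tensor F A B); t \<in> carrier (tensor F A B); Q s; Q t\<rbrakk>
            \<Longrightarrow> Q (s \<oplus>\<^bsub>tensor F A B\<^esub> t)"
  shows "Q t"
proof -
  obtain u where u: "u \<in> carrier P" "t = q u" using t by (auto simp: carrier_tensor)
  have q_smult_basis: "q (r \<odot>\<^bsub>P\<^esub> basis_elem F (a, b)) = pure_tensor F A B (r \<odot>\<^bsub>A\<^esub> a) b"
    if "r \<in> carrier F" "a \<in> carrier A" "b \<in> carrier B" for r a b
    using that by (simp add: pure_tensor_smult_left) (simp add: pure_tensor_q q_smult basis_elem_P)
  have "Q (q u)"
    using A.R.cring_axioms u(1)
  proof (induction rule: monoid_algebra_induct)
    case zero
    have "q \<zero>\<^bsub>P\<^esub> = pure_tensor F A B (\<zero>\<^bsub>F\<^esub> \<odot>\<^bsub>A\<^esub> \<zero>\<^bsub>A\<^esub>) \<zero>\<^bsub>B\<^esub>"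
      by (subst q_smult_basis[symmetric]) (auto simp: basis_elem_P)
    then show ?case using pure by simp
  next
    case (add u v)
    then show ?case using assms(3)[of "q u" "q v"] by (auto simp: q_add carrier_tensor)
  next
    case (smult_basis r m)
    then show ?case using pure q_smult_basis by (cases m) auto
  qed
  then show ?thesis using u by simp
qed

text \<open>Bilinearity makes the linear extension vanish on the relators, hence on the smallest
  submodule containing them. It is then constant on cosets, which gives the \<open>the_elem\<close>
  in \<open>tensor_lift\<close> its meaning.\<close>

lemma tensor_lift_q:
  assumes W: "module F W" and \<beta>: "bilinear_map F A B W \<beta>" and u: "u \<in> carrier P"
  shows "tensor_lift F W \<beta> (q u) = lin_ext F W (\<lambda>p. \<beta> (fst p) (snd p)) u"
proof -
  interpret W: module F W by fact
  let ?f = "\<lambda>p. \<beta> (fst p) (snd p)"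
  have f: "?f \<in> carrier (A \<times>\<times> B) \<rightarrow> carrier W"
    using \<beta> by (auto simp: bilinear_map_def)
  note ext = lin_ext_closed[OF W f]
     lin_ext_add[OF W f]
     lin_ext_minus[OF W f]
     lin_ext_smult[OF W f]
  have bas: "lin_ext F W ?f (basis_elem F (a, b)) = \<beta> a b" if "a \<in> carrier A" "b \<in> carrier B" for a b
    using lin_ext_basis[OF W f, where m = "(a, b)"] that one_not_zero by simp
  define S where "S = {u \<in> carrier P. lin_ext F W ?f u = \<zero>\<^bsub>W\<^esub>}"
  interpret h: abelian_group_hom P W "lin_ext F W ?f"
    by (rule lin_ext_hom[OF W f])
  have "submodule S F P"
    by (rule P.submoduleI) (auto simp: S_def ext)
  moreover have "tensor_relators F A B \<subseteq> S"
  proof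
    fix x assume "x \<in> tensor_relators F A B"
    then consider
      a a' b where "x = basis_elem F (a \<oplus>\<^bsub>A\<^esub> a', b) \<ominus>\<^bsub>P\<^esub> (basis_elem F (a, b) \<oplus>\<^bsub>P\<^esub> basis_elem F (a', b))"
         "a \<in> carrier A" "a' \<in> carrier A" "b \<in> carrier B"
    | a b b' where "x = basis_elem F (a, b \<oplus>\<^bsub>B\<^esub> b') \<ominus>\<^bsub>P\<^esub> (basis_elem F (a, b) \<oplus>\<^bsub>P\<^esub> basis_elem F (a, b'))"
         "a \<in> carrier A" "b \<in> carrier B" "b' \<in> carrier B"
    | r a b where "x = basis_elem F (r \<odot>\<^bsub>A\<^esub> a, b) \<ominus>\<^bsub>P\<^esub> (r \<odot>\<^bsub>P\<^esub> basis_elem F (a, b))"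
         "r \<in> carrier F" "a \<in> carrier A" "b \<in> carrier B"
    | r a b where "x = basis_elem F (a, r \<odot>\<^bsub>B\<^esub> b) \<ominus>\<^bsub>P\<^esub> (r \<odot>\<^bsub>P\<^esub> basis_elem F (a, b))"
         "r \<in> carrier F" "a \<in> carrier A" "b \<in> carrier B"
      unfolding tensor_relators_def Let_def by blast
    then show "x \<in> S"
      by cases (use \<beta> in \<open>auto simp: S_def ext bas basis_elem_P bilinear_map_def W.r_neg a_minus_def\<close>)
  qed
  ultimately have IS: "I \<subseteq> S" by (rule tensor_kernel_minimal)
  have "lin_ext F W ?f v = lin_ext F W ?f u" if "v \<in> q u" for v
  proof -
    have v: "v \<in> carrier P" "v \<ominus>\<^bsub>P\<^esub> u \<in> I" using q_mem_diff[OF u that] .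
    then have "lin_ext F W ?f v \<ominus>\<^bsub>W\<^esub> lin_ext F W ?f u = \<zero>\<^bsub>W\<^esub>"
      using IS u by (auto simp: S_def ext)
    then show ?thesis by (rule W.eq_if_minus_zero[OF ext(1)[OF v(1)] ext(1)[OF u]])
  qed
  then have "lin_ext F W ?f ` q u = (\<lambda>_. lin_ext F W ?f u) ` q u" by (rule image_cong[OF refl])
  also have "\<dots> = {lin_ext F W ?f u}" using I.a_rcos_self[OF u] by blast
  finally have "lin_ext F W ?f ` q u = {lin_ext F W ?f u}" .
  then show ?thesis by (simp add: tensor_lift_def lin_ext_def)
qed

context
  fixes W :: "('f, 'w, 'u) module_scheme" and \<beta> :: "'a \<Rightarrow> 'b \<Rightarrow> 'w"
  assumes W: "module F W" and \<beta>: "bilinear_map F A B W \<beta>"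
begin

private lemma f: "(\<lambda>p. \<beta> (fst p) (snd p)) \<in> carrier (A \<times>\<times> B) \<rightarrow> carrier W"
  using \<beta> by (auto simp: bilinear_map_def)

lemma tensor_lift_closed:
  "t \<in> carrier (tensor F A B) \<Longrightarrow> tensor_lift F W \<beta> t \<in> carrier W"
  by (auto simp: carrier_tensor tensor_lift_q[OF W \<beta>] intro!: lin_ext_closed[OF W f])

lemma tensor_lift_add:
  "s \<in> carrier (tensor F A B) \<Longrightarrow> t \<in> carrier (tensor F A B) \<Longrightarrow>
    tensor_lift F W \<beta> (s \<oplus>\<^bsub>tensor F A B\<^esub> t) = tensor_lift F W \<beta> s \<oplus>\<^bsub>W\<^esub> tensor_lift F W \<beta> t"
  by (auto simp: carrier_tensor q_add tensor_lift_q[OF W \<beta>] intro!: lin_ext_add[OF W f])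

lemma tensor_lift_smult:
  "r \<in> carrier F \<Longrightarrow> t \<in> carrier (tensor F A B) \<Longrightarrow>
    tensor_lift F W \<beta> (r \<odot>\<^bsub>tensor F A B\<^esub> t) = r \<odot>\<^bsub>W\<^esub> tensor_lift F W \<beta> t"
  by (auto simp: carrier_tensor q_smult tensor_lift_q[OF W \<beta>] intro!: lin_ext_smult[OF W f])

lemma tensor_lift_pure:
  "a \<in> carrier A \<Longrightarrow> b \<in> carrier B \<Longrightarrow> tensor_lift F W \<beta> (pure_tensor F A B a b) = \<beta> a b"
  using lin_ext_basis[OF W f, where m = "(a, b)"] one_not_zero
  by (simp add: pure_tensor_q tensor_lift_q[OF W \<beta>] basis_elem_P)

end

end

subsection \<open>Modules embedded in function spaces\<close>

lemma module_restrict_scalars: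
  assumes "module R W" "subfield F R"
  shows "module (R\<lparr>carrier := F\<rparr>) W"
proof -
  interpret module R W by fact
  have F: "F \<subseteq> carrier R" using subfieldE(3)[OF assms(2)] .
  interpret F: field "R\<lparr>carrier := F\<rparr>" using R.subfield_iff(2)[OF assms(2)] .
  show ?thesis
    by (rule moduleI)
       (use F in \<open>auto simp: F.cring_axioms M.abelian_group_axioms smult_l_distr smult_r_distr smult_assoc1 subset_iff\<close>)
qed

lemma self_algebra_simps:
  "carrier (self_algebra R) = carrier R" "monoid.mult (self_algebra R) = monoid.mult R"
  "\<one>\<^bsub>self_algebra R\<^esub> = \<one>\<^bsub>R\<^esub>" "\<zero>\<^bsub>self_algebra R\<^esub> = \<zero>\<^bsub>R\<^esub>"
  "ring.add (self_algebra R) = ring.add R" "smult (self_algebra R) = monoid.mult R"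
  by (simp_all add: self_algebra_def)

lemma self_algebra_module:
  assumes "cring R"
  shows "module R (self_algebra R)"
proof -
  interpret cring R by fact
  have "abelian_group (self_algebra R)"
    by (rule abelian_groupI) (auto simp: self_algebra_simps a_ac intro: l_neg)
  then show ?thesis
    by (intro moduleI) (auto simp: self_algebra_simps cring_axioms l_distr r_distr m_assoc)
qed

lemma finsum_self_algebra: "finsum (self_algebra R) = finsum R"
  by (intro ext) (simp add: finsum_def finprod_def self_algebra_simps)

text \<open>An F-linear map from \<open>A\<close> to the functions on \<open>Z\<close> with values
  in the larger field. Injectivity is not included, because a tensor product receives its
  coordinates before they are known to separate its elements.\<close>

locale coords = field E for E :: "('e, 'm) ring_scheme" (structure) +
  fixes F :: "'e set" and A :: "('e, 'a, 's) module_scheme" and Z :: "'x set"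
    and \<nu> :: "'a \<Rightarrow> 'x \<Rightarrow> 'e"
  assumes subfield_F: "subfield F E"
    and module_A: "module (E\<lparr>carrier := F\<rparr>) A"
    and \<nu>_closed: "a \<in> carrier A \<Longrightarrow> x \<in> Z \<Longrightarrow> \<nu> a x \<in> carrier E"
    and \<nu>_add: "a \<in> carrier A \<Longrightarrow> a' \<in> carrier A \<Longrightarrow> x \<in> Z \<Longrightarrow> \<nu> (a \<oplus>\<^bsub>A\<^esub> a') x = \<nu> a x \<oplus> \<nu> a' x"
    and \<nu>_smult: "r \<in> F \<Longrightarrow> a \<in> carrier A \<Longrightarrow> x \<in> Z \<Longrightarrow> \<nu> (r \<odot>\<^bsub>A\<^esub> a) x = r \<otimes> \<nu> a x"
begin

sublocale A: module "E\<lparr>carrier := F\<rparr>" A by (rule module_A)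

lemma F_carrier: "F \<subseteq> carrier E" using subfieldE(3)[OF subfield_F] .

lemma \<nu>_hom:
  assumes "x \<in> Z"
  shows "abelian_group_hom A E (\<lambda>a. \<nu> a x)"
  by (rule abelian_group_hom_addI[OF A.abelian_group_axioms abelian_group_axioms])
     (use assms in \<open>auto simp: \<nu>_closed \<nu>_add\<close>)

lemma \<nu>_minus: "a \<in> carrier A \<Longrightarrow> a' \<in> carrier A \<Longrightarrow> x \<in> Z \<Longrightarrow> \<nu> (a \<ominus>\<^bsub>A\<^esub> a') x = \<nu> a x \<ominus> \<nu> a' x"
  using abelian_group_hom.hom_a_inv[OF \<nu>_hom, of x a'] by (simp add: a_minus_def \<nu>_add)

lemma \<nu>_finsum:
  "finite S \<Longrightarrow> x \<in> Z \<Longrightarrow> (\<And>i. i \<in> S \<Longrightarrow> f i \<in> carrier A) \<Longrightarrow> \<nu> (finsum A f S) x = (\<Oplus>i\<in>S. \<nu> (f i) x)"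
  by (rule abelian_group_hom_finsum[OF \<nu>_hom])

end

locale faithful_coords = coords +
  assumes faithful: "a \<in> carrier A \<Longrightarrow> (\<And>x. x \<in> Z \<Longrightarrow> \<nu> a x = \<zero>) \<Longrightarrow> a = \<zero>\<^bsub>A\<^esub>"
begin

lemma \<nu>_inject:
  assumes "a \<in> carrier A" "a' \<in> carrier A" "\<And>x. x \<in> Z \<Longrightarrow> \<nu> a x = \<nu> a' x"
  shows "a = a'"
proof (rule A.eq_if_minus_zero)
  show "a \<ominus>\<^bsub>A\<^esub> a' = \<zero>\<^bsub>A\<^esub>"
    by (rule faithful) (use assms \<nu>_closed in \<open>auto simp: \<nu>_minus r_neg a_minus_def[of E]\<close>)
qed (use assms in auto)

end

text \<open>The functionals \<open>a \<mapsto> \<Sum>x. p k x \<cdot> \<nu> a x\<close> together with the elements \<open>g k\<close> form a dual basis of \<open>A\<close>.\<close>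

locale dual_coords = coords E F A Z \<nu>
  for E :: "('e, 'm) ring_scheme" (structure) and F :: "'e set" and A :: "('e, 'a, 's) module_scheme"
    and Z :: "'x set" and \<nu> :: "'a \<Rightarrow> 'x \<Rightarrow> 'e" +
  fixes I :: "'i set" and p :: "'i \<Rightarrow> 'x \<Rightarrow> 'e" and g :: "'i \<Rightarrow> 'a"
  assumes finite_Z: "finite Z" and finite_I: "finite I"
    and g_closed: "k \<in> I \<Longrightarrow> g k \<in> carrier A"
    and p_closed: "k \<in> I \<Longrightarrow> x \<in> Z \<Longrightarrow> p k x \<in> carrier E"
    and functional_closed: "k \<in> I \<Longrightarrow> a \<in> carrier A \<Longrightarrow> (\<Oplus>x\<in>Z. p k x \<otimes> \<nu> a x) \<in> F"
    and expansion: "a \<in> carrier A \<Longrightarrow> a = (\<Oplus>\<^bsub>A\<^esub>k\<in>I. (\<Oplus>x\<in>Z. p k x \<otimes> \<nu> a x) \<odot>\<^bsub>A\<^esub> g k)"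
begin

sublocale faithful_coords
proof
  fix a assume a: "a \<in> carrier A" and 0: "\<And>x. x \<in> Z \<Longrightarrow> \<nu> a x = \<zero>"
  have "(\<Oplus>x\<in>Z. p k x \<otimes> \<nu> a x) = \<zero>" if "k \<in> I" for k
    by (rule finsum_all_zero) (use 0 p_closed that in auto)
  then have "(\<Oplus>\<^bsub>A\<^esub>k\<in>I. (\<Oplus>x\<in>Z. p k x \<otimes> \<nu> a x) \<odot>\<^bsub>A\<^esub> g k) = \<zero>\<^bsub>A\<^esub>"
    using A.smult_l_null g_closed by (intro A.finsum_all_zero) auto
  then show "a = \<zero>\<^bsub>A\<^esub>" using expansion[OF a] by simp
qed

end

locale coord_pair = A: coords E F A Z \<nu>\<^sub>A + B: coords E F B Y \<nu>\<^sub>B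
  for E :: "('e, 'm) ring_scheme" (structure) and F :: "'e set" and A :: "('e, 'a, 's) module_scheme"
    and Z :: "'x set" and \<nu>\<^sub>A :: "'a \<Rightarrow> 'x \<Rightarrow> 'e" and B :: "('e, 'b, 't) module_scheme"
    and Y :: "'y set" and \<nu>\<^sub>B :: "'b \<Rightarrow> 'y \<Rightarrow> 'e"
begin

text \<open>The entry at (x, y) of a tensor seen as a matrix over E: the two coordinate functionals
  are applied to the factors and the values are multiplied in E.\<close>

definition \<kappa> :: "('a \<times> 'b \<Rightarrow> 'e) set \<Rightarrow> 'x \<Rightarrow> 'y \<Rightarrow> 'e" where
  "\<kappa> t x y = tensor_lift (E\<lparr>carrier := F\<rparr>) (self_algebra E) (\<lambda>a b. \<nu>\<^sub>A a x \<otimes> \<nu>\<^sub>B b y) t"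

sublocale AB: module_pair "E\<lparr>carrier := F\<rparr>" A B
  by unfold_locales simp

abbreviation (input) AB where "AB \<equiv> tensor (E\<lparr>carrier := F\<rparr>) A B"

lemma self_module: "module (E\<lparr>carrier := F\<rparr>) (self_algebra E)"
  by (rule module_restrict_scalars[OF self_algebra_module A.subfield_F]) (rule A.cring_axioms)

lemma \<kappa>_bilinear:
  assumes "x \<in> Z" "y \<in> Y"
  shows "bilinear_map (E\<lparr>carrier := F\<rparr>) A B (self_algebra E) (\<lambda>a b. \<nu>\<^sub>A a x \<otimes> \<nu>\<^sub>B b y)"
  by (rule bilinear_mapI)
     (use assms A.F_carrier in \<open>auto simp: self_algebra_simps A.\<nu>_closed B.\<nu>_closed A.\<nu>_add B.\<nu>_add A.\<nu>_smult B.\<nu>_smult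
       A.l_distr A.r_distr A.m_assoc A.m_lcomm subset_iff\<close>)

lemma \<kappa>_closed: "t \<in> carrier AB \<Longrightarrow> x \<in> Z \<Longrightarrow> y \<in> Y \<Longrightarrow> \<kappa> t x y \<in> carrier E"
  using AB.tensor_lift_closed[OF self_module \<kappa>_bilinear] by (simp add: \<kappa>_def self_algebra_simps)

lemma \<kappa>_add: "s \<in> carrier AB \<Longrightarrow> t \<in> carrier AB \<Longrightarrow> x \<in> Z \<Longrightarrow> y \<in> Y
    \<Longrightarrow> \<kappa> (s \<oplus>\<^bsub>AB\<^esub> t) x y = \<kappa> s x y \<oplus> \<kappa> t x y"
  using AB.tensor_lift_add[OF self_module \<kappa>_bilinear] by (simp add: \<kappa>_def self_algebra_simps)

lemma \<kappa>_smult: "r \<in> F \<Longrightarrow> t \<in> carrier AB \<Longrightarrow> x \<in> Z \<Longrightarrow> y \<in> Y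
    \<Longrightarrow> \<kappa> (r \<odot>\<^bsub>AB\<^esub> t) x y = r \<otimes> \<kappa> t x y"
  using AB.tensor_lift_smult[OF self_module \<kappa>_bilinear] by (simp add: \<kappa>_def self_algebra_simps)

lemma \<kappa>_pure: "a \<in> carrier A \<Longrightarrow> b \<in> carrier B \<Longrightarrow> x \<in> Z \<Longrightarrow> y \<in> Y
    \<Longrightarrow> \<kappa> (pure_tensor (E\<lparr>carrier := F\<rparr>) A B a b) x y = \<nu>\<^sub>A a x \<otimes> \<nu>\<^sub>B b y"
  using AB.tensor_lift_pure[OF self_module \<kappa>_bilinear] by (simp add: \<kappa>_def)

lemma \<kappa>_coords: "coords E F AB (Z \<times> Y) (\<lambda>t z. \<kappa> t (fst z) (snd z))"
  by (rule coords.intro[OF A.field_axioms], rule coords_axioms.intro)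
     (auto simp: \<kappa>_closed \<kappa>_add \<kappa>_smult A.subfield_F AB.tensor_module)

end

text \<open>The asymmetry is deliberate. The left factor K' of the base change has its inclusion
  into E as faithful coordinate, and only the right factor E[N]^G is given with a dual
  basis.\<close>

locale dual_coord_pair = coord_pair E F A Z \<nu>\<^sub>A B Y \<nu>\<^sub>B
    + A: faithful_coords E F A Z \<nu>\<^sub>A + B: dual_coords E F B Y \<nu>\<^sub>B I p g
  for E :: "('e, 'm) ring_scheme" (structure) and F :: "'e set" and A :: "('e, 'a, 's) module_scheme"
    and Z :: "'x set" and \<nu>\<^sub>A :: "'a \<Rightarrow> 'x \<Rightarrow> 'e" and B :: "('e, 'b, 't) module_scheme"
    and Y :: "'y set" and \<nu>\<^sub>B :: "'b \<Rightarrow> 'y \<Rightarrow> 'e"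
    and I :: "'i set" and p :: "'i \<Rightarrow> 'y \<Rightarrow> 'e" and g :: "'i \<Rightarrow> 'b"
begin

text \<open>Expanding the second factor in the dual basis gives \<open>t = \<Sum>k. \<alpha> k \<otimes> g k\<close> where \<open>\<alpha> k\<close> depends
  only on \<open>\<kappa> t\<close>.\<close>

lemma tensor_expansion:
  assumes "t \<in> carrier AB"
  shows "\<exists>\<alpha>. (\<forall>k\<in>I. \<alpha> k \<in> carrier A) \<and>
           t = (\<Oplus>\<^bsub>AB\<^esub>k\<in>I. pure_tensor (E\<lparr>carrier := F\<rparr>) A B (\<alpha> k) (g k)) \<and>
           (\<forall>k\<in>I. \<forall>x\<in>Z. \<nu>\<^sub>A (\<alpha> k) x = (\<Oplus>y\<in>Y. p k y \<otimes> \<kappa> t x y))"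
  using assms
proof (induction rule: AB.tensor_induct)
  case (pure a b)
  let ?l = "\<lambda>k. \<Oplus>y\<in>Y. p k y \<otimes> \<nu>\<^sub>B b y"
  let ?pure = "pure_tensor (E\<lparr>carrier := F\<rparr>) A B"
  have l: "?l k \<in> F" if "k \<in> I" for k using B.functional_closed that pure by simp
  have hom: "abelian_group_hom B AB (?pure a)"
    by (rule abelian_group_hom_addI[OF B.A.abelian_group_axioms AB.T.abelian_group_axioms])
       (use pure in \<open>auto simp: AB.pure_tensor_closed AB.pure_tensor_add_right\<close>)
  have "?pure a b = ?pure a (\<Oplus>\<^bsub>B\<^esub>k\<in>I. ?l k \<odot>\<^bsub>B\<^esub> g k)"
    using B.expansion[OF pure(2)] by simp
  also have "\<dots> = (\<Oplus>\<^bsub>AB\<^esub>k\<in>I. ?pure a (?l k \<odot>\<^bsub>B\<^esub> g k))"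
    by (rule abelian_group_hom_finsum[OF hom B.finite_I]) (use l B.g_closed in auto)
  \<comment> \<open>The coefficients lie in F, not merely in E, so they can be moved across the
    tensor sign.\<close>
  also have "\<dots> = (\<Oplus>\<^bsub>AB\<^esub>k\<in>I. ?pure (?l k \<odot>\<^bsub>A\<^esub> a) (g k))"
    by (rule AB.T.finsum_cong_closed)
       (use l B.g_closed pure in \<open>auto simp: AB.pure_tensor_smult_left AB.pure_tensor_smult_right AB.pure_tensor_closed\<close>)
  finally have eq: "?pure a b = (\<Oplus>\<^bsub>AB\<^esub>k\<in>I. ?pure (?l k \<odot>\<^bsub>A\<^esub> a) (g k))" .
  have "\<nu>\<^sub>A (?l k \<odot>\<^bsub>A\<^esub> a) x = (\<Oplus>y\<in>Y. p k y \<otimes> \<kappa> (?pure a b) x y)" if "k \<in> I" "x \<in> Z" for k x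
  proof -
    have "\<nu>\<^sub>A (?l k \<odot>\<^bsub>A\<^esub> a) x = ?l k \<otimes> \<nu>\<^sub>A a x"
      using l that pure by (simp add: A.\<nu>_smult)
    also have "\<dots> = (\<Oplus>y\<in>Y. p k y \<otimes> \<nu>\<^sub>B b y \<otimes> \<nu>\<^sub>A a x)"
      by (rule A.finsum_ldistr) (use that pure B.finite_Z B.p_closed A.\<nu>_closed B.\<nu>_closed in auto)
    also have "\<dots> = (\<Oplus>y\<in>Y. p k y \<otimes> \<kappa> (?pure a b) x y)"
      by (rule A.finsum_cong_closed)
         (use that pure B.p_closed A.\<nu>_closed B.\<nu>_closed in \<open>auto simp: \<kappa>_pure A.m_ac\<close>)
    finally show ?thesis .
  qed
  then show ?case using eq l pure by (intro exI[of _ "\<lambda>k. ?l k \<odot>\<^bsub>A\<^esub> a"]) auto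
next
  case (add s t)
  let ?pure = "pure_tensor (E\<lparr>carrier := F\<rparr>) A B"
  from add obtain \<alpha> \<beta> where \<alpha>: "\<forall>k\<in>I. \<alpha> k \<in> carrier A" "s = (\<Oplus>\<^bsub>AB\<^esub>k\<in>I. ?pure (\<alpha> k) (g k))"
      "\<forall>k\<in>I. \<forall>x\<in>Z. \<nu>\<^sub>A (\<alpha> k) x = (\<Oplus>y\<in>Y. p k y \<otimes> \<kappa> s x y)"
    and \<beta>: "\<forall>k\<in>I. \<beta> k \<in> carrier A" "t = (\<Oplus>\<^bsub>AB\<^esub>k\<in>I. ?pure (\<beta> k) (g k))"
      "\<forall>k\<in>I. \<forall>x\<in>Z. \<nu>\<^sub>A (\<beta> k) x = (\<Oplus>y\<in>Y. p k y \<otimes> \<kappa> t x y)" by blast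
  have "s \<oplus>\<^bsub>AB\<^esub> t = (\<Oplus>\<^bsub>AB\<^esub>k\<in>I. ?pure (\<alpha> k) (g k) \<oplus>\<^bsub>AB\<^esub> ?pure (\<beta> k) (g k))"
    unfolding \<alpha>(2) \<beta>(2)
    by (rule AB.T.finsum_addf[symmetric]) (use \<alpha>(1) \<beta>(1) B.g_closed in \<open>auto simp: AB.pure_tensor_closed\<close>)
  also have "\<dots> = (\<Oplus>\<^bsub>AB\<^esub>k\<in>I. ?pure (\<alpha> k \<oplus>\<^bsub>A\<^esub> \<beta> k) (g k))"
    by (rule AB.T.finsum_cong_closed)
       (use \<alpha>(1) \<beta>(1) B.g_closed in \<open>auto simp: AB.pure_tensor_closed AB.pure_tensor_add_left\<close>)
  finally have eq: "s \<oplus>\<^bsub>AB\<^esub> t = (\<Oplus>\<^bsub>AB\<^esub>k\<in>I. ?pure (\<alpha> k \<oplus>\<^bsub>A\<^esub> \<beta> k) (g k))" .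
  have "\<nu>\<^sub>A (\<alpha> k \<oplus>\<^bsub>A\<^esub> \<beta> k) x = (\<Oplus>y\<in>Y. p k y \<otimes> \<kappa> (s \<oplus>\<^bsub>AB\<^esub> t) x y)" if "k \<in> I" "x \<in> Z" for k x
  proof -
    have "\<nu>\<^sub>A (\<alpha> k \<oplus>\<^bsub>A\<^esub> \<beta> k) x = (\<Oplus>y\<in>Y. p k y \<otimes> \<kappa> s x y) \<oplus> (\<Oplus>y\<in>Y. p k y \<otimes> \<kappa> t x y)"
      using that \<alpha> \<beta> by (simp add: A.\<nu>_add)
    also have "\<dots> = (\<Oplus>y\<in>Y. p k y \<otimes> \<kappa> s x y \<oplus> p k y \<otimes> \<kappa> t x y)"
      by (rule A.finsum_addf[symmetric]) (use that B.p_closed add.hyps \<kappa>_closed in auto)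
    also have "\<dots> = (\<Oplus>y\<in>Y. p k y \<otimes> \<kappa> (s \<oplus>\<^bsub>AB\<^esub> t) x y)"
      by (rule A.finsum_cong_closed)
         (use that B.p_closed add.hyps \<kappa>_closed in \<open>auto simp: \<kappa>_add A.r_distr\<close>)
    finally show ?thesis .
  qed
  then show ?case using eq \<alpha>(1) \<beta>(1) by (intro exI[of _ "\<lambda>k. \<alpha> k \<oplus>\<^bsub>A\<^esub> \<beta> k"]) auto
qed

text \<open>If all entries of t vanish, then so do the coordinates of every left factor in the
  expansion of t along the \<open>g k\<close>. These factors are zero by faithfulness of
  \<open>A\<close>, and so is t.\<close>

sublocale K: faithful_coords E F AB "Z \<times> Y" "\<lambda>t z. \<kappa> t (fst z) (snd z)"
proof (rule faithful_coords.intro[OF \<kappa>_coords], rule faithful_coords_axioms.intro)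
  fix t assume t: "t \<in> carrier AB" and 0: "\<And>z. z \<in> Z \<times> Y \<Longrightarrow> \<kappa> t (fst z) (snd z) = \<zero>"
  let ?pure = "pure_tensor (E\<lparr>carrier := F\<rparr>) A B"
  obtain \<alpha> where \<alpha>: "\<forall>k\<in>I. \<alpha> k \<in> carrier A" "t = (\<Oplus>\<^bsub>AB\<^esub>k\<in>I. ?pure (\<alpha> k) (g k))"
      "\<forall>k\<in>I. \<forall>x\<in>Z. \<nu>\<^sub>A (\<alpha> k) x = (\<Oplus>y\<in>Y. p k y \<otimes> \<kappa> t x y)" using tensor_expansion[OF t] by blast
  have "\<alpha> k = \<zero>\<^bsub>A\<^esub>" if "k \<in> I" for k
  proof (rule A.faithful)
    fix x assume "x \<in> Z"
    with that \<alpha>(3) have "\<nu>\<^sub>A (\<alpha> k) x = (\<Oplus>y\<in>Y. p k y \<otimes> \<kappa> t x y)" by simp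
    also have "\<dots> = \<zero>"
      by (rule A.finsum_all_zero) (use 0[of "(x, _)"] \<open>x \<in> Z\<close> that B.p_closed in auto)
    finally show "\<nu>\<^sub>A (\<alpha> k) x = \<zero>" .
  qed (use \<alpha> that in auto)
  then have "?pure (\<alpha> k) (g k) = \<zero>\<^bsub>AB\<^esub>" if "k \<in> I" for k
  proof -
    have "?pure (\<alpha> k) (g k) = ?pure (\<zero> \<odot>\<^bsub>A\<^esub> \<zero>\<^bsub>A\<^esub>) (g k)"
      using \<open>\<And>k. k \<in> I \<Longrightarrow> \<alpha> k = \<zero>\<^bsub>A\<^esub>\<close> that A.A.smult_l_null[of "\<zero>\<^bsub>A\<^esub>"] by simp
    also have "\<dots> = \<zero> \<odot>\<^bsub>AB\<^esub> ?pure \<zero>\<^bsub>A\<^esub> (g k)"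
      using that B.g_closed AB.pure_tensor_smult_left[of \<zero> "\<zero>\<^bsub>A\<^esub>" "g k"] subringE(2)[OF subfieldE(1)[OF A.subfield_F]] by auto
    also have "\<dots> = \<zero>\<^bsub>AB\<^esub>"
      using that B.g_closed AB.T.smult_l_null[of "?pure \<zero>\<^bsub>A\<^esub> (g k)"] by (simp add: AB.pure_tensor_closed)
    finally show ?thesis .
  qed
  then show "t = \<zero>\<^bsub>AB\<^esub>" unfolding \<alpha>(2) by (intro AB.T.finsum_all_zero)
qed

lemma \<kappa>_inject:
  assumes "s \<in> carrier AB" "t \<in> carrier AB" "\<And>x y. x \<in> Z \<Longrightarrow> y \<in> Y \<Longrightarrow> \<kappa> s x y = \<kappa> t x y"
  shows "s = t"
  by (rule K.\<nu>_inject) (use assms in auto)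

end

subsection \<open>Galois descent\<close>

text \<open>The setting of Artin's theorem: a finite group acting faithfully on a field, with the
  base field recovered afterwards as the fixed field.\<close>

locale automorphism_group = field E for E :: "('e, 'm) ring_scheme" (structure) +
  fixes G :: "('e \<Rightarrow> 'e) monoid"
  assumes group_G: "group G" and finite_G: "finite (carrier G)"
    and ring_hom_G: "\<gamma> \<in> carrier G \<Longrightarrow> \<gamma> \<in> ring_hom E E"
    and mult_G: "\<gamma> \<in> carrier G \<Longrightarrow> \<tau> \<in> carrier G \<Longrightarrow> a \<in> carrier E \<Longrightarrow> (\<gamma> \<otimes>\<^bsub>G\<^esub> \<tau>) a = \<gamma> (\<tau> a)"
    and one_G: "a \<in> carrier E \<Longrightarrow> \<one>\<^bsub>G\<^esub> a = a"
    and faithful_G: "\<gamma> \<in> carrier G \<Longrightarrow> (\<And>a. a \<in> carrier E \<Longrightarrow> \<gamma> a = a) \<Longrightarrow> \<gamma> = \<one>\<^bsub>G\<^esub>"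
begin

sublocale G: group G by (rule group_G)

lemma aut_closed [simp, intro]: "\<gamma> \<in> carrier G \<Longrightarrow> a \<in> carrier E \<Longrightarrow> \<gamma> a \<in> carrier E"
  and aut_add [simp]: "\<gamma> \<in> carrier G \<Longrightarrow> a \<in> carrier E \<Longrightarrow> b \<in> carrier E \<Longrightarrow> \<gamma> (a \<oplus> b) = \<gamma> a \<oplus> \<gamma> b"
  and aut_mult [simp]: "\<gamma> \<in> carrier G \<Longrightarrow> a \<in> carrier E \<Longrightarrow> b \<in> carrier E \<Longrightarrow> \<gamma> (a \<otimes> b) = \<gamma> a \<otimes> \<gamma> b"
  and aut_one [simp]: "\<gamma> \<in> carrier G \<Longrightarrow> \<gamma> \<one> = \<one>"
  using ring_hom_G by (auto dest: ring_hom_closed ring_hom_add ring_hom_mult ring_hom_one)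

lemma aut_hom: "\<gamma> \<in> carrier G \<Longrightarrow> abelian_group_hom E E \<gamma>"
  by (rule abelian_group_hom_addI) (auto intro: abelian_group_axioms)

lemma aut_zero [simp]: "\<gamma> \<in> carrier G \<Longrightarrow> \<gamma> \<zero> = \<zero>"
  using abelian_group_hom.hom_zero[OF aut_hom] by simp

lemma aut_uminus [simp]: "\<gamma> \<in> carrier G \<Longrightarrow> a \<in> carrier E \<Longrightarrow> \<gamma> (\<ominus> a) = \<ominus> \<gamma> a"
  using abelian_group_hom.hom_a_inv[OF aut_hom] by simp

lemma aut_finsum:
  "\<gamma> \<in> carrier G \<Longrightarrow> finite S \<Longrightarrow> (\<And>i. i \<in> S \<Longrightarrow> f i \<in> carrier E) \<Longrightarrow> \<gamma> (finsum E f S) = (\<Oplus>i\<in>S. \<gamma> (f i))"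
  by (rule abelian_group_hom_finsum[OF aut_hom])

lemma aut_inv:
  assumes "\<gamma> \<in> carrier G" "a \<in> carrier E"
  shows "\<gamma> ((inv\<^bsub>G\<^esub> \<gamma>) a) = a" "(inv\<^bsub>G\<^esub> \<gamma>) (\<gamma> a) = a"
  using assms by (simp_all flip: mult_G add: one_G)

lemma aut_m_inv:
  assumes "\<gamma> \<in> carrier G" "a \<in> carrier E" "a \<noteq> \<zero>"
  shows "\<gamma> (inv a) = inv (\<gamma> a)"
proof -
  have a: "a \<in> Units E" using assms field_Units by simp
  have "\<gamma> (inv a) \<otimes> \<gamma> a = \<one>" using a assms aut_mult[of \<gamma> "inv a" a] by simp
  then show ?thesis using assms a by (metis Units_inv_closed aut_closed comm_inv_char inv_char m_comm)
qed

lemma fixed_field_subfield: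
  assumes "S \<subseteq> carrier G"
  shows "subfield (fixed_field E S) E"
proof -
  have "subring (fixed_field E S) E"
  proof (rule subringI)
    fix a b assume "a \<in> fixed_field E S" "b \<in> fixed_field E S"
    then have ab: "a \<in> carrier E" "b \<in> carrier E" and "\<And>\<gamma>. \<gamma> \<in> S \<Longrightarrow> \<gamma> a = a \<and> \<gamma> b = b"
      by (auto simp: fixed_field_def)
    then have "\<gamma> (a \<otimes> b) = a \<otimes> b \<and> \<gamma> (a \<oplus> b) = a \<oplus> b \<and> \<gamma> (\<ominus> a) = \<ominus> a" if "\<gamma> \<in> S" for \<gamma>
      using that assms aut_mult[of \<gamma> a b] aut_add[of \<gamma> a b] aut_uminus[of \<gamma> a] by (metis subsetD)
    then show "a \<otimes> b \<in> fixed_field E S" "a \<oplus> b \<in> fixed_field E S" "\<ominus> a \<in> fixed_field E S"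
      using ab by (auto simp: fixed_field_def)
  qed (use assms in \<open>auto simp: fixed_field_def subset_iff\<close>)
  then have "subcring (fixed_field E S) E"
    by (rule subcringI')
  moreover have "inv k \<in> fixed_field E S" if "k \<in> fixed_field E S - {\<zero>}" for k
  proof -
    have k: "k \<in> carrier E" "k \<noteq> \<zero>" "\<And>\<gamma>. \<gamma> \<in> S \<Longrightarrow> \<gamma> k = k" using that by (auto simp: fixed_field_def)
    then have "\<gamma> (inv k) = inv k" if "\<gamma> \<in> S" for \<gamma>
      using that assms aut_m_inv[of \<gamma> k] by (metis subsetD)
    then show ?thesis using k field_Units by (auto simp: fixed_field_def)
  qed
  ultimately show ?thesis
    using subfieldI' \<open>subring (fixed_field E S) E\<close> by blast
qed

text \<open>For \<open>\<tau> \<noteq> 1\<close> and \<open>a\<close> moved by \<open>\<tau>\<close>, the function \<open>\<gamma> \<mapsto> (\<gamma> a - \<tau> a) / (a - \<tau> a)\<close> is \<open>1\<close> at the identity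
  and \<open>0\<close> at \<open>\<tau>\<close>; the product of these functions over \<open>\<tau>\<close> has the form \<open>\<gamma> \<mapsto> \<Sum>i. \<gamma> (c i) d i\<close>.\<close>

lemma exists_separating_list:
  assumes "finite S" "S \<subseteq> carrier G - {\<one>\<^bsub>G\<^esub>}"
  defines "ev \<equiv> \<lambda>xs \<gamma>. foldr (\<lambda>p acc. \<gamma> (fst p) \<otimes> snd p \<oplus> acc) xs \<zero>"
  shows "\<exists>xs. set xs \<subseteq> carrier E \<times> carrier E \<and> ev xs \<one>\<^bsub>G\<^esub> = \<one> \<and> (\<forall>\<tau>\<in>S. ev xs \<tau> = \<zero>)"
  using assms(1,2)
proof (induction S rule: finite_induct)
  case empty
  have "ev [(\<one>, \<one>)] \<one>\<^bsub>G\<^esub> = \<one>" by (simp add: ev_def)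
  then show ?case by (intro exI[of _ "[(\<one>, \<one>)]"]) auto
next
  case (insert \<tau> S)
  then obtain xs where xs: "set xs \<subseteq> carrier E \<times> carrier E" "ev xs \<one>\<^bsub>G\<^esub> = \<one>" "\<forall>\<tau>\<in>S. ev xs \<tau> = \<zero>" by auto
  have ev_closed: "ev ys \<gamma> \<in> carrier E" if "set ys \<subseteq> carrier E \<times> carrier E" "\<gamma> \<in> carrier G" for ys \<gamma>
    using that by (induction ys) (auto simp: ev_def)
  have ev_append: "ev (ys @ zs) \<gamma> = ev ys \<gamma> \<oplus> ev zs \<gamma>"
    if "set ys \<subseteq> carrier E \<times> carrier E" "set zs \<subseteq> carrier E \<times> carrier E" "\<gamma> \<in> carrier G" for ys zs \<gamma>
    using that(1)
  proof (induction ys)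
    case Nil
    then show ?case using ev_closed[OF that(2,3)] by (simp add: ev_def)
  next
    case (Cons y ys)
    have "ev (y # ys @ zs) \<gamma> = \<gamma> (fst y) \<otimes> snd y \<oplus> (ev ys \<gamma> \<oplus> ev zs \<gamma>)"
      using Cons by (simp add: ev_def)
    also have "\<dots> = ev (y # ys) \<gamma> \<oplus> ev zs \<gamma>"
      using Cons.prems ev_closed[OF that(2,3)] ev_closed[of ys \<gamma>] that(3) by (auto simp: ev_def a_assoc)
    finally show ?case by simp
  qed
  have ev_scale: "ev (map (\<lambda>p. (fst p \<otimes> a, snd p \<otimes> b)) ys) \<gamma> = ev ys \<gamma> \<otimes> (\<gamma> a \<otimes> b)"
    if "set ys \<subseteq> carrier E \<times> carrier E" "\<gamma> \<in> carrier G" "a \<in> carrier E" "b \<in> carrier E" for ys \<gamma> a b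
    using that(1)
  proof (induction ys)
    case Nil
    then show ?case using that by (simp add: ev_def)
  next
    case (Cons y ys)
    have *: "fst y \<in> carrier E" "snd y \<in> carrier E" "ev ys \<gamma> \<in> carrier E"
      using Cons.prems ev_closed[of ys \<gamma>] that(2) by auto
    have "ev (map (\<lambda>p. (fst p \<otimes> a, snd p \<otimes> b)) (y # ys)) \<gamma>
        = \<gamma> (fst y \<otimes> a) \<otimes> (snd y \<otimes> b) \<oplus> ev ys \<gamma> \<otimes> (\<gamma> a \<otimes> b)"
      using Cons by (simp add: ev_def)
    also have "\<dots> = ev (y # ys) \<gamma> \<otimes> (\<gamma> a \<otimes> b)"
    proof -
      have "ev (y # ys) \<gamma> = \<gamma> (fst y) \<otimes> snd y \<oplus> ev ys \<gamma>" by (simp add: ev_def)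
      then have "ev (y # ys) \<gamma> \<otimes> (\<gamma> a \<otimes> b) = \<gamma> (fst y) \<otimes> snd y \<otimes> (\<gamma> a \<otimes> b) \<oplus> ev ys \<gamma> \<otimes> (\<gamma> a \<otimes> b)"
        using * that(2-) by (simp add: l_distr)
      then show ?thesis using * that(2-) by (simp add: m_ac)
    qed
    finally show ?case .
  qed
  have \<tau>: "\<tau> \<in> carrier G" "\<tau> \<noteq> \<one>\<^bsub>G\<^esub>" using insert.prems by auto
  then obtain a where a: "a \<in> carrier E" "\<tau> a \<noteq> a" using faithful_G by blast
  define d where "d = inv (a \<ominus> \<tau> a)"
  have "a \<ominus> \<tau> a \<noteq> \<zero>" using a \<tau> by simp
  then have unit: "a \<ominus> \<tau> a \<in> Units E" using a \<tau> field_Units by simp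
  have d: "d \<in> carrier E" "(a \<ominus> \<tau> a) \<otimes> d = \<one>" using unit by (auto simp: d_def)
  \<comment> \<open>Multiplication by (\<gamma> a - \<tau> a) d is a sum of two functions of the
    admissible form, \<gamma>(a) d and \<gamma>(1) (- \<tau>(a) d). Each rescales all pairs of
    \<open>xs\<close>, and concatenation adds the results.\<close>
  let ?y1 = "map (\<lambda>p. (fst p \<otimes> a, snd p \<otimes> d)) xs"
  let ?y2 = "map (\<lambda>p. (fst p \<otimes> \<one>, snd p \<otimes> (\<ominus> (\<tau> a \<otimes> d)))) xs"
  have ys: "set ?y1 \<subseteq> carrier E \<times> carrier E" "set ?y2 \<subseteq> carrier E \<times> carrier E"
    using xs(1) a d \<tau> by auto
  have ev: "ev (?y1 @ ?y2) \<gamma> = ev xs \<gamma> \<otimes> ((\<gamma> a \<ominus> \<tau> a) \<otimes> d)" if "\<gamma> \<in> carrier G" for \<gamma>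
  proof -
    have "ev (?y1 @ ?y2) \<gamma> = ev xs \<gamma> \<otimes> (\<gamma> a \<otimes> d) \<oplus> ev xs \<gamma> \<otimes> (\<gamma> \<one> \<otimes> (\<ominus> (\<tau> a \<otimes> d)))"
      using ev_append[OF ys that] ev_scale[OF xs(1) that] a d \<tau> by simp
    also have "\<dots> = ev xs \<gamma> \<otimes> ((\<gamma> a \<ominus> \<tau> a) \<otimes> d)"
      using ev_closed[OF xs(1) that] a d \<tau> that
      by (simp add: a_minus_def r_distr l_distr l_minus)
    finally show ?thesis .
  qed
  have "ev (?y1 @ ?y2) \<one>\<^bsub>G\<^esub> = \<one>"
    using xs(2) d a by (simp add: ev one_G)
  moreover have "ev (?y1 @ ?y2) \<tau> = \<zero>"
    using \<tau> a d ev_closed[OF xs(1) \<tau>(1)] by (simp add: ev r_neg a_minus_def)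
  moreover have "ev (?y1 @ ?y2) \<rho> = \<zero>" if "\<rho> \<in> S" for \<rho>
  proof -
    have "\<rho> \<in> carrier G" using that insert.prems by auto
    then show ?thesis using that xs(3) a d \<tau> by (simp add: ev)
  qed
  ultimately show ?case using ys by (intro exI[of _ "?y1 @ ?y2"]) auto
qed

text \<open>The identity for a list separating 1 from the other elements is taken at \<tau>^-1
  \<gamma>, and \<tau> is applied to it. In other words, the matrices with entries \<gamma>(c i) and
  \<tau>(d i) multiply to the identity matrix indexed by G.\<close>

lemma exists_separating_family:
  "\<exists>(n::nat) c d. (\<forall>i<n. c i \<in> carrier E \<and> d i \<in> carrier E) \<and>
     (\<forall>\<gamma>\<in>carrier G. \<forall>\<tau>\<in>carrier G. (\<Oplus>i\<in>{..<n}. \<gamma> (c i) \<otimes> \<tau> (d i)) = (if \<gamma> = \<tau> then \<one> else \<zero>))"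
proof -
  define ev :: "('e \<times> 'e) list \<Rightarrow> ('e \<Rightarrow> 'e) \<Rightarrow> 'e"
    where "ev = (\<lambda>xs \<gamma>. foldr (\<lambda>p acc. \<gamma> (fst p) \<otimes> snd p \<oplus> acc) xs \<zero>)"
  obtain xs where xs: "set xs \<subseteq> carrier E \<times> carrier E" "ev xs \<one>\<^bsub>G\<^esub> = \<one>"
      "\<forall>\<tau>\<in>carrier G - {\<one>\<^bsub>G\<^esub>}. ev xs \<tau> = \<zero>"
    using exists_separating_list[of "carrier G - {\<one>\<^bsub>G\<^esub>}"] finite_G unfolding ev_def by auto
  have ev: "ev ys \<gamma> = (\<Oplus>i\<in>{..<length ys}. \<gamma> (fst (ys ! i)) \<otimes> snd (ys ! i))"
    if "set ys \<subseteq> carrier E \<times> carrier E" "\<gamma> \<in> carrier G" for ys \<gamma>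
    using that(1)
  proof (induction ys)
    case Nil
    then show ?case by (simp add: ev_def)
  next
    case (Cons y ys)
    let ?f = "\<lambda>i. \<gamma> (fst ((y # ys) ! i)) \<otimes> snd ((y # ys) ! i)"
    have f: "?f i \<in> carrier E" if "i < length (y # ys)" for i
    proof -
      have "(y # ys) ! i \<in> carrier E \<times> carrier E" using Cons.prems nth_mem[OF that] by blast
      then show ?thesis using \<open>\<gamma> \<in> carrier G\<close> by auto
    qed
    have "(\<Oplus>i\<in>{..<length (y # ys)}. ?f i) = (\<Oplus>i\<in>insert 0 (Suc ` {..<length ys}). ?f i)"
      by (simp add: lessThan_Suc_eq_insert_0)
    also have "\<dots> = ?f 0 \<oplus> (\<Oplus>i\<in>Suc ` {..<length ys}. ?f i)"
      by (rule finsum_insert) (use f[of 0] f in \<open>auto simp del: nth_Cons_0\<close>)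
    also have "(\<Oplus>i\<in>Suc ` {..<length ys}. ?f i) = (\<Oplus>i\<in>{..<length ys}. ?f (Suc i))"
      by (rule finsum_reindex) (use f in auto)
    finally show ?case using Cons by (simp add: ev_def)
  qed
  define c d where "c = (\<lambda>i. fst (xs ! i))" and "d = (\<lambda>i. snd (xs ! i))"
  have cd: "c i \<in> carrier E" "d i \<in> carrier E" if "i < length xs" for i
    using xs(1) nth_mem[OF that] by (auto simp: c_def d_def mem_Times_iff)
  have "(\<Oplus>i\<in>{..<length xs}. \<gamma> (c i) \<otimes> \<tau> (d i)) = (if \<gamma> = \<tau> then \<one> else \<zero>)"
    if st: "\<gamma> \<in> carrier G" "\<tau> \<in> carrier G" for \<gamma> \<tau>
  proof -
    let ?\<rho> = "inv\<^bsub>G\<^esub> \<tau> \<otimes>\<^bsub>G\<^esub> \<gamma>"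
    have \<rho>: "?\<rho> \<in> carrier G" using st by simp
    have "(\<Oplus>i\<in>{..<length xs}. \<gamma> (c i) \<otimes> \<tau> (d i)) = (\<Oplus>i\<in>{..<length xs}. \<tau> (?\<rho> (c i) \<otimes> d i))"
      by (rule finsum_cong_closed) (use st cd \<rho> in \<open>auto simp: mult_G aut_inv\<close>)
    also have "\<dots> = \<tau> (\<Oplus>i\<in>{..<length xs}. ?\<rho> (c i) \<otimes> d i)"
      by (rule aut_finsum[symmetric]) (use st cd \<rho> in auto)
    also have "\<dots> = \<tau> (ev xs ?\<rho>)" using ev[OF xs(1) \<rho>] by (simp add: c_def d_def)
    also have "\<dots> = (if \<gamma> = \<tau> then \<one> else \<zero>)"
    proof (cases "\<gamma> = \<tau>")
      case True
      then show ?thesis using st xs(2) by simp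
    next
      case False
      have "?\<rho> \<noteq> \<one>\<^bsub>G\<^esub>"
      proof
        assume "?\<rho> = \<one>\<^bsub>G\<^esub>"
        then have "\<tau> \<otimes>\<^bsub>G\<^esub> ?\<rho> = \<tau>" using st by simp
        then show False using False st by (simp flip: G.m_assoc)
      qed
      then show ?thesis using False st xs(3) \<rho> by simp
    qed
    finally show ?thesis .
  qed
  then show ?thesis using cd by (intro exI[of _ "length xs"] exI[of _ c] exI[of _ d]) auto
qed

text \<open>Summing the separating identity over \<gamma> with \<tau> = 1 shows that the sum of tr(c
  i) d i is 1, so some tr(c i) is nonzero. Its inverse is fixed by G and can be drawn into the
  trace.\<close>

lemma exists_trace_one:
  obtains t where "t \<in> carrier E" "(\<Oplus>\<gamma>\<in>carrier G. \<gamma> t) = \<one>"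
proof -
  obtain n c d where cd_closed: "\<forall>i<n. c i \<in> carrier E \<and> d i \<in> carrier E"
    and cd_sum: "\<forall>\<gamma>\<in>carrier G. \<forall>\<tau>\<in>carrier G.
        (\<Oplus>i\<in>{..<n::nat}. \<gamma> (c i) \<otimes> \<tau> (d i)) = (if \<gamma> = \<tau> then \<one> else \<zero>)"
    using exists_separating_family by (elim exE conjE) (rule that)
  from cd_closed have c: "\<And>i. i < n \<Longrightarrow> c i \<in> carrier E" and d: "\<And>i. i < n \<Longrightarrow> d i \<in> carrier E"
    by auto
  from cd_sum have cd: "(\<Oplus>i\<in>{..<n}. \<gamma> (c i) \<otimes> \<tau> (d i)) = (if \<gamma> = \<tau> then \<one> else \<zero>)"
    if "\<gamma> \<in> carrier G" "\<tau> \<in> carrier G" for \<gamma> \<tau>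
    using that by blast
  define tr where "tr = (\<lambda>x. \<Oplus>\<gamma>\<in>carrier G. \<gamma> x)"
  have tr_closed: "tr x \<in> carrier E" if "x \<in> carrier E" for x
    unfolding tr_def by (rule finsum_closed) (use that in auto)
  have tr_fixed: "\<tau> (tr x) = tr x" if "\<tau> \<in> carrier G" "x \<in> carrier E" for \<tau> x
  proof -
    have "\<tau> (tr x) = (\<Oplus>\<gamma>\<in>carrier G. \<tau> (\<gamma> x))"
      unfolding tr_def by (rule aut_finsum) (use that finite_G in auto)
    also have "\<dots> = (\<Oplus>\<gamma>\<in>carrier G. (\<tau> \<otimes>\<^bsub>G\<^esub> \<gamma>) x)"
      by (rule finsum_cong_closed) (use that in \<open>auto simp: mult_G\<close>)
    also have "\<dots> = (\<Oplus>\<gamma>\<in>(\<lambda>\<gamma>. \<tau> \<otimes>\<^bsub>G\<^esub> \<gamma>) ` carrier G. \<gamma> x)"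
      by (rule finsum_reindex[symmetric]) (use that in \<open>auto simp: inj_on_def\<close>)
    also have "(\<lambda>\<gamma>. \<tau> \<otimes>\<^bsub>G\<^esub> \<gamma>) ` carrier G = carrier G"
      using that G.surj_const_mult by simp
    finally show ?thesis by (simp add: tr_def)
  qed
  have "(\<Oplus>i\<in>{..<n}. tr (c i) \<otimes> d i) = (\<Oplus>i\<in>{..<n}. \<Oplus>\<gamma>\<in>carrier G. \<gamma> (c i) \<otimes> d i)"
    unfolding tr_def
    by (rule finsum_cong_closed) (use c d finite_G in \<open>auto intro!: finsum_ldistr finsum_closed\<close>)
  also have "\<dots> = (\<Oplus>\<gamma>\<in>carrier G. \<Oplus>i\<in>{..<n}. \<gamma> (c i) \<otimes> d i)"
    by (rule finsum_swap) (use c d finite_G in auto)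
  also have "\<dots> = (\<Oplus>\<gamma>\<in>carrier G. if \<gamma> = \<one>\<^bsub>G\<^esub> then \<one> else \<zero>)"
  proof (rule finsum_cong_closed)
    fix \<gamma> assume s: "\<gamma> \<in> carrier G"
    have "(\<Oplus>i\<in>{..<n}. \<gamma> (c i) \<otimes> d i) = (\<Oplus>i\<in>{..<n}. \<gamma> (c i) \<otimes> \<one>\<^bsub>G\<^esub> (d i))"
      by (rule finsum_cong_closed) (use c d s in \<open>auto simp: one_G\<close>)
    then show "(\<Oplus>i\<in>{..<n}. \<gamma> (c i) \<otimes> d i) = (if \<gamma> = \<one>\<^bsub>G\<^esub> then \<one> else \<zero>)"
      using cd[OF s G.one_closed] by simp
  qed auto
  also have "\<dots> = \<one>"
    using finsum_delta[of "carrier G" "\<one>\<^bsub>G\<^esub>" "\<lambda>\<gamma>. if \<gamma> = \<one>\<^bsub>G\<^esub> then \<one> else \<zero>"] finite_G by simp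
  finally have "(\<Oplus>i\<in>{..<n}. tr (c i) \<otimes> d i) \<noteq> \<zero>" by simp
  moreover have "(\<Oplus>i\<in>{..<n}. tr (c i) \<otimes> d i) = \<zero>" if "\<forall>i<n. tr (c i) = \<zero>"
    by (rule finsum_all_zero) (use that d in auto)
  ultimately obtain i where i: "i < n" "tr (c i) \<noteq> \<zero>" by blast
  define u where "u = inv (tr (c i))"
  have "tr (c i) \<in> Units E" using i c tr_closed field_Units by simp
  then have u: "u \<in> carrier E" "tr (c i) \<otimes> u = \<one>" by (auto simp: u_def)
  have fixed_u: "\<gamma> u = u" if "\<gamma> \<in> carrier G" for \<gamma>
    unfolding u_def using aut_m_inv[OF that, of "tr (c i)"] tr_fixed[OF that, of "c i"] i c tr_closed by simp
  have "(\<Oplus>\<gamma>\<in>carrier G. \<gamma> (c i \<otimes> u)) = (\<Oplus>\<gamma>\<in>carrier G. \<gamma> (c i) \<otimes> u)"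
  proof (rule finsum_cong_closed)
    fix \<gamma> assume "\<gamma> \<in> carrier G"
    then show "\<gamma> (c i \<otimes> u) = \<gamma> (c i) \<otimes> u" using i c u fixed_u[of \<gamma>] aut_mult[of \<gamma> "c i" u] by simp
  qed (use i c u in auto)
  also have "\<dots> = tr (c i) \<otimes> u"
    unfolding tr_def by (rule finsum_ldistr[symmetric]) (use i c u finite_G in auto)
  finally show ?thesis using that[of "c i \<otimes> u"] u i c by simp
qed

end

section \<open>Dual families of invariants in a group algebra with semilinear action\<close>

locale galois_module = automorphism_group E G for E :: "('e, 'm) ring_scheme" (structure) and G +
  fixes M :: "('x, 'y) monoid_scheme" and act :: "('e \<Rightarrow> 'e) \<Rightarrow> 'x \<Rightarrow> 'x"
  assumes group_M: "group M" and finite_M: "finite (carrier M)"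
    and act_closed [simp, intro]: "\<gamma> \<in> carrier G \<Longrightarrow> m \<in> carrier M \<Longrightarrow> act \<gamma> m \<in> carrier M"
    and act_mult: "\<gamma> \<in> carrier G \<Longrightarrow> \<tau> \<in> carrier G \<Longrightarrow> m \<in> carrier M \<Longrightarrow> act (\<gamma> \<otimes>\<^bsub>G\<^esub> \<tau>) m = act \<gamma> (act \<tau> m)"
    and act_one: "m \<in> carrier M \<Longrightarrow> act \<one>\<^bsub>G\<^esub> m = m"
    and act_hom: "\<gamma> \<in> carrier G \<Longrightarrow> m \<in> carrier M \<Longrightarrow> m' \<in> carrier M \<Longrightarrow> act \<gamma> (m \<otimes>\<^bsub>M\<^esub> m') = act \<gamma> m \<otimes>\<^bsub>M\<^esub> act \<gamma> m'"
begin

sublocale M: group M by (rule group_M)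

lemma act_inv:
  assumes "\<gamma> \<in> carrier G" "m \<in> carrier M"
  shows "act \<gamma> (act (inv\<^bsub>G\<^esub> \<gamma>) m) = m" "act (inv\<^bsub>G\<^esub> \<gamma>) (act \<gamma> m) = m"
  using assms by (simp_all flip: act_mult add: act_one)

lemma act_eq_iff:
  assumes "\<gamma> \<in> carrier G" "m \<in> carrier M" "m' \<in> carrier M"
  shows "act \<gamma> m = m' \<longleftrightarrow> m = act (inv\<^bsub>G\<^esub> \<gamma>) m'"
  using assms act_inv by auto

text \<open>Invariance is written as equivariance of the coefficient function. Any set
  \<open>S\<close> of automorphisms is allowed: the empty set gives all of E[M], the whole group
  gives E[M]^G, and G' gives the target of the base change.\<close>

definition fixed_elems :: "('e \<Rightarrow> 'e) set \<Rightarrow> ('x \<Rightarrow> 'e) set" where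
  "fixed_elems S = {u \<in> carrier (monoid_algebra E M). \<forall>\<gamma>\<in>S. \<forall>m\<in>carrier M. u (act \<gamma> m) = \<gamma> (u m)}"

lemma carrier_monoid_algebra_finite:
  "carrier (monoid_algebra E M) = {u. (\<forall>m. u m \<in> carrier E) \<and> (\<forall>m. m \<notin> carrier M \<longrightarrow> u m = \<zero>)}"
proof -
  have "finite {m. u m \<noteq> \<zero>}" if "\<forall>m. m \<notin> carrier M \<longrightarrow> u m = \<zero>" for u
    by (rule finite_subset[OF _ finite_M]) (use that in auto)
  then show ?thesis by (auto simp: monoid_algebra_simps)
qed

lemma fixed_elemsI:
  assumes "\<And>m. m \<in> carrier M \<Longrightarrow> u m \<in> carrier E" "\<And>m. m \<notin> carrier M \<Longrightarrow> u m = \<zero>"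
    "\<And>\<gamma> m. \<gamma> \<in> S \<Longrightarrow> m \<in> carrier M \<Longrightarrow> u (act \<gamma> m) = \<gamma> (u m)"
  shows "u \<in> fixed_elems S"
  using assms unfolding fixed_elems_def carrier_monoid_algebra_finite by (auto, metis zero_closed)

lemma fixed_elemsD:
  assumes "u \<in> fixed_elems S"
  shows "u m \<in> carrier E" "m \<notin> carrier M \<Longrightarrow> u m = \<zero>"
    "\<gamma> \<in> S \<Longrightarrow> m \<in> carrier M \<Longrightarrow> u (act \<gamma> m) = \<gamma> (u m)"
  using assms by (auto simp: fixed_elems_def carrier_monoid_algebra_finite)

lemma fixed_elems_mono: "S \<subseteq> S' \<Longrightarrow> fixed_elems S' \<subseteq> fixed_elems S"
  by (auto simp: fixed_elems_def)

text \<open>The coefficient at \<open>x\<close> of the trace \<open>\<Sum>\<gamma>. \<gamma>(e m)\<close> of \<open>e m \<in> E[M]\<close>.\<close>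

definition orbit_sum :: "'e \<Rightarrow> 'x \<Rightarrow> 'x \<Rightarrow> 'e" where
  "orbit_sum e m x = (\<Oplus>\<gamma>\<in>{\<gamma> \<in> carrier G. act \<gamma> m = x}. \<gamma> e)"

text \<open>Left multiplication by \<rho> carries the elements moving m to x bijectively to those
  moving m to \<open>act \<rho> x\<close>.\<close>

lemma orbit_sum_invariant:
  assumes "e \<in> carrier E" "m \<in> carrier M"
  shows "orbit_sum e m \<in> fixed_elems (carrier G)"
proof (rule fixed_elemsI)
  fix \<rho> x assume \<rho>: "\<rho> \<in> carrier G" and x: "x \<in> carrier M"
  have eq: "{\<gamma> \<in> carrier G. act \<gamma> m = act \<rho> x} = (\<lambda>\<gamma>. \<rho> \<otimes>\<^bsub>G\<^esub> \<gamma>) ` {\<gamma> \<in> carrier G. act \<gamma> m = x}"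
  proof safe
    fix \<gamma> assume \<gamma>: "\<gamma> \<in> carrier G" "act \<gamma> m = act \<rho> x"
    have "\<gamma> = \<rho> \<otimes>\<^bsub>G\<^esub> (inv\<^bsub>G\<^esub> \<rho> \<otimes>\<^bsub>G\<^esub> \<gamma>)" using \<gamma> \<rho> by (simp flip: G.m_assoc)
    moreover have "act (inv\<^bsub>G\<^esub> \<rho> \<otimes>\<^bsub>G\<^esub> \<gamma>) m = x" using \<gamma> \<rho> x assms by (simp add: act_mult act_inv)
    ultimately show "\<gamma> \<in> (\<lambda>\<gamma>. \<rho> \<otimes>\<^bsub>G\<^esub> \<gamma>) ` {\<gamma> \<in> carrier G. act \<gamma> m = x}"
      using \<gamma> \<rho> by (intro image_eqI[of _ _ "inv\<^bsub>G\<^esub> \<rho> \<otimes>\<^bsub>G\<^esub> \<gamma>"]) auto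
  qed (use \<rho> assms in \<open>auto simp: act_mult\<close>)
  have "orbit_sum e m (act \<rho> x) = (\<Oplus>\<gamma>\<in>{\<gamma> \<in> carrier G. act \<gamma> m = x}. (\<rho> \<otimes>\<^bsub>G\<^esub> \<gamma>) e)"
    unfolding orbit_sum_def eq by (rule finsum_reindex) (use \<rho> assms in \<open>auto simp: inj_on_def\<close>)
  also have "\<dots> = (\<Oplus>\<gamma>\<in>{\<gamma> \<in> carrier G. act \<gamma> m = x}. \<rho> (\<gamma> e))"
    by (rule finsum_cong_closed) (use \<rho> assms in \<open>auto simp: mult_G\<close>)
  also have "\<dots> = \<rho> (orbit_sum e m x)"
    unfolding orbit_sum_def by (rule aut_finsum[symmetric]) (use \<rho> assms finite_G in auto)
  finally show "orbit_sum e m (act \<rho> x) = \<rho> (orbit_sum e m x)" .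
next
  fix x
  show "orbit_sum e m x \<in> carrier E"
    unfolding orbit_sum_def by (rule finsum_closed) (use assms in auto)
  show "orbit_sum e m x = \<zero>" if "x \<notin> carrier M"
  proof -
    have "{\<gamma> \<in> carrier G. act \<gamma> m = x} = {}" using that assms by auto
    then show ?thesis unfolding orbit_sum_def by (simp only: finsum_empty)
  qed
qed

text \<open>After expansion the summands are \<gamma>(t) \<gamma>(c i) \<tau>(d i), where \<gamma>
  moves m to x and \<tau> moves m to y. The sum over i forces \<gamma> = \<tau>, hence x = y, and
  what remains on the diagonal is the trace of t.\<close>

theorem exists_dual_family:
  obtains I :: "('x \<times> nat) set" and p g
  where "finite I" "\<And>k. k \<in> I \<Longrightarrow> p k \<in> fixed_elems (carrier G)" "\<And>k. k \<in> I \<Longrightarrow> g k \<in> fixed_elems (carrier G)"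
    "\<And>x y. x \<in> carrier M \<Longrightarrow> y \<in> carrier M \<Longrightarrow> (\<Oplus>k\<in>I. p k x \<otimes> g k y) = (if x = y then \<one> else \<zero>)"
proof -
  obtain n c d where cd_closed: "\<forall>i<n. c i \<in> carrier E \<and> d i \<in> carrier E"
    and cd_sum: "\<forall>\<gamma>\<in>carrier G. \<forall>\<tau>\<in>carrier G.
        (\<Oplus>i\<in>{..<n::nat}. \<gamma> (c i) \<otimes> \<tau> (d i)) = (if \<gamma> = \<tau> then \<one> else \<zero>)"
    using exists_separating_family by (elim exE conjE) (rule that)
  from cd_closed have c: "\<And>i. i < n \<Longrightarrow> c i \<in> carrier E" and d: "\<And>i. i < n \<Longrightarrow> d i \<in> carrier E"
    by auto
  from cd_sum have cd: "(\<Oplus>i\<in>{..<n}. \<gamma> (c i) \<otimes> \<tau> (d i)) = (if \<gamma> = \<tau> then \<one> else \<zero>)"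
    if "\<gamma> \<in> carrier G" "\<tau> \<in> carrier G" for \<gamma> \<tau>
    using that by blast
  obtain t where t: "t \<in> carrier E" "(\<Oplus>\<gamma>\<in>carrier G. \<gamma> t) = \<one>" using exists_trace_one by blast
  define I where "I = carrier M \<times> {..<n}"
  define p where "p = (\<lambda>k. orbit_sum (c (snd k) \<otimes> t) (fst k))"
  define g where "g = (\<lambda>k. orbit_sum (d (snd k)) (fst k))"
  have "finite I" using finite_M by (simp add: I_def)
  moreover have p: "p k \<in> fixed_elems (carrier G)" if "k \<in> I" for k
    unfolding p_def using that c t by (intro orbit_sum_invariant) (auto simp: I_def)
  moreover have g: "g k \<in> fixed_elems (carrier G)" if "k \<in> I" for k
    unfolding g_def using that d by (intro orbit_sum_invariant) (auto simp: I_def)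
  moreover have "(\<Oplus>k\<in>I. p k x \<otimes> g k y) = (if x = y then \<one> else \<zero>)"
    if x: "x \<in> carrier M" and y: "y \<in> carrier M" for x y
  proof -
    let ?A = "\<lambda>m x. {\<gamma> \<in> carrier G. act \<gamma> m = x}"
    have fin: "finite (?A m x)" for m x using finite_G by simp
    have "(\<Oplus>k\<in>I. p k x \<otimes> g k y) = (\<Oplus>m\<in>carrier M. \<Oplus>i\<in>{..<n}. p (m, i) x \<otimes> g (m, i) y)"
      unfolding I_def
      by (rule finsum_Times)
         (use finite_M fixed_elemsD(1)[OF p] fixed_elemsD(1)[OF g] in \<open>auto simp: I_def\<close>)
    also have "\<dots> = (\<Oplus>m\<in>carrier M. if x = y then (\<Oplus>\<gamma>\<in>?A m x. \<gamma> t) else \<zero>)"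
    proof (rule finsum_cong_closed)
      fix m assume m: "m \<in> carrier M"
      have "(\<Oplus>i\<in>{..<n}. p (m, i) x \<otimes> g (m, i) y)
          = (\<Oplus>i\<in>{..<n}. \<Oplus>\<gamma>\<in>?A m x. \<Oplus>\<tau>\<in>?A m y. \<gamma> t \<otimes> (\<gamma> (c i) \<otimes> \<tau> (d i)))"
      proof (rule finsum_cong_closed)
        fix i assume i: "i \<in> {..<n}"
        have "p (m, i) x \<otimes> g (m, i) y = (\<Oplus>\<gamma>\<in>?A m x. \<gamma> (c i \<otimes> t) \<otimes> g (m, i) y)"
          unfolding p_def orbit_sum_def fst_conv snd_conv
          by (rule finsum_ldistr)
             (use fin i m g[of "(m, i)"] fixed_elemsD(1) c t in \<open>auto simp: I_def\<close>)
        also have "\<dots> = (\<Oplus>\<gamma>\<in>?A m x. \<Oplus>\<tau>\<in>?A m y. \<gamma> (c i \<otimes> t) \<otimes> \<tau> (d i))"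
          unfolding g_def orbit_sum_def fst_conv snd_conv
          by (rule finsum_cong_closed, rule finsum_rdistr)
             (use fin i c d t in \<open>auto intro!: finsum_closed\<close>)
        also have "\<dots> = (\<Oplus>\<gamma>\<in>?A m x. \<Oplus>\<tau>\<in>?A m y. \<gamma> t \<otimes> (\<gamma> (c i) \<otimes> \<tau> (d i)))"
          by (intro finsum_cong_closed) (use i c d t in \<open>auto intro!: finsum_closed simp: m_ac\<close>)
        finally show "p (m, i) x \<otimes> g (m, i) y = (\<Oplus>\<gamma>\<in>?A m x. \<Oplus>\<tau>\<in>?A m y. \<gamma> t \<otimes> (\<gamma> (c i) \<otimes> \<tau> (d i)))" .
      qed (use c d t in \<open>auto intro!: finsum_closed\<close>)
      also have "\<dots> = (\<Oplus>\<gamma>\<in>?A m x. \<Oplus>i\<in>{..<n}. \<Oplus>\<tau>\<in>?A m y. \<gamma> t \<otimes> (\<gamma> (c i) \<otimes> \<tau> (d i)))"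
        by (rule finsum_swap) (use fin c d t in \<open>auto intro!: finsum_closed\<close>)
      also have "\<dots> = (\<Oplus>\<gamma>\<in>?A m x. \<Oplus>\<tau>\<in>?A m y. \<Oplus>i\<in>{..<n}. \<gamma> t \<otimes> (\<gamma> (c i) \<otimes> \<tau> (d i)))"
        by (rule finsum_cong_closed, rule finsum_swap) (use fin c d t in \<open>auto intro!: finsum_closed\<close>)
      \<comment> \<open>The sum over i has been brought innermost, where the separating identity
        evaluates it.\<close>
      also have "\<dots> = (\<Oplus>\<gamma>\<in>?A m x. \<Oplus>\<tau>\<in>?A m y. if \<gamma> = \<tau> then \<gamma> t else \<zero>)"
      proof (intro finsum_cong_closed)
        fix \<gamma> \<tau> assume st: "\<gamma> \<in> ?A m x" "\<tau> \<in> ?A m y"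
        have "(\<Oplus>i\<in>{..<n}. \<gamma> t \<otimes> (\<gamma> (c i) \<otimes> \<tau> (d i))) = \<gamma> t \<otimes> (\<Oplus>i\<in>{..<n}. \<gamma> (c i) \<otimes> \<tau> (d i))"
          by (rule finsum_rdistr[symmetric]) (use st c d t in auto)
        then show "(\<Oplus>i\<in>{..<n}. \<gamma> t \<otimes> (\<gamma> (c i) \<otimes> \<tau> (d i))) = (if \<gamma> = \<tau> then \<gamma> t else \<zero>)"
          using cd[of \<gamma> \<tau>] st t by simp
      qed (use t in \<open>auto intro!: finsum_closed\<close>)
      also have "\<dots> = (if x = y then (\<Oplus>\<gamma>\<in>?A m x. \<gamma> t) else \<zero>)"
      proof (cases "x = y")
        case True
        have "(\<Oplus>\<tau>\<in>?A m y. if \<gamma> = \<tau> then \<gamma> t else \<zero>) = \<gamma> t" if "\<gamma> \<in> ?A m x" for \<gamma>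
          using finsum_delta[of "?A m y" \<gamma> "\<lambda>\<tau>. if \<gamma> = \<tau> then \<gamma> t else \<zero>"] that True fin t by auto
        then have "(\<Oplus>\<gamma>\<in>?A m x. \<Oplus>\<tau>\<in>?A m y. if \<gamma> = \<tau> then \<gamma> t else \<zero>) = (\<Oplus>\<gamma>\<in>?A m x. \<gamma> t)"
          by (rule finsum_cong_closed) (use t in auto)
        then show ?thesis using True by simp
      next
        case False
        have "(\<Oplus>\<gamma>\<in>?A m x. \<Oplus>\<tau>\<in>?A m y. if \<gamma> = \<tau> then \<gamma> t else \<zero>) = \<zero>"
          by (intro finsum_all_zero) (use False in auto)
        then show ?thesis using False by simp
      qed
      finally show "(\<Oplus>i\<in>{..<n}. p (m, i) x \<otimes> g (m, i) y)
          = (if x = y then (\<Oplus>\<gamma>\<in>?A m x. \<gamma> t) else \<zero>)" .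
    qed (use t in \<open>auto intro!: finsum_closed\<close>)
    also have "\<dots> = (if x = y then \<one> else \<zero>)"
    proof (cases "x = y")
      case True
      \<comment> \<open>Each \<gamma> moves exactly one m to x, namely the image of x under its
        inverse. Summing over m thus runs through the whole group once.\<close>
      have "?A m x = {\<gamma> \<in> carrier G. act (inv\<^bsub>G\<^esub> \<gamma>) x = m}" if "m \<in> carrier M" for m
        using that x act_eq_iff by auto
      then have "(\<Oplus>m\<in>carrier M. \<Oplus>\<gamma>\<in>?A m x. \<gamma> t)
          = (\<Oplus>m\<in>carrier M. \<Oplus>\<gamma>\<in>{\<gamma> \<in> carrier G. act (inv\<^bsub>G\<^esub> \<gamma>) x = m}. \<gamma> t)"
        by (intro finsum_cong_closed) (use t in \<open>auto intro!: finsum_closed\<close>)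
      also have "\<dots> = (\<Oplus>\<gamma>\<in>carrier G. \<gamma> t)"
        by (rule finsum_fibres) (use x t finite_G finite_M in auto)
      finally show ?thesis using True t by simp
    next
      case False
      then show ?thesis by (simp add: finsum_all_zero)
    qed
    finally show ?thesis .
  qed
  ultimately show ?thesis using that by blast
qed

end

subsection \<open>The Hopf algebra of invariants\<close>

lemma module_cong:
  assumes "module R A" "carrier A' = carrier A" "\<zero>\<^bsub>A'\<^esub> = \<zero>\<^bsub>A\<^esub>" "ring.add A' = ring.add A" "smult A' = smult A"
  shows "module R A'"
proof -
  interpret module R A by fact
  have "abelian_group A'"
    by (rule abelian_groupI) (auto simp: assms(2-4) M.a_ac M.l_neg intro!: bexI[of _ "\<ominus>\<^bsub>A\<^esub> _"])
  then show ?thesis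
    by (intro moduleI) (auto simp: assms(2-5) R.cring_axioms smult_l_distr smult_r_distr smult_assoc1)
qed

lemma group_hopf_simps:
  "carrier (group_hopf F M) = carrier (monoid_algebra F M)"
  "monoid.mult (group_hopf F M) = monoid.mult (monoid_algebra F M)"
  "\<one>\<^bsub>group_hopf F M\<^esub> = \<one>\<^bsub>monoid_algebra F M\<^esub>"
  "\<zero>\<^bsub>group_hopf F M\<^esub> = \<zero>\<^bsub>monoid_algebra F M\<^esub>"
  "ring.add (group_hopf F M) = ring.add (monoid_algebra F M)"
  "smult (group_hopf F M) = smult (monoid_algebra F M)"
  "counit (group_hopf F M) u = (\<Oplus>\<^bsub>F\<^esub>m \<in> {m. u m \<noteq> \<zero>\<^bsub>F\<^esub>}. u m)"
  "antipode (group_hopf F M) u = (\<lambda>m. if m \<in> carrier M then u (inv\<^bsub>M\<^esub> m) else \<zero>\<^bsub>F\<^esub>)"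
  by (simp_all add: group_hopf_def Let_def module.defs)

text \<open>The definition takes the tensor square of the bare algebra; restating it for the Hopf
  record lets the coordinates of that record be used.\<close>

lemma group_hopf_comult:
  "comult (group_hopf F M) u
     = (\<Oplus>\<^bsub>tensor F (group_hopf F M) (group_hopf F M)\<^esub>m \<in> {m. u m \<noteq> \<zero>\<^bsub>F\<^esub>}.
          u m \<odot>\<^bsub>tensor F (group_hopf F M) (group_hopf F M)\<^esub>
            pure_tensor F (group_hopf F M) (group_hopf F M) (basis_elem F m) (basis_elem F m))"
proof -
  have "tensor F (group_hopf F M) (group_hopf F M) = tensor F (monoid_algebra F M) (monoid_algebra F M)"
    "pure_tensor F (group_hopf F M) (group_hopf F M) = pure_tensor F (monoid_algebra F M) (monoid_algebra F M)"
    by (rule tensor_cong; simp add: group_hopf_simps)+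
  then show ?thesis by (simp add: group_hopf_def Let_def module.defs)
qed

locale galois_dual_family = galois_module E G M act
  for E :: "('e, 'm) ring_scheme" (structure) and G and M :: "('x, 'y) monoid_scheme" and act +
  fixes I :: "'i set" and p g :: "'i \<Rightarrow> 'x \<Rightarrow> 'e"
  assumes finite_I: "finite I"
    and p_fixed: "k \<in> I \<Longrightarrow> p k \<in> fixed_elems (carrier G)"
    and g_fixed: "k \<in> I \<Longrightarrow> g k \<in> fixed_elems (carrier G)"
    and dual: "x \<in> carrier M \<Longrightarrow> y \<in> carrier M \<Longrightarrow> (\<Oplus>k\<in>I. p k x \<otimes> g k y) = (if x = y then \<one> else \<zero>)"
begin

lemma p_closed: "k \<in> I \<Longrightarrow> p k x \<in> carrier E" and g_closed: "k \<in> I \<Longrightarrow> g k x \<in> carrier E"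
  by (auto dest: p_fixed g_fixed intro: fixed_elemsD(1))

text \<open>The reproducing property holds for arbitrary functions over E. Invariance of
  \<open>w\<close> matters only for the coefficients, which then lie in a fixed field.\<close>

lemma dual_expansion:
  assumes "\<And>x. x \<in> carrier M \<Longrightarrow> w x \<in> carrier E" "y \<in> carrier M"
  shows "(\<Oplus>k\<in>I. (\<Oplus>x\<in>carrier M. p k x \<otimes> w x) \<otimes> g k y) = w y"
proof -
  have "(\<Oplus>k\<in>I. (\<Oplus>x\<in>carrier M. p k x \<otimes> w x) \<otimes> g k y)
      = (\<Oplus>k\<in>I. \<Oplus>x\<in>carrier M. p k x \<otimes> w x \<otimes> g k y)"
    by (rule finsum_cong_closed)
       (use assms p_closed g_closed finite_M in \<open>auto intro!: finsum_ldistr finsum_closed\<close>)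
  also have "\<dots> = (\<Oplus>x\<in>carrier M. \<Oplus>k\<in>I. p k x \<otimes> w x \<otimes> g k y)"
    by (rule finsum_swap) (use assms p_closed g_closed finite_M finite_I in auto)
  also have "\<dots> = (\<Oplus>x\<in>carrier M. if x = y then w x else \<zero>)"
  proof (rule finsum_cong_closed)
    fix x assume x: "x \<in> carrier M"
    have "(\<Oplus>k\<in>I. p k x \<otimes> w x \<otimes> g k y) = (\<Oplus>k\<in>I. w x \<otimes> (p k x \<otimes> g k y))"
      by (rule finsum_cong_closed) (use assms x p_closed g_closed in \<open>auto simp: m_ac\<close>)
    also have "\<dots> = w x \<otimes> (\<Oplus>k\<in>I. p k x \<otimes> g k y)"
      by (rule finsum_rdistr[symmetric]) (use assms x p_closed g_closed finite_I in auto)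
    also have "\<dots> = (if x = y then w x else \<zero>)" using dual[OF x assms(2)] assms x by simp
    finally show "(\<Oplus>k\<in>I. p k x \<otimes> w x \<otimes> g k y) = (if x = y then w x else \<zero>)" .
  qed (use assms in auto)
  also have "\<dots> = w y"
    using finsum_delta[of "carrier M" y "\<lambda>x. if x = y then w x else \<zero>"] finite_M assms by simp
  finally show ?thesis .
qed

text \<open>Pairing again with \<open>p k y\<close> and summing over k recovers the value at y. This
  turns identities tested only on invariant elements into identities between functions on M.\<close>

lemma dual_separates:
  assumes "\<And>x. x \<in> carrier M \<Longrightarrow> a x \<in> carrier E" "\<And>x. x \<in> carrier M \<Longrightarrow> b x \<in> carrier E"
    and "\<And>k. k \<in> I \<Longrightarrow> (\<Oplus>x\<in>carrier M. g k x \<otimes> a x) = (\<Oplus>x\<in>carrier M. g k x \<otimes> b x)"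
    and "y \<in> carrier M"
  shows "a y = b y"
proof -
  have *: "(\<Oplus>k\<in>I. p k y \<otimes> (\<Oplus>x\<in>carrier M. g k x \<otimes> a x)) = a y"
    if "\<And>x. x \<in> carrier M \<Longrightarrow> a x \<in> carrier E" for a
  proof -
    have "(\<Oplus>k\<in>I. p k y \<otimes> (\<Oplus>x\<in>carrier M. g k x \<otimes> a x)) = (\<Oplus>k\<in>I. \<Oplus>x\<in>carrier M. p k y \<otimes> (g k x \<otimes> a x))"
      by (rule finsum_cong_closed)
         (use that p_closed g_closed finite_M in \<open>auto intro!: finsum_rdistr finsum_closed\<close>)
    also have "\<dots> = (\<Oplus>x\<in>carrier M. \<Oplus>k\<in>I. p k y \<otimes> (g k x \<otimes> a x))"
      by (rule finsum_swap) (use that p_closed g_closed finite_M finite_I in auto)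
    also have "\<dots> = (\<Oplus>x\<in>carrier M. if y = x then a x else \<zero>)"
    proof (rule finsum_cong_closed)
      fix x assume x: "x \<in> carrier M"
      have "(\<Oplus>k\<in>I. p k y \<otimes> (g k x \<otimes> a x)) = (\<Oplus>k\<in>I. p k y \<otimes> g k x \<otimes> a x)"
        by (rule finsum_cong_closed) (use that x p_closed g_closed in \<open>auto simp: m_assoc\<close>)
      also have "\<dots> = (\<Oplus>k\<in>I. p k y \<otimes> g k x) \<otimes> a x"
        by (rule finsum_ldistr[symmetric]) (use that x p_closed g_closed finite_I in auto)
      also have "\<dots> = (if y = x then a x else \<zero>)" using dual[OF assms(4) x] that x by simp
      finally show "(\<Oplus>k\<in>I. p k y \<otimes> (g k x \<otimes> a x)) = (if y = x then a x else \<zero>)" .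
    qed (use that in auto)
    also have "\<dots> = a y"
      using finsum_delta[of "carrier M" y "\<lambda>x. if y = x then a x else \<zero>"] finite_M that assms(4) by simp
    finally show ?thesis .
  qed
  have "a y = (\<Oplus>k\<in>I. p k y \<otimes> (\<Oplus>x\<in>carrier M. g k x \<otimes> a x))"
    by (rule *[symmetric]) (rule assms(1))
  also have "\<dots> = (\<Oplus>k\<in>I. p k y \<otimes> (\<Oplus>x\<in>carrier M. g k x \<otimes> b x))"
    by (rule finsum_cong_closed) (use assms p_closed g_closed in \<open>auto intro!: finsum_closed\<close>)
  also have "\<dots> = b y" by (rule *) (rule assms(2))
  finally show ?thesis .
qed

lemma act_sum:
  assumes "\<gamma> \<in> carrier G" "\<And>x. x \<in> carrier M \<Longrightarrow> w x \<in> carrier E"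
  shows "(\<Oplus>x\<in>carrier M. w (act \<gamma> x)) = (\<Oplus>x\<in>carrier M. w x)"
proof -
  have inj: "inj_on (act \<gamma>) (carrier M)"
    by (rule inj_on_inverseI[where g = "act (inv\<^bsub>G\<^esub> \<gamma>)"]) (use assms act_inv in auto)
  have surj: "act \<gamma> ` carrier M = carrier M"
  proof
    show "carrier M \<subseteq> act \<gamma> ` carrier M"
    proof
      fix x assume "x \<in> carrier M"
      then show "x \<in> act \<gamma> ` carrier M"
        using assms(1) act_inv(1)[of \<gamma> x] by (intro image_eqI[of _ _ "act (inv\<^bsub>G\<^esub> \<gamma>) x"]) auto
    qed
  qed (use assms in auto)
  have "(\<Oplus>x\<in>act \<gamma> ` carrier M. w x) = (\<Oplus>x\<in>carrier M. w (act \<gamma> x))"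
    by (rule finsum_reindex) (use inj assms surj in auto)
  then show ?thesis using surj by simp
qed

text \<open>Applying \<gamma> to the sum of the coefficients of an invariant only permutes the
  terms.\<close>

lemma sum_fixed:
  assumes S: "S \<subseteq> carrier G" and w: "w \<in> fixed_elems S"
  shows "(\<Oplus>x\<in>carrier M. w x) \<in> fixed_field E S"
  unfolding fixed_field_def
proof (intro CollectI conjI ballI)
  show "(\<Oplus>x\<in>carrier M. w x) \<in> carrier E"
    by (rule finsum_closed) (use fixed_elemsD(1)[OF w] in auto)
  fix \<gamma> assume \<gamma>: "\<gamma> \<in> S"
  then have \<gamma>G: "\<gamma> \<in> carrier G" using S by auto
  have "\<gamma> (\<Oplus>x\<in>carrier M. w x) = (\<Oplus>x\<in>carrier M. \<gamma> (w x))"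
    by (rule aut_finsum[OF \<gamma>G finite_M]) (rule fixed_elemsD(1)[OF w])
  also have "\<dots> = (\<Oplus>x\<in>carrier M. w (act \<gamma> x))"
    by (rule finsum_cong_closed) (use fixed_elemsD[OF w] \<gamma> \<gamma>G in auto)
  also have "\<dots> = (\<Oplus>x\<in>carrier M. w x)"
    by (rule act_sum[OF \<gamma>G]) (rule fixed_elemsD(1)[OF w])
  finally show "\<gamma> (\<Oplus>x\<in>carrier M. w x) = (\<Oplus>x\<in>carrier M. w x)" .
qed

lemma fixed_elems_prod:
  assumes "S \<subseteq> carrier G" "u \<in> fixed_elems S" "v \<in> fixed_elems S"
  shows "(\<lambda>x. u x \<otimes> v x) \<in> fixed_elems S"
  by (rule fixed_elemsI) (use fixed_elemsD[OF assms(2)] fixed_elemsD[OF assms(3)] assms(1) in auto)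

lemma functional_fixed:
  assumes S: "S \<subseteq> carrier G" and k: "k \<in> I" and w: "w \<in> fixed_elems S"
  shows "(\<Oplus>x\<in>carrier M. p k x \<otimes> w x) \<in> fixed_field E S"
  by (rule sum_fixed[OF S fixed_elems_prod[OF S _ w]]) (use p_fixed[OF k] fixed_elems_mono[OF S] in auto)

text \<open>Serves for the module and ring structure of the invariants. Its comultiplication field
  is still that of E[M], with values in the tensor square of E[M] over E; the one with values in the
  tensor square of the invariants comes from \<open>restrict_hopf\<close>.\<close>

definition invariant_algebra :: "('e \<Rightarrow> 'e) set \<Rightarrow> ('e, 'x \<Rightarrow> 'e) hopf" where
  "invariant_algebra S = (group_hopf E M)\<lparr>carrier := fixed_elems S\<rparr>"

lemma invariant_algebra_simps:
  "carrier (invariant_algebra S) = fixed_elems S"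
  "monoid.mult (invariant_algebra S) = monoid.mult (monoid_algebra E M)"
  "\<one>\<^bsub>invariant_algebra S\<^esub> = basis_elem E \<one>\<^bsub>M\<^esub>"
  "\<zero>\<^bsub>invariant_algebra S\<^esub> = (\<lambda>x. \<zero>)"
  "u \<oplus>\<^bsub>invariant_algebra S\<^esub> v = (\<lambda>x. u x \<oplus> v x)"
  "r \<odot>\<^bsub>invariant_algebra S\<^esub> u = (\<lambda>x. r \<otimes> u x)"
  by (simp_all add: invariant_algebra_def group_hopf_simps monoid_algebra_simps)

lemma invariant_algebra_module:
  assumes S: "S \<subseteq> carrier G"
  shows "module (E\<lparr>carrier := fixed_field E S\<rparr>) (invariant_algebra S)"
proof -
  let ?F = "E\<lparr>carrier := fixed_field E S\<rparr>"
  have "module E (group_hopf E M)"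
    by (rule module_cong[OF monoid_algebra_module[OF cring_axioms, of M]]) (simp_all add: group_hopf_simps)
  then interpret V: module ?F "group_hopf E M"
    by (rule module_restrict_scalars) (rule fixed_field_subfield[OF S])
  have minus: "\<ominus>\<^bsub>group_hopf E M\<^esub> a = (\<lambda>x. \<ominus> a x)" if "a \<in> carrier (group_hopf E M)" for a
  proof (rule V.minus_equality)
    show "(\<lambda>x. \<ominus> a x) \<oplus>\<^bsub>group_hopf E M\<^esub> a = \<zero>\<^bsub>group_hopf E M\<^esub>"
      using that by (auto simp: group_hopf_simps monoid_algebra_simps(2,3) carrier_monoid_algebra_finite l_neg)
    show "a \<in> carrier (group_hopf E M)" "(\<lambda>x. \<ominus> a x) \<in> carrier (group_hopf E M)"
      using that by (auto simp: group_hopf_simps carrier_monoid_algebra_finite)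
  qed
  have "submodule (fixed_elems S) ?F (group_hopf E M)"
  proof (rule V.submoduleI)
    show sub: "fixed_elems S \<subseteq> carrier (group_hopf E M)" by (auto simp: fixed_elems_def group_hopf_simps)
    show "\<zero>\<^bsub>group_hopf E M\<^esub> \<in> fixed_elems S"
      by (rule fixed_elemsI) (use S in \<open>auto simp: group_hopf_simps monoid_algebra_simps(2)\<close>)
    show "\<ominus>\<^bsub>group_hopf E M\<^esub> a \<in> fixed_elems S" if "a \<in> fixed_elems S" for a
    proof -
      have "a \<in> carrier (group_hopf E M)" using that sub by auto
      then show ?thesis unfolding minus[OF \<open>a \<in> carrier (group_hopf E M)\<close>]
        by (intro fixed_elemsI) (use fixed_elemsD[OF that] S in auto)
    qed
    show "a \<oplus>\<^bsub>group_hopf E M\<^esub> b \<in> fixed_elems S" if "a \<in> fixed_elems S" "b \<in> fixed_elems S" for a b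
      unfolding group_hopf_simps monoid_algebra_simps
      by (rule fixed_elemsI) (use fixed_elemsD[OF that(1)] fixed_elemsD[OF that(2)] S in auto)
    show "r \<odot>\<^bsub>group_hopf E M\<^esub> a \<in> fixed_elems S" if r: "r \<in> carrier ?F" and a: "a \<in> fixed_elems S" for r a
    proof -
      have rE: "r \<in> carrier E" using r by (auto simp: fixed_field_def)
      have "r \<otimes> a (act \<gamma> m) = \<gamma> (r \<otimes> a m)" if "\<gamma> \<in> S" "m \<in> carrier M" for \<gamma> m
      proof -
        have "\<gamma> r = r" using r that by (auto simp: fixed_field_def)
        then show ?thesis using that S fixed_elemsD[OF a] aut_mult[of \<gamma> r "a m"] rE by auto
      qed
      then show ?thesis
        unfolding group_hopf_simps monoid_algebra_simps
        by (intro fixed_elemsI) (use fixed_elemsD[OF a] rE in auto)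
    qed
  qed
  from submodule.submodule_is_module[OF this V.module_axioms] show ?thesis
    by (simp add: invariant_algebra_def)
qed

text \<open>One family serves all \<open>S\<close>: its members are fixed by G and hence by
  \<open>S\<close>, and their pairings with elements fixed by \<open>S\<close> lie in the fixed
  field of \<open>S\<close>. The coordinates of an element are its own coefficients.\<close>

lemma invariant_dual_coords:
  assumes S: "S \<subseteq> carrier G"
  shows "dual_coords E (fixed_field E S) (invariant_algebra S) (carrier M) (\<lambda>u. u) I p g"
proof -
  interpret c: coords E "fixed_field E S" "invariant_algebra S" "carrier M" "\<lambda>u. u"
    by (rule coords.intro[OF field_axioms], rule coords_axioms.intro)
       (auto simp: invariant_algebra_module[OF S] fixed_field_subfield[OF S] invariant_algebra_simps fixed_elemsD(1))
  show ?thesis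
  proof (rule dual_coords.intro[OF c.coords_axioms], rule dual_coords_axioms.intro)
    show "g k \<in> carrier (invariant_algebra S)" if "k \<in> I" for k
      using g_fixed[OF that] fixed_elems_mono[OF S] by (auto simp: invariant_algebra_simps)
    show fnl: "(\<Oplus>x\<in>carrier M. p k x \<otimes> a x) \<in> fixed_field E S"
      if "k \<in> I" "a \<in> carrier (invariant_algebra S)" for k a
      using functional_fixed[OF S] that by (simp add: invariant_algebra_simps)
    fix a assume a: "a \<in> carrier (invariant_algebra S)"
    let ?f = "\<lambda>k. (\<Oplus>x\<in>carrier M. p k x \<otimes> a x) \<odot>\<^bsub>invariant_algebra S\<^esub> g k"
    have f: "?f k \<in> carrier (invariant_algebra S)" if "k \<in> I" for k
      using that fnl[OF that a] g_fixed[OF that] fixed_elems_mono[OF S]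
      by (intro c.A.smult_closed) (auto simp: invariant_algebra_simps)
    then have sum: "finsum (invariant_algebra S) ?f I \<in> carrier (invariant_algebra S)"
      by (intro c.A.finsum_closed) auto
    show "a = finsum (invariant_algebra S) ?f I"
    proof
      fix y
      show "a y = finsum (invariant_algebra S) ?f I y"
      proof (cases "y \<in> carrier M")
        case True
        have "finsum (invariant_algebra S) ?f I y = (\<Oplus>k\<in>I. ?f k y)"
          by (rule c.\<nu>_finsum[OF finite_I True f])
        also have "\<dots> = a y"
          unfolding invariant_algebra_simps
          by (rule dual_expansion) (use a True in \<open>auto simp: invariant_algebra_simps fixed_elemsD(1)\<close>)
        finally show ?thesis by simp
      next
        case False
        then show ?thesis
          using fixed_elemsD(2)[OF a[unfolded invariant_algebra_simps(1)] False]
            fixed_elemsD(2)[OF sum[unfolded invariant_algebra_simps(1)] False] by simp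
      qed
    qed
  qed (auto simp: finite_M finite_I p_closed)
qed

lemma invariant_dual_coord_pair:
  assumes S: "S \<subseteq> carrier G"
  shows "dual_coord_pair E (fixed_field E S) (invariant_algebra S) (carrier M) (\<lambda>u. u)
           (invariant_algebra S) (carrier M) (\<lambda>u. u) I p g"
proof -
  interpret c: dual_coords E "fixed_field E S" "invariant_algebra S" "carrier M" "\<lambda>u. u" I p g
    by (rule invariant_dual_coords[OF S])
  show ?thesis
    by (intro dual_coord_pair.intro coord_pair.intro c.coords_axioms c.faithful_coords_axioms c.dual_coords_axioms)
qed

abbreviation (input) K\<^sub>0 :: "('e, 'm) ring_scheme" where "K\<^sub>0 \<equiv> E\<lparr>carrier := fixed_field E (carrier G)\<rparr>"
abbreviation (input) H\<^sub>0 :: "('e, 'x \<Rightarrow> 'e) hopf" where "H\<^sub>0 \<equiv> invariant_algebra (carrier G)"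

sublocale HH: dual_coord_pair E "fixed_field E (carrier G)" H\<^sub>0 "carrier M" "\<lambda>u. u" H\<^sub>0 "carrier M" "\<lambda>u. u" I p g
  by (rule invariant_dual_coord_pair) simp

lemma fixed_elems_empty: "fixed_elems {} = carrier (group_hopf E M)"
  by (simp add: fixed_elems_def group_hopf_simps)

lemma invariant_algebra_empty: "invariant_algebra {} = group_hopf E M"
  by (simp add: invariant_algebra_def fixed_elems_empty)

lemma fixed_field_empty: "E\<lparr>carrier := fixed_field E {}\<rparr> = E"
  by (simp add: fixed_field_def)

text \<open>The comultiplication of the group algebra restricts to invariants as \<open>h \<mapsto> \<Sum>k. p k h \<otimes> g k\<close>, where
  \<open>p k h\<close> is the pointwise product of coefficients.\<close>

lemma restrict_comult:
  assumes h: "h \<in> fixed_elems (carrier G)"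
  defines "t \<equiv> comult (restrict_hopf K\<^sub>0 E (group_hopf E M) (fixed_elems (carrier G))) h"
  shows "t \<in> carrier (tensor K\<^sub>0 H\<^sub>0 H\<^sub>0)"
    and "\<And>x y. x \<in> carrier M \<Longrightarrow> y \<in> carrier M \<Longrightarrow> HH.\<kappa> t x y = (if x = y then h x else \<zero>)"
proof -
  let ?V = "group_hopf E M"
  let ?VV = "tensor E ?V ?V"
  let ?HH = "tensor K\<^sub>0 H\<^sub>0 H\<^sub>0"
  \<comment> \<open>For the empty set of automorphisms, the invariants are E[M] itself as a module
    over E, so its tensor square has faithful coordinates too.\<close>
  interpret V: dual_coord_pair E "fixed_field E {}" ?V "carrier M" "\<lambda>u. u" ?V "carrier M" "\<lambda>u. u" I p g
    rewrites "E\<lparr>carrier := fixed_field E {}\<rparr> = E"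
    using invariant_dual_coord_pair[of "{}"] by (simp_all add: invariant_algebra_empty fixed_field_empty)
  define j where "j = tensor_lift K\<^sub>0 ?VV (pure_tensor E ?V ?V)"
  have KE: "fixed_field E (carrier G) \<subseteq> carrier E" by (auto simp: fixed_field_def)
  have HV: "carrier H\<^sub>0 \<subseteq> carrier ?V"
    by (auto simp: invariant_algebra_simps fixed_elems_def group_hopf_simps)
  have VVmod: "module K\<^sub>0 ?VV"
    by (rule module_restrict_scalars[OF V.AB.tensor_module]) (rule fixed_field_subfield, simp)
  have bil: "bilinear_map K\<^sub>0 H\<^sub>0 H\<^sub>0 ?VV (pure_tensor E ?V ?V)"
  proof -
    have "u \<oplus>\<^bsub>H\<^sub>0\<^esub> v = u \<oplus>\<^bsub>?V\<^esub> v" "r \<odot>\<^bsub>H\<^sub>0\<^esub> u = r \<odot>\<^bsub>?V\<^esub> u" for u v r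
      by (simp_all add: invariant_algebra_def)
    then show ?thesis
      using V.AB.pure_tensor_bilinear HV KE unfolding bilinear_map_def by (auto simp: subset_iff)
  qed
  have j_closed: "j s \<in> carrier ?VV" if "s \<in> carrier ?HH" for s
    unfolding j_def by (rule HH.AB.tensor_lift_closed[OF VVmod bil that])
  \<comment> \<open>The canonical map \<open>j\<close> between the tensor squares over the two
    fields leaves coordinates unchanged. As these determine a tensor on either side,
    \<open>j\<close> is injective.\<close>
  have j_\<kappa>: "V.\<kappa> (j s) x y = HH.\<kappa> s x y" if "s \<in> carrier ?HH" "x \<in> carrier M" "y \<in> carrier M" for s x y
    using that(1)
  proof (induction rule: HH.AB.tensor_induct)
    case (pure a b)
    then show ?case
      using HV that HH.AB.tensor_lift_pure[OF VVmod bil pure]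
      by (simp add: j_def HH.\<kappa>_pure V.\<kappa>_pure subset_iff)
  next
    case (add s t)
    then show ?case
      using that HH.AB.tensor_lift_add[OF VVmod bil, of s t] j_closed
      by (simp add: j_def[symmetric] HH.\<kappa>_add V.\<kappa>_add)
  qed
  have comult_V: "comult ?V h \<in> carrier ?VV"
    "\<And>x y. x \<in> carrier M \<Longrightarrow> y \<in> carrier M \<Longrightarrow> V.\<kappa> (comult ?V h) x y = (if x = y then h x else \<zero>)"
  proof -
    let ?S = "{m. h m \<noteq> \<zero>}"
    let ?e = "basis_elem E"
    have S: "finite ?S" "?S \<subseteq> carrier M" using h finite_M fixed_elemsD(2)[OF h] by (auto intro: finite_subset)
    have e: "?e m \<in> carrier ?V" if "m \<in> ?S" for m
      using basis_elem_closed[OF cring_axioms, of m M] that S by (auto simp: group_hopf_simps)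
    have hc: "h m \<in> carrier E" for m using fixed_elemsD(1)[OF h] .
    have f: "h m \<odot>\<^bsub>?VV\<^esub> pure_tensor E ?V ?V (?e m) (?e m) \<in> carrier ?VV" if "m \<in> ?S" for m
      using e[OF that] hc V.AB.pure_tensor_closed by simp
    show "comult ?V h \<in> carrier ?VV"
      unfolding group_hopf_comult by (rule V.AB.T.finsum_closed) (use f in auto)
    fix x y assume x: "x \<in> carrier M" and y: "y \<in> carrier M"
    have "V.\<kappa> (comult ?V h) x y = (\<Oplus>m\<in>?S. V.\<kappa> (h m \<odot>\<^bsub>?VV\<^esub> pure_tensor E ?V ?V (?e m) (?e m)) x y)"
      unfolding group_hopf_comult using V.K.\<nu>_finsum[OF S(1), of "(x, y)", OF _ f] x y by simp
    also have "\<dots> = (\<Oplus>m\<in>?S. h m \<otimes> (?e m x \<otimes> ?e m y))"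
    proof (rule finsum_cong_closed)
      fix m assume m: "m \<in> ?S"
      show "V.\<kappa> (h m \<odot>\<^bsub>?VV\<^esub> pure_tensor E ?V ?V (?e m) (?e m)) x y = h m \<otimes> (?e m x \<otimes> ?e m y)"
      proof -
        have "h m \<in> fixed_field E {}" using hc by (simp add: fixed_field_def)
        from V.\<kappa>_smult[OF this V.AB.pure_tensor_closed[OF e[OF m] e[OF m]] x y]
        show ?thesis unfolding V.\<kappa>_pure[OF e[OF m] e[OF m] x y] .
      qed
    qed (use hc in \<open>auto simp: basis_elem_def\<close>)
    also have "\<dots> = (\<Oplus>m\<in>carrier M. h m \<otimes> (?e m x \<otimes> ?e m y))"
      by (rule finsum_mono_neutral) (use S finite_M hc in \<open>auto simp: basis_elem_def\<close>)
    also have "\<dots> = (\<Oplus>m\<in>carrier M. if x = m then (if x = y then h x else \<zero>) else \<zero>)"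
      by (rule finsum_cong_closed) (use hc in \<open>auto simp: basis_elem_def\<close>)
    also have "\<dots> = (if x = y then h x else \<zero>)"
      using finsum_delta[of "carrier M" x "\<lambda>m. if x = m then (if x = y then h x else \<zero>) else \<zero>"] finite_M x hc
      by simp
    finally show "V.\<kappa> (comult ?V h) x y = (if x = y then h x else \<zero>)" .
  qed
  define s where "s = (\<Oplus>\<^bsub>?HH\<^esub>k\<in>I. pure_tensor K\<^sub>0 H\<^sub>0 H\<^sub>0 (\<lambda>x. p k x \<otimes> h x) (g k))"
  have ph: "(\<lambda>x. p k x \<otimes> h x) \<in> carrier H\<^sub>0" and gk: "g k \<in> carrier H\<^sub>0" if "k \<in> I" for k
    using fixed_elems_prod[OF _ p_fixed[OF that] h] g_fixed[OF that] by (auto simp: invariant_algebra_simps)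
  have s: "s \<in> carrier ?HH"
    unfolding s_def by (rule HH.AB.T.finsum_closed) (use ph gk HH.AB.pure_tensor_closed in auto)
  have s_\<kappa>: "HH.\<kappa> s x y = (if x = y then h x else \<zero>)" if x: "x \<in> carrier M" and y: "y \<in> carrier M" for x y
  proof -
    have hc: "h z \<in> carrier E" for z using fixed_elemsD(1)[OF h] .
    have "HH.\<kappa> s x y = (\<Oplus>k\<in>I. HH.\<kappa> (pure_tensor K\<^sub>0 H\<^sub>0 H\<^sub>0 (\<lambda>x. p k x \<otimes> h x) (g k)) x y)"
      unfolding s_def
      using HH.K.\<nu>_finsum[OF finite_I, of "(x, y)" "\<lambda>k. pure_tensor K\<^sub>0 H\<^sub>0 H\<^sub>0 (\<lambda>x. p k x \<otimes> h x) (g k)"]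
        ph gk HH.AB.pure_tensor_closed x y by auto
    also have "\<dots> = (\<Oplus>k\<in>I. h x \<otimes> (p k x \<otimes> g k y))"
      by (rule finsum_cong_closed)
         (use ph gk x y hc p_closed g_closed in \<open>auto simp: HH.\<kappa>_pure m_ac\<close>)
    also have "\<dots> = h x \<otimes> (\<Oplus>k\<in>I. p k x \<otimes> g k y)"
      by (rule finsum_rdistr[symmetric]) (use hc p_closed g_closed finite_I in auto)
    also have "\<dots> = (if x = y then h x else \<zero>)" using dual[OF x y] hc by simp
    finally show ?thesis .
  qed
  \<comment> \<open>The explicit tensor and the comultiplication of E[M] have the same diagonal
    coordinates.\<close>
  have js: "j s = comult ?V h"
    by (rule V.\<kappa>_inject) (use s j_closed comult_V j_\<kappa> s_\<kappa> in auto)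
  have "t = (THE t. t \<in> carrier ?HH \<and> j t = comult ?V h)"
    by (simp add: t_def restrict_hopf_def j_def invariant_algebra_def)
  also have "\<dots> = s"
  proof (rule the_equality)
    show "s \<in> carrier ?HH \<and> j s = comult ?V h" using s js by simp
    \<comment> \<open>This is the uniqueness demanded by \<open>THE\<close>, that is, the
      injectivity of \<open>j\<close>.\<close>
    fix r assume r: "r \<in> carrier ?HH \<and> j r = comult ?V h"
    show "r = s"
    proof (rule HH.\<kappa>_inject)
      fix x y assume "x \<in> carrier M" "y \<in> carrier M"
      then show "HH.\<kappa> r x y = HH.\<kappa> s x y" using r js s j_\<kappa>[of r x y] j_\<kappa>[of s x y] by simp
    qed (use r s in auto)
  qed
  finally have "t = s" .
  then show "t \<in> carrier ?HH" "\<And>x y. x \<in> carrier M \<Longrightarrow> y \<in> carrier M \<Longrightarrow> HH.\<kappa> t x y = (if x = y then h x else \<zero>)"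
    using s s_\<kappa> by auto
qed

end

section \<open>Coordinate models of Hopf algebras over a fixed field\<close>

lemma monoid_algebra_mult_eq:
  assumes F: "cring F" and M: "group M" "finite (carrier M)"
    and u: "u \<in> carrier (monoid_algebra F M)" and v: "v \<in> carrier (monoid_algebra F M)"
    and m: "m \<in> carrier M"
  shows "(u \<otimes>\<^bsub>monoid_algebra F M\<^esub> v) m = (\<Oplus>\<^bsub>F\<^esub>x\<in>carrier M. u x \<otimes>\<^bsub>F\<^esub> v (inv\<^bsub>M\<^esub> x \<otimes>\<^bsub>M\<^esub> m))"
proof -
  interpret F: cring F by fact
  interpret M: group M by fact
  have uc: "u x \<in> carrier F" "v x \<in> carrier F" for x using u v by (auto simp: monoid_algebra_simps)
  have supp: "u x \<noteq> \<zero>\<^bsub>F\<^esub> \<Longrightarrow> x \<in> carrier M" "v x \<noteq> \<zero>\<^bsub>F\<^esub> \<Longrightarrow> x \<in> carrier M" for x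
    using u v by (auto simp: monoid_algebra_simps)
  let ?A = "{x \<in> carrier M. u x \<noteq> \<zero>\<^bsub>F\<^esub> \<and> v (inv\<^bsub>M\<^esub> x \<otimes>\<^bsub>M\<^esub> m) \<noteq> \<zero>\<^bsub>F\<^esub>}"
  let ?B = "{p. u (fst p) \<noteq> \<zero>\<^bsub>F\<^esub> \<and> v (snd p) \<noteq> \<zero>\<^bsub>F\<^esub> \<and> fst p \<otimes>\<^bsub>M\<^esub> snd p = m}"
  \<comment> \<open>In a group, a factorisation of m is determined by its first factor.\<close>
  have B: "?B = (\<lambda>x. (x, inv\<^bsub>M\<^esub> x \<otimes>\<^bsub>M\<^esub> m)) ` ?A"
  proof safe
    fix x y assume xy: "u (fst (x, y)) \<noteq> \<zero>\<^bsub>F\<^esub>" "v (snd (x, y)) \<noteq> \<zero>\<^bsub>F\<^esub>" "m = fst (x, y) \<otimes>\<^bsub>M\<^esub> snd (x, y)"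
    then have c: "x \<in> carrier M" "y \<in> carrier M" using supp by auto
    have "y = inv\<^bsub>M\<^esub> x \<otimes>\<^bsub>M\<^esub> (x \<otimes>\<^bsub>M\<^esub> y)" using c by (simp flip: M.m_assoc)
    then show "(x, y) \<in> (\<lambda>z. (z, inv\<^bsub>M\<^esub> z \<otimes>\<^bsub>M\<^esub> (fst (x, y) \<otimes>\<^bsub>M\<^esub> snd (x, y)))) `
        {z \<in> carrier M. u z \<noteq> \<zero>\<^bsub>F\<^esub> \<and> v (inv\<^bsub>M\<^esub> z \<otimes>\<^bsub>M\<^esub> (fst (x, y) \<otimes>\<^bsub>M\<^esub> snd (x, y))) \<noteq> \<zero>\<^bsub>F\<^esub>}"
      using xy c by (intro image_eqI[of _ _ x]) auto
  qed (use m in \<open>auto simp flip: M.m_assoc\<close>)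
  have "(u \<otimes>\<^bsub>monoid_algebra F M\<^esub> v) m = (\<Oplus>\<^bsub>F\<^esub>p\<in>?B. u (fst p) \<otimes>\<^bsub>F\<^esub> v (snd p))"
    by (simp add: monoid_algebra_def)
  also have "\<dots> = (\<Oplus>\<^bsub>F\<^esub>x\<in>?A. u x \<otimes>\<^bsub>F\<^esub> v (inv\<^bsub>M\<^esub> x \<otimes>\<^bsub>M\<^esub> m))"
    unfolding B using uc by (subst F.finsum_reindex) (auto simp: inj_on_def)
  also have "\<dots> = (\<Oplus>\<^bsub>F\<^esub>x\<in>carrier M. u x \<otimes>\<^bsub>F\<^esub> v (inv\<^bsub>M\<^esub> x \<otimes>\<^bsub>M\<^esub> m))"
    by (rule F.finsum_mono_neutral) (use uc M in auto)
  finally show ?thesis .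
qed

text \<open>An abstract copy of E[M]^S. The base change consists of cosets in a tensor product, so
  it can be identified with the invariants but is not equal to them.\<close>

locale invariant_model = galois_dual_family E G M act I p g
  for E :: "('e, 'm) ring_scheme" (structure) and G and M :: "('x, 'y) monoid_scheme" and act
    and I :: "'i set" and p g +
  fixes S :: "('e \<Rightarrow> 'e) set" and T :: "('e, 't, 'z) module_scheme" and \<nu> :: "'t \<Rightarrow> 'x \<Rightarrow> 'e"
  assumes S_subset: "S \<subseteq> carrier G"
    and T_module: "module (E\<lparr>carrier := fixed_field E S\<rparr>) T"
    and \<nu>_bij: "bij_betw \<nu> (carrier T) (fixed_elems S)"
    and \<nu>_add: "a \<in> carrier T \<Longrightarrow> b \<in> carrier T \<Longrightarrow> \<nu> (a \<oplus>\<^bsub>T\<^esub> b) = (\<lambda>x. \<nu> a x \<oplus> \<nu> b x)"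
    and \<nu>_smult: "r \<in> fixed_field E S \<Longrightarrow> a \<in> carrier T \<Longrightarrow> \<nu> (r \<odot>\<^bsub>T\<^esub> a) = (\<lambda>x. r \<otimes> \<nu> a x)"
begin

lemma \<nu>_fixed: "a \<in> carrier T \<Longrightarrow> \<nu> a \<in> fixed_elems S"
  using \<nu>_bij by (auto simp: bij_betw_def)

lemma \<nu>_closed: "a \<in> carrier T \<Longrightarrow> \<nu> a x \<in> carrier E"
  using fixed_elemsD(1)[OF \<nu>_fixed] .

lemma \<nu>_eqI:
  assumes "a \<in> carrier T" "b \<in> carrier T" "\<And>x. x \<in> carrier M \<Longrightarrow> \<nu> a x = \<nu> b x"
  shows "a = b"
proof -
  have "\<nu> a x = \<nu> b x" for x
    using assms fixed_elemsD(2)[OF \<nu>_fixed, of _ x] by (cases "x \<in> carrier M") auto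
  then have "\<nu> a = \<nu> b" by blast
  then show ?thesis using \<nu>_bij assms by (auto simp: bij_betw_def inj_on_def)
qed

lemma fixed_elems_obtain:
  assumes "w \<in> fixed_elems S"
  obtains a where "a \<in> carrier T" "\<nu> a = w"
  using assms \<nu>_bij that by (metis bij_betw_imp_surj_on imageE)

sublocale C: coords E "fixed_field E S" T "carrier M" \<nu>
  by (rule coords.intro[OF field_axioms], rule coords_axioms.intro)
     (auto simp: fixed_field_subfield[OF S_subset] T_module \<nu>_closed \<nu>_add \<nu>_smult)

definition g\<^sub>T :: "'i \<Rightarrow> 't" where "g\<^sub>T k = inv_into (carrier T) \<nu> (g k)"

lemma g\<^sub>T:
  assumes "k \<in> I"
  shows "g\<^sub>T k \<in> carrier T" "\<nu> (g\<^sub>T k) = g k"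
proof -
  have "g k \<in> fixed_elems S" using g_fixed[OF assms] fixed_elems_mono[OF S_subset] by auto
  then have "g k \<in> \<nu> ` carrier T" using \<nu>_bij by (auto simp: bij_betw_def)
  then show "g\<^sub>T k \<in> carrier T" "\<nu> (g\<^sub>T k) = g k"
    unfolding g\<^sub>T_def by (auto intro: inv_into_into f_inv_into_f)
qed

sublocale C: dual_coords E "fixed_field E S" T "carrier M" \<nu> I p g\<^sub>T
proof (rule dual_coords.intro[OF C.coords_axioms], rule dual_coords_axioms.intro)
  show functional: "(\<Oplus>x\<in>carrier M. p k x \<otimes> \<nu> a x) \<in> fixed_field E S" if "k \<in> I" "a \<in> carrier T" for k a
    using functional_fixed[OF S_subset that(1) \<nu>_fixed[OF that(2)]] .
  fix a assume a: "a \<in> carrier T"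
  let ?f = "\<lambda>k. (\<Oplus>x\<in>carrier M. p k x \<otimes> \<nu> a x) \<odot>\<^bsub>T\<^esub> g\<^sub>T k"
  have f: "?f k \<in> carrier T" if "k \<in> I" for k
    using that functional[OF that a] g\<^sub>T by (intro C.A.smult_closed) auto
  show "a = finsum T ?f I"
  proof (rule \<nu>_eqI[OF a])
    show "finsum T ?f I \<in> carrier T" by (rule C.A.finsum_closed) (use f in auto)
    fix y assume y: "y \<in> carrier M"
    have "\<nu> (finsum T ?f I) y = (\<Oplus>k\<in>I. \<nu> (?f k) y)" by (rule C.\<nu>_finsum[OF finite_I y f])
    also have "\<dots> = (\<Oplus>k\<in>I. (\<Oplus>x\<in>carrier M. p k x \<otimes> \<nu> a x) \<otimes> g k y)"
      by (rule finsum_cong_closed)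
         (use functional a g\<^sub>T p_closed g_closed \<nu>_closed in \<open>auto simp: \<nu>_smult intro!: finsum_closed\<close>)
    also have "\<dots> = \<nu> a y" by (rule dual_expansion) (use a y \<nu>_closed in auto)
    finally show "\<nu> a y = \<nu> (finsum T ?f I) y" by simp
  qed
qed (auto simp: finite_M finite_I p_closed g\<^sub>T)

sublocale TT: dual_coord_pair E "fixed_field E S" T "carrier M" \<nu> T "carrier M" \<nu> I p g\<^sub>T
  by (intro dual_coord_pair.intro coord_pair.intro C.coords_axioms C.faithful_coords_axioms C.dual_coords_axioms)

end

text \<open>A Hopf algebra over the fixed field of \<open>S\<close>, identified with the invariants of \<open>S\<close> in \<open>E[M]\<close>.\<close>

locale hopf_model = invariant_model E G M act I p g S T \<nu>
  for E :: "('e, 'm) ring_scheme" (structure) and G and M :: "('x, 'y) monoid_scheme" and act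
    and I :: "'i set" and p g S and T :: "('e, 't, 'z) hopf_scheme" and \<nu> +
  assumes mult_closed: "a \<in> carrier T \<Longrightarrow> b \<in> carrier T \<Longrightarrow> a \<otimes>\<^bsub>T\<^esub> b \<in> carrier T"
    and \<nu>_mult: "a \<in> carrier T \<Longrightarrow> b \<in> carrier T \<Longrightarrow> m \<in> carrier M
       \<Longrightarrow> \<nu> (a \<otimes>\<^bsub>T\<^esub> b) m = (\<Oplus>x\<in>carrier M. \<nu> a x \<otimes> \<nu> b (inv\<^bsub>M\<^esub> x \<otimes>\<^bsub>M\<^esub> m))"
    and one_closed: "\<one>\<^bsub>T\<^esub> \<in> carrier T"
    and \<nu>_one: "m \<in> carrier M \<Longrightarrow> \<nu> \<one>\<^bsub>T\<^esub> m = (if m = \<one>\<^bsub>M\<^esub> then \<one> else \<zero>)"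
    and counit_eq: "a \<in> carrier T \<Longrightarrow> counit T a = (\<Oplus>x\<in>carrier M. \<nu> a x)"
    and antipode_closed: "a \<in> carrier T \<Longrightarrow> antipode T a \<in> carrier T"
    and \<nu>_antipode: "a \<in> carrier T \<Longrightarrow> m \<in> carrier M \<Longrightarrow> \<nu> (antipode T a) m = \<nu> a (inv\<^bsub>M\<^esub> m)"
    and comult_closed: "a \<in> carrier T
       \<Longrightarrow> comult T a \<in> carrier (tensor (E\<lparr>carrier := fixed_field E S\<rparr>) T T)"
    and \<kappa>_comult: "a \<in> carrier T \<Longrightarrow> x \<in> carrier M \<Longrightarrow> y \<in> carrier M
       \<Longrightarrow> coord_pair.\<kappa> E (fixed_field E S) \<nu> \<nu> (comult T a) x y = (if x = y then \<nu> a x else \<zero>)"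

subsection \<open>Base change of the invariants\<close>

locale galois_base_change = galois_dual_family E G M act I p g
  for E :: "('e, 'm) ring_scheme" (structure) and G and M :: "('x, 'y) monoid_scheme" and act
    and I :: "'i set" and p g +
  fixes S :: "('e \<Rightarrow> 'e) set"
  assumes S_subset: "S \<subseteq> carrier G"
begin

abbreviation (input) F\<^sub>0 :: "('e, 'm) ring_scheme" where "F\<^sub>0 \<equiv> E\<lparr>carrier := fixed_field E S\<rparr>"
abbreviation (input) L\<^sub>0 :: "('e, 'e) module" where "L\<^sub>0 \<equiv> self_algebra F\<^sub>0"
abbreviation (input) H :: "('e, 'x \<Rightarrow> 'e) hopf" where
  "H \<equiv> restrict_hopf K\<^sub>0 E (group_hopf E M) (fixed_elems (carrier G))"
abbreviation (input) T\<^sub>0 :: "('e, ('e \<times> ('x \<Rightarrow> 'e) \<Rightarrow> 'e) set) module" where "T\<^sub>0 \<equiv> tensor K\<^sub>0 L\<^sub>0 H\<^sub>0"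
abbreviation (input) pt :: "'e \<Rightarrow> ('x \<Rightarrow> 'e) \<Rightarrow> ('e \<times> ('x \<Rightarrow> 'e) \<Rightarrow> 'e) set" where
  "pt \<equiv> pure_tensor K\<^sub>0 L\<^sub>0 H\<^sub>0"
abbreviation (input) BC :: "('e, ('e \<times> ('x \<Rightarrow> 'e) \<Rightarrow> 'e) set) hopf" where
  "BC \<equiv> base_change K\<^sub>0 F\<^sub>0 H"

lemma fixed_field_mono: "fixed_field E (carrier G) \<subseteq> fixed_field E S"
  using S_subset by (auto simp: fixed_field_def)

lemma fixed_field_carrier: "fixed_field E S' \<subseteq> carrier E"
  by (auto simp: fixed_field_def)

lemma subfield_F: "subfield (fixed_field E S) E"
  by (rule fixed_field_subfield[OF S_subset])

lemma subfield_K: "subfield (fixed_field E (carrier G)) E"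
  by (rule fixed_field_subfield) simp

lemma F_closed:
  "a \<in> fixed_field E S \<Longrightarrow> b \<in> fixed_field E S \<Longrightarrow> a \<oplus> b \<in> fixed_field E S"
  "a \<in> fixed_field E S \<Longrightarrow> b \<in> fixed_field E S \<Longrightarrow> a \<otimes> b \<in> fixed_field E S"
  "\<one> \<in> fixed_field E S"
  using subringE[OF subfieldE(1)[OF subfield_F]] by auto

lemma L\<^sub>0_module: "module K\<^sub>0 L\<^sub>0"
proof -
  interpret F: field F\<^sub>0 using subfield_iff(2)[OF subfield_F] .
  have K: "cring K\<^sub>0" using subfield_iff(2)[OF subfield_K] domain.axioms(1) field.axioms(1) by blast
  interpret L: module F\<^sub>0 L\<^sub>0 by (rule self_algebra_module[OF F.cring_axioms])
  show ?thesis
    by (rule moduleI)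
       (use fixed_field_mono L.smult_l_distr L.smult_r_distr L.smult_assoc1 L.smult_closed
        in \<open>auto simp: K L.abelian_group_axioms self_algebra_simps subset_iff F.m_closed[simplified]
          F.l_distr[simplified] F.r_distr[simplified] F.m_assoc[simplified] F.l_one[simplified]\<close>)
qed

text \<open>K' has the single coordinate given by its inclusion into E; the one-point index set
  makes it fit the general scheme.\<close>

lemma L\<^sub>0_coords: "faithful_coords E (fixed_field E (carrier G)) L\<^sub>0 {()} (\<lambda>a _. a)"
  by (intro faithful_coords.intro coords.intro[OF field_axioms] coords_axioms.intro faithful_coords_axioms.intro)
     (auto simp: self_algebra_simps L\<^sub>0_module subfield_K fixed_field_carrier[THEN subsetD])

sublocale KH: dual_coord_pair E "fixed_field E (carrier G)" L\<^sub>0 "{()}" "\<lambda>a _. a" H\<^sub>0 "carrier M" "\<lambda>u. u" I p g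
proof -
  interpret l: faithful_coords E "fixed_field E (carrier G)" L\<^sub>0 "{()}" "\<lambda>a _. a" by (rule L\<^sub>0_coords)
  note h = invariant_dual_coords[OF subset_refl]
  show "dual_coord_pair E (fixed_field E (carrier G)) L\<^sub>0 {()} (\<lambda>a _. a) H\<^sub>0 (carrier M) (\<lambda>u. u) I p g"
    by (intro dual_coord_pair.intro coord_pair.intro l.coords_axioms l.faithful_coords_axioms
        dual_coords.axioms(1)[OF h] h)
qed

text \<open>The multiplication map from K' \<otimes> E[M]^G to E[M] with a \<otimes> h sent to a h.
  Coordinates are controlled only on \<open>M\<close>, so the function is set to zero elsewhere, as
  membership in E[M] demands.\<close>

definition \<nu> :: "('e \<times> ('x \<Rightarrow> 'e) \<Rightarrow> 'e) set \<Rightarrow> 'x \<Rightarrow> 'e" where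
  "\<nu> t x = (if x \<in> carrier M then KH.\<kappa> t () x else \<zero>)"

lemma mem_H\<^sub>0: "h \<in> carrier H\<^sub>0 \<longleftrightarrow> h \<in> fixed_elems (carrier G)"
  by (simp add: invariant_algebra_simps)

lemma mem_L\<^sub>0: "a \<in> carrier L\<^sub>0 \<longleftrightarrow> a \<in> fixed_field E S"
  by (simp add: self_algebra_simps)

lemma \<nu>_pure:
  assumes "a \<in> fixed_field E S" "h \<in> fixed_elems (carrier G)"
  shows "\<nu> (pt a h) = (\<lambda>x. a \<otimes> h x)"
proof
  fix x
  show "\<nu> (pt a h) x = a \<otimes> h x"
  proof (cases "x \<in> carrier M")
    case True
    then show ?thesis using assms by (simp add: \<nu>_def KH.\<kappa>_pure mem_H\<^sub>0 mem_L\<^sub>0)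
  next
    case False
    then show ?thesis
      using assms fixed_elemsD(2)[OF assms(2) False] fixed_field_carrier[of S] by (auto simp: \<nu>_def)
  qed
qed

lemma \<nu>_add:
  assumes "s \<in> carrier T\<^sub>0" "t \<in> carrier T\<^sub>0"
  shows "\<nu> (s \<oplus>\<^bsub>T\<^sub>0\<^esub> t) = (\<lambda>x. \<nu> s x \<oplus> \<nu> t x)"
  using assms by (auto simp: \<nu>_def KH.\<kappa>_add)

lemma \<nu>_fixed:
  assumes "t \<in> carrier T\<^sub>0"
  shows "\<nu> t \<in> fixed_elems S"
  using assms
proof (induction rule: KH.AB.tensor_induct)
  case (pure a h)
  then have a: "a \<in> fixed_field E S" and h: "h \<in> fixed_elems S" and h': "h \<in> fixed_elems (carrier G)"
    using fixed_elems_mono[OF S_subset] by (auto simp: mem_H\<^sub>0 mem_L\<^sub>0)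
  have aE: "a \<in> carrier E" using a by (auto simp: fixed_field_def)
  have "a \<otimes> h (act \<gamma> m) = \<gamma> (a \<otimes> h m)" if "\<gamma> \<in> S" "m \<in> carrier M" for \<gamma> m
  proof -
    have "\<gamma> a = a" using a that by (auto simp: fixed_field_def)
    then show ?thesis using that S_subset fixed_elemsD[OF h] aut_mult[of \<gamma> a "h m"] aE by auto
  qed
  then show ?case unfolding \<nu>_pure[OF a h']
    by (intro fixed_elemsI) (use fixed_elemsD[OF h] aE in auto)
next
  case (add s t)
  show ?case unfolding \<nu>_add[OF add.hyps(1,2)]
    by (rule fixed_elemsI) (use fixed_elemsD[OF add.IH(1)] fixed_elemsD[OF add.IH(2)] S_subset in auto)
qed

lemma \<nu>_inject:
  assumes "s \<in> carrier T\<^sub>0" "t \<in> carrier T\<^sub>0" "\<And>x. x \<in> carrier M \<Longrightarrow> \<nu> s x = \<nu> t x"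
  shows "s = t"
  by (rule KH.\<kappa>_inject) (use assms in \<open>auto simp: \<nu>_def\<close>)

lemma \<nu>_finsum:
  assumes "finite J" "\<And>i. i \<in> J \<Longrightarrow> f i \<in> carrier T\<^sub>0" "x \<in> carrier M"
  shows "\<nu> (finsum T\<^sub>0 f J) x = (\<Oplus>i\<in>J. \<nu> (f i) x)"
  using KH.K.\<nu>_finsum[OF assms(1), of "((), x)" f] assms(2,3) by (simp add: \<nu>_def)

text \<open>Galois descent: an element of E[M]^S is a combination of the \<open>g k\<close>, which
  lie in E[M]^G, with coefficients in the fixed field of \<open>S\<close>. Reading the products as
  tensors gives a preimage; injectivity is the faithfulness of the coordinates.\<close>

lemma \<nu>_bij: "bij_betw \<nu> (carrier T\<^sub>0) (fixed_elems S)"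
proof (rule bij_betwI')
  fix s t assume "s \<in> carrier T\<^sub>0" "t \<in> carrier T\<^sub>0"
  then show "\<nu> s = \<nu> t \<longleftrightarrow> s = t" by (metis \<nu>_inject)
next
  fix w assume w: "w \<in> fixed_elems S"
  let ?f = "\<lambda>k. pt (\<Oplus>x\<in>carrier M. p k x \<otimes> w x) (g k)"
  have B: "(\<Oplus>x\<in>carrier M. p k x \<otimes> w x) \<in> fixed_field E S" if "k \<in> I" for k
    using functional_fixed[OF S_subset that w] .
  have f: "?f k \<in> carrier T\<^sub>0" if "k \<in> I" for k
    using B[OF that] g_fixed[OF that] by (intro KH.AB.pure_tensor_closed) (auto simp: mem_H\<^sub>0 mem_L\<^sub>0)
  have sum: "finsum T\<^sub>0 ?f I \<in> carrier T\<^sub>0" by (rule KH.AB.T.finsum_closed) (use f in auto)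
  have "w = \<nu> (finsum T\<^sub>0 ?f I)"
  proof
    fix y
    show "w y = \<nu> (finsum T\<^sub>0 ?f I) y"
    proof (cases "y \<in> carrier M")
      case True
      have "\<nu> (finsum T\<^sub>0 ?f I) y = (\<Oplus>k\<in>I. \<nu> (?f k) y)" by (rule \<nu>_finsum[OF finite_I f True])
      also have "\<dots> = (\<Oplus>k\<in>I. (\<Oplus>x\<in>carrier M. p k x \<otimes> w x) \<otimes> g k y)"
        by (rule finsum_cong_closed)
           (use B g_fixed p_closed g_closed fixed_elemsD(1)[OF w] in \<open>auto simp: \<nu>_pure intro!: finsum_closed\<close>)
      also have "\<dots> = w y" by (rule dual_expansion) (use True fixed_elemsD(1)[OF w] in auto)
      finally show ?thesis by simp
    next
      case False
      then show ?thesis using fixed_elemsD(2)[OF w False] fixed_elemsD(2)[OF \<nu>_fixed[OF sum] False] by simp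
    qed
  qed
  then show "\<exists>t\<in>carrier T\<^sub>0. w = \<nu> t" using sum by blast
qed (rule \<nu>_fixed)

text \<open>The scalar action of K' that \<open>base_change_algebra\<close> installs in place of the
  action of K on the tensor product.\<close>

definition scale :: "'e \<Rightarrow> ('e \<times> ('x \<Rightarrow> 'e) \<Rightarrow> 'e) set \<Rightarrow> ('e \<times> ('x \<Rightarrow> 'e) \<Rightarrow> 'e) set" where
  "scale c = tensor_lift K\<^sub>0 T\<^sub>0 (\<lambda>a h. pt (c \<otimes> a) h)"

lemma scale_bilinear:
  assumes "c \<in> fixed_field E S"
  shows "bilinear_map K\<^sub>0 L\<^sub>0 H\<^sub>0 T\<^sub>0 (\<lambda>a h. pt (c \<otimes> a) h)"
proof -
  have cE: "c \<in> carrier E" and sub: "a \<in> fixed_field E S \<Longrightarrow> a \<in> carrier E"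
    "r \<in> fixed_field E (carrier G) \<Longrightarrow> r \<in> carrier E" for a r
    using assms by (auto simp: fixed_field_def)
  show ?thesis
  proof (rule bilinear_mapI)
    fix a a' h assume *: "a \<in> carrier L\<^sub>0" "a' \<in> carrier L\<^sub>0" "h \<in> carrier H\<^sub>0"
    have "c \<otimes> (a \<oplus>\<^bsub>L\<^sub>0\<^esub> a') = (c \<otimes> a) \<oplus>\<^bsub>L\<^sub>0\<^esub> (c \<otimes> a')"
      using * cE sub by (simp add: self_algebra_simps r_distr)
    then show "pt (c \<otimes> (a \<oplus>\<^bsub>L\<^sub>0\<^esub> a')) h = pt (c \<otimes> a) h \<oplus>\<^bsub>T\<^sub>0\<^esub> pt (c \<otimes> a') h"
      using * assms F_closed by (simp add: KH.AB.pure_tensor_add_left mem_L\<^sub>0)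
  next
    fix r a h assume *: "r \<in> carrier K\<^sub>0" "a \<in> carrier L\<^sub>0" "h \<in> carrier H\<^sub>0"
    have "c \<otimes> (r \<odot>\<^bsub>L\<^sub>0\<^esub> a) = r \<odot>\<^bsub>L\<^sub>0\<^esub> (c \<otimes> a)"
      using * cE sub by (simp add: self_algebra_simps m_lcomm)
    then show "pt (c \<otimes> (r \<odot>\<^bsub>L\<^sub>0\<^esub> a)) h = r \<odot>\<^bsub>T\<^sub>0\<^esub> pt (c \<otimes> a) h"
      using * assms F_closed by (simp add: KH.AB.pure_tensor_smult_left mem_L\<^sub>0)
    show "pt (c \<otimes> a) (r \<odot>\<^bsub>H\<^sub>0\<^esub> h) = r \<odot>\<^bsub>T\<^sub>0\<^esub> pt (c \<otimes> a) h"
      using * assms F_closed by (simp add: KH.AB.pure_tensor_smult_right mem_L\<^sub>0)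
  qed (use assms F_closed in \<open>auto simp: KH.AB.pure_tensor_closed KH.AB.pure_tensor_add_right mem_L\<^sub>0\<close>)
qed

lemma scale_closed: "c \<in> fixed_field E S \<Longrightarrow> t \<in> carrier T\<^sub>0 \<Longrightarrow> scale c t \<in> carrier T\<^sub>0"
  unfolding scale_def by (rule KH.AB.tensor_lift_closed[OF KH.AB.tensor_module scale_bilinear])

lemma \<nu>_scale:
  assumes c: "c \<in> fixed_field E S" and t: "t \<in> carrier T\<^sub>0"
  shows "\<nu> (scale c t) = (\<lambda>x. c \<otimes> \<nu> t x)"
  using t
proof (induction rule: KH.AB.tensor_induct)
  case (pure a h)
  have cE: "c \<in> carrier E" "a \<in> carrier E"
    using c pure(1)[unfolded mem_L\<^sub>0] by (auto simp: fixed_field_def)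
  have "scale c (pt a h) = pt (c \<otimes> a) h"
    unfolding scale_def by (rule KH.AB.tensor_lift_pure[OF KH.AB.tensor_module scale_bilinear[OF c] pure])
  then show ?case
    using pure c F_closed cE fixed_elemsD(1)[of h "carrier G"] by (auto simp: \<nu>_pure mem_L\<^sub>0 mem_H\<^sub>0 m_assoc)
next
  case (add s t)
  have "scale c (s \<oplus>\<^bsub>T\<^sub>0\<^esub> t) = scale c s \<oplus>\<^bsub>T\<^sub>0\<^esub> scale c t"
    unfolding scale_def by (rule KH.AB.tensor_lift_add[OF KH.AB.tensor_module scale_bilinear[OF c] add.hyps(1,2)])
  then show ?case
    using add c scale_closed fixed_elemsD(1)[OF \<nu>_fixed] fixed_field_carrier[of S]
    by (auto simp: \<nu>_add r_distr subset_iff)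
qed

text \<open>\<open>H\<close> and \<open>H\<^sub>0\<close> differ only in the comultiplication, which
  the tensor product does not read.\<close>

lemma tensor_H: "tensor K\<^sub>0 L\<^sub>0 H = T\<^sub>0" "pure_tensor K\<^sub>0 L\<^sub>0 H = pt"
  by (rule tensor_cong; simp add: restrict_hopf_def invariant_algebra_def)+

lemma BC_simps:
  "carrier BC = carrier T\<^sub>0" "monoid.mult BC = monoid.mult T\<^sub>0" "\<one>\<^bsub>BC\<^esub> = \<one>\<^bsub>T\<^sub>0\<^esub>" "\<zero>\<^bsub>BC\<^esub> = \<zero>\<^bsub>T\<^sub>0\<^esub>"
  "ring.add BC = ring.add T\<^sub>0" "smult BC = scale"
  by (simp_all add: base_change_def base_change_algebra_def Let_def module.defs tensor_H scale_def[abs_def])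

text \<open>Since \<open>\<nu>\<close> is injective and turns \<open>scale\<close> into pointwise
  multiplication, the scalar laws are inherited from E.\<close>

lemma BC_module: "module F\<^sub>0 BC"
proof (rule moduleI)
  interpret F: field F\<^sub>0 using subfield_iff(2)[OF subfield_F] .
  show "cring F\<^sub>0" by (rule F.cring_axioms)
  show "abelian_group BC"
    by (rule abelian_groupI)
       (auto simp: BC_simps KH.AB.T.a_ac KH.AB.T.l_neg intro!: bexI[of _ "\<ominus>\<^bsub>T\<^sub>0\<^esub> _"])
  have sub: "a \<in> fixed_field E S \<Longrightarrow> a \<in> carrier E" for a by (auto simp: fixed_field_def)
  have n: "t \<in> carrier T\<^sub>0 \<Longrightarrow> \<nu> t x \<in> carrier E" for t x using fixed_elemsD(1)[OF \<nu>_fixed] .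
  fix a b x y assume a: "a \<in> carrier F\<^sub>0" and b: "b \<in> carrier F\<^sub>0" and x: "x \<in> carrier BC" and y: "y \<in> carrier BC"
  note * = a[simplified] b[simplified] x[unfolded BC_simps] y[unfolded BC_simps] sub[OF a[simplified]] sub[OF b[simplified]]
  show "a \<odot>\<^bsub>BC\<^esub> x \<in> carrier BC" using * by (simp add: BC_simps scale_closed)
  show "(a \<oplus>\<^bsub>F\<^sub>0\<^esub> b) \<odot>\<^bsub>BC\<^esub> x = (a \<odot>\<^bsub>BC\<^esub> x) \<oplus>\<^bsub>BC\<^esub> (b \<odot>\<^bsub>BC\<^esub> x)"
    unfolding BC_simps
    by (rule \<nu>_inject) (use * F_closed n in \<open>auto simp: scale_closed \<nu>_scale \<nu>_add l_distr\<close>)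
  show "a \<odot>\<^bsub>BC\<^esub> (x \<oplus>\<^bsub>BC\<^esub> y) = (a \<odot>\<^bsub>BC\<^esub> x) \<oplus>\<^bsub>BC\<^esub> (a \<odot>\<^bsub>BC\<^esub> y)"
    unfolding BC_simps
    by (rule \<nu>_inject) (use * F_closed n in \<open>auto simp: scale_closed \<nu>_scale \<nu>_add r_distr\<close>)
  show "(a \<otimes>\<^bsub>F\<^sub>0\<^esub> b) \<odot>\<^bsub>BC\<^esub> x = a \<odot>\<^bsub>BC\<^esub> (b \<odot>\<^bsub>BC\<^esub> x)"
    unfolding BC_simps
    by (rule \<nu>_inject) (use * F_closed n in \<open>auto simp: scale_closed \<nu>_scale m_assoc\<close>)
next
  fix x assume x: "x \<in> carrier BC"
  have n: "t \<in> carrier T\<^sub>0 \<Longrightarrow> \<nu> t y \<in> carrier E" for t y using fixed_elemsD(1)[OF \<nu>_fixed] .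
  show "\<one>\<^bsub>F\<^sub>0\<^esub> \<odot>\<^bsub>BC\<^esub> x = x"
    unfolding BC_simps
    by (rule \<nu>_inject) (use x F_closed n in \<open>auto simp: BC_simps scale_closed \<nu>_scale\<close>)
qed

sublocale model: invariant_model E G M act I p g S BC \<nu>
  by (rule invariant_model.intro[OF galois_dual_family_axioms], rule invariant_model_axioms.intro)
     (auto simp: S_subset BC_module BC_simps \<nu>_bij \<nu>_add \<nu>_scale)

end

lemma module_restrict_subfield:
  assumes "field E" "subfield F E" "subfield K E" "K \<subseteq> F" "module (E\<lparr>carrier := F\<rparr>) W"
  shows "module (E\<lparr>carrier := K\<rparr>) W"
proof -
  interpret field E by fact
  interpret W: module "E\<lparr>carrier := F\<rparr>" W by fact
  have K: "cring (E\<lparr>carrier := K\<rparr>)"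
    using subfield_iff(2)[OF assms(3)] domain.axioms(1) field.axioms(1) by blast
  show ?thesis
    by (rule moduleI)
       (use assms(4) W.smult_l_distr W.smult_r_distr W.smult_assoc1 W.smult_closed W.smult_one
        in \<open>auto simp: K W.abelian_group_axioms subset_iff\<close>)
qed

section \<open>Closure of the invariants under product, unit and antipode\<close>

context galois_module
begin

lemma act_M_one:
  assumes "\<gamma> \<in> carrier G"
  shows "act \<gamma> \<one>\<^bsub>M\<^esub> = \<one>\<^bsub>M\<^esub>"
proof -
  have c: "act \<gamma> \<one>\<^bsub>M\<^esub> \<in> carrier M" using assms by simp
  have "act \<gamma> \<one>\<^bsub>M\<^esub> \<otimes>\<^bsub>M\<^esub> act \<gamma> \<one>\<^bsub>M\<^esub> = act \<gamma> \<one>\<^bsub>M\<^esub> \<otimes>\<^bsub>M\<^esub> \<one>\<^bsub>M\<^esub>"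
    using act_hom[OF assms M.one_closed M.one_closed] c by simp
  then show ?thesis using c by (metis M.l_cancel M.one_closed)
qed

lemma act_M_inv:
  assumes "\<gamma> \<in> carrier G" "m \<in> carrier M"
  shows "act \<gamma> (inv\<^bsub>M\<^esub> m) = inv\<^bsub>M\<^esub> (act \<gamma> m)"
proof (rule M.inv_equality[symmetric])
  show "act \<gamma> (inv\<^bsub>M\<^esub> m) \<otimes>\<^bsub>M\<^esub> act \<gamma> m = \<one>\<^bsub>M\<^esub>"
    using assms by (simp flip: act_hom add: act_M_one)
qed (use assms in auto)

end

context galois_dual_family
begin

text \<open>In the convolution sum at \<open>act \<gamma> m\<close> the substitution of
  \<open>act \<gamma> x\<close> for x is allowed because \<open>act \<gamma>\<close> permutes
  \<open>M\<close>. As it respects inverses and products, \<gamma> can then be taken out of every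
  summand.\<close>

lemma fixed_elems_mult:
  assumes S: "S \<subseteq> carrier G" and u: "u \<in> fixed_elems S" and v: "v \<in> fixed_elems S"
  shows "u \<otimes>\<^bsub>monoid_algebra E M\<^esub> v \<in> fixed_elems S"
proof (rule fixed_elemsI)
  have uv: "u \<in> carrier (monoid_algebra E M)" "v \<in> carrier (monoid_algebra E M)"
    using u v by (auto simp: fixed_elems_def)
  note eq = monoid_algebra_mult_eq[OF cring_axioms group_M finite_M uv]
  note uc = fixed_elemsD(1)[OF u] and vc = fixed_elemsD(1)[OF v]
  show "(u \<otimes>\<^bsub>monoid_algebra E M\<^esub> v) m \<in> carrier E" if "m \<in> carrier M" for m
    unfolding eq[OF that] using uc vc by (intro finsum_closed) auto
  show "(u \<otimes>\<^bsub>monoid_algebra E M\<^esub> v) m = \<zero>" if m: "m \<notin> carrier M" for m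
  proof -
    have "fst p \<otimes>\<^bsub>M\<^esub> snd p \<noteq> m" if "u (fst p) \<noteq> \<zero>" "v (snd p) \<noteq> \<zero>" for p
      using that fixed_elemsD(2)[OF u, of "fst p"] fixed_elemsD(2)[OF v, of "snd p"] m M.m_closed by auto
    then have "{p. u (fst p) \<noteq> \<zero> \<and> v (snd p) \<noteq> \<zero> \<and> fst p \<otimes>\<^bsub>M\<^esub> snd p = m} = {}" by blast
    then show ?thesis by (simp only: monoid_algebra_def monoid.simps finsum_empty)
  qed
  fix \<gamma> m assume \<gamma>: "\<gamma> \<in> S" and m: "m \<in> carrier M"
  then have \<gamma>G: "\<gamma> \<in> carrier G" using S by auto
  have "(u \<otimes>\<^bsub>monoid_algebra E M\<^esub> v) (act \<gamma> m) = (\<Oplus>x\<in>carrier M. u x \<otimes> v (inv\<^bsub>M\<^esub> x \<otimes>\<^bsub>M\<^esub> act \<gamma> m))"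
    using eq \<gamma>G m by simp
  also have "\<dots> = (\<Oplus>x\<in>carrier M. u (act \<gamma> x) \<otimes> v (inv\<^bsub>M\<^esub> (act \<gamma> x) \<otimes>\<^bsub>M\<^esub> act \<gamma> m))"
    by (rule act_sum[OF \<gamma>G, symmetric]) (use uc vc in auto)
  also have "\<dots> = (\<Oplus>x\<in>carrier M. \<gamma> (u x \<otimes> v (inv\<^bsub>M\<^esub> x \<otimes>\<^bsub>M\<^esub> m)))"
  proof (rule finsum_cong_closed)
    fix x assume x: "x \<in> carrier M"
    have "inv\<^bsub>M\<^esub> (act \<gamma> x) \<otimes>\<^bsub>M\<^esub> act \<gamma> m = act \<gamma> (inv\<^bsub>M\<^esub> x \<otimes>\<^bsub>M\<^esub> m)"
      using x m \<gamma>G by (simp add: act_hom act_M_inv)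
    then show "u (act \<gamma> x) \<otimes> v (inv\<^bsub>M\<^esub> (act \<gamma> x) \<otimes>\<^bsub>M\<^esub> act \<gamma> m) = \<gamma> (u x \<otimes> v (inv\<^bsub>M\<^esub> x \<otimes>\<^bsub>M\<^esub> m))"
      using x m \<gamma> \<gamma>G uc vc fixed_elemsD(3)[OF u \<gamma>] fixed_elemsD(3)[OF v \<gamma>] by simp
  qed (use uc vc \<gamma>G in auto)
  also have "\<dots> = \<gamma> ((u \<otimes>\<^bsub>monoid_algebra E M\<^esub> v) m)"
    unfolding eq[OF m] by (rule aut_finsum[symmetric]) (use uc vc \<gamma>G finite_M in auto)
  finally show "(u \<otimes>\<^bsub>monoid_algebra E M\<^esub> v) (act \<gamma> m) = \<gamma> ((u \<otimes>\<^bsub>monoid_algebra E M\<^esub> v) m)" .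
qed

lemma fixed_elems_one:
  assumes S: "S \<subseteq> carrier G"
  shows "basis_elem E \<one>\<^bsub>M\<^esub> \<in> fixed_elems S"
proof (rule fixed_elemsI)
  fix \<gamma> m assume "\<gamma> \<in> S" and m: "m \<in> carrier M"
  then have \<gamma>: "\<gamma> \<in> carrier G" using S by auto
  have "act \<gamma> m = \<one>\<^bsub>M\<^esub> \<longleftrightarrow> m = \<one>\<^bsub>M\<^esub>"
    using act_eq_iff[OF \<gamma> m M.one_closed] act_M_one[of "inv\<^bsub>G\<^esub> \<gamma>"] \<gamma> by simp
  then show "basis_elem E \<one>\<^bsub>M\<^esub> (act \<gamma> m) = \<gamma> (basis_elem E \<one>\<^bsub>M\<^esub> m)"
    using \<gamma> by (simp add: basis_elem_def)
qed (auto simp: basis_elem_def)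

lemma fixed_elems_antipode:
  assumes S: "S \<subseteq> carrier G" and u: "u \<in> fixed_elems S"
  shows "(\<lambda>m. if m \<in> carrier M then u (inv\<^bsub>M\<^esub> m) else \<zero>) \<in> fixed_elems S"
proof (rule fixed_elemsI)
  fix \<gamma> m assume \<gamma>: "\<gamma> \<in> S" and m: "m \<in> carrier M"
  then have "act \<gamma> (inv\<^bsub>M\<^esub> m) = inv\<^bsub>M\<^esub> (act \<gamma> m)" using S act_M_inv by auto
  then show "(if act \<gamma> m \<in> carrier M then u (inv\<^bsub>M\<^esub> (act \<gamma> m)) else \<zero>)
      = \<gamma> (if m \<in> carrier M then u (inv\<^bsub>M\<^esub> m) else \<zero>)"
    using fixed_elemsD(3)[OF u \<gamma>, of "inv\<^bsub>M\<^esub> m"] m \<gamma> S by auto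
qed (use fixed_elemsD(1)[OF u] in auto)

end

section \<open>The Hopf operations of the base change in coordinates\<close>

context galois_base_change
begin

abbreviation (input) P\<^sub>0 :: "('e, 'e \<times> ('x \<Rightarrow> 'e) \<Rightarrow> 'e) module" where
  "P\<^sub>0 \<equiv> monoid_algebra K\<^sub>0 (L\<^sub>0 \<times>\<times> H\<^sub>0)"

text \<open>The product of the free module multiplies (a, h) and (a', h') to (a a', h h'), while
  \<open>\<nu>\<close> sends the coset of (a, h) to a h. By bilinearity both sides equal the same
  triple sum, over the two supports and over \<open>M\<close>; so the map from
  \<open>P\<^sub>0\<close> to E[M] is multiplicative.\<close>

lemma mult_P\<^sub>0:
  assumes a: "a \<in> carrier P\<^sub>0" and b: "b \<in> carrier P\<^sub>0"
  shows "a \<otimes>\<^bsub>P\<^sub>0\<^esub> b \<in> carrier P\<^sub>0"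
    and "m \<in> carrier M \<Longrightarrow> \<nu> (KH.AB.q (a \<otimes>\<^bsub>P\<^sub>0\<^esub> b)) m
       = (\<Oplus>x\<in>carrier M. \<nu> (KH.AB.q a) x \<otimes> \<nu> (KH.AB.q b) (inv\<^bsub>M\<^esub> x \<otimes>\<^bsub>M\<^esub> m))"
proof -
  let ?f = "\<lambda>x z. fst z \<otimes> snd z x"
  let ?A = "{s. a s \<noteq> \<zero>}" and ?B = "{s. b s \<noteq> \<zero>}"
  have coeff: "a s \<in> fixed_field E (carrier G)" "b s \<in> fixed_field E (carrier G)" for s
  proof -
    have "a s \<in> carrier K\<^sub>0" "b s \<in> carrier K\<^sub>0" using a b unfolding monoid_algebra_simps(1) by blast+
    then show "a s \<in> fixed_field E (carrier G)" "b s \<in> fixed_field E (carrier G)" by simp_all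
  qed
  have A: "finite ?A" "?A \<subseteq> carrier (L\<^sub>0 \<times>\<times> H\<^sub>0)" "\<And>s. a s \<in> carrier E"
    and B: "finite ?B" "?B \<subseteq> carrier (L\<^sub>0 \<times>\<times> H\<^sub>0)" "\<And>s. b s \<in> carrier E"
    using a b coeff[THEN subsetD[OF fixed_field_carrier]] by (auto simp: monoid_algebra_simps(1))
  have car: "fst z \<in> carrier E" "snd z x \<in> carrier E" "fst z \<in> fixed_field E S" "snd z \<in> fixed_elems (carrier G)"
    if "z \<in> carrier (L\<^sub>0 \<times>\<times> H\<^sub>0)" for z x
  proof -
    show F: "fst z \<in> fixed_field E S" "snd z \<in> fixed_elems (carrier G)"
      using that by (auto simp: mem_L\<^sub>0 mem_H\<^sub>0)
    show "fst z \<in> carrier E" "snd z x \<in> carrier E"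
      using F fixed_field_carrier[of S] fixed_elemsD(1)[OF F(2)] by auto
  qed
  have Pi: "?f x \<in> carrier (L\<^sub>0 \<times>\<times> H\<^sub>0) \<rightarrow> carrier (self_algebra E)" for x
    using car by (auto simp: self_algebra_simps)
  have \<nu>_q: "\<nu> (KH.AB.q u) x = lin_ext K\<^sub>0 (self_algebra E) (?f x) u"
    if "u \<in> carrier P\<^sub>0" "x \<in> carrier M" for u x
    using KH.AB.tensor_lift_q[OF KH.self_module KH.\<kappa>_bilinear that(1), of "()" x] that(2)
    by (simp add: \<nu>_def KH.\<kappa>_def)
  have closed: "s \<otimes>\<^bsub>L\<^sub>0 \<times>\<times> H\<^sub>0\<^esub> t \<in> carrier (L\<^sub>0 \<times>\<times> H\<^sub>0)"
    if "s \<in> carrier (L\<^sub>0 \<times>\<times> H\<^sub>0)" "t \<in> carrier (L\<^sub>0 \<times>\<times> H\<^sub>0)" for s t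
    using that F_closed fixed_elems_mult[of "carrier G"]
    by (auto simp: mult_DirProd' self_algebra_simps invariant_algebra_simps)
  note ext = lin_ext_mult[OF KH.self_module Pi a b closed]
  show ab: "a \<otimes>\<^bsub>P\<^sub>0\<^esub> b \<in> carrier P\<^sub>0" by (rule ext(1))
  assume m: "m \<in> carrier M"
  let ?u = "\<lambda>s x. a s \<otimes> ?f x s" and ?v = "\<lambda>t x. b t \<otimes> ?f x t"
  have uc: "?u s x \<in> carrier E" if "s \<in> ?A" for s x
    using car(1,2)[OF subsetD[OF A(2) that]] A(3) by (intro m_closed)
  have vc: "?v t x \<in> carrier E" if "t \<in> ?B" for t x
    using car(1,2)[OF subsetD[OF B(2) that]] B(3) by (intro m_closed)
  have lin: "\<nu> (KH.AB.q a) x = (\<Oplus>s\<in>?A. ?u s x)" "\<nu> (KH.AB.q b) x = (\<Oplus>t\<in>?B. ?v t x)" if "x \<in> carrier M" for x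
    using \<nu>_q a b that by (simp_all add: lin_ext_def finsum_self_algebra self_algebra_simps)
  have "\<nu> (KH.AB.q (a \<otimes>\<^bsub>P\<^sub>0\<^esub> b)) m = (\<Oplus>s\<in>?A. \<Oplus>t\<in>?B. (a s \<otimes> b t) \<otimes> ?f m (s \<otimes>\<^bsub>L\<^sub>0 \<times>\<times> H\<^sub>0\<^esub> t))"
    using \<nu>_q[OF ab m] ext(2)[of m] by (simp add: finsum_self_algebra self_algebra_simps)
  also have "\<dots> = (\<Oplus>s\<in>?A. \<Oplus>t\<in>?B. \<Oplus>x\<in>carrier M. ?u s x \<otimes> ?v t (inv\<^bsub>M\<^esub> x \<otimes>\<^bsub>M\<^esub> m))"
  proof (intro finsum_cong_closed)
    fix s t assume st: "s \<in> ?A" "t \<in> ?B"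
    then have stc: "s \<in> carrier (L\<^sub>0 \<times>\<times> H\<^sub>0)" "t \<in> carrier (L\<^sub>0 \<times>\<times> H\<^sub>0)" using A B by auto
    have sv: "snd s \<in> carrier (monoid_algebra E M)" "snd t \<in> carrier (monoid_algebra E M)"
      using car(4)[OF stc(1)] car(4)[OF stc(2)] by (auto simp: fixed_elems_def)
    have cc: "fst s \<in> carrier E" "snd s x \<in> carrier E" "fst t \<in> carrier E" "snd t x \<in> carrier E" "a s \<in> carrier E" "b t \<in> carrier E" for x
      using car[OF stc(1)] car[OF stc(2)] A(3) B(3) by auto
    have "(a s \<otimes> b t) \<otimes> ?f m (s \<otimes>\<^bsub>L\<^sub>0 \<times>\<times> H\<^sub>0\<^esub> t)
        = (a s \<otimes> b t \<otimes> (fst s \<otimes> fst t)) \<otimes> (\<Oplus>x\<in>carrier M. snd s x \<otimes> snd t (inv\<^bsub>M\<^esub> x \<otimes>\<^bsub>M\<^esub> m))"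
      using cc monoid_algebra_mult_eq[OF cring_axioms group_M finite_M sv m]
      by (simp add: mult_DirProd' self_algebra_simps invariant_algebra_simps m_assoc finsum_closed)
    also have "\<dots> = (\<Oplus>x\<in>carrier M. (a s \<otimes> b t \<otimes> (fst s \<otimes> fst t)) \<otimes> (snd s x \<otimes> snd t (inv\<^bsub>M\<^esub> x \<otimes>\<^bsub>M\<^esub> m)))"
      by (rule finsum_rdistr) (use cc finite_M in auto)
    also have "\<dots> = (\<Oplus>x\<in>carrier M. ?u s x \<otimes> ?v t (inv\<^bsub>M\<^esub> x \<otimes>\<^bsub>M\<^esub> m))"
      by (rule finsum_cong_closed) (use cc in \<open>auto simp: m_ac\<close>)
    finally show "(a s \<otimes> b t) \<otimes> ?f m (s \<otimes>\<^bsub>L\<^sub>0 \<times>\<times> H\<^sub>0\<^esub> t)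
        = (\<Oplus>x\<in>carrier M. ?u s x \<otimes> ?v t (inv\<^bsub>M\<^esub> x \<otimes>\<^bsub>M\<^esub> m))" .
  qed (use uc vc in \<open>auto intro!: finsum_closed\<close>)
  also have "\<dots> = (\<Oplus>s\<in>?A. \<Oplus>x\<in>carrier M. \<Oplus>t\<in>?B. ?u s x \<otimes> ?v t (inv\<^bsub>M\<^esub> x \<otimes>\<^bsub>M\<^esub> m))"
    by (rule finsum_cong_closed, rule finsum_swap)
       (use uc vc B finite_M in \<open>auto intro!: finsum_closed\<close>)
  also have "\<dots> = (\<Oplus>x\<in>carrier M. \<Oplus>s\<in>?A. \<Oplus>t\<in>?B. ?u s x \<otimes> ?v t (inv\<^bsub>M\<^esub> x \<otimes>\<^bsub>M\<^esub> m))"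
    by (rule finsum_swap) (use uc vc A finite_M in \<open>auto intro!: finsum_closed\<close>)
  also have "\<dots> = (\<Oplus>x\<in>carrier M. \<nu> (KH.AB.q a) x \<otimes> \<nu> (KH.AB.q b) (inv\<^bsub>M\<^esub> x \<otimes>\<^bsub>M\<^esub> m))"
  proof (rule finsum_cong_closed)
    fix x assume x: "x \<in> carrier M"
    let ?y = "inv\<^bsub>M\<^esub> x \<otimes>\<^bsub>M\<^esub> m"
    have y: "?y \<in> carrier M" using x m by simp
    have V: "(\<Oplus>t\<in>?B. ?v t ?y) \<in> carrier E" by (rule finsum_closed) (use vc in auto)
    have "(\<Oplus>s\<in>?A. \<Oplus>t\<in>?B. ?u s x \<otimes> ?v t ?y) = (\<Oplus>s\<in>?A. ?u s x \<otimes> (\<Oplus>t\<in>?B. ?v t ?y))"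
      by (rule finsum_cong_closed, rule finsum_rdistr[symmetric]) (use uc vc B V in auto)
    also have "\<dots> = (\<Oplus>s\<in>?A. ?u s x) \<otimes> (\<Oplus>t\<in>?B. ?v t ?y)"
      by (rule finsum_ldistr[symmetric]) (use uc A V in auto)
    finally show "(\<Oplus>s\<in>?A. \<Oplus>t\<in>?B. ?u s x \<otimes> ?v t ?y) = \<nu> (KH.AB.q a) x \<otimes> \<nu> (KH.AB.q b) ?y"
      using lin x y by simp
    show "\<nu> (KH.AB.q a) x \<otimes> \<nu> (KH.AB.q b) ?y \<in> carrier E"
      using lin x y V uc by (auto intro!: m_closed finsum_closed)
  qed
  finally show "\<nu> (KH.AB.q (a \<otimes>\<^bsub>P\<^sub>0\<^esub> b)) m
       = (\<Oplus>x\<in>carrier M. \<nu> (KH.AB.q a) x \<otimes> \<nu> (KH.AB.q b) (inv\<^bsub>M\<^esub> x \<otimes>\<^bsub>M\<^esub> m))" .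
qed

text \<open>The kernel of \<open>P\<^sub>0 \<rightarrow> T\<^sub>0\<close> is the kernel of a multiplicative map to \<open>E[M]\<close>, so the product of cosets is a coset.\<close>

lemma mult_BC:
  assumes s: "s \<in> carrier T\<^sub>0" and t: "t \<in> carrier T\<^sub>0"
  shows "s \<otimes>\<^bsub>T\<^sub>0\<^esub> t \<in> carrier T\<^sub>0"
    and "m \<in> carrier M \<Longrightarrow> \<nu> (s \<otimes>\<^bsub>T\<^sub>0\<^esub> t) m = (\<Oplus>x\<in>carrier M. \<nu> s x \<otimes> \<nu> t (inv\<^bsub>M\<^esub> x \<otimes>\<^bsub>M\<^esub> m))"
proof -
  obtain u v where u: "u \<in> carrier P\<^sub>0" "s = KH.AB.q u" and v: "v \<in> carrier P\<^sub>0" "t = KH.AB.q v"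
    using s t unfolding KH.AB.carrier_tensor by blast
  have const: "KH.AB.q (a \<otimes>\<^bsub>P\<^sub>0\<^esub> b) = KH.AB.q (u \<otimes>\<^bsub>P\<^sub>0\<^esub> v)" if "a \<in> s" "b \<in> t" for a b
  proof -
    have a: "a \<in> carrier P\<^sub>0" "KH.AB.q a = s" and b: "b \<in> carrier P\<^sub>0" "KH.AB.q b = t"
      using that u v KH.AB.q_mem_diff(1) KH.AB.I.a_repr_independence' by blast+
    show ?thesis
    proof (rule \<nu>_inject)
      show "KH.AB.q (a \<otimes>\<^bsub>P\<^sub>0\<^esub> b) \<in> carrier T\<^sub>0" "KH.AB.q (u \<otimes>\<^bsub>P\<^sub>0\<^esub> v) \<in> carrier T\<^sub>0"
        unfolding KH.AB.carrier_tensor using mult_P\<^sub>0(1) a b u v by blast+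
      show "\<nu> (KH.AB.q (a \<otimes>\<^bsub>P\<^sub>0\<^esub> b)) m = \<nu> (KH.AB.q (u \<otimes>\<^bsub>P\<^sub>0\<^esub> v)) m" if "m \<in> carrier M" for m
        unfolding mult_P\<^sub>0(2)[OF a(1) b(1) that] mult_P\<^sub>0(2)[OF u(1) v(1) that] a b u(2)[symmetric] v(2)[symmetric] ..
    qed
  qed
  have mem: "u \<in> s" "v \<in> t" using u v KH.AB.I.a_rcos_self by auto
  \<comment> \<open>The product of cosets is a union over all pairs of representatives, all of which
    yield one and the same coset by \<open>const\<close>.\<close>
  have "s \<otimes>\<^bsub>T\<^sub>0\<^esub> t = (\<Union>a\<in>s. \<Union>b\<in>t. KH.AB.q (a \<otimes>\<^bsub>P\<^sub>0\<^esub> b))"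
    by (simp add: tensor_def Let_def rcoset_mult_def)
  also have "\<dots> = (\<Union>a\<in>s. \<Union>b\<in>t. KH.AB.q (u \<otimes>\<^bsub>P\<^sub>0\<^esub> v))"
    using const by (intro SUP_cong refl) blast
  also have "\<dots> = KH.AB.q (u \<otimes>\<^bsub>P\<^sub>0\<^esub> v)" using mem by blast
  finally have eq: "s \<otimes>\<^bsub>T\<^sub>0\<^esub> t = KH.AB.q (u \<otimes>\<^bsub>P\<^sub>0\<^esub> v)" .
  show "s \<otimes>\<^bsub>T\<^sub>0\<^esub> t \<in> carrier T\<^sub>0"
    unfolding eq KH.AB.carrier_tensor using mult_P\<^sub>0(1)[OF u(1) v(1)] by blast
  show "\<nu> (s \<otimes>\<^bsub>T\<^sub>0\<^esub> t) m = (\<Oplus>x\<in>carrier M. \<nu> s x \<otimes> \<nu> t (inv\<^bsub>M\<^esub> x \<otimes>\<^bsub>M\<^esub> m))" if "m \<in> carrier M"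
    unfolding eq using mult_P\<^sub>0(2)[OF u(1) v(1) that] u v by simp
qed

lemma one_BC:
  shows "\<one>\<^bsub>T\<^sub>0\<^esub> \<in> carrier T\<^sub>0" and "m \<in> carrier M \<Longrightarrow> \<nu> \<one>\<^bsub>T\<^sub>0\<^esub> m = (if m = \<one>\<^bsub>M\<^esub> then \<one> else \<zero>)"
proof -
  have "\<one>\<^bsub>T\<^sub>0\<^esub> = KH.AB.q \<one>\<^bsub>P\<^sub>0\<^esub>" by (simp add: tensor_def Let_def)
  also have "\<one>\<^bsub>P\<^sub>0\<^esub> = basis_elem K\<^sub>0 (\<one>, basis_elem E \<one>\<^bsub>M\<^esub>)"
    by (simp add: monoid_algebra_simps self_algebra_simps invariant_algebra_simps)
  finally have eq: "\<one>\<^bsub>T\<^sub>0\<^esub> = pt \<one> (basis_elem E \<one>\<^bsub>M\<^esub>)" by (simp add: KH.AB.pure_tensor_q)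
  have e: "basis_elem E \<one>\<^bsub>M\<^esub> \<in> fixed_elems (carrier G)" by (rule fixed_elems_one) simp
  show "\<one>\<^bsub>T\<^sub>0\<^esub> \<in> carrier T\<^sub>0"
    unfolding eq by (rule KH.AB.pure_tensor_closed) (use e F_closed in \<open>auto simp: mem_L\<^sub>0 mem_H\<^sub>0\<close>)
  show "\<nu> \<one>\<^bsub>T\<^sub>0\<^esub> m = (if m = \<one>\<^bsub>M\<^esub> then \<one> else \<zero>)" if "m \<in> carrier M"
    unfolding eq \<nu>_pure[OF F_closed(3) e] by (simp add: basis_elem_def)
qed

lemma H_sums:
  assumes "h \<in> fixed_elems (carrier G)"
  shows "counit H h = (\<Oplus>x\<in>carrier M. h x)" "counit H h \<in> fixed_field E (carrier G)"
proof -
  have "(\<Oplus>x\<in>{m. h m \<noteq> \<zero>}. h x) = (\<Oplus>x\<in>carrier M. h x)"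
    by (rule finsum_mono_neutral) (use fixed_elemsD(1,2)[OF assms] finite_M in auto)
  then show *: "counit H h = (\<Oplus>x\<in>carrier M. h x)" by (simp add: restrict_hopf_def group_hopf_simps)
  show "counit H h \<in> fixed_field E (carrier G)" unfolding * by (rule sum_fixed[OF subset_refl assms])
qed

text \<open>The algebra over which \<open>base_change\<close> forms its tensor square, before the
  Hopf operations are attached to it.\<close>

abbreviation (input) BA :: "('e, ('e \<times> ('x \<Rightarrow> 'e) \<Rightarrow> 'e) set) module" where
  "BA \<equiv> base_change_algebra K\<^sub>0 F\<^sub>0 H"

lemma BA_simps:
  "carrier BA = carrier T\<^sub>0" "monoid.mult BA = monoid.mult T\<^sub>0" "\<one>\<^bsub>BA\<^esub> = \<one>\<^bsub>T\<^sub>0\<^esub>" "\<zero>\<^bsub>BA\<^esub> = \<zero>\<^bsub>T\<^sub>0\<^esub>"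
  "ring.add BA = ring.add T\<^sub>0" "smult BA = scale"
  by (simp_all add: base_change_algebra_def Let_def module.defs tensor_H scale_def[abs_def])

lemma tensor_BA: "tensor F\<^sub>0 BA BA = tensor F\<^sub>0 BC BC" "pure_tensor F\<^sub>0 BA BA = pure_tensor F\<^sub>0 BC BC"
  by (rule tensor_cong; simp add: BA_simps BC_simps)+

lemma BA_module: "module K\<^sub>0 BA"
  by (rule module_restrict_subfield[OF field_axioms subfield_F subfield_K fixed_field_mono
        module_cong[OF BC_module]])
     (simp_all add: BA_simps BC_simps)

text \<open>The tensor product over K carries two actions of K, its own and the restriction of the
  action of K'. They have the same effect on coordinates.\<close>

lemma scale_eq_smult:
  assumes r: "r \<in> fixed_field E (carrier G)" and t: "t \<in> carrier T\<^sub>0"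
  shows "r \<odot>\<^bsub>T\<^sub>0\<^esub> t = scale r t"
proof (rule \<nu>_inject)
  have rS: "r \<in> fixed_field E S" using r fixed_field_mono by auto
  show "r \<odot>\<^bsub>T\<^sub>0\<^esub> t \<in> carrier T\<^sub>0" using r t by simp
  show "scale r t \<in> carrier T\<^sub>0" using rS t by (rule scale_closed)
  show "\<nu> (r \<odot>\<^bsub>T\<^sub>0\<^esub> t) x = \<nu> (scale r t) x" if "x \<in> carrier M" for x
    unfolding \<nu>_scale[OF rS t] using r t that by (simp add: \<nu>_def KH.\<kappa>_smult)
qed

text \<open>A \<open>tensor_lift\<close> can be evaluated only after its argument is known to be
  bilinear. Once this holds, both sides are additive in t and need to be compared only on pure
  tensors.\<close>

lemma counit_BC:
  assumes t: "t \<in> carrier T\<^sub>0"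
  shows "counit BC t = (\<Oplus>x\<in>carrier M. \<nu> t x)"
proof -
  let ?\<epsilon> = "\<lambda>a h. a \<otimes> counit H h"
  have sub: "r \<in> fixed_field E S' \<Longrightarrow> r \<in> carrier E" for r S' by (auto simp: fixed_field_def)
  have add: "counit H (\<lambda>x. h x \<oplus> h' x) = counit H h \<oplus> counit H h'"
    if h: "h \<in> fixed_elems (carrier G)" and h': "h' \<in> fixed_elems (carrier G)" for h h'
  proof -
    have "(\<lambda>x. h x \<oplus> h' x) \<in> fixed_elems (carrier G)"
      using HH.A.A.a_closed[of h h'] h h' by (simp add: invariant_algebra_simps)
    then show ?thesis using h h' by (simp add: H_sums finsum_addf fixed_elemsD(1))
  qed
  have smult: "counit H (\<lambda>x. r \<otimes> h x) = r \<otimes> counit H h"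
    if h: "h \<in> fixed_elems (carrier G)" and r: "r \<in> fixed_field E (carrier G)" for h r
  proof -
    have "(\<lambda>x. r \<otimes> h x) \<in> fixed_elems (carrier G)"
      using HH.A.A.smult_closed[of r h] h r by (simp add: invariant_algebra_simps)
    moreover have "(\<Oplus>x\<in>carrier M. r \<otimes> h x) = r \<otimes> (\<Oplus>x\<in>carrier M. h x)"
      by (rule finsum_rdistr[symmetric]) (use fixed_elemsD(1)[OF h] sub[OF r] finite_M in auto)
    ultimately show ?thesis using h by (simp add: H_sums)
  qed
  have bil: "bilinear_map K\<^sub>0 L\<^sub>0 H\<^sub>0 L\<^sub>0 ?\<epsilon>"
  proof -
    have c: "counit H h \<in> fixed_field E S" "counit H h \<in> carrier E" if "h \<in> fixed_elems (carrier G)" for h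
      using H_sums(2)[OF that] fixed_field_mono sub by auto
    show ?thesis
    proof (rule bilinear_mapI)
      fix a a' h assume "a \<in> carrier L\<^sub>0" "a' \<in> carrier L\<^sub>0" "h \<in> carrier H\<^sub>0"
      then show "?\<epsilon> (a \<oplus>\<^bsub>L\<^sub>0\<^esub> a') h = ?\<epsilon> a h \<oplus>\<^bsub>L\<^sub>0\<^esub> ?\<epsilon> a' h"
        using c(2) sub[of a S] sub[of a' S] by (simp add: self_algebra_simps mem_H\<^sub>0 l_distr)
    next
      fix a h h' assume "a \<in> carrier L\<^sub>0" "h \<in> carrier H\<^sub>0" "h' \<in> carrier H\<^sub>0"
      then show "?\<epsilon> a (h \<oplus>\<^bsub>H\<^sub>0\<^esub> h') = ?\<epsilon> a h \<oplus>\<^bsub>L\<^sub>0\<^esub> ?\<epsilon> a h'"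
        using c(2) sub[of a S] by (simp add: self_algebra_simps mem_H\<^sub>0 invariant_algebra_simps(5) add r_distr)
    next
      fix r a h assume *: "r \<in> carrier K\<^sub>0" "a \<in> carrier L\<^sub>0" "h \<in> carrier H\<^sub>0"
      then have rE: "r \<in> carrier E" "a \<in> carrier E" using sub[of r "carrier G"] sub[of a S] by (simp_all add: mem_L\<^sub>0)
      show "?\<epsilon> (r \<odot>\<^bsub>L\<^sub>0\<^esub> a) h = r \<odot>\<^bsub>L\<^sub>0\<^esub> ?\<epsilon> a h"
        using * c(2) rE by (simp add: self_algebra_simps mem_H\<^sub>0 m_assoc)
      show "?\<epsilon> a (r \<odot>\<^bsub>H\<^sub>0\<^esub> h) = r \<odot>\<^bsub>L\<^sub>0\<^esub> ?\<epsilon> a h"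
        using * c(2) rE by (simp add: self_algebra_simps mem_H\<^sub>0 invariant_algebra_simps(6) smult m_lcomm)
    qed (use c(1) F_closed in \<open>auto simp: mem_L\<^sub>0 mem_H\<^sub>0\<close>)
  qed
  have eq: "counit BC = tensor_lift K\<^sub>0 L\<^sub>0 ?\<epsilon>"
    by (simp add: base_change_def Let_def module.defs)
  note lift = KH.AB.tensor_lift_pure[OF L\<^sub>0_module bil] KH.AB.tensor_lift_add[OF L\<^sub>0_module bil]
  show ?thesis
    unfolding eq using t
  proof (induction rule: KH.AB.tensor_induct)
    case (pure a h)
    then have a: "a \<in> fixed_field E S" and h: "h \<in> fixed_elems (carrier G)" by (auto simp: mem_L\<^sub>0 mem_H\<^sub>0)
    have "a \<otimes> (\<Oplus>x\<in>carrier M. h x) = (\<Oplus>x\<in>carrier M. a \<otimes> h x)"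
      by (rule finsum_rdistr) (use fixed_elemsD(1)[OF h] sub[OF a] finite_M in auto)
    then show ?case using lift(1)[OF pure] H_sums(1)[OF h] by (simp add: \<nu>_pure[OF a h])
  next
    case (add s t)
    have "(\<Oplus>x\<in>carrier M. \<nu> s x \<oplus> \<nu> t x) = (\<Oplus>x\<in>carrier M. \<nu> s x) \<oplus> (\<Oplus>x\<in>carrier M. \<nu> t x)"
      by (rule finsum_addf) (use fixed_elemsD(1)[OF \<nu>_fixed] add.hyps in auto)
    then show ?case using add lift(2)[of s t] by (simp add: \<nu>_add self_algebra_simps)
  qed
qed

lemma antipode_BC:
  assumes t: "t \<in> carrier T\<^sub>0"
  shows "antipode BC t \<in> carrier T\<^sub>0" "m \<in> carrier M \<Longrightarrow> \<nu> (antipode BC t) m = \<nu> t (inv\<^bsub>M\<^esub> m)"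
proof -
  have aH: "antipode H h = (\<lambda>m. if m \<in> carrier M then h (inv\<^bsub>M\<^esub> m) else \<zero>)" for h
    by (simp add: restrict_hopf_def group_hopf_simps)
  have aH_closed: "antipode H h \<in> fixed_elems (carrier G)" if "h \<in> fixed_elems (carrier G)" for h
    unfolding aH by (rule fixed_elems_antipode[OF subset_refl that])
  let ?\<beta> = "\<lambda>a h. pt a (antipode H h)"
  have add: "antipode H (h \<oplus>\<^bsub>H\<^sub>0\<^esub> h') = antipode H h \<oplus>\<^bsub>H\<^sub>0\<^esub> antipode H h'" for h h'
    unfolding aH invariant_algebra_simps by auto
  have smult: "antipode H (r \<odot>\<^bsub>H\<^sub>0\<^esub> h) = r \<odot>\<^bsub>H\<^sub>0\<^esub> antipode H h" if "r \<in> carrier K\<^sub>0" for r h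
    using that unfolding aH invariant_algebra_simps by (auto simp: fixed_field_def)
  \<comment> \<open>The antipode is lifted into \<open>BA\<close>, whose scalars act by
    \<open>scale\<close>; for scalars from K this is the action of \<open>T\<^sub>0\<close>.\<close>
  have bil: "bilinear_map K\<^sub>0 L\<^sub>0 H\<^sub>0 BA ?\<beta>"
    by (rule bilinear_mapI)
       (use aH_closed in \<open>auto simp: BA_simps add smult mem_H\<^sub>0 KH.AB.pure_tensor_closed KH.AB.pure_tensor_add_left
          KH.AB.pure_tensor_add_right KH.AB.pure_tensor_smult_left KH.AB.pure_tensor_smult_right scale_eq_smult\<close>)
  have eq: "antipode BC = tensor_lift K\<^sub>0 BA ?\<beta>"
    by (simp add: base_change_def Let_def module.defs tensor_H)
  note lift = KH.AB.tensor_lift_pure[OF BA_module bil] KH.AB.tensor_lift_add[OF BA_module bil]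
    KH.AB.tensor_lift_closed[OF BA_module bil]
  show "antipode BC t \<in> carrier T\<^sub>0" unfolding eq using lift(3)[OF t] by (simp add: BA_simps)
  show "\<nu> (antipode BC t) m = \<nu> t (inv\<^bsub>M\<^esub> m)" if m: "m \<in> carrier M"
    unfolding eq using t
  proof (induction rule: KH.AB.tensor_induct)
    case (pure a h)
    then have a: "a \<in> fixed_field E S" and h: "h \<in> fixed_elems (carrier G)" by (auto simp: mem_L\<^sub>0 mem_H\<^sub>0)
    show ?case unfolding lift(1)[OF pure] \<nu>_pure[OF a h] \<nu>_pure[OF a aH_closed[OF h]]
      using m by (simp add: aH)
  next
    case (add s t)
    then show ?case using lift(2,3)[of s] lift(3)[of t] m by (simp add: \<nu>_add BA_simps)
  qed
qed

text \<open>The comultiplication is a lift nested in a lift. The inner one carries the tensor square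
  of E[M]^G over K to that of the base change over K' without changing coordinates, so 1 \<otimes> h
  goes to h on the diagonal and zero off it. The outer one multiplies by a.\<close>

lemma comult_BC:
  assumes t: "t \<in> carrier T\<^sub>0"
  shows "comult BC t \<in> carrier (tensor F\<^sub>0 BC BC)"
    and "x \<in> carrier M \<Longrightarrow> y \<in> carrier M \<Longrightarrow> model.TT.\<kappa> (comult BC t) x y = (if x = y then \<nu> t x else \<zero>)"
proof -
  let ?TT = "tensor F\<^sub>0 BC BC"
  let ?\<delta> = "\<lambda>h1 h2. pure_tensor F\<^sub>0 BC BC (pt \<one> h1) (pt \<one> h2)"
  let ?D = "\<lambda>h. tensor_lift K\<^sub>0 ?TT ?\<delta> (comult H h)"
  have TT_module: "module K\<^sub>0 ?TT"
    by (rule module_restrict_subfield[OF field_axioms subfield_F subfield_K fixed_field_mono model.TT.AB.tensor_module])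
  have \<rho>: "pt \<one> h \<in> carrier BC" "\<nu> (pt \<one> h) = h" if "h \<in> carrier H\<^sub>0" for h
  proof -
    show "pt \<one> h \<in> carrier BC"
      unfolding BC_simps by (rule KH.AB.pure_tensor_closed) (use that F_closed in \<open>auto simp: mem_L\<^sub>0\<close>)
    have h: "h \<in> fixed_elems (carrier G)" using that by (simp add: mem_H\<^sub>0)
    show "\<nu> (pt \<one> h) = h"
      unfolding \<nu>_pure[OF F_closed(3) h] using fixed_elemsD(1)[OF h] by auto
  qed
  have \<rho>_add: "pt \<one> (h \<oplus>\<^bsub>H\<^sub>0\<^esub> h') = pt \<one> h \<oplus>\<^bsub>BC\<^esub> pt \<one> h'" if "h \<in> carrier H\<^sub>0" "h' \<in> carrier H\<^sub>0" for h h'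
    unfolding BC_simps by (rule KH.AB.pure_tensor_add_right) (use that F_closed in \<open>auto simp: mem_L\<^sub>0\<close>)
  have \<rho>_smult: "pt \<one> (r \<odot>\<^bsub>H\<^sub>0\<^esub> h) = r \<odot>\<^bsub>BC\<^esub> pt \<one> h" if "r \<in> carrier K\<^sub>0" "h \<in> carrier H\<^sub>0" for h r
  proof -
    have "pt \<one> (r \<odot>\<^bsub>H\<^sub>0\<^esub> h) = r \<odot>\<^bsub>T\<^sub>0\<^esub> pt \<one> h"
      by (rule KH.AB.pure_tensor_smult_right) (use that F_closed in \<open>auto simp: mem_L\<^sub>0\<close>)
    then show ?thesis using that \<rho>(1) by (simp add: scale_eq_smult BC_simps)
  qed
  have K_sub: "r \<in> carrier F\<^sub>0" if "r \<in> carrier K\<^sub>0" for r using that fixed_field_mono by auto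
  have bil\<delta>: "bilinear_map K\<^sub>0 H\<^sub>0 H\<^sub>0 ?TT ?\<delta>"
    by (rule bilinear_mapI)
       (use K_sub in \<open>simp_all add: \<rho> \<rho>_add \<rho>_smult model.TT.AB.pure_tensor_closed model.TT.AB.pure_tensor_add_left
         model.TT.AB.pure_tensor_add_right model.TT.AB.pure_tensor_smult_left model.TT.AB.pure_tensor_smult_right\<close>)
  note lift\<delta> = HH.AB.tensor_lift_pure[OF TT_module bil\<delta>] HH.AB.tensor_lift_add[OF TT_module bil\<delta>]
    HH.AB.tensor_lift_closed[OF TT_module bil\<delta>]
  \<comment> \<open>Both maps to E are additive and agree on pure tensors, because 1 \<otimes> h has
    the coordinates of h.\<close>
  have \<kappa>\<delta>: "model.TT.\<kappa> (tensor_lift K\<^sub>0 ?TT ?\<delta> s) x y = HH.\<kappa> s x y"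
    if "s \<in> carrier (tensor K\<^sub>0 H\<^sub>0 H\<^sub>0)" "x \<in> carrier M" "y \<in> carrier M" for s x y
    using that(1)
  proof (induction rule: HH.AB.tensor_induct)
    case (pure a b)
    show ?case
      unfolding lift\<delta>(1)[OF pure] model.TT.\<kappa>_pure[OF \<rho>(1)[OF pure(1)] \<rho>(1)[OF pure(2)] that(2,3)]
        HH.\<kappa>_pure[OF pure that(2,3)] \<rho>(2)[OF pure(1)] \<rho>(2)[OF pure(2)] ..
  next
    case (add s t)
    show ?case
      unfolding lift\<delta>(2)[OF add.hyps(1,2)] HH.\<kappa>_add[OF add.hyps(1,2) that(2,3)]
        model.TT.\<kappa>_add[OF lift\<delta>(3)[OF add.hyps(1)] lift\<delta>(3)[OF add.hyps(2)] that(2,3)] add.IH ..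
  qed
  have D: "?D h \<in> carrier ?TT"
    "\<And>x y. x \<in> carrier M \<Longrightarrow> y \<in> carrier M \<Longrightarrow> model.TT.\<kappa> (?D h) x y = (if x = y then h x else \<zero>)"
    if "h \<in> carrier H\<^sub>0" for h
  proof -
    have h: "h \<in> fixed_elems (carrier G)" using that by (simp add: mem_H\<^sub>0)
    show "?D h \<in> carrier ?TT" by (rule lift\<delta>(3)[OF restrict_comult(1)[OF h]])
    show "\<And>x y. x \<in> carrier M \<Longrightarrow> y \<in> carrier M \<Longrightarrow> model.TT.\<kappa> (?D h) x y = (if x = y then h x else \<zero>)"
      by (simp only: \<kappa>\<delta>[OF restrict_comult(1)[OF h]] restrict_comult(2)[OF h])
  qed
  let ?\<beta> = "\<lambda>a h. a \<odot>\<^bsub>?TT\<^esub> ?D h"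
  have sub: "a \<in> fixed_field E S' \<Longrightarrow> a \<in> carrier E" for a S' by (auto simp: fixed_field_def)
  have \<beta>: "?\<beta> a h \<in> carrier ?TT"
    "\<And>x y. x \<in> carrier M \<Longrightarrow> y \<in> carrier M \<Longrightarrow> model.TT.\<kappa> (?\<beta> a h) x y = (if x = y then a \<otimes> h x else \<zero>)"
    if a: "a \<in> carrier L\<^sub>0" and h: "h \<in> carrier H\<^sub>0" for a h
  proof -
    have a': "a \<in> fixed_field E S" "a \<in> carrier F\<^sub>0" using a by (simp_all add: mem_L\<^sub>0)
    show "?\<beta> a h \<in> carrier ?TT" by (rule model.TT.AB.T.smult_closed[OF a'(2) D(1)[OF h]])
    show "model.TT.\<kappa> (?\<beta> a h) x y = (if x = y then a \<otimes> h x else \<zero>)"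
      if "x \<in> carrier M" "y \<in> carrier M" for x y
      unfolding model.TT.\<kappa>_smult[OF a'(1) D(1)[OF h] that] D(2)[OF h that] using sub[OF a'(1)] by simp
  qed
  have hc: "h x \<in> carrier E" if "h \<in> carrier H\<^sub>0" for h x
    using that fixed_elemsD(1)[of h "carrier G"] by (simp add: mem_H\<^sub>0)
  \<comment> \<open>The laws hold between tensors because they hold between coordinates, which are
    faithful on the tensor square over K'.\<close>
  have bil: "bilinear_map K\<^sub>0 L\<^sub>0 H\<^sub>0 ?TT ?\<beta>"
  proof (rule bilinear_mapI)
    fix a a' h assume *: "a \<in> carrier L\<^sub>0" "a' \<in> carrier L\<^sub>0" "h \<in> carrier H\<^sub>0"
    have c: "a \<oplus>\<^bsub>L\<^sub>0\<^esub> a' \<in> carrier L\<^sub>0" using * by simp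
    show "?\<beta> (a \<oplus>\<^bsub>L\<^sub>0\<^esub> a') h = ?\<beta> a h \<oplus>\<^bsub>?TT\<^esub> ?\<beta> a' h"
    proof (rule model.TT.\<kappa>_inject)
      fix x y assume xy: "x \<in> carrier M" "y \<in> carrier M"
      show "model.TT.\<kappa> (?\<beta> (a \<oplus>\<^bsub>L\<^sub>0\<^esub> a') h) x y = model.TT.\<kappa> (?\<beta> a h \<oplus>\<^bsub>?TT\<^esub> ?\<beta> a' h) x y"
        unfolding \<beta>(2)[OF c *(3) xy] model.TT.\<kappa>_add[OF \<beta>(1)[OF *(1,3)] \<beta>(1)[OF *(2,3)] xy]
          \<beta>(2)[OF *(1,3) xy] \<beta>(2)[OF *(2,3) xy]
        using * sub[of _ S] hc[OF *(3)] by (simp add: self_algebra_simps l_distr)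
    qed (rule \<beta>(1)[OF c *(3)] model.TT.AB.T.a_closed[OF \<beta>(1)[OF *(1,3)] \<beta>(1)[OF *(2,3)]])+
  next
    fix a h h' assume *: "a \<in> carrier L\<^sub>0" "h \<in> carrier H\<^sub>0" "h' \<in> carrier H\<^sub>0"
    have c: "h \<oplus>\<^bsub>H\<^sub>0\<^esub> h' \<in> carrier H\<^sub>0" using * by simp
    show "?\<beta> a (h \<oplus>\<^bsub>H\<^sub>0\<^esub> h') = ?\<beta> a h \<oplus>\<^bsub>?TT\<^esub> ?\<beta> a h'"
    proof (rule model.TT.\<kappa>_inject)
      fix x y assume xy: "x \<in> carrier M" "y \<in> carrier M"
      show "model.TT.\<kappa> (?\<beta> a (h \<oplus>\<^bsub>H\<^sub>0\<^esub> h')) x y = model.TT.\<kappa> (?\<beta> a h \<oplus>\<^bsub>?TT\<^esub> ?\<beta> a h') x y"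
        unfolding \<beta>(2)[OF *(1) c xy] model.TT.\<kappa>_add[OF \<beta>(1)[OF *(1,2)] \<beta>(1)[OF *(1,3)] xy]
          \<beta>(2)[OF *(1,2) xy] \<beta>(2)[OF *(1,3) xy]
        using * sub[of _ S] hc[OF *(2)] hc[OF *(3)] by (simp add: self_algebra_simps invariant_algebra_simps(5) r_distr)
    qed (rule \<beta>(1)[OF *(1) c] model.TT.AB.T.a_closed[OF \<beta>(1)[OF *(1,2)] \<beta>(1)[OF *(1,3)]])+
  next
    fix r a h assume *: "r \<in> carrier K\<^sub>0" "a \<in> carrier L\<^sub>0" "h \<in> carrier H\<^sub>0"
    have c: "r \<odot>\<^bsub>L\<^sub>0\<^esub> a \<in> carrier L\<^sub>0" "r \<odot>\<^bsub>H\<^sub>0\<^esub> h \<in> carrier H\<^sub>0" using * by auto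
    have r: "r \<in> fixed_field E S" "r \<in> carrier F\<^sub>0" using K_sub[OF *(1)] by auto
    have rs: "r \<odot>\<^bsub>?TT\<^esub> ?\<beta> a h \<in> carrier ?TT" by (rule model.TT.AB.T.smult_closed[OF r(2) \<beta>(1)[OF *(2,3)]])
    show "?\<beta> (r \<odot>\<^bsub>L\<^sub>0\<^esub> a) h = r \<odot>\<^bsub>?TT\<^esub> ?\<beta> a h"
    proof (rule model.TT.\<kappa>_inject)
      fix x y assume xy: "x \<in> carrier M" "y \<in> carrier M"
      show "model.TT.\<kappa> (?\<beta> (r \<odot>\<^bsub>L\<^sub>0\<^esub> a) h) x y = model.TT.\<kappa> (r \<odot>\<^bsub>?TT\<^esub> ?\<beta> a h) x y"
        unfolding \<beta>(2)[OF c(1) *(3) xy] model.TT.\<kappa>_smult[OF r(1) \<beta>(1)[OF *(2,3)] xy] \<beta>(2)[OF *(2,3) xy]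
        using * sub[of _ S] r hc[OF *(3)] by (simp add: self_algebra_simps m_assoc)
    qed (rule \<beta>(1)[OF c(1) *(3)] rs)+
    show "?\<beta> a (r \<odot>\<^bsub>H\<^sub>0\<^esub> h) = r \<odot>\<^bsub>?TT\<^esub> ?\<beta> a h"
    proof (rule model.TT.\<kappa>_inject)
      fix x y assume xy: "x \<in> carrier M" "y \<in> carrier M"
      show "model.TT.\<kappa> (?\<beta> a (r \<odot>\<^bsub>H\<^sub>0\<^esub> h)) x y = model.TT.\<kappa> (r \<odot>\<^bsub>?TT\<^esub> ?\<beta> a h) x y"
        unfolding \<beta>(2)[OF *(2) c(2) xy] model.TT.\<kappa>_smult[OF r(1) \<beta>(1)[OF *(2,3)] xy] \<beta>(2)[OF *(2,3) xy]
        using * sub[of _ S] r hc[OF *(3)] by (simp add: self_algebra_simps invariant_algebra_simps(6) m_lcomm)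
    qed (rule \<beta>(1)[OF *(2) c(2)] rs)+
  qed (rule \<beta>(1))
  have "comult BC = tensor_lift K\<^sub>0 (tensor F\<^sub>0 BA BA) (\<lambda>a h. a \<odot>\<^bsub>tensor F\<^sub>0 BA BA\<^esub>
      tensor_lift K\<^sub>0 (tensor F\<^sub>0 BA BA) (\<lambda>h1 h2. pure_tensor F\<^sub>0 BA BA (pt \<one> h1) (pt \<one> h2)) (comult H h))"
    by (simp add: base_change_def Let_def module.defs tensor_H)
  then have eq: "comult BC = tensor_lift K\<^sub>0 ?TT ?\<beta>" unfolding tensor_BA .
  note lift = KH.AB.tensor_lift_pure[OF TT_module bil] KH.AB.tensor_lift_add[OF TT_module bil]
    KH.AB.tensor_lift_closed[OF TT_module bil]
  show "comult BC t \<in> carrier ?TT" unfolding eq by (rule lift(3)[OF t])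
  show "model.TT.\<kappa> (comult BC t) x y = (if x = y then \<nu> t x else \<zero>)"
    if xy: "x \<in> carrier M" "y \<in> carrier M"
    unfolding eq using t
  proof (induction rule: KH.AB.tensor_induct)
    case (pure a h)
    then have a: "a \<in> fixed_field E S" and h: "h \<in> fixed_elems (carrier G)" by (auto simp: mem_L\<^sub>0 mem_H\<^sub>0)
    show ?case unfolding lift(1)[OF pure] \<beta>(2)[OF pure xy] \<nu>_pure[OF a h] ..
  next
    case (add s t)
    show ?case
      unfolding lift(2)[OF add.hyps(1,2)] model.TT.\<kappa>_add[OF lift(3)[OF add.hyps(1)] lift(3)[OF add.hyps(2)] xy] add.IH
        \<nu>_add[OF add.hyps(1,2)] by simp
  qed
qed

theorem base_change_model: "hopf_model E G M act I p g S BC \<nu>"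
  by (rule hopf_model.intro[OF model.invariant_model_axioms], rule hopf_model_axioms.intro)
     (simp_all only: BC_simps mult_BC one_BC counit_BC antipode_BC comult_BC)

end

subsection \<open>Isomorphisms of the Hopf algebras\<close>

text \<open>Both Hopf algebras live over the fixed field of the same \<open>S\<close>. The equality
  of cardinalities will turn a surjective map between the groups into a bijection.\<close>

locale hopf_model_pair = A: hopf_model E G M\<^sub>1 act\<^sub>1 I\<^sub>1 p\<^sub>1 g\<^sub>1 S T\<^sub>1 \<nu>\<^sub>1 + B: hopf_model E G M\<^sub>2 act\<^sub>2 I\<^sub>2 p\<^sub>2 g\<^sub>2 S T\<^sub>2 \<nu>\<^sub>2
  for E :: "('e, 'm) ring_scheme" (structure) and G and S
    and M\<^sub>1 :: "('x1, 'y1) monoid_scheme" and act\<^sub>1 and I\<^sub>1 :: "'i1 set" and p\<^sub>1 g\<^sub>1 and T\<^sub>1 :: "('e, 't1, 'z1) hopf_scheme" and \<nu>\<^sub>1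
    and M\<^sub>2 :: "('x2, 'y2) monoid_scheme" and act\<^sub>2 and I\<^sub>2 :: "'i2 set" and p\<^sub>2 g\<^sub>2 and T\<^sub>2 :: "('e, 't2, 'z2) hopf_scheme" and \<nu>\<^sub>2 +
  assumes card_eq: "card (carrier M\<^sub>1) = card (carrier M\<^sub>2)"
begin

abbreviation (input) F\<^sub>S :: "('e, 'm) ring_scheme" where "F\<^sub>S \<equiv> E\<lparr>carrier := fixed_field E S\<rparr>"

lemma \<gamma>_carrier: "\<gamma> \<in> S \<Longrightarrow> \<gamma> \<in> carrier G" using A.S_subset by auto

section \<open>From an equivariant group isomorphism to a Hopf algebra isomorphism\<close>

context
  fixes f :: "'x1 \<Rightarrow> 'x2"
  assumes f: "f \<in> iso M\<^sub>1 M\<^sub>2"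
    and f_act: "\<And>\<gamma> m. \<gamma> \<in> S \<Longrightarrow> m \<in> carrier M\<^sub>1 \<Longrightarrow> f (act\<^sub>1 \<gamma> m) = act\<^sub>2 \<gamma> (f m)"
begin

private lemma f_closed: "m \<in> carrier M\<^sub>1 \<Longrightarrow> f m \<in> carrier M\<^sub>2"
  and f_mult: "m \<in> carrier M\<^sub>1 \<Longrightarrow> m' \<in> carrier M\<^sub>1 \<Longrightarrow> f (m \<otimes>\<^bsub>M\<^sub>1\<^esub> m') = f m \<otimes>\<^bsub>M\<^sub>2\<^esub> f m'"
  and f_inj: "inj_on f (carrier M\<^sub>1)" and f_surj: "f ` carrier M\<^sub>1 = carrier M\<^sub>2"
  using f by (auto simp: iso_def hom_def bij_betw_def)

private lemma f_hom: "group_hom M\<^sub>1 M\<^sub>2 f"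
  by (intro group_hom.intro group_hom_axioms.intro A.group_M B.group_M) (use f in \<open>simp add: iso_def\<close>)

private lemma f_one: "f \<one>\<^bsub>M\<^sub>1\<^esub> = \<one>\<^bsub>M\<^sub>2\<^esub>"
  using group_hom.hom_one[OF f_hom] .

private lemma f_inv: "m \<in> carrier M\<^sub>1 \<Longrightarrow> f (inv\<^bsub>M\<^sub>1\<^esub> m) = inv\<^bsub>M\<^sub>2\<^esub> (f m)"
  using group_hom.hom_inv[OF f_hom] by simp

private lemma f_sum:
  assumes "\<And>y. y \<in> carrier M\<^sub>2 \<Longrightarrow> w y \<in> carrier E"
  shows "(\<Oplus>y\<in>carrier M\<^sub>2. w y) = (\<Oplus>x\<in>carrier M\<^sub>1. w (f x))"
  unfolding f_surj[symmetric] by (rule A.finsum_reindex) (use assms f_inj f_closed in auto)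

private lemma push:
  assumes "w \<in> A.fixed_elems S"
  shows "\<exists>v\<in>B.fixed_elems S. \<forall>x\<in>carrier M\<^sub>1. v (f x) = w x"
proof
  let ?v = "\<lambda>y. if y \<in> carrier M\<^sub>2 then w (inv_into (carrier M\<^sub>1) f y) else \<zero>"
  show v: "\<forall>x\<in>carrier M\<^sub>1. ?v (f x) = w x" using f_inj f_closed by simp
  show "?v \<in> B.fixed_elems S"
  proof (rule B.fixed_elemsI)
    fix \<gamma> y assume \<gamma>: "\<gamma> \<in> S" and y: "y \<in> carrier M\<^sub>2"
    then obtain x where x: "x \<in> carrier M\<^sub>1" "y = f x" using f_surj by blast
    have "?v (act\<^sub>2 \<gamma> y) = ?v (f (act\<^sub>1 \<gamma> x))" using f_act[OF \<gamma> x(1)] x(2) by simp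
    also have "\<dots> = w (act\<^sub>1 \<gamma> x)" using v x \<gamma>_carrier[OF \<gamma>] by blast
    also have "\<dots> = \<gamma> (w x)" by (rule A.fixed_elemsD(3)[OF assms \<gamma> x(1)])
    also have "w x = ?v y" unfolding x(2) by (rule bspec[OF v x(1), symmetric])
    finally show "?v (act\<^sub>2 \<gamma> y) = \<gamma> (?v y)" .
  qed (use A.fixed_elemsD(1)[OF assms] in auto)
qed

private lemma pull:
  assumes "v \<in> B.fixed_elems S"
  shows "\<exists>w\<in>A.fixed_elems S. \<forall>x\<in>carrier M\<^sub>1. v (f x) = w x"
proof
  let ?w = "\<lambda>x. if x \<in> carrier M\<^sub>1 then v (f x) else \<zero>"
  show "\<forall>x\<in>carrier M\<^sub>1. v (f x) = ?w x" by simp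
  show "?w \<in> A.fixed_elems S"
    by (rule A.fixed_elemsI)
       (use B.fixed_elemsD[OF assms] f_act f_closed \<gamma>_carrier in auto)
qed

text \<open>The isomorphism transports coordinates along \<open>f\<close>; equivariance of
  \<open>f\<close> keeps them in the invariants. Every operation is determined by coordinates, and
  the points \<open>f x\<close> exhaust the second group, so each compatibility reduces to one of
  \<open>f\<close>.\<close>

lemma hopf_isomorphic_if_equivariant_iso: "hopf_isomorphic F\<^sub>S T\<^sub>1 T\<^sub>2"
proof -
  \<comment> \<open>The element is described only by its coordinates, so it is chosen;
    \<open>push\<close> and the bijectivity of \<open>\<nu>\<^sub>2\<close> provide it.\<close>
  define \<phi> where "\<phi> = (\<lambda>t. SOME a. a \<in> carrier T\<^sub>2 \<and> (\<forall>x\<in>carrier M\<^sub>1. \<nu>\<^sub>2 a (f x) = \<nu>\<^sub>1 t x))"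
  have \<phi>: "\<phi> t \<in> carrier T\<^sub>2 \<and> (\<forall>x\<in>carrier M\<^sub>1. \<nu>\<^sub>2 (\<phi> t) (f x) = \<nu>\<^sub>1 t x)" if t: "t \<in> carrier T\<^sub>1" for t
  proof -
    obtain v where "v \<in> B.fixed_elems S" "\<forall>x\<in>carrier M\<^sub>1. v (f x) = \<nu>\<^sub>1 t x"
      using push[OF A.\<nu>_fixed[OF t]] by blast
    then obtain a where "a \<in> carrier T\<^sub>2 \<and> (\<forall>x\<in>carrier M\<^sub>1. \<nu>\<^sub>2 a (f x) = \<nu>\<^sub>1 t x)"
      using B.fixed_elems_obtain by metis
    then show ?thesis unfolding \<phi>_def by (rule someI)
  qed
  then have \<phi>_closed: "\<And>t. t \<in> carrier T\<^sub>1 \<Longrightarrow> \<phi> t \<in> carrier T\<^sub>2"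
    and \<phi>_\<nu>: "\<And>t x. t \<in> carrier T\<^sub>1 \<Longrightarrow> x \<in> carrier M\<^sub>1 \<Longrightarrow> \<nu>\<^sub>2 (\<phi> t) (f x) = \<nu>\<^sub>1 t x" by auto
  have eqI: "a = b" if "a \<in> carrier T\<^sub>2" "b \<in> carrier T\<^sub>2" "\<And>x. x \<in> carrier M\<^sub>1 \<Longrightarrow> \<nu>\<^sub>2 a (f x) = \<nu>\<^sub>2 b (f x)" for a b
  proof (rule B.\<nu>_eqI[OF that(1,2)])
    fix y assume "y \<in> carrier M\<^sub>2"
    then obtain x where "x \<in> carrier M\<^sub>1" "y = f x" using f_surj by blast
    then show "\<nu>\<^sub>2 a y = \<nu>\<^sub>2 b y" using that(3) by simp
  qed
  have add: "\<phi> (a \<oplus>\<^bsub>T\<^sub>1\<^esub> b) = \<phi> a \<oplus>\<^bsub>T\<^sub>2\<^esub> \<phi> b" if "a \<in> carrier T\<^sub>1" "b \<in> carrier T\<^sub>1" for a b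
  proof (rule eqI)
    show "\<nu>\<^sub>2 (\<phi> (a \<oplus>\<^bsub>T\<^sub>1\<^esub> b)) (f x) = \<nu>\<^sub>2 (\<phi> a \<oplus>\<^bsub>T\<^sub>2\<^esub> \<phi> b) (f x)" if x: "x \<in> carrier M\<^sub>1" for x
      unfolding \<phi>_\<nu>[OF A.C.A.a_closed[OF \<open>a \<in> _\<close> \<open>b \<in> _\<close>] x] A.\<nu>_add[OF \<open>a \<in> _\<close> \<open>b \<in> _\<close>]
        B.\<nu>_add[OF \<phi>_closed[OF \<open>a \<in> _\<close>] \<phi>_closed[OF \<open>b \<in> _\<close>]] \<phi>_\<nu>[OF \<open>a \<in> _\<close> x] \<phi>_\<nu>[OF \<open>b \<in> _\<close> x] ..
  qed (use that \<phi>_closed in auto)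
  have smult: "\<phi> (r \<odot>\<^bsub>T\<^sub>1\<^esub> a) = r \<odot>\<^bsub>T\<^sub>2\<^esub> \<phi> a" if r: "r \<in> fixed_field E S" and a: "a \<in> carrier T\<^sub>1" for r a
  proof (rule eqI)
    have ra: "r \<odot>\<^bsub>T\<^sub>1\<^esub> a \<in> carrier T\<^sub>1" using r a by (intro A.C.A.smult_closed) auto
    show "\<phi> (r \<odot>\<^bsub>T\<^sub>1\<^esub> a) \<in> carrier T\<^sub>2" by (rule \<phi>_closed[OF ra])
    show "r \<odot>\<^bsub>T\<^sub>2\<^esub> \<phi> a \<in> carrier T\<^sub>2" using r \<phi>_closed[OF a] by (intro B.C.A.smult_closed) auto
    show "\<nu>\<^sub>2 (\<phi> (r \<odot>\<^bsub>T\<^sub>1\<^esub> a)) (f x) = \<nu>\<^sub>2 (r \<odot>\<^bsub>T\<^sub>2\<^esub> \<phi> a) (f x)" if x: "x \<in> carrier M\<^sub>1" for x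
      unfolding \<phi>_\<nu>[OF ra x] A.\<nu>_smult[OF r a] B.\<nu>_smult[OF r \<phi>_closed[OF a]] \<phi>_\<nu>[OF a x] ..
  qed
  have mult: "\<phi> (a \<otimes>\<^bsub>T\<^sub>1\<^esub> b) = \<phi> a \<otimes>\<^bsub>T\<^sub>2\<^esub> \<phi> b" if a: "a \<in> carrier T\<^sub>1" and b: "b \<in> carrier T\<^sub>1" for a b
  proof (rule eqI)
    show "\<phi> (a \<otimes>\<^bsub>T\<^sub>1\<^esub> b) \<in> carrier T\<^sub>2" "\<phi> a \<otimes>\<^bsub>T\<^sub>2\<^esub> \<phi> b \<in> carrier T\<^sub>2"
      using a b \<phi>_closed A.mult_closed B.mult_closed by auto
    fix m assume m: "m \<in> carrier M\<^sub>1"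
    have "\<nu>\<^sub>2 (\<phi> a \<otimes>\<^bsub>T\<^sub>2\<^esub> \<phi> b) (f m) = (\<Oplus>y\<in>carrier M\<^sub>2. \<nu>\<^sub>2 (\<phi> a) y \<otimes> \<nu>\<^sub>2 (\<phi> b) (inv\<^bsub>M\<^sub>2\<^esub> y \<otimes>\<^bsub>M\<^sub>2\<^esub> f m))"
      by (rule B.\<nu>_mult[OF \<phi>_closed[OF a] \<phi>_closed[OF b] f_closed[OF m]])
    also have "\<dots> = (\<Oplus>x\<in>carrier M\<^sub>1. \<nu>\<^sub>2 (\<phi> a) (f x) \<otimes> \<nu>\<^sub>2 (\<phi> b) (inv\<^bsub>M\<^sub>2\<^esub> (f x) \<otimes>\<^bsub>M\<^sub>2\<^esub> f m))"
      by (rule f_sum) (use B.\<nu>_closed \<phi>_closed a b in auto)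
    also have "\<dots> = (\<Oplus>x\<in>carrier M\<^sub>1. \<nu>\<^sub>1 a x \<otimes> \<nu>\<^sub>1 b (inv\<^bsub>M\<^sub>1\<^esub> x \<otimes>\<^bsub>M\<^sub>1\<^esub> m))"
    proof (rule A.finsum_cong_closed)
      fix x assume x: "x \<in> carrier M\<^sub>1"
      have "inv\<^bsub>M\<^sub>2\<^esub> (f x) \<otimes>\<^bsub>M\<^sub>2\<^esub> f m = f (inv\<^bsub>M\<^sub>1\<^esub> x \<otimes>\<^bsub>M\<^sub>1\<^esub> m)" using x m by (simp add: f_mult f_inv)
      then show "\<nu>\<^sub>2 (\<phi> a) (f x) \<otimes> \<nu>\<^sub>2 (\<phi> b) (inv\<^bsub>M\<^sub>2\<^esub> (f x) \<otimes>\<^bsub>M\<^sub>2\<^esub> f m) = \<nu>\<^sub>1 a x \<otimes> \<nu>\<^sub>1 b (inv\<^bsub>M\<^sub>1\<^esub> x \<otimes>\<^bsub>M\<^sub>1\<^esub> m)"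
        using x m a b by (simp add: \<phi>_\<nu>)
    qed (use A.\<nu>_closed a b in auto)
    also have "\<dots> = \<nu>\<^sub>1 (a \<otimes>\<^bsub>T\<^sub>1\<^esub> b) m" by (rule A.\<nu>_mult[OF a b m, symmetric])
    also have "\<dots> = \<nu>\<^sub>2 (\<phi> (a \<otimes>\<^bsub>T\<^sub>1\<^esub> b)) (f m)" by (rule \<phi>_\<nu>[OF A.mult_closed[OF a b] m, symmetric])
    finally show "\<nu>\<^sub>2 (\<phi> (a \<otimes>\<^bsub>T\<^sub>1\<^esub> b)) (f m) = \<nu>\<^sub>2 (\<phi> a \<otimes>\<^bsub>T\<^sub>2\<^esub> \<phi> b) (f m)" by simp
  qed
  have one: "\<phi> \<one>\<^bsub>T\<^sub>1\<^esub> = \<one>\<^bsub>T\<^sub>2\<^esub>"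
  proof (rule eqI[OF \<phi>_closed[OF A.one_closed] B.one_closed])
    fix m assume m: "m \<in> carrier M\<^sub>1"
    have "f m = \<one>\<^bsub>M\<^sub>2\<^esub> \<longleftrightarrow> m = \<one>\<^bsub>M\<^sub>1\<^esub>" using f_one f_inj m by (metis A.M.one_closed inj_on_eq_iff)
    then show "\<nu>\<^sub>2 (\<phi> \<one>\<^bsub>T\<^sub>1\<^esub>) (f m) = \<nu>\<^sub>2 \<one>\<^bsub>T\<^sub>2\<^esub> (f m)"
      unfolding \<phi>_\<nu>[OF A.one_closed m] A.\<nu>_one[OF m] B.\<nu>_one[OF f_closed[OF m]] by simp
  qed
  have bij: "bij_betw \<phi> (carrier T\<^sub>1) (carrier T\<^sub>2)"
  proof (rule bij_betwI')
    fix a b assume ab: "a \<in> carrier T\<^sub>1" "b \<in> carrier T\<^sub>1"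
    show "\<phi> a = \<phi> b \<longleftrightarrow> a = b"
    proof
      assume eq: "\<phi> a = \<phi> b"
      show "a = b"
        by (rule A.\<nu>_eqI[OF ab]) (use \<phi>_\<nu>[OF ab(1)] \<phi>_\<nu>[OF ab(2)] eq in auto)
    qed simp
  next
    fix b assume b: "b \<in> carrier T\<^sub>2"
    obtain w where w: "w \<in> A.fixed_elems S" "\<forall>x\<in>carrier M\<^sub>1. \<nu>\<^sub>2 b (f x) = w x" using pull[OF B.\<nu>_fixed[OF b]] by blast
    obtain a where a: "a \<in> carrier T\<^sub>1" "\<nu>\<^sub>1 a = w" using A.fixed_elems_obtain[OF w(1)] .
    have "b = \<phi> a" by (rule eqI[OF b \<phi>_closed[OF a(1)]]) (use \<phi>_\<nu>[OF a(1)] a w in auto)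
    then show "\<exists>a\<in>carrier T\<^sub>1. b = \<phi> a" using a by blast
  qed (rule \<phi>_closed)
  have counit: "counit T\<^sub>2 (\<phi> a) = counit T\<^sub>1 a" if a: "a \<in> carrier T\<^sub>1" for a
  proof -
    have "counit T\<^sub>2 (\<phi> a) = (\<Oplus>y\<in>carrier M\<^sub>2. \<nu>\<^sub>2 (\<phi> a) y)" by (rule B.counit_eq[OF \<phi>_closed[OF a]])
    also have "\<dots> = (\<Oplus>x\<in>carrier M\<^sub>1. \<nu>\<^sub>2 (\<phi> a) (f x))" by (rule f_sum) (rule B.\<nu>_closed[OF \<phi>_closed[OF a]])
    also have "\<dots> = (\<Oplus>x\<in>carrier M\<^sub>1. \<nu>\<^sub>1 a x)"
      by (rule A.finsum_cong_closed) (use \<phi>_\<nu> A.\<nu>_closed a in auto)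
    finally show ?thesis using A.counit_eq[OF a] by simp
  qed
  have antipode: "antipode T\<^sub>2 (\<phi> a) = \<phi> (antipode T\<^sub>1 a)" if a: "a \<in> carrier T\<^sub>1" for a
  proof (rule eqI[OF B.antipode_closed[OF \<phi>_closed[OF a]] \<phi>_closed[OF A.antipode_closed[OF a]]])
    fix m assume m: "m \<in> carrier M\<^sub>1"
    show "\<nu>\<^sub>2 (antipode T\<^sub>2 (\<phi> a)) (f m) = \<nu>\<^sub>2 (\<phi> (antipode T\<^sub>1 a)) (f m)"
      unfolding B.\<nu>_antipode[OF \<phi>_closed[OF a] f_closed[OF m]] f_inv[OF m, symmetric]
        \<phi>_\<nu>[OF a A.M.inv_closed[OF m]] \<phi>_\<nu>[OF A.antipode_closed[OF a] m] A.\<nu>_antipode[OF a m] ..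
  qed
  let ?TT = "tensor F\<^sub>S T\<^sub>2 T\<^sub>2"
  let ?\<beta> = "\<lambda>a b. pure_tensor F\<^sub>S T\<^sub>2 T\<^sub>2 (\<phi> a) (\<phi> b)"
  have bil: "bilinear_map F\<^sub>S T\<^sub>1 T\<^sub>1 ?TT ?\<beta>"
    by (rule bilinear_mapI)
       (simp_all add: \<phi>_closed add smult B.TT.AB.pure_tensor_closed B.TT.AB.pure_tensor_add_left
         B.TT.AB.pure_tensor_add_right B.TT.AB.pure_tensor_smult_left B.TT.AB.pure_tensor_smult_right)
  note lift = A.TT.AB.tensor_lift_pure[OF B.TT.AB.tensor_module bil] A.TT.AB.tensor_lift_add[OF B.TT.AB.tensor_module bil]
    A.TT.AB.tensor_lift_closed[OF B.TT.AB.tensor_module bil]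
  \<comment> \<open>The map induced on tensor squares transports matrix entries along
    \<open>f\<close> in both indices.\<close>
  have \<kappa>: "B.TT.\<kappa> (tensor_lift F\<^sub>S ?TT ?\<beta> s) (f x) (f y) = A.TT.\<kappa> s x y"
    if s: "s \<in> carrier (tensor F\<^sub>S T\<^sub>1 T\<^sub>1)" and x: "x \<in> carrier M\<^sub>1" and y: "y \<in> carrier M\<^sub>1" for s x y
    using s
  proof (induction rule: A.TT.AB.tensor_induct)
    case (pure a b)
    show ?case
      unfolding lift(1)[OF pure] A.TT.\<kappa>_pure[OF pure x y] B.TT.\<kappa>_pure[OF \<phi>_closed[OF pure(1)] \<phi>_closed[OF pure(2)] f_closed[OF x] f_closed[OF y]]
        \<phi>_\<nu>[OF pure(1) x] \<phi>_\<nu>[OF pure(2) y] ..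
  next
    case (add s t)
    show ?case
      unfolding lift(2)[OF add.hyps(1,2)] A.TT.\<kappa>_add[OF add.hyps(1,2) x y]
        B.TT.\<kappa>_add[OF lift(3)[OF add.hyps(1)] lift(3)[OF add.hyps(2)] f_closed[OF x] f_closed[OF y]] add.IH ..
  qed
  have comult: "comult T\<^sub>2 (\<phi> a) = tensor_lift F\<^sub>S ?TT ?\<beta> (comult T\<^sub>1 a)" if a: "a \<in> carrier T\<^sub>1" for a
  proof (rule B.TT.\<kappa>_inject)
    show "comult T\<^sub>2 (\<phi> a) \<in> carrier ?TT" by (rule B.comult_closed[OF \<phi>_closed[OF a]])
    show "tensor_lift F\<^sub>S ?TT ?\<beta> (comult T\<^sub>1 a) \<in> carrier ?TT" by (rule lift(3)[OF A.comult_closed[OF a]])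
    fix x' y' assume xy': "x' \<in> carrier M\<^sub>2" "y' \<in> carrier M\<^sub>2"
    then obtain x y where x: "x \<in> carrier M\<^sub>1" "x' = f x" and y: "y \<in> carrier M\<^sub>1" "y' = f y" using f_surj by blast
    have "f x = f y \<longleftrightarrow> x = y" using f_inj x y by (simp add: inj_on_eq_iff)
    then show "B.TT.\<kappa> (comult T\<^sub>2 (\<phi> a)) x' y' = B.TT.\<kappa> (tensor_lift F\<^sub>S ?TT ?\<beta> (comult T\<^sub>1 a)) x' y'"
      unfolding x(2) y(2) B.\<kappa>_comult[OF \<phi>_closed[OF a] f_closed[OF x(1)] f_closed[OF y(1)]] \<kappa>[OF A.comult_closed[OF a] x(1) y(1)]
        A.\<kappa>_comult[OF a x(1) y(1)] \<phi>_\<nu>[OF a x(1)] by simp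
  qed
  have "\<phi> \<in> ring_iso T\<^sub>1 T\<^sub>2"
    unfolding ring_iso_def using bij by (auto intro!: ring_hom_memI simp: \<phi>_closed mult add one)
  then have "\<phi> \<in> hopf_iso F\<^sub>S T\<^sub>1 T\<^sub>2"
    unfolding hopf_iso_def using smult comult counit antipode by simp
  then show ?thesis unfolding hopf_isomorphic_def by blast
qed

end

section \<open>From a Hopf algebra isomorphism to an equivariant group isomorphism\<close>

text \<open>A Hopf algebra isomorphism \<open>\<phi>\<close> is given by a matrix \<open>m\<close> over \<open>E\<close>. Compatibility with the comultiplication
  makes the entries of each row orthogonal idempotents, and compatibility with the counit makes their
  sum \<open>1\<close>; so \<open>m\<close> is the matrix of a map \<open>f\<close>.\<close>

lemma equivariant_iso_if_hopf_isomorphic: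
  assumes "hopf_isomorphic F\<^sub>S T\<^sub>1 T\<^sub>2"
  shows "\<exists>f\<in>iso M\<^sub>1 M\<^sub>2. \<forall>\<gamma>\<in>S. \<forall>m\<in>carrier M\<^sub>1. f (act\<^sub>1 \<gamma> m) = act\<^sub>2 \<gamma> (f m)"
proof -
  obtain \<phi> where \<phi>: "\<phi> \<in> hopf_iso F\<^sub>S T\<^sub>1 T\<^sub>2" using assms by (auto simp: hopf_isomorphic_def)
  let ?TT = "tensor F\<^sub>S T\<^sub>2 T\<^sub>2"
  let ?\<beta> = "\<lambda>a b. pure_tensor F\<^sub>S T\<^sub>2 T\<^sub>2 (\<phi> a) (\<phi> b)"
  have bij: "bij_betw \<phi> (carrier T\<^sub>1) (carrier T\<^sub>2)"
    and \<phi>_closed: "\<And>a. a \<in> carrier T\<^sub>1 \<Longrightarrow> \<phi> a \<in> carrier T\<^sub>2"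
    and add: "\<And>a b. a \<in> carrier T\<^sub>1 \<Longrightarrow> b \<in> carrier T\<^sub>1 \<Longrightarrow> \<phi> (a \<oplus>\<^bsub>T\<^sub>1\<^esub> b) = \<phi> a \<oplus>\<^bsub>T\<^sub>2\<^esub> \<phi> b"
    and mult: "\<And>a b. a \<in> carrier T\<^sub>1 \<Longrightarrow> b \<in> carrier T\<^sub>1 \<Longrightarrow> \<phi> (a \<otimes>\<^bsub>T\<^sub>1\<^esub> b) = \<phi> a \<otimes>\<^bsub>T\<^sub>2\<^esub> \<phi> b"
    and smult: "\<And>r a. r \<in> fixed_field E S \<Longrightarrow> a \<in> carrier T\<^sub>1 \<Longrightarrow> \<phi> (r \<odot>\<^bsub>T\<^sub>1\<^esub> a) = r \<odot>\<^bsub>T\<^sub>2\<^esub> \<phi> a"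
    and comult: "\<And>a. a \<in> carrier T\<^sub>1 \<Longrightarrow> comult T\<^sub>2 (\<phi> a) = tensor_lift F\<^sub>S ?TT ?\<beta> (comult T\<^sub>1 a)"
    and counit: "\<And>a. a \<in> carrier T\<^sub>1 \<Longrightarrow> counit T\<^sub>2 (\<phi> a) = counit T\<^sub>1 a"
    using \<phi> by (auto simp: hopf_iso_def ring_iso_def ring_hom_def bij_betw_def)
  \<comment> \<open>By duality a group element x, viewed in the group algebra over E, is the sum of
    \<open>p\<^sub>1 k x\<close> times \<open>g\<^sub>1 k\<close>. So \<open>m x y\<close> is the
    coefficient at y of the image of x under the E-linear extension of
    \<open>\<phi>\<close>.\<close>
  define m where "m = (\<lambda>x y. \<Oplus>k\<in>I\<^sub>1. p\<^sub>1 k x \<otimes> \<nu>\<^sub>2 (\<phi> (A.g\<^sub>T k)) y)"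
  have m_closed: "m x y \<in> carrier E" for x y
    unfolding m_def by (rule A.finsum_closed) (use A.p_closed A.g\<^sub>T \<phi>_closed B.\<nu>_closed in auto)
  \<comment> \<open>The coefficients of the expansion of a lie in the fixed field of
    \<open>S\<close>, so \<open>\<phi>\<close> commutes with them.\<close>
  have \<nu>\<phi>: "\<nu>\<^sub>2 (\<phi> a) y = (\<Oplus>x\<in>carrier M\<^sub>1. \<nu>\<^sub>1 a x \<otimes> m x y)"
    if a: "a \<in> carrier T\<^sub>1" and y: "y \<in> carrier M\<^sub>2" for a y
  proof -
    let ?l = "\<lambda>k. \<Oplus>x\<in>carrier M\<^sub>1. p\<^sub>1 k x \<otimes> \<nu>\<^sub>1 a x"
    have l: "?l k \<in> fixed_field E S" if "k \<in> I\<^sub>1" for k using A.C.functional_closed[OF that a] .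
    have hom: "abelian_group_hom T\<^sub>1 T\<^sub>2 \<phi>"
      by (rule abelian_group_hom_addI[OF A.C.A.abelian_group_axioms B.C.A.abelian_group_axioms \<phi>_closed add])
    have lg: "?l k \<odot>\<^bsub>T\<^sub>1\<^esub> A.g\<^sub>T k \<in> carrier T\<^sub>1" if "k \<in> I\<^sub>1" for k
      using l[OF that] A.g\<^sub>T(1)[OF that] by (intro A.C.A.smult_closed) auto
    have "\<phi> a = \<phi> (\<Oplus>\<^bsub>T\<^sub>1\<^esub>k\<in>I\<^sub>1. ?l k \<odot>\<^bsub>T\<^sub>1\<^esub> A.g\<^sub>T k)"
      by (rule arg_cong[where f = \<phi>, OF A.C.expansion[OF a]])
    also have "\<dots> = (\<Oplus>\<^bsub>T\<^sub>2\<^esub>k\<in>I\<^sub>1. \<phi> (?l k \<odot>\<^bsub>T\<^sub>1\<^esub> A.g\<^sub>T k))"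
      by (rule abelian_group_hom_finsum[OF hom A.finite_I lg])
    finally have "\<nu>\<^sub>2 (\<phi> a) y = (\<Oplus>k\<in>I\<^sub>1. \<nu>\<^sub>2 (\<phi> (?l k \<odot>\<^bsub>T\<^sub>1\<^esub> A.g\<^sub>T k)) y)"
      using B.C.\<nu>_finsum[OF A.finite_I y, of "\<lambda>k. \<phi> (?l k \<odot>\<^bsub>T\<^sub>1\<^esub> A.g\<^sub>T k)"] \<phi>_closed[OF lg] by simp
    also have "\<dots> = (\<Oplus>k\<in>I\<^sub>1. \<Oplus>x\<in>carrier M\<^sub>1. \<nu>\<^sub>1 a x \<otimes> (p\<^sub>1 k x \<otimes> \<nu>\<^sub>2 (\<phi> (A.g\<^sub>T k)) y))"
    proof (rule A.finsum_cong_closed)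
      fix k assume k: "k \<in> I\<^sub>1"
      note gk = \<phi>_closed[OF A.g\<^sub>T(1)[OF k]]
      have c: "p\<^sub>1 k x \<in> carrier E" "\<nu>\<^sub>1 a x \<in> carrier E" "\<nu>\<^sub>2 (\<phi> (A.g\<^sub>T k)) y \<in> carrier E" for x
        using A.p_closed[OF k] A.\<nu>_closed[OF a] B.\<nu>_closed[OF gk] by auto
      have "\<nu>\<^sub>2 (\<phi> (?l k \<odot>\<^bsub>T\<^sub>1\<^esub> A.g\<^sub>T k)) y = ?l k \<otimes> \<nu>\<^sub>2 (\<phi> (A.g\<^sub>T k)) y"
        unfolding smult[OF l[OF k] A.g\<^sub>T(1)[OF k]] B.\<nu>_smult[OF l[OF k] gk] ..
      also have "\<dots> = (\<Oplus>x\<in>carrier M\<^sub>1. p\<^sub>1 k x \<otimes> \<nu>\<^sub>1 a x \<otimes> \<nu>\<^sub>2 (\<phi> (A.g\<^sub>T k)) y)"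
        by (rule A.finsum_ldistr) (use c A.finite_M in auto)
      also have "\<dots> = (\<Oplus>x\<in>carrier M\<^sub>1. \<nu>\<^sub>1 a x \<otimes> (p\<^sub>1 k x \<otimes> \<nu>\<^sub>2 (\<phi> (A.g\<^sub>T k)) y))"
        by (rule A.finsum_cong_closed) (use c in \<open>auto simp: A.m_ac\<close>)
      finally show "\<nu>\<^sub>2 (\<phi> (?l k \<odot>\<^bsub>T\<^sub>1\<^esub> A.g\<^sub>T k)) y = (\<Oplus>x\<in>carrier M\<^sub>1. \<nu>\<^sub>1 a x \<otimes> (p\<^sub>1 k x \<otimes> \<nu>\<^sub>2 (\<phi> (A.g\<^sub>T k)) y))" .
      show "(\<Oplus>x\<in>carrier M\<^sub>1. \<nu>\<^sub>1 a x \<otimes> (p\<^sub>1 k x \<otimes> \<nu>\<^sub>2 (\<phi> (A.g\<^sub>T k)) y)) \<in> carrier E"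
        by (rule A.finsum_closed) (use c in auto)
    qed
    also have "\<dots> = (\<Oplus>x\<in>carrier M\<^sub>1. \<Oplus>k\<in>I\<^sub>1. \<nu>\<^sub>1 a x \<otimes> (p\<^sub>1 k x \<otimes> \<nu>\<^sub>2 (\<phi> (A.g\<^sub>T k)) y))"
      by (rule A.finsum_swap)
         (use A.finite_I A.finite_M A.p_closed A.\<nu>_closed[OF a] B.\<nu>_closed \<phi>_closed A.g\<^sub>T in auto)
    also have "\<dots> = (\<Oplus>x\<in>carrier M\<^sub>1. \<nu>\<^sub>1 a x \<otimes> m x y)"
      unfolding m_def
      by (rule A.finsum_cong_closed, rule A.finsum_rdistr[symmetric])
         (use A.finite_I A.p_closed A.\<nu>_closed[OF a] B.\<nu>_closed \<phi>_closed A.g\<^sub>T in \<open>auto intro!: A.finsum_closed\<close>)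
    finally show ?thesis .
  qed
  have gT_\<nu>\<phi>: "\<nu>\<^sub>2 (\<phi> (A.g\<^sub>T k)) y = (\<Oplus>x\<in>carrier M\<^sub>1. g\<^sub>1 k x \<otimes> m x y)" if "k \<in> I\<^sub>1" "y \<in> carrier M\<^sub>2" for k y
    using \<nu>\<phi>[OF A.g\<^sub>T(1)[OF that(1)] that(2)] A.g\<^sub>T(2)[OF that(1)] by simp
  have bil: "bilinear_map F\<^sub>S T\<^sub>1 T\<^sub>1 ?TT ?\<beta>"
    by (rule bilinear_mapI)
       (simp_all add: \<phi>_closed add smult B.TT.AB.pure_tensor_closed B.TT.AB.pure_tensor_add_left
         B.TT.AB.pure_tensor_add_right B.TT.AB.pure_tensor_smult_left B.TT.AB.pure_tensor_smult_right)
  note lift = A.TT.AB.tensor_lift_pure[OF B.TT.AB.tensor_module bil] A.TT.AB.tensor_lift_add[OF B.TT.AB.tensor_module bil]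
    A.TT.AB.tensor_lift_closed[OF B.TT.AB.tensor_module bil]
  \<comment> \<open>On tensor squares the induced map acts by the matrix in each index.\<close>
  have \<kappa>: "B.TT.\<kappa> (tensor_lift F\<^sub>S ?TT ?\<beta> s) y z
      = (\<Oplus>x\<in>carrier M\<^sub>1. \<Oplus>x'\<in>carrier M\<^sub>1. A.TT.\<kappa> s x x' \<otimes> (m x y \<otimes> m x' z))"
    if s: "s \<in> carrier (tensor F\<^sub>S T\<^sub>1 T\<^sub>1)" and y: "y \<in> carrier M\<^sub>2" and z: "z \<in> carrier M\<^sub>2" for s y z
    using s
  proof (induction rule: A.TT.AB.tensor_induct)
    case (pure a b)
    have c: "\<nu>\<^sub>1 a x \<in> carrier E" "\<nu>\<^sub>1 b x \<in> carrier E" for x using A.\<nu>_closed pure by auto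
    have sc: "(\<Oplus>x'\<in>carrier M\<^sub>1. \<nu>\<^sub>1 b x' \<otimes> m x' z) \<in> carrier E"
      by (rule A.finsum_closed) (use c m_closed in auto)
    have "B.TT.\<kappa> (tensor_lift F\<^sub>S ?TT ?\<beta> (pure_tensor F\<^sub>S T\<^sub>1 T\<^sub>1 a b)) y z
        = (\<Oplus>x\<in>carrier M\<^sub>1. \<nu>\<^sub>1 a x \<otimes> m x y) \<otimes> (\<Oplus>x'\<in>carrier M\<^sub>1. \<nu>\<^sub>1 b x' \<otimes> m x' z)"
      unfolding lift(1)[OF pure] B.TT.\<kappa>_pure[OF \<phi>_closed[OF pure(1)] \<phi>_closed[OF pure(2)] y z]
        \<nu>\<phi>[OF pure(1) y] \<nu>\<phi>[OF pure(2) z] ..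
    also have "\<dots> = (\<Oplus>x\<in>carrier M\<^sub>1. \<nu>\<^sub>1 a x \<otimes> m x y \<otimes> (\<Oplus>x'\<in>carrier M\<^sub>1. \<nu>\<^sub>1 b x' \<otimes> m x' z))"
      by (rule A.finsum_ldistr) (use c m_closed sc A.finite_M in auto)
    also have "\<dots> = (\<Oplus>x\<in>carrier M\<^sub>1. \<Oplus>x'\<in>carrier M\<^sub>1. \<nu>\<^sub>1 a x \<otimes> m x y \<otimes> (\<nu>\<^sub>1 b x' \<otimes> m x' z))"
      by (rule A.finsum_cong_closed, rule A.finsum_rdistr)
         (use c m_closed A.finite_M in \<open>auto intro!: A.finsum_closed\<close>)
    also have "\<dots> = (\<Oplus>x\<in>carrier M\<^sub>1. \<Oplus>x'\<in>carrier M\<^sub>1. A.TT.\<kappa> (pure_tensor F\<^sub>S T\<^sub>1 T\<^sub>1 a b) x x' \<otimes> (m x y \<otimes> m x' z))"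
    proof (intro A.finsum_cong_closed)
      fix x x' assume x: "x \<in> carrier M\<^sub>1" "x' \<in> carrier M\<^sub>1"
      show "\<nu>\<^sub>1 a x \<otimes> m x y \<otimes> (\<nu>\<^sub>1 b x' \<otimes> m x' z) = A.TT.\<kappa> (pure_tensor F\<^sub>S T\<^sub>1 T\<^sub>1 a b) x x' \<otimes> (m x y \<otimes> m x' z)"
        unfolding A.TT.\<kappa>_pure[OF pure x] using c m_closed by (simp add: A.m_ac)
    qed (use A.TT.\<kappa>_closed[OF A.TT.AB.pure_tensor_closed[OF pure]] m_closed in \<open>auto intro!: A.finsum_closed\<close>)
    finally show ?case .
  next
    case (add s t)
    note kc = A.TT.\<kappa>_closed[OF add.hyps(1)] A.TT.\<kappa>_closed[OF add.hyps(2)]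
    have "(\<Oplus>x\<in>carrier M\<^sub>1. \<Oplus>x'\<in>carrier M\<^sub>1. A.TT.\<kappa> (s \<oplus>\<^bsub>tensor F\<^sub>S T\<^sub>1 T\<^sub>1\<^esub> t) x x' \<otimes> (m x y \<otimes> m x' z))
      = (\<Oplus>x\<in>carrier M\<^sub>1. (\<Oplus>x'\<in>carrier M\<^sub>1. A.TT.\<kappa> s x x' \<otimes> (m x y \<otimes> m x' z))
           \<oplus> (\<Oplus>x'\<in>carrier M\<^sub>1. A.TT.\<kappa> t x x' \<otimes> (m x y \<otimes> m x' z)))"
    proof (rule A.finsum_cong_closed)
      fix x assume x: "x \<in> carrier M\<^sub>1"
      have "(\<Oplus>x'\<in>carrier M\<^sub>1. A.TT.\<kappa> (s \<oplus>\<^bsub>tensor F\<^sub>S T\<^sub>1 T\<^sub>1\<^esub> t) x x' \<otimes> (m x y \<otimes> m x' z))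
        = (\<Oplus>x'\<in>carrier M\<^sub>1. A.TT.\<kappa> s x x' \<otimes> (m x y \<otimes> m x' z) \<oplus> A.TT.\<kappa> t x x' \<otimes> (m x y \<otimes> m x' z))"
        by (rule A.finsum_cong_closed)
           (use x kc m_closed in \<open>auto simp: A.TT.\<kappa>_add[OF add.hyps(1,2)] A.l_distr\<close>)
      also have "\<dots> = (\<Oplus>x'\<in>carrier M\<^sub>1. A.TT.\<kappa> s x x' \<otimes> (m x y \<otimes> m x' z)) \<oplus> (\<Oplus>x'\<in>carrier M\<^sub>1. A.TT.\<kappa> t x x' \<otimes> (m x y \<otimes> m x' z))"
        by (rule A.finsum_addf) (use x kc m_closed in auto)
      finally show "(\<Oplus>x'\<in>carrier M\<^sub>1. A.TT.\<kappa> (s \<oplus>\<^bsub>tensor F\<^sub>S T\<^sub>1 T\<^sub>1\<^esub> t) x x' \<otimes> (m x y \<otimes> m x' z))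
        = (\<Oplus>x'\<in>carrier M\<^sub>1. A.TT.\<kappa> s x x' \<otimes> (m x y \<otimes> m x' z)) \<oplus> (\<Oplus>x'\<in>carrier M\<^sub>1. A.TT.\<kappa> t x x' \<otimes> (m x y \<otimes> m x' z))" .
    qed (use kc m_closed in \<open>auto intro!: A.finsum_closed\<close>)
    also have "\<dots> = (\<Oplus>x\<in>carrier M\<^sub>1. \<Oplus>x'\<in>carrier M\<^sub>1. A.TT.\<kappa> s x x' \<otimes> (m x y \<otimes> m x' z))
           \<oplus> (\<Oplus>x\<in>carrier M\<^sub>1. \<Oplus>x'\<in>carrier M\<^sub>1. A.TT.\<kappa> t x x' \<otimes> (m x y \<otimes> m x' z))"
      by (rule A.finsum_addf) (use kc m_closed in \<open>auto intro!: A.finsum_closed\<close>)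
    finally show ?case
      unfolding lift(2)[OF add.hyps(1,2)] B.TT.\<kappa>_add[OF lift(3)[OF add.hyps(1)] lift(3)[OF add.hyps(2)] y z] add.IH
      by simp
  qed
  \<comment> \<open>Both sides, as functions of x, are paired with \<open>g\<^sub>1 k\<close>. As
    the comultiplication lives on the diagonal, the left pairing is the entry at (y, z) of the image
    of the comultiplication of \<open>g\<^sub>1 k\<close>, the right one that of the
    comultiplication of its image.\<close>
  have orth: "m x y \<otimes> m x z = (if y = z then m x y else \<zero>)"
    if x: "x \<in> carrier M\<^sub>1" and y: "y \<in> carrier M\<^sub>2" and z: "z \<in> carrier M\<^sub>2" for x y z
  proof (rule A.dual_separates[OF _ _ _ x, where a = "\<lambda>x. m x y \<otimes> m x z" and b = "\<lambda>x. if y = z then m x y else \<zero>"])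
    fix k assume k: "k \<in> I\<^sub>1"
    note gT = A.g\<^sub>T(1)[OF k]
    have "(\<Oplus>x\<in>carrier M\<^sub>1. g\<^sub>1 k x \<otimes> (m x y \<otimes> m x z))
        = (\<Oplus>x\<in>carrier M\<^sub>1. \<Oplus>x'\<in>carrier M\<^sub>1. A.TT.\<kappa> (comult T\<^sub>1 (A.g\<^sub>T k)) x x' \<otimes> (m x y \<otimes> m x' z))"
    proof (rule A.finsum_cong_closed)
      fix x assume x: "x \<in> carrier M\<^sub>1"
      have "(\<Oplus>x'\<in>carrier M\<^sub>1. A.TT.\<kappa> (comult T\<^sub>1 (A.g\<^sub>T k)) x x' \<otimes> (m x y \<otimes> m x' z))
          = A.TT.\<kappa> (comult T\<^sub>1 (A.g\<^sub>T k)) x x \<otimes> (m x y \<otimes> m x z)"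
        by (rule A.finsum_delta)
           (use x A.finite_M m_closed A.\<kappa>_comult[OF gT] A.\<nu>_closed[OF gT] in auto)
      then show "g\<^sub>1 k x \<otimes> (m x y \<otimes> m x z)
          = (\<Oplus>x'\<in>carrier M\<^sub>1. A.TT.\<kappa> (comult T\<^sub>1 (A.g\<^sub>T k)) x x' \<otimes> (m x y \<otimes> m x' z))"
        using A.\<kappa>_comult[OF gT x x] A.g\<^sub>T(2)[OF k] by simp
      show "(\<Oplus>x'\<in>carrier M\<^sub>1. A.TT.\<kappa> (comult T\<^sub>1 (A.g\<^sub>T k)) x x' \<otimes> (m x y \<otimes> m x' z)) \<in> carrier E"
        by (rule A.finsum_closed) (use x m_closed A.TT.\<kappa>_closed[OF A.comult_closed[OF gT]] in auto)
    qed
    also have "\<dots> = B.TT.\<kappa> (comult T\<^sub>2 (\<phi> (A.g\<^sub>T k))) y z"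
      unfolding comult[OF gT] by (rule \<kappa>[OF A.comult_closed[OF gT] y z, symmetric])
    also have "\<dots> = (if y = z then \<nu>\<^sub>2 (\<phi> (A.g\<^sub>T k)) y else \<zero>)" by (rule B.\<kappa>_comult[OF \<phi>_closed[OF gT] y z])
    also have "\<dots> = (\<Oplus>x\<in>carrier M\<^sub>1. g\<^sub>1 k x \<otimes> (if y = z then m x y else \<zero>))"
    proof (cases "y = z")
      case True
      then show ?thesis using gT_\<nu>\<phi>[OF k y] by simp
    next
      case False
      have "(\<Oplus>x\<in>carrier M\<^sub>1. g\<^sub>1 k x \<otimes> (if y = z then m x y else \<zero>)) = \<zero>"
        by (rule A.finsum_all_zero) (use False A.g_closed[OF k] in auto)
      then show ?thesis using False by simp
    qed
    finally show "(\<Oplus>x\<in>carrier M\<^sub>1. g\<^sub>1 k x \<otimes> (m x y \<otimes> m x z))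
        = (\<Oplus>x\<in>carrier M\<^sub>1. g\<^sub>1 k x \<otimes> (if y = z then m x y else \<zero>))" .
  qed (use m_closed in auto)
  \<comment> \<open>The pairings with \<open>g\<^sub>1 k\<close> are the counit of its image and the
    counit of \<open>g\<^sub>1 k\<close> itself.\<close>
  have total: "(\<Oplus>y\<in>carrier M\<^sub>2. m x y) = \<one>" if x: "x \<in> carrier M\<^sub>1" for x
  proof (rule A.dual_separates[OF _ _ _ x, where a = "\<lambda>x. \<Oplus>y\<in>carrier M\<^sub>2. m x y" and b = "\<lambda>_. \<one>"])
    fix k assume k: "k \<in> I\<^sub>1"
    note gT = A.g\<^sub>T(1)[OF k]
    have "(\<Oplus>x\<in>carrier M\<^sub>1. g\<^sub>1 k x \<otimes> (\<Oplus>y\<in>carrier M\<^sub>2. m x y)) = (\<Oplus>x\<in>carrier M\<^sub>1. \<Oplus>y\<in>carrier M\<^sub>2. g\<^sub>1 k x \<otimes> m x y)"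
      by (rule A.finsum_cong_closed, rule A.finsum_rdistr)
         (use A.g_closed[OF k] m_closed B.finite_M in \<open>auto intro!: A.finsum_closed\<close>)
    also have "\<dots> = (\<Oplus>y\<in>carrier M\<^sub>2. \<Oplus>x\<in>carrier M\<^sub>1. g\<^sub>1 k x \<otimes> m x y)"
      by (rule A.finsum_swap) (use A.g_closed[OF k] m_closed A.finite_M B.finite_M in auto)
    also have "\<dots> = (\<Oplus>y\<in>carrier M\<^sub>2. \<nu>\<^sub>2 (\<phi> (A.g\<^sub>T k)) y)"
      by (rule A.finsum_cong_closed) (use gT_\<nu>\<phi>[OF k] A.g_closed[OF k] m_closed in \<open>auto intro!: A.finsum_closed\<close>)
    also have "\<dots> = counit T\<^sub>1 (A.g\<^sub>T k)" using B.counit_eq[OF \<phi>_closed[OF gT]] counit[OF gT] by simp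
    also have "\<dots> = (\<Oplus>x\<in>carrier M\<^sub>1. g\<^sub>1 k x)" using A.counit_eq[OF gT] A.g\<^sub>T(2)[OF k] by simp
    also have "\<dots> = (\<Oplus>x\<in>carrier M\<^sub>1. g\<^sub>1 k x \<otimes> \<one>)"
      by (rule A.finsum_cong_closed) (use A.g_closed[OF k] in auto)
    finally show "(\<Oplus>x\<in>carrier M\<^sub>1. g\<^sub>1 k x \<otimes> (\<Oplus>y\<in>carrier M\<^sub>2. m x y)) = (\<Oplus>x\<in>carrier M\<^sub>1. g\<^sub>1 k x \<otimes> \<one>)" .
  qed (use m_closed in \<open>auto intro!: A.finsum_closed\<close>)
  have "\<exists>y. y \<in> carrier M\<^sub>2 \<and> (\<forall>z\<in>carrier M\<^sub>2. m x z = (if z = y then \<one> else \<zero>))" if x: "x \<in> carrier M\<^sub>1" for x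
  proof -
    have "\<exists>y\<in>carrier M\<^sub>2. m x y \<noteq> \<zero>"
    proof (rule ccontr)
      assume "\<not> ?thesis"
      then have "(\<Oplus>y\<in>carrier M\<^sub>2. m x y) = \<zero>" by (intro A.finsum_all_zero) auto
      then show False using total[OF x] by simp
    qed
    then obtain y where y: "y \<in> carrier M\<^sub>2" "m x y \<noteq> \<zero>" by blast
    \<comment> \<open>A nonzero idempotent of a field is 1, and orthogonality then annihilates the
      rest of the row.\<close>
    have "m x y \<otimes> m x y = m x y \<otimes> \<one>" using orth[OF x y(1) y(1)] m_closed by simp
    moreover have "\<one> \<in> carrier E" by simp
    ultimately have 1: "m x y = \<one>" using A.m_lcancel[OF y(2) m_closed m_closed] by blast
    have "m x z = \<zero>" if "z \<in> carrier M\<^sub>2" "z \<noteq> y" for z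
      using orth[OF x y(1) that(1)] that(2) 1 m_closed by simp
    then show ?thesis using y 1 by (intro exI[of _ y]) auto
  qed
  then obtain f where f: "f x \<in> carrier M\<^sub>2" "\<forall>z\<in>carrier M\<^sub>2. m x z = (if z = f x then \<one> else \<zero>)"
    if "x \<in> carrier M\<^sub>1" for x by metis
  have delta_eq: "P = Q" if "(if P then \<one> else \<zero>) = (if Q then \<one> else \<zero>)" for P Q
    using that by (auto split: if_splits)
  have \<nu>f: "\<nu>\<^sub>2 (\<phi> a) y = (\<Oplus>x\<in>carrier M\<^sub>1. \<nu>\<^sub>1 a x \<otimes> (if f x = y then \<one> else \<zero>))"
    if a: "a \<in> carrier T\<^sub>1" and y: "y \<in> carrier M\<^sub>2" for a y
    unfolding \<nu>\<phi>[OF a y]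
    by (rule A.finsum_cong_closed) (use f(2) y A.\<nu>_closed[OF a] in auto)
  \<comment> \<open>For y = f x, the conditions that f z equals \<gamma> y and that f sends
    \<gamma>^-1 z to y have indicator functions with equal pairings, because
    \<open>g\<^sub>1 k\<close> and its image are both fixed by \<gamma>. At the image of x under
    \<gamma> the second condition holds, hence the first.\<close>
  have f_act: "f (act\<^sub>1 \<gamma> x) = act\<^sub>2 \<gamma> (f x)" if \<gamma>: "\<gamma> \<in> S" and x: "x \<in> carrier M\<^sub>1" for \<gamma> x
  proof -
    have \<gamma>G: "\<gamma> \<in> carrier G" by (rule \<gamma>_carrier[OF \<gamma>])
    let ?y = "f x" and ?i = "inv\<^bsub>G\<^esub> \<gamma>"
    have y: "?y \<in> carrier M\<^sub>2" "act\<^sub>2 \<gamma> ?y \<in> carrier M\<^sub>2" using f(1)[OF x] \<gamma>G by auto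
    have "(if f z = act\<^sub>2 \<gamma> ?y then \<one> else \<zero>) = (if f (act\<^sub>1 ?i z) = ?y then \<one> else \<zero>)" if z: "z \<in> carrier M\<^sub>1" for z
    proof (rule A.dual_separates[OF _ _ _ z, where a = "\<lambda>z. if f z = act\<^sub>2 \<gamma> ?y then \<one> else \<zero>"
          and b = "\<lambda>z. if f (act\<^sub>1 ?i z) = ?y then \<one> else \<zero>"])
      fix k assume k: "k \<in> I\<^sub>1"
      note gT = A.g\<^sub>T(1)[OF k] and gc = A.g_closed[OF k]
      have gS: "g\<^sub>1 k \<in> A.fixed_elems S" using A.\<nu>_fixed[OF gT] A.g\<^sub>T(2)[OF k] by simp
      have "(\<Oplus>z\<in>carrier M\<^sub>1. g\<^sub>1 k z \<otimes> (if f z = act\<^sub>2 \<gamma> ?y then \<one> else \<zero>)) = \<nu>\<^sub>2 (\<phi> (A.g\<^sub>T k)) (act\<^sub>2 \<gamma> ?y)"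
        using \<nu>f[OF gT y(2)] A.g\<^sub>T(2)[OF k] by simp
      also have "\<dots> = \<gamma> (\<nu>\<^sub>2 (\<phi> (A.g\<^sub>T k)) ?y)"
        by (rule B.fixed_elemsD(3)[OF B.\<nu>_fixed[OF \<phi>_closed[OF gT]] \<gamma> y(1)])
      also have "\<dots> = \<gamma> (\<Oplus>z\<in>carrier M\<^sub>1. g\<^sub>1 k z \<otimes> (if f z = ?y then \<one> else \<zero>))"
        using \<nu>f[OF gT y(1)] A.g\<^sub>T(2)[OF k] by simp
      also have "\<dots> = (\<Oplus>z\<in>carrier M\<^sub>1. \<gamma> (g\<^sub>1 k z \<otimes> (if f z = ?y then \<one> else \<zero>)))"
        by (rule A.aut_finsum[OF \<gamma>G A.finite_M]) (use gc in auto)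
      also have "\<dots> = (\<Oplus>z\<in>carrier M\<^sub>1. g\<^sub>1 k (act\<^sub>1 \<gamma> z) \<otimes> (if f (act\<^sub>1 ?i (act\<^sub>1 \<gamma> z)) = ?y then \<one> else \<zero>))"
        by (rule A.finsum_cong_closed)
           (use gc \<gamma>G A.fixed_elemsD(3)[OF gS \<gamma>] A.act_inv(2)[OF \<gamma>G] in auto)
      also have "\<dots> = (\<Oplus>z\<in>carrier M\<^sub>1. g\<^sub>1 k z \<otimes> (if f (act\<^sub>1 ?i z) = ?y then \<one> else \<zero>))"
        by (rule A.act_sum[OF \<gamma>G]) (use gc in auto)
      finally show "(\<Oplus>z\<in>carrier M\<^sub>1. g\<^sub>1 k z \<otimes> (if f z = act\<^sub>2 \<gamma> ?y then \<one> else \<zero>))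
        = (\<Oplus>z\<in>carrier M\<^sub>1. g\<^sub>1 k z \<otimes> (if f (act\<^sub>1 ?i z) = ?y then \<one> else \<zero>))" .
    qed auto
    from delta_eq[OF this[OF A.act_closed[OF \<gamma>G x]]] show ?thesis
      using A.act_inv(2)[OF \<gamma>G x] by simp
  qed
  \<comment> \<open>With y the image of the product of x and x', the conditions f(z z') = y and f(z)
    f(z') = y are compared. Pairing their indicators with \<open>g\<^sub>1 k\<close> in z and
    \<open>g\<^sub>1 l\<close> in z' yields the coordinate at y of the image of the product and of
    the product of the images.\<close>
  have f_mult: "f (x \<otimes>\<^bsub>M\<^sub>1\<^esub> x') = f x \<otimes>\<^bsub>M\<^sub>2\<^esub> f x'" if x: "x \<in> carrier M\<^sub>1" and x': "x' \<in> carrier M\<^sub>1" for x x'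
  proof -
    let ?y = "f (x \<otimes>\<^bsub>M\<^sub>1\<^esub> x')"
    have y: "?y \<in> carrier M\<^sub>2" using f(1) x x' by simp
    let ?c = "\<lambda>z z'. if f (z \<otimes>\<^bsub>M\<^sub>1\<^esub> z') = ?y then \<one> else \<zero>"
    let ?d = "\<lambda>z z'. if f z \<otimes>\<^bsub>M\<^sub>2\<^esub> f z' = ?y then \<one> else \<zero>"
    have cE: "?c z z' \<in> carrier E" "?d z z' \<in> carrier E" for z z' by auto
    have sums: "(\<Oplus>z\<in>carrier M\<^sub>1. g\<^sub>1 k z \<otimes> (\<Oplus>z'\<in>carrier M\<^sub>1. g\<^sub>1 l z' \<otimes> ?c z z'))
        = (\<Oplus>z\<in>carrier M\<^sub>1. g\<^sub>1 k z \<otimes> (\<Oplus>z'\<in>carrier M\<^sub>1. g\<^sub>1 l z' \<otimes> ?d z z'))"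
      if k: "k \<in> I\<^sub>1" and l: "l \<in> I\<^sub>1" for k l
    proof -
      note gk = A.g\<^sub>T(1)[OF k] and gl = A.g\<^sub>T(1)[OF l]
      note gkl = A.g\<^sub>T(2)[OF k] A.g\<^sub>T(2)[OF l]
      note gc = A.g_closed[OF k] A.g_closed[OF l]
      have "(\<Oplus>z\<in>carrier M\<^sub>1. g\<^sub>1 k z \<otimes> (\<Oplus>z'\<in>carrier M\<^sub>1. g\<^sub>1 l z' \<otimes> ?c z z'))
          = (\<Oplus>z\<in>carrier M\<^sub>1. \<Oplus>w\<in>carrier M\<^sub>1. g\<^sub>1 k z \<otimes> g\<^sub>1 l (inv\<^bsub>M\<^sub>1\<^esub> z \<otimes>\<^bsub>M\<^sub>1\<^esub> w) \<otimes> (if f w = ?y then \<one> else \<zero>))"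
      proof (rule A.finsum_cong_closed)
        fix z assume z: "z \<in> carrier M\<^sub>1"
        have inj: "inj_on (\<lambda>w. inv\<^bsub>M\<^sub>1\<^esub> z \<otimes>\<^bsub>M\<^sub>1\<^esub> w) (carrier M\<^sub>1)" using z by (auto simp: inj_on_def)
        have im: "(\<lambda>w. inv\<^bsub>M\<^sub>1\<^esub> z \<otimes>\<^bsub>M\<^sub>1\<^esub> w) ` carrier M\<^sub>1 = carrier M\<^sub>1"
          \<comment> \<open>Substituting z^-1 w for z' turns the double sum into a
            convolution.\<close>
          by (rule A.M.surj_const_mult) (use z in simp)
        have "(\<Oplus>z'\<in>carrier M\<^sub>1. g\<^sub>1 l z' \<otimes> ?c z z') = (\<Oplus>z'\<in>(\<lambda>w. inv\<^bsub>M\<^sub>1\<^esub> z \<otimes>\<^bsub>M\<^sub>1\<^esub> w) ` carrier M\<^sub>1. g\<^sub>1 l z' \<otimes> ?c z z')"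
          unfolding im ..
        also have "\<dots> = (\<Oplus>w\<in>carrier M\<^sub>1. g\<^sub>1 l (inv\<^bsub>M\<^sub>1\<^esub> z \<otimes>\<^bsub>M\<^sub>1\<^esub> w) \<otimes> ?c z (inv\<^bsub>M\<^sub>1\<^esub> z \<otimes>\<^bsub>M\<^sub>1\<^esub> w))"
          by (rule A.finsum_reindex) (use gc inj in auto)
        also have "\<dots> = (\<Oplus>w\<in>carrier M\<^sub>1. g\<^sub>1 l (inv\<^bsub>M\<^sub>1\<^esub> z \<otimes>\<^bsub>M\<^sub>1\<^esub> w) \<otimes> (if f w = ?y then \<one> else \<zero>))"
        proof (rule A.finsum_cong_closed)
          fix w assume w: "w \<in> carrier M\<^sub>1"
          have "z \<otimes>\<^bsub>M\<^sub>1\<^esub> (inv\<^bsub>M\<^sub>1\<^esub> z \<otimes>\<^bsub>M\<^sub>1\<^esub> w) = w" using z w by (simp flip: A.M.m_assoc)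
          then show "g\<^sub>1 l (inv\<^bsub>M\<^sub>1\<^esub> z \<otimes>\<^bsub>M\<^sub>1\<^esub> w) \<otimes> ?c z (inv\<^bsub>M\<^sub>1\<^esub> z \<otimes>\<^bsub>M\<^sub>1\<^esub> w)
              = g\<^sub>1 l (inv\<^bsub>M\<^sub>1\<^esub> z \<otimes>\<^bsub>M\<^sub>1\<^esub> w) \<otimes> (if f w = ?y then \<one> else \<zero>)" by simp
        qed (use gc in auto)
        finally have "g\<^sub>1 k z \<otimes> (\<Oplus>z'\<in>carrier M\<^sub>1. g\<^sub>1 l z' \<otimes> ?c z z')
            = g\<^sub>1 k z \<otimes> (\<Oplus>w\<in>carrier M\<^sub>1. g\<^sub>1 l (inv\<^bsub>M\<^sub>1\<^esub> z \<otimes>\<^bsub>M\<^sub>1\<^esub> w) \<otimes> (if f w = ?y then \<one> else \<zero>))" by simp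
        also have "\<dots> = (\<Oplus>w\<in>carrier M\<^sub>1. g\<^sub>1 k z \<otimes> (g\<^sub>1 l (inv\<^bsub>M\<^sub>1\<^esub> z \<otimes>\<^bsub>M\<^sub>1\<^esub> w) \<otimes> (if f w = ?y then \<one> else \<zero>)))"
          by (rule A.finsum_rdistr) (use gc A.finite_M in auto)
        also have "\<dots> = (\<Oplus>w\<in>carrier M\<^sub>1. g\<^sub>1 k z \<otimes> g\<^sub>1 l (inv\<^bsub>M\<^sub>1\<^esub> z \<otimes>\<^bsub>M\<^sub>1\<^esub> w) \<otimes> (if f w = ?y then \<one> else \<zero>))"
          by (rule A.finsum_cong_closed) (use gc in \<open>auto simp: A.m_assoc\<close>)
        finally show "g\<^sub>1 k z \<otimes> (\<Oplus>z'\<in>carrier M\<^sub>1. g\<^sub>1 l z' \<otimes> ?c z z')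
            = (\<Oplus>w\<in>carrier M\<^sub>1. g\<^sub>1 k z \<otimes> g\<^sub>1 l (inv\<^bsub>M\<^sub>1\<^esub> z \<otimes>\<^bsub>M\<^sub>1\<^esub> w) \<otimes> (if f w = ?y then \<one> else \<zero>))" .
      qed (use gc in \<open>auto intro!: A.finsum_closed\<close>)
      also have "\<dots> = (\<Oplus>w\<in>carrier M\<^sub>1. \<Oplus>z\<in>carrier M\<^sub>1. g\<^sub>1 k z \<otimes> g\<^sub>1 l (inv\<^bsub>M\<^sub>1\<^esub> z \<otimes>\<^bsub>M\<^sub>1\<^esub> w) \<otimes> (if f w = ?y then \<one> else \<zero>))"
        by (rule A.finsum_swap) (use gc A.finite_M in auto)
      also have "\<dots> = (\<Oplus>w\<in>carrier M\<^sub>1. \<nu>\<^sub>1 (A.g\<^sub>T k \<otimes>\<^bsub>T\<^sub>1\<^esub> A.g\<^sub>T l) w \<otimes> (if f w = ?y then \<one> else \<zero>))"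
      proof (rule A.finsum_cong_closed)
        fix w assume w: "w \<in> carrier M\<^sub>1"
        have "(\<Oplus>z\<in>carrier M\<^sub>1. g\<^sub>1 k z \<otimes> g\<^sub>1 l (inv\<^bsub>M\<^sub>1\<^esub> z \<otimes>\<^bsub>M\<^sub>1\<^esub> w) \<otimes> (if f w = ?y then \<one> else \<zero>))
            = (\<Oplus>z\<in>carrier M\<^sub>1. g\<^sub>1 k z \<otimes> g\<^sub>1 l (inv\<^bsub>M\<^sub>1\<^esub> z \<otimes>\<^bsub>M\<^sub>1\<^esub> w)) \<otimes> (if f w = ?y then \<one> else \<zero>)"
          by (rule A.finsum_ldistr[symmetric]) (use gc A.finite_M in auto)
        then show "(\<Oplus>z\<in>carrier M\<^sub>1. g\<^sub>1 k z \<otimes> g\<^sub>1 l (inv\<^bsub>M\<^sub>1\<^esub> z \<otimes>\<^bsub>M\<^sub>1\<^esub> w) \<otimes> (if f w = ?y then \<one> else \<zero>))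
            = \<nu>\<^sub>1 (A.g\<^sub>T k \<otimes>\<^bsub>T\<^sub>1\<^esub> A.g\<^sub>T l) w \<otimes> (if f w = ?y then \<one> else \<zero>)"
          using A.\<nu>_mult[OF gk gl w] gkl by simp
      qed (use A.\<nu>_closed[OF A.mult_closed[OF gk gl]] in auto)
      also have "\<dots> = \<nu>\<^sub>2 (\<phi> (A.g\<^sub>T k \<otimes>\<^bsub>T\<^sub>1\<^esub> A.g\<^sub>T l)) ?y"
        by (rule \<nu>f[OF A.mult_closed[OF gk gl] y, symmetric])
      also have "\<dots> = (\<Oplus>v\<in>carrier M\<^sub>2. \<nu>\<^sub>2 (\<phi> (A.g\<^sub>T k)) v \<otimes> \<nu>\<^sub>2 (\<phi> (A.g\<^sub>T l)) (inv\<^bsub>M\<^sub>2\<^esub> v \<otimes>\<^bsub>M\<^sub>2\<^esub> ?y))"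
        unfolding mult[OF gk gl] by (rule B.\<nu>_mult[OF \<phi>_closed[OF gk] \<phi>_closed[OF gl] y])
      also have "\<dots> = (\<Oplus>v\<in>carrier M\<^sub>2. \<Oplus>z\<in>carrier M\<^sub>1.
          g\<^sub>1 k z \<otimes> (if f z = v then \<one> else \<zero>) \<otimes> \<nu>\<^sub>2 (\<phi> (A.g\<^sub>T l)) (inv\<^bsub>M\<^sub>2\<^esub> v \<otimes>\<^bsub>M\<^sub>2\<^esub> ?y))"
      proof (rule A.finsum_cong_closed)
        fix v assume v: "v \<in> carrier M\<^sub>2"
        show "\<nu>\<^sub>2 (\<phi> (A.g\<^sub>T k)) v \<otimes> \<nu>\<^sub>2 (\<phi> (A.g\<^sub>T l)) (inv\<^bsub>M\<^sub>2\<^esub> v \<otimes>\<^bsub>M\<^sub>2\<^esub> ?y) = (\<Oplus>z\<in>carrier M\<^sub>1.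
          g\<^sub>1 k z \<otimes> (if f z = v then \<one> else \<zero>) \<otimes> \<nu>\<^sub>2 (\<phi> (A.g\<^sub>T l)) (inv\<^bsub>M\<^sub>2\<^esub> v \<otimes>\<^bsub>M\<^sub>2\<^esub> ?y))"
          unfolding \<nu>f[OF gk v] gkl
          by (rule A.finsum_ldistr) (use gc A.finite_M B.\<nu>_closed[OF \<phi>_closed[OF gl]] in auto)
      qed (use gc B.\<nu>_closed[OF \<phi>_closed[OF gl]] in \<open>auto intro!: A.finsum_closed\<close>)
      also have "\<dots> = (\<Oplus>z\<in>carrier M\<^sub>1. \<Oplus>v\<in>carrier M\<^sub>2.
          g\<^sub>1 k z \<otimes> (if f z = v then \<one> else \<zero>) \<otimes> \<nu>\<^sub>2 (\<phi> (A.g\<^sub>T l)) (inv\<^bsub>M\<^sub>2\<^esub> v \<otimes>\<^bsub>M\<^sub>2\<^esub> ?y))"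
        by (rule A.finsum_swap) (use gc A.finite_M B.finite_M B.\<nu>_closed[OF \<phi>_closed[OF gl]] in auto)
      also have "\<dots> = (\<Oplus>z\<in>carrier M\<^sub>1. g\<^sub>1 k z \<otimes> (\<Oplus>z'\<in>carrier M\<^sub>1. g\<^sub>1 l z' \<otimes> ?d z z'))"
      proof (rule A.finsum_cong_closed)
        fix z assume z: "z \<in> carrier M\<^sub>1"
        note fz = f(1)[OF z]
        have "(\<Oplus>v\<in>carrier M\<^sub>2. g\<^sub>1 k z \<otimes> (if f z = v then \<one> else \<zero>) \<otimes> \<nu>\<^sub>2 (\<phi> (A.g\<^sub>T l)) (inv\<^bsub>M\<^sub>2\<^esub> v \<otimes>\<^bsub>M\<^sub>2\<^esub> ?y))
            = g\<^sub>1 k z \<otimes> (if f z = f z then \<one> else \<zero>) \<otimes> \<nu>\<^sub>2 (\<phi> (A.g\<^sub>T l)) (inv\<^bsub>M\<^sub>2\<^esub> (f z) \<otimes>\<^bsub>M\<^sub>2\<^esub> ?y)"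
          by (rule A.finsum_delta) (use fz gc B.finite_M B.\<nu>_closed[OF \<phi>_closed[OF gl]] in auto)
        also have "\<dots> = g\<^sub>1 k z \<otimes> (\<Oplus>z'\<in>carrier M\<^sub>1. g\<^sub>1 l z' \<otimes> (if f z' = inv\<^bsub>M\<^sub>2\<^esub> (f z) \<otimes>\<^bsub>M\<^sub>2\<^esub> ?y then \<one> else \<zero>))"
          using gc fz y gkl \<nu>f[OF gl, of "inv\<^bsub>M\<^sub>2\<^esub> (f z) \<otimes>\<^bsub>M\<^sub>2\<^esub> ?y"] by simp
        also have "(\<Oplus>z'\<in>carrier M\<^sub>1. g\<^sub>1 l z' \<otimes> (if f z' = inv\<^bsub>M\<^sub>2\<^esub> (f z) \<otimes>\<^bsub>M\<^sub>2\<^esub> ?y then \<one> else \<zero>))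
            = (\<Oplus>z'\<in>carrier M\<^sub>1. g\<^sub>1 l z' \<otimes> ?d z z')"
        proof (rule A.finsum_cong_closed)
          fix z' assume z': "z' \<in> carrier M\<^sub>1"
          have "f z' = inv\<^bsub>M\<^sub>2\<^esub> (f z) \<otimes>\<^bsub>M\<^sub>2\<^esub> ?y \<longleftrightarrow> f z \<otimes>\<^bsub>M\<^sub>2\<^esub> f z' = ?y"
            using B.M.inv_solve_left[OF f(1)[OF z'] fz y] by auto
          then show "g\<^sub>1 l z' \<otimes> (if f z' = inv\<^bsub>M\<^sub>2\<^esub> (f z) \<otimes>\<^bsub>M\<^sub>2\<^esub> ?y then \<one> else \<zero>) = g\<^sub>1 l z' \<otimes> ?d z z'" by simp
        qed (use gc in auto)
        finally show "(\<Oplus>v\<in>carrier M\<^sub>2. g\<^sub>1 k z \<otimes> (if f z = v then \<one> else \<zero>) \<otimes> \<nu>\<^sub>2 (\<phi> (A.g\<^sub>T l)) (inv\<^bsub>M\<^sub>2\<^esub> v \<otimes>\<^bsub>M\<^sub>2\<^esub> ?y))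
            = g\<^sub>1 k z \<otimes> (\<Oplus>z'\<in>carrier M\<^sub>1. g\<^sub>1 l z' \<otimes> ?d z z')" .
      qed (use gc in \<open>auto intro!: A.finsum_closed\<close>)
      finally show ?thesis .
    qed
    have "?c x x' = ?d x x'"
    \<comment> \<open>Separation is applied twice: for each fixed l in the variable z, and then in
      z'.\<close>
    proof (rule A.dual_separates[OF _ _ _ x', where a = "?c x" and b = "?d x"])
      fix l assume l: "l \<in> I\<^sub>1"
      show "(\<Oplus>z'\<in>carrier M\<^sub>1. g\<^sub>1 l z' \<otimes> ?c x z') = (\<Oplus>z'\<in>carrier M\<^sub>1. g\<^sub>1 l z' \<otimes> ?d x z')"
        by (rule A.dual_separates[OF _ _ _ x, where a = "\<lambda>z. \<Oplus>z'\<in>carrier M\<^sub>1. g\<^sub>1 l z' \<otimes> ?c z z'"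
              and b = "\<lambda>z. \<Oplus>z'\<in>carrier M\<^sub>1. g\<^sub>1 l z' \<otimes> ?d z z'"])
           (use sums[OF _ l] A.g_closed[OF l] in \<open>auto intro!: A.finsum_closed\<close>)
    qed (rule cE)+
    from delta_eq[OF this] show ?thesis by simp
  qed
  \<comment> \<open>At a point y outside the image of f all elements of \<open>\<phi>\<close>
    applied to the first algebra would have coordinate 0. As \<open>\<phi>\<close> is onto, every
    \<open>g\<^sub>2 k\<close> would vanish at y, against duality at (y, y).\<close>
  have f_surj: "f ` carrier M\<^sub>1 = carrier M\<^sub>2"
  proof (rule ccontr)
    assume "f ` carrier M\<^sub>1 \<noteq> carrier M\<^sub>2"
    then obtain y where y: "y \<in> carrier M\<^sub>2" "y \<notin> f ` carrier M\<^sub>1" using f(1) by blast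
    have 0: "\<nu>\<^sub>2 b y = \<zero>" if b: "b \<in> carrier T\<^sub>2" for b
    proof -
      obtain a where a: "a \<in> carrier T\<^sub>1" "b = \<phi> a" using bij b by (auto simp: bij_betw_def)
      show ?thesis unfolding a(2) \<nu>f[OF a(1) y(1)]
        by (rule A.finsum_all_zero) (use y A.\<nu>_closed[OF a(1)] in auto)
    qed
    have "g\<^sub>2 k y = \<zero>" if "k \<in> I\<^sub>2" for k using 0[OF B.g\<^sub>T(1)[OF that]] B.g\<^sub>T(2)[OF that] by simp
    then have "(\<Oplus>k\<in>I\<^sub>2. p\<^sub>2 k y \<otimes> g\<^sub>2 k y) = \<zero>"
      by (intro A.finsum_all_zero) (use B.p_closed in auto)
    then show False using B.dual[OF y(1) y(1)] by simp
  qed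
  then have "inj_on f (carrier M\<^sub>1)"
    using card_eq A.finite_M by (intro eq_card_imp_inj_on) auto
  then have "f \<in> iso M\<^sub>1 M\<^sub>2"
    using f_surj f(1) f_mult by (auto simp: iso_def hom_def bij_betw_def)
  then show ?thesis using f_act by blast
qed

theorem hopf_isomorphic_iff:
  "hopf_isomorphic F\<^sub>S T\<^sub>1 T\<^sub>2 \<longleftrightarrow>
    (\<exists>f\<in>iso M\<^sub>1 M\<^sub>2. \<forall>\<gamma>\<in>S. \<forall>m\<in>carrier M\<^sub>1. f (act\<^sub>1 \<gamma> m) = act\<^sub>2 \<gamma> (f m))"
  using hopf_isomorphic_if_equivariant_iso equivariant_iso_if_hopf_isomorphic by blast

end

subsection \<open>Finite Galois extensions\<close>

context field
begin

lemma eval_as_sum: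
  assumes "set p \<subseteq> carrier R" "x \<in> carrier R"
  shows "eval p x = (\<Oplus>i\<in>{..<length p}. coeff p i \<otimes> x [^] i)"
  using assms(1)
proof (induction p)
  case Nil
  then show ?case by simp
next
  case (Cons a p)
  have "(\<Oplus>i\<in>{..<length (a # p)}. coeff (a # p) i \<otimes> x [^] i)
      = (\<Oplus>i\<in>insert (length p) {..<length p}. coeff (a # p) i \<otimes> x [^] i)"
    by (simp add: lessThan_Suc)
  also have "\<dots> = coeff (a # p) (length p) \<otimes> x [^] length p \<oplus> (\<Oplus>i\<in>{..<length p}. coeff (a # p) i \<otimes> x [^] i)"
    by (rule finsum_insert) (use Cons.prems assms(2) in auto)
  also have "(\<Oplus>i\<in>{..<length p}. coeff (a # p) i \<otimes> x [^] i) = (\<Oplus>i\<in>{..<length p}. coeff p i \<otimes> x [^] i)"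
    by (rule finsum_cong_closed) (use Cons.prems assms(2) in auto)
  finally show ?case using Cons by simp
qed

lemma poly_mult_linear_coeff:
  assumes q: "set q \<subseteq> carrier R" and x: "x \<in> carrier R"
  shows "coeff (poly_mult [\<one>, \<ominus> x] q) (Suc i) = coeff q i \<ominus> x \<otimes> coeff q (Suc i)"
proof -
  let ?f = "\<lambda>k. coeff [\<one>, \<ominus> x] k \<otimes> coeff q (Suc i - k)"
  have "coeff (poly_mult [\<one>, \<ominus> x] q) (Suc i) = (\<Oplus>k\<in>{..Suc i}. ?f k)"
    using poly_mult_coeff[of "[\<one>, \<ominus> x]" q] q x by simp
  also have "\<dots> = (\<Oplus>k\<in>{0, 1}. ?f k)"
    by (rule finsum_mono_neutral[symmetric]) (use q x in auto)
  also have "\<dots> = coeff q i \<ominus> x \<otimes> coeff q (Suc i)"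
    using q x by (simp add: a_minus_def l_minus a_comm)
  finally show ?thesis .
qed

lemma poly_deriv_coeff:
  assumes "set p \<subseteq> carrier R"
  shows "coeff (poly_deriv R p) i = [Suc i] \<cdot> coeff p (Suc i)"
proof -
  let ?d = "map (\<lambda>i. add_pow R (degree p - i) (p ! i)) [0..<degree p]"
  have "coeff (poly_deriv R p) i = coeff ?d i"
    unfolding poly_deriv_def using normalize_coeff[of ?d] by simp
  also have "\<dots> = [Suc i] \<cdot> coeff p (Suc i)"
  proof (cases "i < degree p")
    case True
    have len: "length ?d = degree p" by simp
    have "coeff ?d i = ?d ! (length ?d - 1 - i)" by (rule coeff_nth) (use True len in simp)
    then have "coeff ?d i = ?d ! (degree p - 1 - i)" unfolding len .
    \<comment> \<open>Leading coefficients come first, so position degree p - 1 - i of the list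
      belongs to the exponent i + 1 in p and to i in the derivative.\<close>
    also have "\<dots> = add_pow R (degree p - (degree p - 1 - i)) (p ! (degree p - 1 - i))"
      using True by (subst nth_map) (auto simp: nth_upt)
    also have "degree p - (degree p - 1 - i) = Suc i" using True by simp
    also have "p ! (degree p - 1 - i) = coeff p (Suc i)"
      using coeff_nth[of "Suc i" p] True by simp
    finally show ?thesis .
  next
    case False
    then have "coeff ?d i = \<zero>" "coeff p (Suc i) = \<zero>"
      using coeff_length[of ?d i] coeff_length[of p "Suc i"] by auto
    then show ?thesis by (metis add.nat_pow_one)
  qed
  finally show ?thesis .
qed

text \<open>The product rule would give q + (X - x) q', whose second term vanishes at x. It is
  obtained here from coefficients, without a general product rule.\<close>

lemma eval_deriv_linear_factor:
  assumes q: "q \<in> carrier (poly_ring R)" and x: "x \<in> carrier R"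
  shows "eval (poly_deriv R ([\<one>, \<ominus> x] \<otimes>\<^bsub>poly_ring R\<^esub> q)) x = eval q x"
proof -
  let ?p = "[\<one>, \<ominus> x] \<otimes>\<^bsub>poly_ring R\<^esub> q"
  have qc: "set q \<subseteq> carrier R" using q polynomial_incl univ_poly_carrier by blast
  have p_eq: "?p = poly_mult [\<one>, \<ominus> x] q" by (simp add: univ_poly_mult)
  have pc: "set ?p \<subseteq> carrier R" unfolding p_eq by (rule poly_mult_in_carrier) (use qc x in auto)
  have dc: "set (poly_deriv R ?p) \<subseteq> carrier R"
    unfolding poly_deriv_def
  proof (rule normalize_in_carrier)
    show "set (map (\<lambda>i. add_pow R (degree ?p - i) (?p ! i)) [0..<degree ?p]) \<subseteq> carrier R"
      using pc nth_mem[of _ ?p] by (fastforce simp: subset_iff)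
  qed
  define n where "n = length q + length (poly_deriv R ?p)"
  let ?c = "coeff q"
  have c: "?c i \<in> carrier R" for i using qc by simp
  \<comment> \<open>With u i = c i x^i the summand is (i + 1) (u i - u (i + 1)), so summation by
    parts leaves the sum of the u i and the remainder n u n. The remainder vanishes once n is at
    least the length of q.\<close>
  have "(\<Oplus>i\<in>{..<n}. ([Suc i] \<cdot> (?c i \<ominus> x \<otimes> ?c (Suc i))) \<otimes> x [^] i)
      = (\<Oplus>i\<in>{..<n}. ?c i \<otimes> x [^] i) \<ominus> [n] \<cdot> (?c n \<otimes> x [^] n)" for n :: nat
  proof (induction n)
    case 0
    then show ?case by (simp add: a_minus_def)
  next
    case (Suc n)
    let ?S = "\<Oplus>i\<in>{..<n}. ?c i \<otimes> x [^] i"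
    let ?u = "?c n \<otimes> x [^] n" and ?v = "?c (Suc n) \<otimes> x [^] Suc n"
    have S: "?S \<in> carrier R" by (rule finsum_closed) (use c x in auto)
    have uv: "?u \<in> carrier R" "?v \<in> carrier R" using c x by auto
    have step: "([Suc n] \<cdot> (?c n \<ominus> x \<otimes> ?c (Suc n))) \<otimes> x [^] n = [Suc n] \<cdot> (?u \<ominus> ?v)"
    proof -
      have "([Suc n] \<cdot> (?c n \<ominus> x \<otimes> ?c (Suc n))) \<otimes> x [^] n = [Suc n] \<cdot> ((?c n \<ominus> x \<otimes> ?c (Suc n)) \<otimes> x [^] n)"
        by (rule add_pow_ldistr) (use c x in auto)
      moreover have "(?c n \<ominus> x \<otimes> ?c (Suc n)) \<otimes> x [^] n = ?u \<ominus> ?v"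
      proof -
        have "(a \<ominus> x \<otimes> b) \<otimes> y = a \<otimes> y \<ominus> b \<otimes> (y \<otimes> x)"
          if "a \<in> carrier R" "b \<in> carrier R" "y \<in> carrier R" for a b y
          using that x by algebra
        then show ?thesis using c x by simp
      qed
      ultimately show ?thesis by simp
    qed
    have dist: "[Suc n] \<cdot> (?u \<ominus> ?v) = [Suc n] \<cdot> ?u \<ominus> [Suc n] \<cdot> ?v"
      unfolding a_minus_def using uv by (simp only: add.nat_pow_distrib a_inv_closed add.nat_pow_inv)
    have "(\<Oplus>i\<in>{..<Suc n}. ([Suc i] \<cdot> (?c i \<ominus> x \<otimes> ?c (Suc i))) \<otimes> x [^] i)
        = ([Suc n] \<cdot> (?c n \<ominus> x \<otimes> ?c (Suc n))) \<otimes> x [^] n \<oplus> (\<Oplus>i\<in>{..<n}. ([Suc i] \<cdot> (?c i \<ominus> x \<otimes> ?c (Suc i))) \<otimes> x [^] i)"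
      unfolding lessThan_Suc by (rule finsum_insert) (use c x in auto)
    also have "\<dots> = ([Suc n] \<cdot> ?u \<ominus> [Suc n] \<cdot> ?v) \<oplus> (?S \<ominus> [n] \<cdot> ?u)"
      unfolding Suc.IH step dist ..
    also have "[Suc n] \<cdot> ?u = [n] \<cdot> ?u \<oplus> ?u" by simp
    also have "([n] \<cdot> ?u \<oplus> ?u \<ominus> [Suc n] \<cdot> ?v) \<oplus> (?S \<ominus> [n] \<cdot> ?u) = ?u \<oplus> ?S \<ominus> [Suc n] \<cdot> ?v"
    proof -
      have nv: "[n] \<cdot> ?u \<in> carrier R" "[Suc n] \<cdot> ?v \<in> carrier R" using uv by (auto simp del: add.nat_pow_Suc)
      have "(A \<oplus> u \<ominus> V) \<oplus> (S \<ominus> A) = u \<oplus> S \<ominus> V"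
        if "A \<in> carrier R" "u \<in> carrier R" "V \<in> carrier R" "S \<in> carrier R" for A u V S
        using that by algebra
      from this[OF nv(1) uv(1) nv(2) S] show ?thesis .
    qed
    also have "?u \<oplus> ?S = (\<Oplus>i\<in>{..<Suc n}. ?c i \<otimes> x [^] i)"
      unfolding lessThan_Suc by (rule finsum_insert[symmetric]) (use c x in auto)
    finally show ?case .
  qed
  note sum = this
  have "eval (poly_deriv R ?p) x = (\<Oplus>i\<in>{..<length (poly_deriv R ?p)}. coeff (poly_deriv R ?p) i \<otimes> x [^] i)"
    by (rule eval_as_sum[OF dc x])
  also have "\<dots> = (\<Oplus>i\<in>{..<n}. coeff (poly_deriv R ?p) i \<otimes> x [^] i)"
    by (rule finsum_mono_neutral) (use coeff_length[of "poly_deriv R ?p"] dc x in \<open>auto simp: n_def\<close>)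
  also have "\<dots> = (\<Oplus>i\<in>{..<n}. ([Suc i] \<cdot> (?c i \<ominus> x \<otimes> ?c (Suc i))) \<otimes> x [^] i)"
    unfolding poly_deriv_coeff[OF pc] unfolding p_eq poly_mult_linear_coeff[OF qc x] ..
  also have "\<dots> = (\<Oplus>i\<in>{..<n}. ?c i \<otimes> x [^] i)"
  proof -
    have "?c n = \<zero>" using coeff_length[of q n] by (simp add: n_def)
    moreover have "(\<Oplus>i\<in>{..<n}. ?c i \<otimes> x [^] i) \<in> carrier R" by (rule finsum_closed) (use c x in auto)
    ultimately show ?thesis using sum[of n] x add.nat_pow_one[of n] by (simp add: a_minus_def)
  qed
  also have "\<dots> = (\<Oplus>i\<in>{..<length q}. ?c i \<otimes> x [^] i)"
    by (rule finsum_mono_neutral[symmetric]) (use coeff_length[of q] c x in \<open>auto simp: n_def\<close>)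
  also have "\<dots> = eval q x" by (rule eval_as_sum[OF qc x, symmetric])
  finally show ?thesis .
qed

text \<open>A multiple root \<open>x\<close> of its minimal polynomial would be a root of the derivative, which would then be
  divisible by the minimal polynomial.\<close>

lemma separable_other_root:
  assumes K: "subfield K R" and x: "x \<in> carrier R" "x \<notin> K" and alg: "(algebraic over K) x"
    and sep: "separable_poly R K (Irr K x)" and split: "splitted (Irr K x)"
  shows "\<exists>y\<in>carrier R. y \<noteq> x \<and> eval (Irr K x) y = \<zero>"
proof (rule ccontr)
  assume no: "\<not> ?thesis"
  let ?p = "Irr K x"
  note p = IrrE[OF K x(1) alg]
  note subring = subfieldE(1)[OF K]
  have pR: "?p \<in> carrier (poly_ring R)" by (rule carrier_polynomial_shell[OF subring p(1)])
  have deg1: "degree ?p \<ge> 1" by (rule pirreducible_degree[OF K p(1,2)])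
  \<comment> \<open>A monic minimal polynomial X + b would put x = - b into K.\<close>
  have "degree ?p \<noteq> 1"
  proof
    assume "degree ?p = 1"
    then have "length ?p = 2" by simp
    then obtain a b where ab: "?p = [a, b]"
      by (metis (no_types, opaque_lifting) One_nat_def Suc_1 length_0_conv length_Suc_conv)
    have "a = \<one>" "b \<in> K" using p(1,3) ab by (auto simp: univ_poly_def polynomial_def)
    moreover have bR: "b \<in> carrier R" using \<open>b \<in> K\<close> subfieldE(3)[OF K] by auto
    ultimately have "x \<oplus> b = \<zero>" using p(4) ab x by simp
    then have "x = \<ominus> b" using x bR by (metis minus_equality minus_minus a_inv_closed a_comm)
    then show False using x(2) \<open>b \<in> K\<close> subringE(5)[OF subring] by auto
  qed
  with deg1 have deg: "degree ?p \<ge> 2" by simp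
  have "y = x" if "y \<in># roots ?p" for y
    using that no roots_mem_iff_is_root[OF pR] by (auto simp: is_root_def)
  \<comment> \<open>The polynomial splits and x is its only root, so the multiplicity of x is the
    full degree.\<close>
  then have "roots ?p = replicate_mset (size (roots ?p)) x"
    by (intro set_mset_subset_singletonD) auto
  then have "count (roots ?p) x = degree ?p"
    using split by (metis count_replicate_mset splitted_def)
  then have "2 \<le> alg_mult ?p x" using alg_mult_eq_count_roots[OF pR] deg by simp
  then have "([\<one>, \<ominus> x] [^]\<^bsub>poly_ring R\<^esub> (2::nat)) pdivides ?p"
    by (rule le_alg_mult_imp_pdivides[OF x(1) pR])
  then obtain r where r: "r \<in> carrier (poly_ring R)" "?p = ([\<one>, \<ominus> x] [^]\<^bsub>poly_ring R\<^esub> (2::nat)) \<otimes>\<^bsub>poly_ring R\<^esub> r"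
    unfolding pdivides_def by auto
  interpret UP: domain "poly_ring R" by (rule univ_poly_is_domain[OF carrier_is_subring])
  let ?l = "[\<one>, \<ominus> x]"
  have l: "?l \<in> carrier (poly_ring R)" using x by (auto simp: univ_poly_def polynomial_def)
  have pq: "?p = ?l \<otimes>\<^bsub>poly_ring R\<^esub> (?l \<otimes>\<^bsub>poly_ring R\<^esub> r)"
    using r l by (simp add: numeral_2_eq_2 UP.m_assoc)
  have lr: "?l \<otimes>\<^bsub>poly_ring R\<^esub> r \<in> carrier (poly_ring R)" using l r by simp
  have "eval (poly_deriv R ?p) x = eval (?l \<otimes>\<^bsub>poly_ring R\<^esub> r) x"
    using eval_deriv_linear_factor[OF lr x(1)] pq by simp
  also have "\<dots> = eval ?l x \<otimes> eval r x"
    using ring_hom_mult[OF eval_is_hom[OF carrier_is_subring x(1)] l r(1)] by simp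
  also have "eval ?l x = \<zero>" using x by (simp add: r_neg)
  finally have zero: "eval (poly_deriv R ?p) x = \<zero>"
    using eval_in_carrier[OF _ x(1), of r] r polynomial_incl univ_poly_carrier by (metis l_null)
  have dK: "poly_deriv R ?p \<in> carrier (K[X])"
  proof -
    have pK: "set ?p \<subseteq> K" using p(1) polynomial_incl univ_poly_carrier by blast
    have "add_pow R n k \<in> K" if "k \<in> K" for n :: nat and k
      using that subringE(1,2,7)[OF subring] by (induction n) auto
    then have "set (map (\<lambda>i. add_pow R (degree ?p - i) (?p ! i)) [0..<degree ?p]) \<subseteq> K"
      using pK nth_mem[of _ ?p] by (fastforce simp: subset_iff)
    then show ?thesis unfolding poly_deriv_def univ_poly_carrier[symmetric] by (rule normalize_gives_polynomial)
  qed
  have "?p pdivides (poly_deriv R ?p)" by (rule Irr_minimal[OF K x(1) alg dK zero])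
  then have "?p divides\<^bsub>K[X]\<^esub> (poly_deriv R ?p)" using pdivides_iff_shell[OF K p(1) dK] by simp
  moreover have "?p divides\<^bsub>K[X]\<^esub> ?p"
    using monoid.divides_refl[OF univ_poly_is_monoid[OF subring] p(1)] .
  ultimately have "?p \<in> Units (K[X])" using sep p(1) by (auto simp: separable_poly_def)
  then show False using pirreducibleE(2)[OF subring p(1,2)] by simp
qed

section \<open>Extension of embeddings along algebraic elements\<close>

lemma extend_to_simple_extension:
  assumes M: "subfield M R" and \<phi>: "\<phi> \<in> ring_hom (R\<lparr>carrier := M\<rparr>) R"
    and a: "a \<in> carrier R" and alg: "(algebraic over M) a"
    and b: "b \<in> carrier R" "eval (map \<phi> (Irr M a)) b = \<zero>"
  shows "\<exists>\<psi>\<in>ring_hom (R\<lparr>carrier := simple_extension M a\<rparr>) R. (\<forall>z\<in>M. \<psi> z = \<phi> z) \<and> \<psi> a = b"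
proof -
  note subring = subfieldE(1)[OF M]
  have MR: "M \<subseteq> carrier R" using subfieldE(3)[OF M] .
  interpret Mf: field "R\<lparr>carrier := M\<rparr>" using subfield_iff(2)[OF M] .
  interpret h: ring_hom_ring "R\<lparr>carrier := M\<rparr>" R \<phi>
    by (rule ring_hom_ringI2[OF Mf.ring_axioms ring_axioms \<phi>])
  interpret UP: domain "M[X]" by (rule univ_poly_is_domain[OF subring])
  \<comment> \<open>The embedding to be constructed sends q(a) to the value at b of the polynomial
    with coefficients moved by \<open>\<phi>\<close>.\<close>
  define \<Phi> where "\<Phi> = (\<lambda>q. eval (map \<phi> q) b)"
  have set_M: "set q \<subseteq> M" if "q \<in> carrier (M[X])" for q using that polynomial_incl univ_poly_carrier by blast
  have set_map: "set (map \<phi> q) \<subseteq> carrier R" if "set q \<subseteq> M" for q using that h.hom_closed by auto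
  \<comment> \<open>Moving coefficients by \<open>\<phi>\<close> is compatible with sums and
    products of lists up to leading zeros, which evaluation ignores.\<close>
  have \<Phi>_norm: "\<Phi> q = eval (normalize (map \<phi> q)) b" if "set q \<subseteq> M" for q
    unfolding \<Phi>_def using eval_normalize[OF set_map[OF that] b(1)] by simp
  have \<Phi>: "\<Phi> \<in> ring_hom (M[X]) R"
  proof (rule ring_hom_memI)
    fix p q assume pq: "p \<in> carrier (M[X])" "q \<in> carrier (M[X])"
    note s = set_M[OF pq(1)] set_M[OF pq(2)]
    have "\<Phi> (p \<otimes>\<^bsub>M[X]\<^esub> q) = eval (normalize (map \<phi> (poly_mult p q))) b"
      using \<Phi>_norm[OF set_M[OF UP.m_closed[OF pq]]] by (simp add: univ_poly_mult)
    also have "\<dots> = eval (poly_mult (map \<phi> p) (map \<phi> q)) b"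
      using h.poly_mult_hom'[of p q] s poly_mult_consistent[OF subring] by simp
    also have "\<dots> = \<Phi> p \<otimes> \<Phi> q" unfolding \<Phi>_def by (rule eval_poly_mult[OF set_map[OF s(1)] set_map[OF s(2)] b(1)])
    finally show "\<Phi> (p \<otimes>\<^bsub>M[X]\<^esub> q) = \<Phi> p \<otimes> \<Phi> q" .
    have "\<Phi> (p \<oplus>\<^bsub>M[X]\<^esub> q) = eval (normalize (map \<phi> (poly_add p q))) b"
      using \<Phi>_norm[OF set_M[OF UP.a_closed[OF pq]]] by (simp add: univ_poly_add)
    also have "\<dots> = eval (poly_add (map \<phi> p) (map \<phi> q)) b"
      using h.poly_add_hom'[of p q] s poly_add_consistent[OF subring] by simp
    also have "\<dots> = \<Phi> p \<oplus> \<Phi> q" unfolding \<Phi>_def by (rule eval_poly_add[OF set_map[OF s(1)] set_map[OF s(2)] b(1)])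
    finally show "\<Phi> (p \<oplus>\<^bsub>M[X]\<^esub> q) = \<Phi> p \<oplus> \<Phi> q" .
  next
    show "\<Phi> \<one>\<^bsub>M[X]\<^esub> = \<one>" using h.hom_one by (simp add: \<Phi>_def univ_poly_one)
    show "\<Phi> q \<in> carrier R" if "q \<in> carrier (M[X])" for q
      unfolding \<Phi>_def by (rule eval_in_carrier[OF set_map[OF set_M[OF that]] b(1)])
  qed
  interpret \<Phi>: ring_hom_ring "M[X]" R \<Phi> by (rule ring_hom_ringI2[OF UP.ring_axioms ring_axioms \<Phi>])
  interpret ev: ring_hom_ring "M[X]" R "\<lambda>q. eval q a" by (rule eval_ring_hom[OF subring a])
  note I = IrrE[OF M a alg]
  \<comment> \<open>Two polynomials agreeing at a differ by a multiple of the minimal polynomial of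
    a over M, whose image vanishes at b.\<close>
  have wd: "\<Phi> p = \<Phi> q" if pq: "p \<in> carrier (M[X])" "q \<in> carrier (M[X])" and eq: "eval p a = eval q a" for p q
  proof -
    let ?d = "p \<ominus>\<^bsub>M[X]\<^esub> q"
    have d: "?d \<in> carrier (M[X])" using pq by simp
    have "eval ?d a = \<zero>" using pq eq by (simp add: a_minus_def r_neg)
    then have "Irr M a pdivides ?d" by (rule Irr_minimal[OF M a alg d])
    then have "Irr M a divides\<^bsub>M[X]\<^esub> ?d" using pdivides_iff_shell[OF M I(1) d] by simp
    then obtain r where r: "r \<in> carrier (M[X])" "?d = Irr M a \<otimes>\<^bsub>M[X]\<^esub> r" by auto
    have "\<Phi> ?d = \<Phi> (Irr M a) \<otimes> \<Phi> r" using r I(1) by simp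
    also have "\<Phi> (Irr M a) = \<zero>" using b(2) by (simp add: \<Phi>_def)
    also have "\<zero> \<otimes> \<Phi> r = \<zero>" using r by simp
    finally have "\<Phi> p \<ominus> \<Phi> q = \<zero>" using pq by (simp add: a_minus_def)
    then show ?thesis using pq by simp
  qed
  have img: "simple_extension M a = (\<lambda>q. eval q a) ` carrier (M[X])"
    by (rule simple_extension_as_eval_img[OF MR a])
  define \<psi> where "\<psi> = (\<lambda>z. \<Phi> (SOME q. q \<in> carrier (M[X]) \<and> eval q a = z))"
  have \<psi>: "\<psi> (eval q a) = \<Phi> q" if "q \<in> carrier (M[X])" for q
  proof -
    have "(SOME q'. q' \<in> carrier (M[X]) \<and> eval q' a = eval q a) \<in> carrier (M[X]) \<and>
        eval (SOME q'. q' \<in> carrier (M[X]) \<and> eval q' a = eval q a) a = eval q a"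
      by (rule someI[of _ q]) (use that in simp)
    then show ?thesis unfolding \<psi>_def using wd that by blast
  qed
  have "\<psi> \<in> ring_hom (R\<lparr>carrier := simple_extension M a\<rparr>) R"
  proof (rule ring_hom_memI)
    fix y z assume yz: "y \<in> carrier (R\<lparr>carrier := simple_extension M a\<rparr>)" "z \<in> carrier (R\<lparr>carrier := simple_extension M a\<rparr>)"
    then obtain p q where p: "p \<in> carrier (M[X])" "y = eval p a" and q: "q \<in> carrier (M[X])" "z = eval q a"
      by (auto simp: img)
    have eqs: "y \<otimes> z = eval (p \<otimes>\<^bsub>M[X]\<^esub> q) a" "y \<oplus> z = eval (p \<oplus>\<^bsub>M[X]\<^esub> q) a" using p q by simp_all
    have "\<psi> (y \<otimes> z) = \<psi> y \<otimes> \<psi> z"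
    proof -
      have "\<psi> (y \<otimes> z) = \<Phi> (p \<otimes>\<^bsub>M[X]\<^esub> q)" by (subst eqs(1)) (rule \<psi>[OF UP.m_closed[OF p(1) q(1)]])
      then show ?thesis using \<psi>[OF p(1)] \<psi>[OF q(1)] p q by simp
    qed
    moreover have "\<psi> (y \<oplus> z) = \<psi> y \<oplus> \<psi> z"
    proof -
      have "\<psi> (y \<oplus> z) = \<Phi> (p \<oplus>\<^bsub>M[X]\<^esub> q)" by (subst eqs(2)) (rule \<psi>[OF UP.a_closed[OF p(1) q(1)]])
      then show ?thesis using \<psi>[OF p(1)] \<psi>[OF q(1)] p q by simp
    qed
    ultimately show "\<psi> (y \<otimes>\<^bsub>R\<lparr>carrier := simple_extension M a\<rparr>\<^esub> z) = \<psi> y \<otimes> \<psi> z"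
      "\<psi> (y \<oplus>\<^bsub>R\<lparr>carrier := simple_extension M a\<rparr>\<^esub> z) = \<psi> y \<oplus> \<psi> z"
      by simp_all
    show "\<psi> y \<in> carrier R" using p \<psi> by simp
  next
    have "eval \<one>\<^bsub>M[X]\<^esub> a = \<one>" by simp
    then show "\<psi> \<one>\<^bsub>R\<lparr>carrier := simple_extension M a\<rparr>\<^esub> = \<one>" using \<psi>[of "\<one>\<^bsub>M[X]\<^esub>"] by simp
  qed
  moreover have "\<psi> z = \<phi> z" if z: "z \<in> M" for z
  proof -
    have zc: "poly_of_const z \<in> carrier (M[X])"
      unfolding univ_poly_carrier[symmetric] poly_of_const_def by (rule normalize_gives_polynomial) (use z in simp)
    have "eval (poly_of_const z) a = z"
      using z MR a by (auto simp: poly_of_const_def)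
    moreover have "\<Phi> (poly_of_const z) = \<phi> z"
      using z b h.hom_closed[of z] h.hom_zero by (auto simp: \<Phi>_def poly_of_const_def)
    ultimately show ?thesis using \<psi>[OF zc] by simp
  qed
  moreover have "\<psi> a = b"
  proof -
    have "X \<in> carrier (M[X])" by (rule var_closed(1)[OF subring])
    moreover have "\<Phi> X = b" using b h.hom_one h.hom_zero by (simp add: \<Phi>_def var_def)
    ultimately show ?thesis using \<psi>[of X] eval_var[OF a] by simp
  qed
  ultimately show ?thesis by blast
qed

text \<open>Over M the minimal polynomial of a divides the one over K. Since \<open>\<phi>\<close>
  fixes K, the image of the former still divides the latter, which splits; the image has positive
  degree and so has a root.\<close>

lemma exists_conjugate_root:
  assumes K: "subfield K R" and M: "subfield M R" and KM: "K \<subseteq> M"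
    and \<phi>: "\<phi> \<in> ring_hom (R\<lparr>carrier := M\<rparr>) R" and fix_K: "\<And>z. z \<in> K \<Longrightarrow> \<phi> z = z"
    and a: "a \<in> carrier R" and alg: "(algebraic over K) a" and split: "splitted (Irr K a)"
  shows "\<exists>b\<in>carrier R. eval (map \<phi> (Irr M a)) b = \<zero>"
proof -
  note subring = subfieldE(1)[OF M]
  have algM: "(algebraic over M) a" by (rule algebraic_mono[OF KM alg])
  note P = IrrE[OF K a alg] and f = IrrE[OF M a algM]
  interpret Mf: field "R\<lparr>carrier := M\<rparr>" using subfield_iff(2)[OF M] .
  interpret h: ring_hom_ring "R\<lparr>carrier := M\<rparr>" R \<phi>
    by (rule ring_hom_ringI2[OF Mf.ring_axioms ring_axioms \<phi>])
  have set_M: "set q \<subseteq> M" if "q \<in> carrier (M[X])" for q using that polynomial_incl univ_poly_carrier by blast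
  have set_map: "set (map \<phi> q) \<subseteq> carrier R" if "set q \<subseteq> M" for q using that h.hom_closed by auto
  have PM: "Irr K a \<in> carrier (M[X])" using P(1) KM by (auto simp: univ_poly_def polynomial_def)
  have PR: "Irr K a \<in> carrier (poly_ring R)" by (rule carrier_polynomial_shell[OF subfieldE(1)[OF K] P(1)])
  have Pne: "Irr K a \<noteq> []" using pirreducibleE(1)[OF subfieldE(1)[OF K] P(1,2)] .
  have "Irr M a divides\<^bsub>M[X]\<^esub> Irr K a"
    using Irr_minimal[OF M a algM PM P(4)] pdivides_iff_shell[OF M f(1) PM] by simp
  then obtain r where r: "r \<in> carrier (M[X])" "Irr K a = Irr M a \<otimes>\<^bsub>M[X]\<^esub> r" by auto
  let ?f = "map \<phi> (Irr M a)" and ?r = "normalize (map \<phi> r)"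
  note s = set_M[OF f(1)] set_M[OF r(1)]
  have "map \<phi> (Irr K a) = Irr K a"
    using fix_K P(1) by (intro map_idI) (auto simp: univ_poly_def polynomial_def)
  then have "Irr K a = normalize (map \<phi> (poly_mult (Irr M a) r))"
    using r(2) PR normalize_polynomial[of "carrier R"] univ_poly_carrier by (metis univ_poly_mult)
  also have "\<dots> = poly_mult ?f (map \<phi> r)"
    using h.poly_mult_hom'[of "Irr M a" r] s poly_mult_consistent[OF subring] by simp
  also have "\<dots> = poly_mult ?f ?r"
    using poly_mult_normalize[OF set_map[OF s(2)] set_map[OF s(1)]] poly_mult_comm set_map[OF s(1)] set_map[OF s(2)]
      normalize_in_carrier[OF set_map[OF s(2)]] by metis
  finally have eq: "Irr K a = ?f \<otimes>\<^bsub>poly_ring R\<^esub> ?r" by (simp add: univ_poly_mult)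
  have fne: "Irr M a \<noteq> []" using pirreducibleE(1)[OF subring f(1,2)] .
  have "lead_coeff ?f = \<one>" using f(3) fne h.hom_one by (simp add: hd_map)
  then have fR: "?f \<in> carrier (poly_ring R)"
    unfolding univ_poly_carrier[symmetric] by (intro polynomialI) (use set_map[OF s(1)] in auto)
  have rR: "?r \<in> carrier (poly_ring R)"
    unfolding univ_poly_carrier[symmetric] by (rule normalize_gives_polynomial[OF set_map[OF s(2)]])
  have "?f pdivides Irr K a" unfolding pdivides_def factor_def using eq rR by blast
  then have "splitted ?f" using pdivides_imp_splitted[OF fR PR Pne split] by simp
  then have "size (roots ?f) \<noteq> 0"
    using pirreducible_degree[OF M f(1,2)] by (simp add: splitted_def)
  then obtain b where "b \<in># roots ?f" by (metis multiset_nonemptyE size_empty)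
  then show ?thesis using roots_mem_iff_is_root[OF fR] by (auto simp: is_root_def)
qed

text \<open>The head of the list is adjoined last. The embedding obtained for the tail still fixes
  K, which is what the existence of a conjugate root requires for the next generator.\<close>

lemma extend_to_finite_extension:
  assumes K: "subfield K R" and M: "subfield M R" and KM: "K \<subseteq> M"
    and \<phi>: "\<phi> \<in> ring_hom (R\<lparr>carrier := M\<rparr>) R" and fix_K: "\<And>z. z \<in> K \<Longrightarrow> \<phi> z = z"
    and xs: "set xs \<subseteq> carrier R" "\<And>a. a \<in> set xs \<Longrightarrow> (algebraic over K) a"
      "\<And>a. a \<in> set xs \<Longrightarrow> splitted (Irr K a)"
  shows "\<exists>\<psi>\<in>ring_hom (R\<lparr>carrier := finite_extension M xs\<rparr>) R. \<forall>z\<in>M. \<psi> z = \<phi> z"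
  using xs
proof (induction xs)
  case Nil
  then show ?case using \<phi> by auto
next
  case (Cons a xs)
  let ?M' = "finite_extension M xs"
  obtain \<psi> where \<psi>: "\<psi> \<in> ring_hom (R\<lparr>carrier := ?M'\<rparr>) R" "\<forall>z\<in>M. \<psi> z = \<phi> z" using Cons by auto
  have MR: "M \<subseteq> carrier R" using subfieldE(3)[OF M] .
  have algM: "(algebraic over M) c" if "c \<in> set xs" for c
    by (rule algebraic_mono[OF KM]) (use Cons.prems that in auto)
  have M': "subfield ?M' R"
    by (rule finite_extension_is_subfield[OF M]) (use Cons.prems algM in auto)
  have MM': "M \<subseteq> ?M'" by (rule finite_extension_incl[OF MR]) (use Cons.prems in auto)
  have a: "a \<in> carrier R" "(algebraic over K) a" "splitted (Irr K a)" using Cons.prems by auto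
  have "\<psi> z = z" if "z \<in> K" for z using that KM \<psi>(2) fix_K by auto
  then obtain b where b: "b \<in> carrier R" "eval (map \<psi> (Irr ?M' a)) b = \<zero>"
    using exists_conjugate_root[OF K M' order_trans[OF KM MM'] \<psi>(1) _ a] by blast
  have "(algebraic over ?M') a" by (rule algebraic_mono[OF order_trans[OF KM MM'] a(2)])
  then obtain \<theta> where \<theta>: "\<theta> \<in> ring_hom (R\<lparr>carrier := simple_extension ?M' a\<rparr>) R" "\<forall>z\<in>?M'. \<theta> z = \<psi> z"
    using extend_to_simple_extension[OF M' \<psi>(1) a(1) _ b] by blast
  have "finite_extension M (a # xs) = simple_extension ?M' a" by simp
  moreover have "\<forall>z\<in>M. \<theta> z = \<phi> z" using \<theta>(2) \<psi>(2) MM' by auto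
  ultimately show ?case using \<theta>(1) by auto
qed

text \<open>Finite dimension provides a spanning list, while embeddings are extended by adjoining
  elements. A subring containing K and the list contains its span.\<close>

lemma finite_extension_of_spanning:
  assumes M: "subring M R" "K \<subseteq> M" and Us: "set Us \<subseteq> carrier R" "Span K Us = carrier R"
  shows "finite_extension M Us = carrier R"
proof -
  let ?F = "finite_extension M Us"
  have F: "subring ?F R" by (rule finite_extension_is_subring[OF M(1) Us(1)])
  have KF: "K \<subseteq> ?F" using finite_extension_incl[OF subringE(1)[OF M(1)] Us(1)] M(2) by auto
  have UF: "set Us \<subseteq> ?F" by (rule finite_extension_mem[OF M(1) Us(1)])
  have "Span K Vs \<subseteq> ?F" if "set Vs \<subseteq> ?F" for Vs
    using that
  proof (induction Vs)
    case Nil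
    then show ?case using subringE(2)[OF F] by simp
  next
    case (Cons v Vs)
    show ?case
    proof
      fix z assume "z \<in> Span K (v # Vs)"
      then obtain k w where kw: "k \<in> K" "w \<in> Span K Vs" "z = k \<otimes> v \<oplus> w"
        by (auto simp: line_extension_mem_iff)
      have Vs: "set Vs \<subseteq> ?F" by (rule order_trans[OF set_subset_Cons Cons.prems])
      have k: "k \<in> ?F" by (rule subsetD[OF KF kw(1)])
      have w: "w \<in> ?F" by (rule subsetD[OF Cons.IH[OF Vs] kw(2)])
      have v: "v \<in> ?F" by (rule subsetD[OF Cons.prems list.set_intros(1)])
      show "z \<in> ?F" unfolding kw(3) by (rule subringE(7)[OF F subringE(6)[OF F k v] w])
    qed
  qed
  from this[OF UF] have "carrier R \<subseteq> ?F" unfolding Us(2) .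
  then show ?thesis using subringE(1)[OF F] by (rule equalityI[rotated])
qed

lemma ring_hom_inj_on:
  assumes "\<psi> \<in> ring_hom R R"
  shows "inj_on \<psi> (carrier R)"
proof -
  interpret h: ring_hom_ring R R \<psi> by (rule ring_hom_ringI2[OF ring_axioms ring_axioms assms])
  have "x = \<zero>" if x: "x \<in> carrier R" "\<psi> x = \<zero>" for x
  proof (rule ccontr)
    assume "x \<noteq> \<zero>"
    then have u: "x \<in> Units R" using x field_Units by simp
    have "\<psi> (x \<otimes> inv x) = \<psi> x \<otimes> \<psi> (inv x)" by (rule h.hom_mult[OF Units_closed[OF u] Units_inv_closed[OF u]])
    moreover have "\<psi> x \<otimes> \<psi> (inv x) = \<zero>" using u x by simp
    ultimately have "\<one> = \<zero>" using u h.hom_one by simp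
    then show False by simp
  qed
  then have "a_kernel R R \<psi> = {\<zero>}" unfolding a_kernel_def' using h.hom_zero by auto
  then show ?thesis by (rule h.trivial_ker_imp_inj)
qed

text \<open>The minimal polynomial over K of a given element has finitely many roots. They are
  permuted by the injective map \<open>\<psi>\<close>, so the element is a value of
  \<open>\<psi>\<close>.\<close>

lemma algebraic_endomorphism_bij:
  assumes K: "subfield K R" and alg: "\<And>x. x \<in> carrier R \<Longrightarrow> (algebraic over K) x"
    and \<psi>: "\<psi> \<in> ring_hom R R" and fix_K: "\<And>z. z \<in> K \<Longrightarrow> \<psi> z = z"
  shows "bij_betw \<psi> (carrier R) (carrier R)"
proof -
  interpret h: ring_hom_ring R R \<psi> by (rule ring_hom_ringI2[OF ring_axioms ring_axioms \<psi>])
  have inj: "inj_on \<psi> (carrier R)" by (rule ring_hom_inj_on[OF \<psi>])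
  have "z \<in> \<psi> ` carrier R" if z: "z \<in> carrier R" for z
  proof -
    note P = IrrE[OF K z alg[OF z]]
    let ?Z = "{x. is_root (Irr K z) x}"
    have "finite ?Z" by (rule finite_number_of_roots[OF carrier_polynomial_shell[OF subfieldE(1)[OF K] P(1)]])
    moreover have "\<psi> ` ?Z \<subseteq> ?Z"
    proof
      fix y assume "y \<in> \<psi> ` ?Z"
      then obtain x where x: "y = \<psi> x" "x \<in> carrier R" "eval (Irr K z) x = \<zero>" "Irr K z \<noteq> []" by (auto simp: is_root_def)
      have "map \<psi> (Irr K z) = Irr K z"
        using fix_K P(1) by (intro map_idI) (auto simp: univ_poly_def polynomial_def)
      then have "eval (Irr K z) (\<psi> x) = \<psi> (eval (Irr K z) x)"
        using h.eval_hom[OF subfieldE(1)[OF K] x(2) P(1)] by simp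
      then show "y \<in> ?Z" using x by (auto simp: is_root_def)
    qed
    moreover have "inj_on \<psi> ?Z" by (rule inj_on_subset[OF inj]) (auto simp: is_root_def)
    ultimately have "\<psi> ` ?Z = ?Z" by (rule endo_inj_surj)
    moreover have "z \<in> ?Z" using z P(4) pirreducibleE(1)[OF subfieldE(1)[OF K] P(1,2)] by (simp add: is_root_def)
    ultimately show ?thesis by (auto simp: is_root_def)
  qed
  then show ?thesis using inj by (auto simp: bij_betw_def)
qed

section \<open>The Galois group: finiteness and fixed field\<close>

lemma galois_group_mem:
  "\<gamma> \<in> carrier (galois_group R K) \<longleftrightarrow> \<gamma> \<in> Bij (carrier R) \<and> \<gamma> \<in> ring_hom R R \<and> (\<forall>x\<in>K. \<gamma> x = x)"
  by (auto simp: galois_group_def)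

lemma galois_group_subgroup:
  assumes K: "K \<subseteq> carrier R"
  shows "subgroup (carrier (galois_group R K)) (BijGroup (carrier R))"
proof -
  let ?G = "carrier (galois_group R K)"
  interpret B: group "BijGroup (carrier R)" by (rule group_BijGroup)
  show ?thesis
  proof (rule B.subgroupI)
    show "?G \<subseteq> carrier (BijGroup (carrier R))" by (auto simp: galois_group_mem BijGroup_def)
    have "(\<lambda>x\<in>carrier R. x) \<in> ?G"
      unfolding galois_group_mem using id_Bij K by (auto intro!: ring_hom_memI)
    then show "?G \<noteq> {}" by blast
    fix \<gamma> assume \<gamma>: "\<gamma> \<in> ?G"
    then have bij: "\<gamma> \<in> Bij (carrier R)" and hom: "\<gamma> \<in> ring_hom R R" and fixK: "\<And>x. x \<in> K \<Longrightarrow> \<gamma> x = x"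
      by (auto simp: galois_group_mem)
    have inj: "inj_on \<gamma> (carrier R)" using bij by (auto simp: Bij_def bij_betw_def)
    show "inv\<^bsub>BijGroup (carrier R)\<^esub> \<gamma> \<in> ?G"
      unfolding inv_BijGroup[OF bij] galois_group_mem
    proof (intro conjI ballI)
      show "(\<lambda>x\<in>carrier R. inv_into (carrier R) \<gamma> x) \<in> Bij (carrier R)" by (rule restrict_inv_into_Bij[OF bij])
      have inv_eq: "inv_into (carrier R) \<gamma> x = x" if "x \<in> carrier R" "\<gamma> x = x" for x
        using inv_into_f_eq[OF inj that(1,2)] .
      show "(\<lambda>x\<in>carrier R. inv_into (carrier R) \<gamma> x) \<in> ring_hom R R"
      proof (rule ring_hom_memI)
        fix x y assume xy: "x \<in> carrier R" "y \<in> carrier R"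
        have "inv_into (carrier R) \<gamma> (x \<otimes> y) = inv_into (carrier R) \<gamma> x \<otimes> inv_into (carrier R) \<gamma> y"
          by (rule Bij_inv_into_lemma[OF _ bij _ xy]) (auto simp: ring_hom_mult[OF hom])
        then show "(\<lambda>x\<in>carrier R. inv_into (carrier R) \<gamma> x) (x \<otimes> y)
            = (\<lambda>x\<in>carrier R. inv_into (carrier R) \<gamma> x) x \<otimes> (\<lambda>x\<in>carrier R. inv_into (carrier R) \<gamma> x) y"
          using xy by simp
        have "inv_into (carrier R) \<gamma> (x \<oplus> y) = inv_into (carrier R) \<gamma> x \<oplus> inv_into (carrier R) \<gamma> y"
          by (rule Bij_inv_into_lemma[OF _ bij _ xy]) (auto simp: ring_hom_add[OF hom])
        then show "(\<lambda>x\<in>carrier R. inv_into (carrier R) \<gamma> x) (x \<oplus> y)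
            = (\<lambda>x\<in>carrier R. inv_into (carrier R) \<gamma> x) x \<oplus> (\<lambda>x\<in>carrier R. inv_into (carrier R) \<gamma> x) y"
          using xy by simp
      next
        show "(\<lambda>x\<in>carrier R. inv_into (carrier R) \<gamma> x) x \<in> carrier R" if "x \<in> carrier R" for x
          using that Bij_inv_into_mem[OF bij that] by simp
        show "(\<lambda>x\<in>carrier R. inv_into (carrier R) \<gamma> x) \<one> = \<one>"
          using inv_eq[OF one_closed ring_hom_one[OF hom]] by simp
      qed
      show "(\<lambda>x\<in>carrier R. inv_into (carrier R) \<gamma> x) x = x" if "x \<in> K" for x
      proof -
        have "x \<in> carrier R" using that K by auto
        then show ?thesis using inv_eq[OF _ fixK[OF that]] by simp
      qed
    qed
    fix \<tau> assume \<tau>: "\<tau> \<in> ?G"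
    then have bij': "\<tau> \<in> Bij (carrier R)" and hom': "\<tau> \<in> ring_hom R R" and fixK': "\<And>x. x \<in> K \<Longrightarrow> \<tau> x = x"
      by (auto simp: galois_group_mem)
    have eq: "\<gamma> \<otimes>\<^bsub>BijGroup (carrier R)\<^esub> \<tau> = compose (carrier R) \<gamma> \<tau>"
      using bij bij' by (simp add: BijGroup_def)
    show "\<gamma> \<otimes>\<^bsub>BijGroup (carrier R)\<^esub> \<tau> \<in> ?G"
      unfolding eq galois_group_mem
    proof (intro conjI ballI)
      show "compose (carrier R) \<gamma> \<tau> \<in> Bij (carrier R)" by (rule compose_Bij[OF bij bij'])
      show "compose (carrier R) \<gamma> \<tau> \<in> ring_hom R R"
        by (rule ring_hom_memI)
           (auto simp: compose_eq ring_hom_closed[OF hom] ring_hom_closed[OF hom'] ring_hom_mult[OF hom] ring_hom_mult[OF hom']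
             ring_hom_add[OF hom] ring_hom_add[OF hom'] ring_hom_one[OF hom] ring_hom_one[OF hom'])
      show "compose (carrier R) \<gamma> \<tau> x = x" if "x \<in> K" for x
        using that K fixK fixK' by (auto simp: compose_eq subset_iff)
    qed
  qed
qed

text \<open>An automorphism over K is determined by its values on a spanning list, and each value is
  a root of the minimal polynomial of the element it comes from.\<close>

lemma galois_group_finite:
  assumes K: "subfield K R" and alg: "\<And>x. x \<in> carrier R \<Longrightarrow> (algebraic over K) x"
    and Us: "set Us \<subseteq> carrier R" "Span K Us = carrier R"
  shows "finite (carrier (galois_group R K))"
proof -
  let ?G = "carrier (galois_group R K)"
  let ?Z = "\<Union>u\<in>set Us. {x. is_root (Irr K u) x}"
  have Zfin: "finite ?Z"
  proof (intro finite_UN_I)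
    fix u assume "u \<in> set Us"
    then have u: "u \<in> carrier R" using Us by auto
    show "finite {x. is_root (Irr K u) x}"
      by (rule finite_number_of_roots[OF carrier_polynomial_shell[OF subfieldE(1)[OF K] IrrE(1)[OF K u alg[OF u]]]])
  qed simp
  have KR: "K \<subseteq> carrier R" by (rule subfieldE(3)[OF K])
  have img: "(\<lambda>\<gamma>. map \<gamma> Us) ` ?G \<subseteq> {xs. set xs \<subseteq> ?Z \<and> length xs = length Us}"
  proof safe
    fix \<gamma> y assume \<gamma>: "\<gamma> \<in> ?G" and "y \<in> set (map \<gamma> Us)"
    then obtain u where u: "u \<in> set Us" "y = \<gamma> u" by auto
    have uR: "u \<in> carrier R" using u Us by auto
    note P = IrrE[OF K uR alg[OF uR]]
    have hom: "\<gamma> \<in> ring_hom R R" and fixK: "\<And>x. x \<in> K \<Longrightarrow> \<gamma> x = x" using \<gamma> by (auto simp: galois_group_mem)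
    interpret h: ring_hom_ring R R \<gamma> by (rule ring_hom_ringI2[OF ring_axioms ring_axioms hom])
    have "map \<gamma> (Irr K u) = Irr K u"
      using fixK P(1) by (intro map_idI) (auto simp: univ_poly_def polynomial_def)
    then have "eval (Irr K u) (\<gamma> u) = \<zero>"
      using h.eval_hom[OF subfieldE(1)[OF K] uR P(1)] P(4) by simp
    then have "is_root (Irr K u) y"
      using u(2) uR pirreducibleE(1)[OF subfieldE(1)[OF K] P(1,2)] by (simp add: is_root_def)
    then show "y \<in> ?Z" using u(1) by blast
  qed auto
  have "inj_on (\<lambda>\<gamma>. map \<gamma> Us) ?G"
  proof (rule inj_onI)
    fix \<gamma> \<tau> assume \<gamma>: "\<gamma> \<in> ?G" and \<tau>: "\<tau> \<in> ?G" and eq: "map \<gamma> Us = map \<tau> Us"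
    have hom: "\<gamma> \<in> ring_hom R R" "\<tau> \<in> ring_hom R R" and fixK: "\<And>x. x \<in> K \<Longrightarrow> \<gamma> x = \<tau> x"
      and ext: "\<gamma> \<in> extensional (carrier R)" "\<tau> \<in> extensional (carrier R)"
      using \<gamma> \<tau> by (auto simp: galois_group_mem Bij_def)
    interpret g: ring_hom_ring R R \<gamma> by (rule ring_hom_ringI2[OF ring_axioms ring_axioms hom(1)])
    interpret t: ring_hom_ring R R \<tau> by (rule ring_hom_ringI2[OF ring_axioms ring_axioms hom(2)])
    \<comment> \<open>Two automorphisms agree on a subring; here it contains K and the spanning
      list, hence everything.\<close>
    let ?E = "{x \<in> carrier R. \<gamma> x = \<tau> x}"
    have "subring ?E R" by (rule subringI) (auto simp: g.hom_one t.hom_one)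
    moreover have "K \<subseteq> ?E" using KR fixK by auto
    moreover have "set Us \<subseteq> ?E" using Us(1) eq by auto
    ultimately have "finite_extension K Us \<subseteq> ?E" by (rule finite_extension_subring_incl)
    moreover have "finite_extension K Us = carrier R"
      by (rule finite_extension_of_spanning[OF subfieldE(1)[OF K] order_refl Us])
    ultimately show "\<gamma> = \<tau>" by (intro extensionalityI[OF ext]) auto
  qed
  then show ?thesis
    using finite_subset[OF img finite_lists_length_eq[OF Zfin]] by (rule finite_imageD[rotated])
qed

text \<open>For x outside K, separability and splitting give a second root y of its minimal
  polynomial. The embedding of K(x) that sends x to y extends to the whole field by normality and is
  bijective there, so x is moved.\<close>

lemma galois_group_fixed_field:
  assumes K: "subfield K R" and gal: "finite_galois_extension R K (carrier R)"
  shows "finite (carrier (galois_group R K))" "fixed_field R (carrier (galois_group R K)) = K"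
proof -
  have dim: "finite_dimension K (carrier R)" and normal: "normal_extension R K (carrier R)"
    and sep: "separable_extension R K (carrier R)" using gal by (auto simp: finite_galois_extension_def)
  have alg: "(algebraic over K) x" if "x \<in> carrier R" for x
    using sep that by (auto simp: separable_extension_def over_def)
  have split: "splitted (Irr K x)" if "x \<in> carrier R" for x
    using normal IrrE[OF K that alg[OF that]] that by (auto simp: normal_extension_def)
  obtain n where "dimension n K (carrier R)" using dim by blast
  then obtain Us where Us: "set Us \<subseteq> carrier R" "Span K Us = carrier R" using exists_base[OF K] by blast
  show "finite (carrier (galois_group R K))" by (rule galois_group_finite[OF K alg Us])
  have KR: "K \<subseteq> carrier R" by (rule subfieldE(3)[OF K])
  show "fixed_field R (carrier (galois_group R K)) = K"
  proof
    show "K \<subseteq> fixed_field R (carrier (galois_group R K))"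
      using KR by (auto simp: fixed_field_def galois_group_mem)
    show "fixed_field R (carrier (galois_group R K)) \<subseteq> K"
    proof (rule ccontr)
      assume "\<not> ?thesis"
      then obtain x where x: "x \<in> carrier R" "x \<notin> K" and fixed: "\<And>\<gamma>. \<gamma> \<in> carrier (galois_group R K) \<Longrightarrow> \<gamma> x = x"
        by (auto simp: fixed_field_def)
      have "separable_poly R K (Irr K x)" using sep x by (auto simp: separable_extension_def)
      then obtain y where y: "y \<in> carrier R" "y \<noteq> x" "eval (Irr K x) y = \<zero>"
        using separable_other_root[OF K x alg[OF x(1)] _ split[OF x(1)]] by blast
      let ?M = "simple_extension K x"
      have id: "(\<lambda>z. z) \<in> ring_hom (R\<lparr>carrier := K\<rparr>) R" by (rule ring_hom_memI) (use KR in auto)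
      obtain \<phi> where \<phi>: "\<phi> \<in> ring_hom (R\<lparr>carrier := ?M\<rparr>) R" "\<forall>z\<in>K. \<phi> z = z" "\<phi> x = y"
        using extend_to_simple_extension[OF K id x(1) alg[OF x(1)] y(1)] y(3) by auto
      have M: "subfield ?M R" using simple_extension_is_subfield[OF K x(1)] alg[OF x(1)] by simp
      have KM: "K \<subseteq> ?M" by (rule simple_extension_incl[OF KR x(1)])
      have xM: "x \<in> ?M" by (rule simple_extension_mem[OF subfieldE(1)[OF K] x(1)])
      obtain \<psi> where "\<psi> \<in> ring_hom (R\<lparr>carrier := finite_extension ?M Us\<rparr>) R" and \<psi>_ext: "\<forall>z\<in>?M. \<psi> z = \<phi> z"
        using extend_to_finite_extension[OF K M KM \<phi>(1), of Us] \<phi>(2) Us(1) alg split by blast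
      moreover have "finite_extension ?M Us = carrier R"
        by (rule finite_extension_of_spanning[OF subfieldE(1)[OF M] KM Us])
      ultimately have \<psi>: "\<psi> \<in> ring_hom R R" by simp
      have \<psi>_K: "\<psi> z = z" if "z \<in> K" for z using that \<psi>_ext \<phi>(2) KM by auto
      have bij: "bij_betw \<psi> (carrier R) (carrier R)" by (rule algebraic_endomorphism_bij[OF K alg \<psi> \<psi>_K])
      \<comment> \<open>Members of \<open>Bij\<close> are undefined outside the carrier, so the
        endomorphism must be restricted to be one.\<close>
      have "restrict \<psi> (carrier R) \<in> carrier (galois_group R K)"
        unfolding galois_group_mem
      proof (intro conjI ballI)
        show "restrict \<psi> (carrier R) \<in> Bij (carrier R)" using bij by (auto simp: Bij_def bij_betw_def inj_on_def)
        show "restrict \<psi> (carrier R) \<in> ring_hom R R"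
          by (rule ring_hom_memI)
             (auto simp: ring_hom_closed[OF \<psi>] ring_hom_mult[OF \<psi>] ring_hom_add[OF \<psi>] ring_hom_one[OF \<psi>])
        show "restrict \<psi> (carrier R) z = z" if "z \<in> K" for z using that KR \<psi>_K by auto
      qed
      from fixed[OF this] have "\<psi> x = x" using x by simp
      then show False using \<psi>_ext xM \<phi>(3) y(2) by auto
    qed
  qed
qed

lemma galois_automorphism_group:
  assumes K: "subfield K R" and gal: "finite_galois_extension R K (carrier R)"
  shows "automorphism_group R (galois_group R K)"
proof (rule automorphism_group.intro[OF field_axioms], rule automorphism_group_axioms.intro)
  let ?G = "galois_group R K"
  have KR: "K \<subseteq> carrier R" by (rule subfieldE(3)[OF K])
  have mult: "\<gamma> \<otimes>\<^bsub>?G\<^esub> \<tau> = compose (carrier R) \<gamma> \<tau>" if "\<gamma> \<in> carrier ?G" "\<tau> \<in> carrier ?G" for \<gamma> \<tau>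
    using that by (simp add: galois_group_def BijGroup_def)
  have one: "\<one>\<^bsub>?G\<^esub> = (\<lambda>x\<in>carrier R. x)" by (simp add: galois_group_def BijGroup_def)
  have "?G = (BijGroup (carrier R))\<lparr>carrier := carrier ?G\<rparr>" by (simp add: galois_group_def)
  then show "group ?G"
    using subgroup.subgroup_is_group[OF galois_group_subgroup[OF KR] group_BijGroup] by simp
  show "finite (carrier ?G)" by (rule galois_group_fixed_field(1)[OF K gal])
  show "\<gamma> \<in> ring_hom R R" if "\<gamma> \<in> carrier ?G" for \<gamma> using that by (simp add: galois_group_mem)
  show "(\<gamma> \<otimes>\<^bsub>?G\<^esub> \<tau>) a = \<gamma> (\<tau> a)" if "\<gamma> \<in> carrier ?G" "\<tau> \<in> carrier ?G" "a \<in> carrier R" for \<gamma> \<tau> a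
    using that by (simp add: mult compose_eq)
  show "\<one>\<^bsub>?G\<^esub> a = a" if "a \<in> carrier R" for a using that by (simp add: one)
  show "\<gamma> = \<one>\<^bsub>?G\<^esub>" if "\<gamma> \<in> carrier ?G" "\<And>a. a \<in> carrier R \<Longrightarrow> \<gamma> a = a" for \<gamma>
    unfolding one using that by (intro extensionalityI[of _ "carrier R"]) (auto simp: galois_group_mem Bij_def)
qed

end

subsection \<open>The action on a regular subgroup\<close>

context automorphism_group
begin

text \<open>The action is conjugation by left translations. These multiply as the elements of G do,
  and they normalise N, so conjugation is an action on N by group automorphisms.\<close>

lemma star_galois_module:
  assumes H: "H \<subseteq> carrier G"
  defines "Y \<equiv> lcosets\<^bsub>G\<^esub> H"
  assumes N: "subgroup N (BijGroup Y)"
    and norm: "left_translation G H ` carrier G \<subseteq> normalizer (BijGroup Y) N"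
  shows "galois_module E G (perm_group Y N) (star_action G H)"
proof (rule galois_module.intro[OF automorphism_group_axioms], rule galois_module_axioms.intro)
  let ?P = "BijGroup Y" and ?l = "left_translation G H"
  interpret P: group ?P by (rule group_BijGroup)
  have Nsub: "N \<subseteq> carrier ?P" using N subgroup.subset by blast
  have Y_carrier: "C \<subseteq> carrier G" if "C \<in> Y" for C
    using that G.l_coset_subset_G[OF H] by (auto simp: Y_def LCOSETS_def)
  have Y_coset: "\<gamma> <#\<^bsub>G\<^esub> C \<in> Y" if "\<gamma> \<in> carrier G" "C \<in> Y" for \<gamma> C
    using that G.lcos_m_assoc[OF H] by (auto simp: Y_def LCOSETS_def)
  \<comment> \<open>The normalizer is the stabilizer of N under conjugation inside the permutation
    group, so membership says both that \<open>?l \<gamma>\<close> is a permutation and that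
    conjugation by it maps N onto N.\<close>
  have l: "?l \<gamma> \<in> carrier ?P" and conj: "?l \<gamma> <#\<^bsub>?P\<^esub> N #>\<^bsub>?P\<^esub> inv\<^bsub>?P\<^esub> (?l \<gamma>) = N" if "\<gamma> \<in> carrier G" for \<gamma>
    using norm that Nsub by (auto simp: normalizer_def stabilizer_def)
  have l_Bij: "?l \<gamma> \<in> Bij Y" if "\<gamma> \<in> carrier G" for \<gamma> using l[OF that] by (simp add: BijGroup_def)
  have l_mult: "?l (\<gamma> \<otimes>\<^bsub>G\<^esub> \<tau>) = ?l \<gamma> \<otimes>\<^bsub>?P\<^esub> ?l \<tau>" if "\<gamma> \<in> carrier G" "\<tau> \<in> carrier G" for \<gamma> \<tau>
  proof -
    have "?l \<gamma> \<otimes>\<^bsub>?P\<^esub> ?l \<tau> = compose Y (?l \<gamma>) (?l \<tau>)" using l_Bij that by (simp add: BijGroup_def)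
    also have "\<dots> = ?l (\<gamma> \<otimes>\<^bsub>G\<^esub> \<tau>)"
    proof
      fix C
      show "compose Y (?l \<gamma>) (?l \<tau>) C = ?l (\<gamma> \<otimes>\<^bsub>G\<^esub> \<tau>) C"
      proof (cases "C \<in> Y")
        case True
        then show ?thesis
          using Y_coset[OF that(2) True] G.lcos_m_assoc[OF Y_carrier[OF True] that]
          by (simp add: compose_eq left_translation_def Y_def)
      next
        case False
        then show ?thesis by (simp add: compose_def left_translation_def Y_def)
      qed
    qed
    finally show ?thesis by simp
  qed
  have star: "star_action G H \<gamma> \<eta> = ?l \<gamma> \<otimes>\<^bsub>?P\<^esub> \<eta> \<otimes>\<^bsub>?P\<^esub> inv\<^bsub>?P\<^esub> (?l \<gamma>)" for \<gamma> \<eta>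
    by (simp add: star_action_def Let_def Y_def)
  have simps: "carrier (perm_group Y N) = N" "monoid.mult (perm_group Y N) = monoid.mult ?P"
    by (simp_all add: perm_group_def)
  show "group (perm_group Y N)"
    unfolding perm_group_def by (rule subgroup.subgroup_is_group[OF N group_BijGroup])
  have "finite Y" using finite_G by (auto simp: Y_def LCOSETS_def)
  moreover have "N \<subseteq> Y \<rightarrow>\<^sub>E Y"
    using Nsub by (auto simp: BijGroup_def Bij_def PiE_def bij_betw_def)
  ultimately show "finite (carrier (perm_group Y N))"
    unfolding simps using finite_PiE[of Y "\<lambda>_. Y"] finite_subset by blast
  fix \<gamma> assume \<gamma>: "\<gamma> \<in> carrier G"
  show "star_action G H \<gamma> \<eta> \<in> carrier (perm_group Y N)" if "\<eta> \<in> carrier (perm_group Y N)" for \<eta>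
  proof -
    have "?l \<gamma> \<otimes>\<^bsub>?P\<^esub> \<eta> \<otimes>\<^bsub>?P\<^esub> inv\<^bsub>?P\<^esub> (?l \<gamma>) \<in> ?l \<gamma> <#\<^bsub>?P\<^esub> N #>\<^bsub>?P\<^esub> inv\<^bsub>?P\<^esub> (?l \<gamma>)"
      using that by (auto simp: simps l_coset_def r_coset_def)
    then show ?thesis unfolding conj[OF \<gamma>] star simps .
  qed
  show "star_action G H (\<gamma> \<otimes>\<^bsub>G\<^esub> \<tau>) \<eta> = star_action G H \<gamma> (star_action G H \<tau> \<eta>)"
    if "\<tau> \<in> carrier G" "\<eta> \<in> carrier (perm_group Y N)" for \<tau> \<eta>
  proof -
    have "\<eta> \<in> carrier ?P" using that Nsub by (auto simp: simps)
    then show ?thesis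
      unfolding star l_mult[OF \<gamma> that(1)]
      using l[OF \<gamma>] l[OF that(1)] by (simp add: P.inv_mult_group P.m_assoc)
  qed
  show "star_action G H \<gamma> (\<eta> \<otimes>\<^bsub>perm_group Y N\<^esub> \<theta>)
      = star_action G H \<gamma> \<eta> \<otimes>\<^bsub>perm_group Y N\<^esub> star_action G H \<gamma> \<theta>"
    if "\<eta> \<in> carrier (perm_group Y N)" "\<theta> \<in> carrier (perm_group Y N)" for \<eta> \<theta>
  proof -
    have c: "\<eta> \<in> carrier ?P" "\<theta> \<in> carrier ?P" "?l \<gamma> \<in> carrier ?P" using that Nsub l[OF \<gamma>] by (auto simp: simps)
    have "inv\<^bsub>?P\<^esub> (?l \<gamma>) \<otimes>\<^bsub>?P\<^esub> (?l \<gamma> \<otimes>\<^bsub>?P\<^esub> z) = z" if "z \<in> carrier ?P" for z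
      using that c by (simp flip: P.m_assoc)
    then show ?thesis unfolding star simps using c by (simp add: P.m_assoc)
  qed
next
  interpret P: group "BijGroup Y" by (rule group_BijGroup)
  fix \<eta> assume "\<eta> \<in> carrier (perm_group Y N)"
  then have "\<eta> \<in> carrier (BijGroup Y)" using subgroup.subset[OF N] by (auto simp: perm_group_def)
  moreover have "left_translation G H \<one>\<^bsub>G\<^esub> = \<one>\<^bsub>BijGroup Y\<^esub>"
  proof -
    have "C \<subseteq> carrier G" if "C \<in> Y" for C
      using that G.l_coset_subset_G[OF H] by (auto simp: Y_def LCOSETS_def)
    then show ?thesis
      using G.lcos_mult_one by (auto simp: left_translation_def BijGroup_def Y_def intro!: restrict_ext)
  qed
  ultimately show "star_action G H \<one>\<^bsub>G\<^esub> \<eta> = \<eta>"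
    unfolding star_action_def Let_def Y_def[symmetric] by simp
qed

end

text \<open>Evaluating the invariance condition at \<open>act \<gamma> m\<close> removes the inverse
  of \<gamma> and leaves equivariance of the coefficient function.\<close>

lemma (in galois_module) galois_fixed_elems:
  "{u \<in> carrier (monoid_algebra E M).
      \<forall>\<gamma>\<in>carrier G. (\<lambda>m. if m \<in> carrier M then \<gamma> (u (act (inv\<^bsub>G\<^esub> \<gamma>) m)) else \<zero>) = u} = fixed_elems (carrier G)"
proof (intro Set.set_eqI iffI)
  fix u assume u: "u \<in> fixed_elems (carrier G)"
  have "(\<lambda>m. if m \<in> carrier M then \<gamma> (u (act (inv\<^bsub>G\<^esub> \<gamma>) m)) else \<zero>) = u" if \<gamma>: "\<gamma> \<in> carrier G" for \<gamma>
  proof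
    fix m
    show "(if m \<in> carrier M then \<gamma> (u (act (inv\<^bsub>G\<^esub> \<gamma>) m)) else \<zero>) = u m"
    proof (cases "m \<in> carrier M")
      case True
      have "\<gamma> (u (act (inv\<^bsub>G\<^esub> \<gamma>) m)) = u (act \<gamma> (act (inv\<^bsub>G\<^esub> \<gamma>) m))"
        by (rule fixed_elemsD(3)[OF u \<gamma>, symmetric]) (use \<gamma> True in simp)
      then show ?thesis using True act_inv(1)[OF \<gamma> True] by simp
    next
      case False
      then show ?thesis using fixed_elemsD(2)[OF u False] by simp
    qed
  qed
  then show "u \<in> {u \<in> carrier (monoid_algebra E M).
      \<forall>\<gamma>\<in>carrier G. (\<lambda>m. if m \<in> carrier M then \<gamma> (u (act (inv\<^bsub>G\<^esub> \<gamma>) m)) else \<zero>) = u}"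
    using u by (auto simp: fixed_elems_def)
next
  fix u assume u: "u \<in> {u \<in> carrier (monoid_algebra E M).
      \<forall>\<gamma>\<in>carrier G. (\<lambda>m. if m \<in> carrier M then \<gamma> (u (act (inv\<^bsub>G\<^esub> \<gamma>) m)) else \<zero>) = u}"
  have "u (act \<gamma> m) = \<gamma> (u m)" if \<gamma>: "\<gamma> \<in> carrier G" and m: "m \<in> carrier M" for \<gamma> m
  proof -
    have "(\<lambda>m. if m \<in> carrier M then \<gamma> (u (act (inv\<^bsub>G\<^esub> \<gamma>) m)) else \<zero>) = u" using u \<gamma> by blast
    from fun_cong[OF this, of "act \<gamma> m"] show ?thesis using \<gamma> m act_inv(2)[OF \<gamma> m] by simp
  qed
  then show "u \<in> fixed_elems (carrier G)" using u by (simp add: fixed_elems_def)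
qed

section \<open>The equivalence for regular subgroups of the permutations of G/H\<close>

theorem theorem2p9:
  fixes E :: "('e, 'm) ring_scheme"
    and K L K' :: "'e set"
    and G :: "('e \<Rightarrow> 'e) monoid"
    and G\<^sub>L G' :: "('e \<Rightarrow> 'e) set"
    and X\<^sub>L :: "('e \<Rightarrow> 'e) set set"
    and N\<^sub>1 N\<^sub>2 :: "(('e \<Rightarrow> 'e) set \<Rightarrow> ('e \<Rightarrow> 'e) set) set"
  assumes "field E" and "subfield K E" and "subfield L E" and "K \<subseteq> L"
    and "ring.finite_dimension E K L" and "separable_extension E K L"
    and "galois_closure E K L"
    and "G = galois_group E K" and "G\<^sub>L = carrier (galois_group E L)" and "X\<^sub>L = lcosets\<^bsub>G\<^esub> G\<^sub>L"
    and "regular_subgroup X\<^sub>L N\<^sub>1" and "left_translation G G\<^sub>L ` carrier G \<subseteq> normalizer (BijGroup X\<^sub>L) N\<^sub>1"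
    and "regular_subgroup X\<^sub>L N\<^sub>2" and "left_translation G G\<^sub>L ` carrier G \<subseteq> normalizer (BijGroup X\<^sub>L) N\<^sub>2"
    and "G' \<lhd> G" and "K' = fixed_field E G'"
  shows "hopf_isomorphic (E\<lparr>carrier := K'\<rparr>)
           (base_change (E\<lparr>carrier := K\<rparr>) (E\<lparr>carrier := K'\<rparr>) (fixed_hopf E K G G\<^sub>L N\<^sub>1))
           (base_change (E\<lparr>carrier := K\<rparr>) (E\<lparr>carrier := K'\<rparr>) (fixed_hopf E K G G\<^sub>L N\<^sub>2))
         \<longleftrightarrow>
         (\<exists>f \<in> iso (perm_group X\<^sub>L N\<^sub>1) (perm_group X\<^sub>L N\<^sub>2).
            \<forall>\<sigma> \<in> G'. \<forall>\<eta> \<in> N\<^sub>1. f (star_action G G\<^sub>L \<sigma> \<eta>) = star_action G G\<^sub>L \<sigma> (f \<eta>))"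
proof -
  interpret field E by fact
  have gal: "finite_galois_extension E K (carrier E)" using assms(7) by (simp add: galois_closure_def)
  interpret automorphism_group E G
    unfolding assms(8) by (rule galois_automorphism_group[OF assms(2) gal])
  have K: "fixed_field E (carrier G) = K"
    unfolding assms(8) by (rule galois_group_fixed_field(2)[OF assms(2) gal])
  \<comment> \<open>Automorphisms fixing L fix its subfield K.\<close>
  have G\<^sub>L: "G\<^sub>L \<subseteq> carrier G"
    unfolding assms(8,9) subset_iff galois_group_mem using assms(4) by blast
  have G': "G' \<subseteq> carrier G" using assms(15) by (simp add: normal_imp_subgroup subgroup.subset)
  \<comment> \<open>Each N supplies its own dual family, built from the action of G on N. The
    existential quantifiers hide the construction; only the coordinate description of the base
    change is needed afterwards.\<close>
  have model: "\<exists>(I :: ((('e \<Rightarrow> 'e) set \<Rightarrow> ('e \<Rightarrow> 'e) set) \<times> nat) set) p g \<nu>.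
      hopf_model E G (perm_group X\<^sub>L N) (star_action G G\<^sub>L) I p g G'
        (base_change (E\<lparr>carrier := K\<rparr>) (E\<lparr>carrier := K'\<rparr>) (fixed_hopf E K G G\<^sub>L N)) \<nu>"
    if N: "regular_subgroup X\<^sub>L N" "left_translation G G\<^sub>L ` carrier G \<subseteq> normalizer (BijGroup X\<^sub>L) N" for N
  proof -
    let ?M = "perm_group X\<^sub>L N"
    interpret M: galois_module E G ?M "star_action G G\<^sub>L"
      unfolding assms(10)
      by (rule star_galois_module[OF G\<^sub>L]) (use N assms(10) in \<open>auto simp: regular_subgroup_def\<close>)
    obtain I :: "((('e \<Rightarrow> 'e) set \<Rightarrow> ('e \<Rightarrow> 'e) set) \<times> nat) set" and p g where dual: "finite I"
      "\<And>k. k \<in> I \<Longrightarrow> p k \<in> M.fixed_elems (carrier G)" "\<And>k. k \<in> I \<Longrightarrow> g k \<in> M.fixed_elems (carrier G)"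
      "\<And>x y. x \<in> carrier ?M \<Longrightarrow> y \<in> carrier ?M \<Longrightarrow>
        (\<Oplus>\<^bsub>E\<^esub>k\<in>I. p k x \<otimes>\<^bsub>E\<^esub> g k y) = (if x = y then \<one>\<^bsub>E\<^esub> else \<zero>\<^bsub>E\<^esub>)"
      by (rule M.exists_dual_family) blast
    interpret B: galois_base_change E G ?M "star_action G G\<^sub>L" I p g G'
      by (intro galois_base_change.intro galois_dual_family.intro galois_dual_family_axioms.intro
          galois_base_change_axioms.intro M.galois_module_axioms dual G')
    have "fixed_hopf E K G G\<^sub>L N = restrict_hopf (E\<lparr>carrier := fixed_field E (carrier G)\<rparr>) E (group_hopf E ?M) (M.fixed_elems (carrier G))"
      unfolding fixed_hopf_def Let_def K M.galois_fixed_elems[symmetric]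
      by (simp add: assms(10) galois_action_def group_hopf_simps perm_group_def)
    then show ?thesis using B.base_change_model K assms(16) by auto
  qed
  obtain I\<^sub>1 :: "((('e \<Rightarrow> 'e) set \<Rightarrow> ('e \<Rightarrow> 'e) set) \<times> nat) set" and p\<^sub>1 g\<^sub>1 \<nu>\<^sub>1 where m1:
    "hopf_model E G (perm_group X\<^sub>L N\<^sub>1) (star_action G G\<^sub>L) I\<^sub>1 p\<^sub>1 g\<^sub>1 G'
        (base_change (E\<lparr>carrier := K\<rparr>) (E\<lparr>carrier := K'\<rparr>) (fixed_hopf E K G G\<^sub>L N\<^sub>1)) \<nu>\<^sub>1"
    using model[OF assms(11,12)] by blast
  obtain I\<^sub>2 :: "((('e \<Rightarrow> 'e) set \<Rightarrow> ('e \<Rightarrow> 'e) set) \<times> nat) set" and p\<^sub>2 g\<^sub>2 \<nu>\<^sub>2 where m2: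
    "hopf_model E G (perm_group X\<^sub>L N\<^sub>2) (star_action G G\<^sub>L) I\<^sub>2 p\<^sub>2 g\<^sub>2 G'
        (base_change (E\<lparr>carrier := K\<rparr>) (E\<lparr>carrier := K'\<rparr>) (fixed_hopf E K G G\<^sub>L N\<^sub>2)) \<nu>\<^sub>2"
    using model[OF assms(13,14)] by blast
  \<comment> \<open>Both groups have as many elements as the coset space, by regularity.\<close>
  have card: "card (carrier (perm_group X\<^sub>L N\<^sub>1)) = card (carrier (perm_group X\<^sub>L N\<^sub>2))"
    using assms(11,13) by (simp add: perm_group_def regular_subgroup_def)
  from hopf_model_pair.hopf_isomorphic_iff[OF hopf_model_pair.intro[OF m1 m2 hopf_model_pair_axioms.intro[OF card]]]
  show ?thesis by (simp add: perm_group_def assms(16))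
qed

end
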